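(* Let $d>1$, let $r\ge1$ be an integer, and let $B$ be a Banach space of functions on $\mathbb{R}^d$ or on $\mathbb{T}^d$ whose norm satisfies, for some $2\le s<\infty$ and some $m>0$, $$\max\big(\|F+G\|_B,\|F-G\|_B\big)\ge\big(\|F\|_B^s+m\|G\|_B^s\big)^{1/s}\quad\text{for all }F,G\in B,$$ and, for all $f\in B$ and all $\xi,h\in\mathbb{R}^d$, $$\|f(\cdot+\xi)\|_B=\|f(\cdot)\|_B,\qquad\lim_{|h|\to0}\|f(\cdot+h)-f(\cdot)\|_B=0,\qquad\|f(-\,\cdot)\|_B=\|f(\cdot)\|_B.$$ Then there is a constant $C>0$, independent of $f$ and $t$, such that for all $f\in B$ and $t>0$ $$\omega^r(f,t)_B\ge C\Big\{\sum_{j=1}^\infty2^{-jrs}E_{1/(t2^j)}(f)_B^s\Big\}^{1/s}.$$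
   Context: $\omega^r(f,t)_B=\sup_{|h|\le t}\|\Delta_h^rf\|_B$, with $h\in\mathbb{R}^d$, $\Delta_hf(x)=f(x+h)-f(x)$ and $\Delta_h^{\ell+1}f=\Delta_h(\Delta_h^\ell f)$. For $\lambda>0$, $E_\lambda(f)_B$ is the error of best approximation defined as follows. If $B$ is a space of functions on $\mathbb{R}^d$, $E_\lambda(f)_B=\inf\{\|f-\varphi\|_B:\operatorname{supp}\widehat\varphi\subset\{y:|y|\le\lambda\}\}$, the infimum being over $\varphi\in B$, where $\widehat\varphi$ is the Fourier transform of $\varphi$ (in the sense of tempered distributions). If $B$ is a space of functions on $\mathbb{T}^d$ (functions $2\pi$-periodic in each variable), $E_\lambda(f)_B=\inf\{\|f-\varphi\|_B:\varphi(\boldsymbol x)=\sum_{|\boldsymbol n|<\lambda}a_{\boldsymbol n}e^{i\boldsymbol n\cdot\boldsymbol x}\}$, with $\boldsymbol n\in\mathbb{Z}^d$ and $|\cdot|$ the Euclidean norm. The constant $C$ may depend on $B$ and $r$.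
   Formalization: Functions in B are taken locally integrable (and tempered on R^d); on R^d it is also assumed that convergence in B implies convergence as distributions (f -> integral of f times each test function is bounded on B), without which the claim fails for pathological spaces. *)

theory Defs
  imports "HOL-Analysis.Analysis"
begin

text \<open>Functions on \<open>\<real>\<^sup>d\<close>, \<open>d = CARD('n)\<close>, have type \<open>real ^ 'n \<Rightarrow> complex\<close>; functions on
  the torus are those that are \<open>2 \<pi>\<close>-periodic in each variable. Functions that agree almost
  everywhere are identified by requiring that the norm vanish exactly on null functions,
  not by passing to a quotient type.\<close>

definition locally_integrable :: "(real ^ 'n \<Rightarrow> complex) \<Rightarrow> bool" where
  "locally_integrable f \<longleftrightarrow> (\<forall>K. compact K \<longrightarrow> f absolutely_integrable_on K)"

definition periodic :: "(real ^ 'n \<Rightarrow> complex) \<Rightarrow> bool" where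
  "periodic f \<longleftrightarrow> (\<forall>x i. f (x + axis i (2 * pi)) = f x)"

subsection \<open>Schwartz functions and tempered distributions\<close>

primrec partials :: "'n list \<Rightarrow> (real ^ 'n \<Rightarrow> complex) \<Rightarrow> real ^ 'n \<Rightarrow> complex" where
  "partials [] f = f"
| "partials (i # is) f = (\<lambda>x. frechet_derivative (partials is f) (at x) (axis i 1))"

definition smooth :: "(real ^ 'n \<Rightarrow> complex) \<Rightarrow> bool" where
  "smooth f \<longleftrightarrow> (\<forall>is x. partials is f differentiable at x)"

definition supp :: "(real ^ 'n \<Rightarrow> complex) \<Rightarrow> (real ^ 'n) set" where
  "supp f = closure {x. f x \<noteq> 0}"

definition test_function :: "(real ^ 'n \<Rightarrow> complex) \<Rightarrow> bool" where
  "test_function \<psi> \<longleftrightarrow> smooth \<psi> \<and> compact (supp \<psi>)"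

definition schwartz :: "(real ^ 'n \<Rightarrow> complex) \<Rightarrow> bool" where
  "schwartz \<psi> \<longleftrightarrow>
     smooth \<psi> \<and> (\<forall>is k. \<exists>C. \<forall>x. norm x ^ k * norm (partials is \<psi> x) \<le> C)"

text \<open>A tempered distribution is a functional on Schwartz functions; its values at other
  functions are irrelevant. Continuity is the existence of \<open>N\<close> and \<open>C\<close> such that
  \<open>\<bar>u \<psi>\<bar> \<le> C p\<^sub>N(\<psi>)\<close>, where \<open>p\<^sub>N(\<psi>)\<close> is the least bound \<open>M\<close> of the Schwartz seminorms
  with at most \<open>N\<close> derivatives and weights of degree at most \<open>N\<close>.\<close>

definition tempered_distribution :: "((real ^ 'n \<Rightarrow> complex) \<Rightarrow> complex) \<Rightarrow> bool" where
  "tempered_distribution u \<longleftrightarrow>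
     (\<forall>\<psi> \<eta>. schwartz \<psi> \<longrightarrow> schwartz \<eta> \<longrightarrow> u (\<lambda>x. \<psi> x + \<eta> x) = u \<psi> + u \<eta>) \<and>
     (\<forall>c \<psi>. schwartz \<psi> \<longrightarrow> u (\<lambda>x. c * \<psi> x) = c * u \<psi>) \<and>
     (\<exists>N C. \<forall>\<psi> M. schwartz \<psi> \<longrightarrow>
        (\<forall>is k x. length is \<le> N \<longrightarrow> k \<le> N \<longrightarrow> norm x ^ k * norm (partials is \<psi> x) \<le> M) \<longrightarrow>
        norm (u \<psi>) \<le> C * M)"

text \<open>\<open>u\<close> is the function \<open>f\<close> regarded as a tempered distribution. On Schwartz functions \<open>u\<close>
  is determined by \<open>f\<close>, since test functions are dense there. The integral of \<open>f \<psi>\<close> is not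
  required to converge absolutely for every Schwartz function \<open>\<psi>\<close>.\<close>

definition distribution_of :: "(real ^ 'n \<Rightarrow> complex) \<Rightarrow> ((real ^ 'n \<Rightarrow> complex) \<Rightarrow> complex) \<Rightarrow> bool"
  where
  "distribution_of f u \<longleftrightarrow>
     locally_integrable f \<and> tempered_distribution u \<and>
     (\<forall>\<psi>. test_function \<psi> \<longrightarrow> u \<psi> = (LINT x|lebesgue. f x * \<psi> x))"

definition fourier :: "(real ^ 'n \<Rightarrow> complex) \<Rightarrow> real ^ 'n \<Rightarrow> complex" where
  "fourier \<psi> y = (LINT x|lebesgue. cis (- (x \<bullet> y)) * \<psi> x)"

definition fourier_dist ::
    "((real ^ 'n \<Rightarrow> complex) \<Rightarrow> complex) \<Rightarrow> (real ^ 'n \<Rightarrow> complex) \<Rightarrow> complex" where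
  "fourier_dist u \<psi> = u (fourier \<psi>)"

definition dist_supp :: "((real ^ 'n \<Rightarrow> complex) \<Rightarrow> complex) \<Rightarrow> (real ^ 'n) set" where
  "dist_supp u = - \<Union>{U. open U \<and> (\<forall>\<psi>. test_function \<psi> \<longrightarrow> supp \<psi> \<subseteq> U \<longrightarrow> u \<psi> = 0)}"

subsection \<open>Banach spaces of functions\<close>

datatype underlying = Euclidean | Torus

primrec function_on :: "underlying \<Rightarrow> (real ^ 'n \<Rightarrow> complex) \<Rightarrow> bool" where
  "function_on Euclidean f \<longleftrightarrow> (\<exists>u. distribution_of f u)"
| "function_on Torus f \<longleftrightarrow> locally_integrable f \<and> periodic f"

text \<open>Only real scalars are used, so that real and complex Banach spaces are both covered.
  The last clause, for functions on \<open>\<real>\<^sup>d\<close>, says that convergence in \<open>B\<close> implies convergence in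
  the sense of distributions; without such a compatibility of the norm with the
  distributional structure, membership in \<open>B\<close> and the Fourier transform are unrelated.\<close>

definition banach_function_space ::
    "underlying \<Rightarrow> (real ^ 'n \<Rightarrow> complex) set \<Rightarrow> ((real ^ 'n \<Rightarrow> complex) \<Rightarrow> real) \<Rightarrow> bool" where
  "banach_function_space D B N \<longleftrightarrow>
     (\<forall>f\<in>B. function_on D f) \<and>
     (\<lambda>x. 0) \<in> B \<and>
     (\<forall>f\<in>B. \<forall>g\<in>B. (\<lambda>x. f x + g x) \<in> B \<and> N (\<lambda>x. f x + g x) \<le> N f + N g) \<and>
     (\<forall>c. \<forall>f\<in>B. (\<lambda>x. c *\<^sub>R f x) \<in> B \<and> N (\<lambda>x. c *\<^sub>R f x) = \<bar>c\<bar> * N f) \<and>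
     (\<forall>f\<in>B. 0 \<le> N f \<and> (N f = 0 \<longleftrightarrow> (AE x in lebesgue. f x = 0))) \<and>
     (\<forall>X. (\<forall>n::nat. X n \<in> B) \<longrightarrow>
        (\<forall>e>0. \<exists>M. \<forall>i\<ge>M. \<forall>j\<ge>M. N (\<lambda>x. X i x - X j x) < e) \<longrightarrow>
        (\<exists>f\<in>B. (\<lambda>n. N (\<lambda>x. X n x - f x)) \<longlonglongrightarrow> 0)) \<and>
     (D = Euclidean \<longrightarrow>
        (\<forall>\<psi>. test_function \<psi> \<longrightarrow>
           (\<exists>C. \<forall>f\<in>B. norm (LINT x|lebesgue. f x * \<psi> x) \<le> C * N f)))"

subsection \<open>Moduli of smoothness and best approximation\<close>

definition fdiff :: "real ^ 'n \<Rightarrow> (real ^ 'n \<Rightarrow> complex) \<Rightarrow> real ^ 'n \<Rightarrow> complex" where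
  "fdiff h f = (\<lambda>x. f (x + h) - f x)"

text \<open>For \<open>f\<close> in a space with translation-invariant norm the supremum is bounded by \<open>2\<^sup>r N f\<close>,
  so the real-valued \<open>SUP\<close> is the actual supremum; the infimum in \<open>best_approx\<close> is over a
  nonempty set bounded below by \<open>0\<close>, because \<open>\<phi> = 0\<close> is always admitted.\<close>

definition modulus ::
    "((real ^ 'n \<Rightarrow> complex) \<Rightarrow> real) \<Rightarrow> nat \<Rightarrow> (real ^ 'n \<Rightarrow> complex) \<Rightarrow> real \<Rightarrow> real" where
  "modulus N r f t = (SUP h\<in>{h. norm h \<le> t}. N ((fdiff h ^^ r) f))"

primrec approximant :: "underlying \<Rightarrow> real \<Rightarrow> (real ^ 'n \<Rightarrow> complex) \<Rightarrow> bool" where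
  "approximant Euclidean \<sigma> \<phi> \<longleftrightarrow>
     (\<exists>u. distribution_of \<phi> u \<and> dist_supp (fourier_dist u) \<subseteq> {y. norm y \<le> \<sigma>})"
| "approximant Torus \<sigma> \<phi> \<longleftrightarrow>
     (\<exists>a. AE x in lebesgue.
        \<phi> x = (\<Sum>n\<in>{n :: real ^ 'n. (\<forall>i. n $ i \<in> \<int>) \<and> norm n < \<sigma>}. a n * cis (n \<bullet> x)))"

definition best_approx ::
    "underlying \<Rightarrow> (real ^ 'n \<Rightarrow> complex) set \<Rightarrow> ((real ^ 'n \<Rightarrow> complex) \<Rightarrow> real) \<Rightarrow>
     real \<Rightarrow> (real ^ 'n \<Rightarrow> complex) \<Rightarrow> real" where
  "best_approx D B N \<sigma> f = (INF \<phi>\<in>{\<phi>\<in>B. approximant D \<sigma> \<phi>}. N (\<lambda>x. f x - \<phi> x))"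

end

theory Submission
  imports Defs "HOL-Probability.Probability"
begin

text \<open>Write \<open>\<Delta>\<^sub>h\<close> for the difference operator and \<open>T\<^sub>h\<close> for translation by \<open>h\<close>. The convexity
  hypothesis with \<open>F = (T\<^sub>h g + g) / 2\<close> and \<open>G = (T\<^sub>h g - g) / 2\<close> has \<open>F + G = T\<^sub>h g\<close> and
  \<open>F - G = g\<close>, functions of the same norm. For \<open>g = \<Delta>\<^sub>h\<^sup>r f\<close> the function \<open>\<Delta>\<^bsub>2h\<^esub>\<^sup>r f\<close> is
  \<open>(T\<^sub>h + 1)\<^sup>r g\<close>, of norm at most \<open>2\<^sup>r\<close> times that of \<open>F\<close>. Hence \<open>fdiff_doubling\<close>: passing
  from \<open>h\<close> to \<open>2h\<close> the quantity \<open>\<parallel>\<Delta>\<^sub>h\<^sup>r f\<parallel>\<^sup>s\<close>, weighted with \<open>2\<^bsup>-rs\<^esup>\<close> at \<open>2h\<close>, loses at least a fixed multiple of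
  \<open>\<parallel>\<Delta>\<^sub>h\<^bsup>r+1\<^esup> f\<parallel>\<^sup>s\<close>. Iteration bounds the sum of \<open>2\<^bsup>-jrs\<^esup> \<parallel>\<Delta>\<^sub>v\<^bsup>r+1\<^esup> f\<parallel>\<^sup>s\<close>, where
  \<open>v = 2\<^sup>j h\<close>, by a multiple of \<open>\<parallel>\<Delta>\<^sub>h\<^sup>r f\<parallel>\<^sup>s\<close> (\<open>fdiff_doubling_sum\<close>).

  This controls a sum over dyadic multiples of one step \<open>h\<close>, not a sum of suprema over steps, so
  Jackson's inequality is needed with a mean in place of the modulus: for every \<open>p\<close>, however large,
  \<open>E\<^bsub>1/a\<^esub>(f)\<close> is at most a constant times the integral of \<open>\<parallel>\<Delta>\<^sub>v\<^bsup>r+1\<^esup> f\<parallel> / weight(u)\<^sup>p\<close>, with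
  \<open>v = a u\<close>, over all \<open>u\<close>, where \<open>weight u\<close> lies between \<open>1 + \<bar>u\<bar>\<close> and its \<open>d\<close>-th power
  (\<open>torus_jackson\<close>, \<open>euclidean_jackson\<close>). By Jensen's inequality the power \<open>s\<close> can be moved inside the
  integral; there the sum over \<open>j\<close> is estimated for each \<open>u\<close> with \<open>h = t u\<close>, and
  \<open>\<parallel>\<Delta>\<^sub>h\<^sup>r f\<parallel>\<close> grows at most like \<open>weight(u)\<^sup>r\<close> times the modulus at \<open>t\<close>, which the decay of the
  majorant absorbs (\<open>sharp_lower_bound\<close>).

  The approximant in Jackson's inequality is the integral of \<open>K(u)\<close> times the combination of the
  translates \<open>f(x + l a u)\<close>, \<open>1 \<le> l \<le> r + 1\<close>, that differs from \<open>f(x)\<close> by \<open>\<Delta>\<^sub>v\<^bsup>r+1\<^esup> f(x)\<close> up to sign, with a kernel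
  \<open>K\<close> of integral \<open>1\<close>. Elements of \<open>B\<close> need not be integrable against \<open>K\<close> pointwise; the integral
  is the limit in \<open>B\<close> of dyadic Riemann sums (\<open>grid_sum_limit_exists\<close>). Its spectrum has to be
  read off from convergence in \<open>B\<close> alone. On the torus \<open>K\<close> is, on a period cell, a trigonometric polynomial (a product
  of even powers of Dirichlet kernels), whose translates span a finite-dimensional space; so the translates of the limit are combinations, with
  coefficients depending only on the translation, of finitely many elements of \<open>B\<close>, and this forces
  it to be a trigonometric sum (\<open>translates_determine_function\<close>, \<open>cube_mean_trigonometric\<close>). On
  \<open>\<real>\<^sup>d\<close> the kernel is rapidly decreasing with Fourier transform supported in the unit ball
  (\<open>band_limited_kernel_exists\<close>), and convergence in \<open>B\<close> is tested against test functions. Fourier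
  transforms of test functions are not compactly supported, so they are first cut off, and the
  commutator of the cutoff with the convolution is estimated by the continuity of the tempered
  distribution \<open>f\<close> (\<open>kernel_mean_band_limited\<close>).\<close>

section \<open>Product integrals and dyadic Riemann sums on \<open>\<real>\<^sup>d\<close>\<close>

lemma Basis_vec_range: "(Basis :: (real ^ 'n::finite) set) = range (\<lambda>i. axis i 1)"
  by (auto simp: Basis_vec_def)

lemma inj_axis_one: "inj (\<lambda>i::'n::finite. axis i (1::real))"
  by (auto simp: inj_on_def axis_eq_axis)

text \<open>Lebesgue measure on \<open>real ^ 'n\<close> is the image of a product measure indexed by the basis vectors;
  the factors are reindexed by their coordinates.\<close>

lemma lborel_vec_prod:
  fixes g :: "'n::finite \<Rightarrow> real \<Rightarrow> 'b::{real_normed_field,banach,second_countable_topology}"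
  assumes g: "\<And>i. integrable lborel (g i)"
  shows integrable_vec_prod: "integrable lborel (\<lambda>x::real^'n. \<Prod>i\<in>UNIV. g i (x $ i))"
    and integral_vec_prod:
      "(LINT x|lborel. (\<Prod>i\<in>UNIV. g i ((x::real^'n) $ i))) = (\<Prod>i\<in>UNIV. (LINT t|lborel. g i t))"
proof -
  interpret product_sigma_finite "\<lambda>b::real^'n. lborel :: real measure" ..
  define h where "h b = g (THE i. b = axis i 1)" for b :: "real^'n"
  have h: "h (axis i 1) = g i" for i
    by (simp add: h_def axis_eq_axis)
  have hint: "integrable lborel (h b)" if "b \<in> Basis" for b
    using that g h by (auto simp: Basis_vec_range)
  have gb[measurable]: "g i \<in> borel_measurable borel" for i
    using borel_measurable_integrable[OF g] by simp
  have comp: "(\<Sum>b\<in>Basis. f b *\<^sub>R b) $ i = f (axis i 1)" for f and i :: 'n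
  proof -
    have "(\<Sum>b\<in>Basis. f b *\<^sub>R b) $ i = (\<Sum>b\<in>Basis. f b *\<^sub>R b) \<bullet> axis i 1"
      by (simp add: inner_axis)
    also have "\<dots> = f (axis i 1)"
      by (subst inner_sum_left_Basis) (auto simp: Basis_vec_range)
    finally show ?thesis .
  qed
  have eq: "(\<Prod>i\<in>UNIV. g i ((\<Sum>b\<in>Basis. f b *\<^sub>R b) $ i)) = (\<Prod>b\<in>Basis. h b (f b))" for f
    unfolding comp by (simp add: Basis_vec_range prod.reindex[OF inj_axis_one] h o_def)
  have m: "(\<lambda>f. \<Sum>b\<in>Basis. f b *\<^sub>R b :: real^'n) \<in> (\<Pi>\<^sub>M b\<in>Basis. lborel) \<rightarrow>\<^sub>M borel"
    by measurable
  have int: "integrable (\<Pi>\<^sub>M b\<in>Basis. lborel) (\<lambda>f. \<Prod>b\<in>Basis. h b (f b :: real))"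
    by (rule product_integrable_prod) (use hint in auto)
  show "integrable lborel (\<lambda>x::real^'n. \<Prod>i\<in>UNIV. g i (x $ i))"
    unfolding lborel_eq[where 'a="real^'n"]
    by (subst integrable_distr_eq[OF m]) (use int in \<open>simp_all only: eq, measurable\<close>)
  have "(LINT x|lborel. (\<Prod>i\<in>UNIV. g i ((x::real^'n) $ i))) = 
      (LINT f|(\<Pi>\<^sub>M b\<in>Basis. lborel). (\<Prod>b\<in>Basis. h b (f b)))"
    unfolding lborel_eq[where 'a="real^'n"]
    by (subst integral_distr[OF m]) (simp_all only: eq, measurable)
  also have "\<dots> = (\<Prod>b\<in>Basis. (LINT t|lborel. h b t))"
    by (rule product_integral_prod) (use hint in auto)
  also have "\<dots> = (\<Prod>i\<in>UNIV. (LINT t|lborel. g i t))"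
    by (simp add: Basis_vec_range prod.reindex[OF inj_axis_one] h o_def)
  finally show "(LINT x|lborel. (\<Prod>i\<in>UNIV. g i ((x::real^'n) $ i))) = (\<Prod>i\<in>UNIV. (LINT t|lborel. g i t))" .
qed

text \<open>A product in place of a power of \<open>1 + \<bar>u\<bar>\<close>, so that integrals of its powers factor into
  one-dimensional ones and tensor product kernels are bounded one coordinate at a time.\<close>

definition weight :: "real ^ 'n::finite \<Rightarrow> real" where
  "weight u = (\<Prod>i\<in>UNIV. 1 + \<bar>u $ i\<bar>)"

lemma weight_ge_1: "1 \<le> weight u"
  unfolding weight_def by (rule prod_ge_1) simp

lemma weight_pos: "0 < weight u"
  using weight_ge_1[of u] by linarith

lemma weight_nonneg: "0 \<le> weight u"
  using weight_pos[of u] by linarith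

lemma continuous_on_weight[continuous_intros]:
  "continuous_on S f \<Longrightarrow> continuous_on S (\<lambda>x. weight (f x))"
  unfolding weight_def by (intro continuous_intros)

lemma measurable_weight[measurable]: "weight \<in> borel_measurable borel"
  by (intro borel_measurable_continuous_onI continuous_intros)

lemma one_plus_norm_le_weight: "1 + norm u \<le> weight u"
proof -
  have "1 + (\<Sum>i\<in>A. \<bar>u $ i\<bar>) \<le> (\<Prod>i\<in>A. 1 + \<bar>u $ i\<bar>)" if "finite A" for A
    using that
  proof induction
    case (insert i A)
    have "1 + (\<Sum>i\<in>insert i A. \<bar>u $ i\<bar>) \<le> 1 + (\<Sum>i\<in>A. \<bar>u $ i\<bar>) + \<bar>u $ i\<bar> * (1 + (\<Sum>i\<in>A. \<bar>u $ i\<bar>))"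
      using insert by (simp add: algebra_simps sum_nonneg)
    also have "\<dots> = (1 + \<bar>u $ i\<bar>) * (1 + (\<Sum>i\<in>A. \<bar>u $ i\<bar>))" by (simp add: algebra_simps)
    also have "\<dots> \<le> (\<Prod>i\<in>insert i A. 1 + \<bar>u $ i\<bar>)"
      using insert by (simp add: mult_left_mono)
    finally show ?case .
  qed simp
  from this[of UNIV] show ?thesis
    using norm_le_l1_cart[of u] by (simp add: weight_def)
qed

lemma weight_le_power: "weight (u::real^'n::finite) \<le> (1 + norm u) ^ CARD('n)"
  unfolding weight_def
  by (rule order_trans[OF prod_mono[where g="\<lambda>_. 1 + norm u"]]) (auto simp: component_le_norm_cart)

lemma integrable_inverse_weight:
  assumes "2 \<le> p"
  shows "integrable lborel (\<lambda>u::real^'n::finite. 1 / weight u ^ p)"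
proof -
  have *: "integrable lborel (\<lambda>t::real. 1 / (1 + \<bar>t\<bar>)^2)"
  proof (rule Bochner_Integration.integrable_bound)
    show "integrable lborel (\<lambda>t::real. inverse (1 + t^2))"
      using integrable_inverse_1_plus_square by (simp add: set_integrable_def)
    show "AE t::real in lborel. norm (1 / (1 + \<bar>t\<bar>)^2) \<le> norm (inverse (1 + t^2))"
    proof (rule AE_I2)
      fix t :: real
      have "1 + t\<^sup>2 \<le> (1 + \<bar>t\<bar>)\<^sup>2" by (simp add: power2_sum)
      then have "1 / (1 + \<bar>t\<bar>)\<^sup>2 \<le> 1 / (1 + t\<^sup>2)"
        by (intro divide_left_mono) (auto intro!: mult_pos_pos add_pos_nonneg)
      then show "norm (1 / (1 + \<bar>t\<bar>)^2) \<le> norm (inverse (1 + t^2))" by (simp add: inverse_eq_divide)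
    qed
  qed measurable
  have "integrable lborel (\<lambda>u::real^'n. \<Prod>i\<in>UNIV. 1 / (1 + \<bar>u $ i\<bar>)^2)"
    by (rule integrable_vec_prod) (rule *)
  moreover have "(\<Prod>i\<in>UNIV. 1 / (1 + \<bar>u $ i\<bar>)^2) = 1 / weight u ^ 2" for u :: "real^'n"
    by (simp add: weight_def prod_dividef prod_power_distrib)
  ultimately have 2: "integrable lborel (\<lambda>u::real^'n. 1 / weight u ^ 2)" by simp
  show ?thesis
  proof (rule Bochner_Integration.integrable_bound[OF 2])
    show "AE u::real^'n in lborel. norm (1 / weight u ^ p) \<le> norm (1 / weight u ^ 2)"
      using weight_ge_1 weight_pos assms 
      by (auto intro!: AE_I2 divide_left_mono power_increasing mult_pos_pos zero_less_power simp: weight_nonneg)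
  qed measurable
qed

text \<open>The corner of the dyadic cell of side \<open>2\<^bsup>-n\<^esup>\<close> that contains \<open>u\<close>. The cells at level \<open>n\<close> are
  used inside a cube of side \<open>2\<^bsup>n+1\<^esup>\<close>, so that the Riemann sums exhaust the space while they are refined.\<close>

definition gridcell :: "nat \<Rightarrow> real ^ 'n::finite \<Rightarrow> real ^ 'n" where
  "gridcell n u = (\<chi> i. of_int \<lfloor>2 ^ n * u $ i\<rfloor> / 2 ^ n)"

definition gridindex :: "nat \<Rightarrow> (int ^ 'n::finite) set" where
  "gridindex n = {z. \<forall>i. - (4 ^ n) \<le> z $ i \<and> z $ i < 4 ^ n}"

definition gridpoint :: "nat \<Rightarrow> int ^ 'n::finite \<Rightarrow> real ^ 'n" where
  "gridpoint n z = (\<chi> i. of_int (z $ i) / 2 ^ n)"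

definition gridbox :: "nat \<Rightarrow> (real ^ 'n::finite) set" where
  "gridbox n = {u. \<forall>i. - (2 ^ n) \<le> u $ i \<and> u $ i < 2 ^ n}"

lemma finite_vec_set:
  fixes A :: "'n::finite \<Rightarrow> 'a set"
  assumes "\<And>i. finite (A i)"
  shows "finite {z::'a^'n. \<forall>i. z $ i \<in> A i}"
proof (rule finite_subset)
  show "{z::'a^'n. \<forall>i. z $ i \<in> A i} \<subseteq> vec_lambda ` Pi\<^sub>E UNIV A"
  proof
    fix z :: "'a^'n" assume "z \<in> {z. \<forall>i. z $ i \<in> A i}"
    then have "z = vec_lambda (vec_nth z)" "vec_nth z \<in> Pi\<^sub>E UNIV A" by (auto simp: PiE_def)
    then show "z \<in> vec_lambda ` Pi\<^sub>E UNIV A" by blast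
  qed
  show "finite (vec_lambda ` Pi\<^sub>E UNIV A :: ('a^'n) set)"
    by (intro finite_imageI finite_PiE) (use assms in auto)
qed

lemma finite_gridindex: "finite (gridindex n :: (int^'n::finite) set)"
proof (rule finite_subset)
  show "gridindex n \<subseteq> {z::int^'n. \<forall>i. z $ i \<in> {- (4 ^ n)..<4 ^ n}}"
    by (auto simp: gridindex_def)
qed (rule finite_vec_set, simp)

lemma gridpoint_inj: "gridpoint n z = gridpoint n z' \<longleftrightarrow> z = z'"
  by (simp add: gridpoint_def vec_eq_iff)

text \<open>Since the grids are nested, a step function at level \<open>n\<close> is also one at every finer level. This
  allows two Riemann sums to be compared on a common grid.\<close>

lemma gridcell_gridcell:
  assumes "n \<le> k"
  shows "gridcell n (gridcell k u) = gridcell n u"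
proof -
  have "\<lfloor>2 ^ n * (of_int \<lfloor>2 ^ k * x\<rfloor> / 2 ^ k :: real)\<rfloor> = \<lfloor>2 ^ n * x\<rfloor>" for x :: real
  proof -
    have k: "(2::real)^k = 2^n * 2^(k-n)" using assms by (simp flip: power_add)
    have "\<lfloor>2 ^ n * (of_int \<lfloor>2 ^ k * x\<rfloor> / 2 ^ k :: real)\<rfloor> = \<lfloor>of_int \<lfloor>2 ^ k * x\<rfloor> / real (2 ^ (k-n))\<rfloor>"
      by (simp add: k)
    also have "\<dots> = \<lfloor>2^k * x\<rfloor> div int (2^(k-n))"
      using floor_divide_of_int_eq[of "\<lfloor>2^k * x\<rfloor>" "int (2^(k-n))", where ?'a=real] by simp
    also have "\<dots> = \<lfloor>2^k * x / real (2^(k-n))\<rfloor>"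
      using floor_divide_real_eq_div[of "int (2^(k-n))" "2^k * x"] by simp
    also have "2^k * x / real (2^(k-n)) = 2^n * x" by (simp add: k)
    finally show ?thesis .
  qed
  then show ?thesis by (simp add: gridcell_def)
qed

lemma gridcell_close: "\<bar>gridcell n u $ i - u $ i\<bar> \<le> 1 / 2 ^ n"
proof -
  have "gridcell n u $ i - u $ i = (of_int \<lfloor>2 ^ n * u $ i\<rfloor> - 2 ^ n * u $ i) / 2 ^ n"
    by (simp add: gridcell_def field_simps)
  moreover have "\<bar>of_int \<lfloor>2 ^ n * u $ i\<rfloor> - 2 ^ n * u $ i\<bar> \<le> (1::real)" by linarith
  ultimately show ?thesis by (simp add: divide_right_mono)
qed

lemma tendsto_gridcell: "(\<lambda>n. gridcell n u) \<longlonglongrightarrow> u"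
proof (rule vec_tendstoI)
  fix i
  have "(\<lambda>n. gridcell n u $ i - u $ i) \<longlonglongrightarrow> 0"
  proof (rule Lim_null_comparison[where g="\<lambda>n. 1 / 2 ^ n"])
    show "(\<lambda>n. 1 / 2 ^ n :: real) \<longlonglongrightarrow> 0"
      using LIMSEQ_power_zero[of "1/2::real"] by (simp add: power_one_over)
  qed (use gridcell_close in \<open>auto simp: eventually_sequentially\<close>)
  then show "(\<lambda>n. gridcell n u $ i) \<longlonglongrightarrow> u $ i" by (simp add: LIM_zero_iff)
qed

lemma weight_gridcell: 
  fixes u :: "real^'n::finite"
  shows "weight u \<le> 2 ^ CARD('n) * weight (gridcell n u)"
proof -
  have "1 + \<bar>u $ i\<bar> \<le> 2 * (1 + \<bar>gridcell n u $ i\<bar>)" for i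
  proof -
    have "1 / 2 ^ n \<le> (1::real)" by simp
    then have "\<bar>gridcell n u $ i - u $ i\<bar> \<le> 1" using gridcell_close[of n u i] by (rule order_trans[rotated])
    moreover have "1 + \<bar>a\<bar> \<le> 2 * (1 + \<bar>b\<bar>)" if "\<bar>b - a\<bar> \<le> 1" for a b :: real using that by (smt (verit))
    ultimately show ?thesis by blast
  qed
  then have "weight u \<le> (\<Prod>i\<in>UNIV. 2 * (1 + \<bar>gridcell n u $ i\<bar>))"
    unfolding weight_def by (intro prod_mono) auto
  also have "\<dots> = 2 ^ CARD('n) * weight (gridcell n u)"
    by (simp only: weight_def prod.distrib prod_constant)
  finally show ?thesis .
qed

lemma gridbox_mono: "n \<le> k \<Longrightarrow> gridbox n \<subseteq> gridbox k"
proof -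
  assume "n \<le> k"
  then have "(2::real)^n \<le> 2^k" by simp
  then show ?thesis unfolding gridbox_def by (smt (verit) mem_Collect_eq subsetI)
qed

lemma eventually_gridbox: "\<forall>\<^sub>F n in sequentially. u \<in> gridbox n"
proof -
  obtain n :: nat where "norm u < real n" using reals_Archimedean2 by blast
  then have n: "norm u < 2 ^ n" using of_nat_less_two_power[of n, where ?'a=real] by linarith
  have "\<bar>u $ i\<bar> < 2 ^ n" for i using component_le_norm_cart[of u i] n by linarith
  then have "u \<in> gridbox n" unfolding gridbox_def 
    by (smt (verit) mem_Collect_eq)
  then show ?thesis using gridbox_mono unfolding eventually_sequentially by blast
qed

lemma gridcell_mem_gridbox_iff:
  assumes "n \<le> k"
  shows "gridcell k u \<in> gridbox n \<longleftrightarrow> u \<in> gridbox n"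
proof -
  have "- (2 ^ n) \<le> of_int \<lfloor>2 ^ k * x\<rfloor> / (2::real) ^ k \<longleftrightarrow> - (2 ^ n) \<le> x" for x :: real
  proof -
    have "- (2 ^ n) \<le> of_int \<lfloor>2 ^ k * x\<rfloor> / (2::real) ^ k \<longleftrightarrow> - (2^n * 2^k) \<le> (of_int \<lfloor>2 ^ k * x\<rfloor> :: real)"
      by (simp add: field_simps)
    also have "\<dots> \<longleftrightarrow> of_int (- (2^n*2^k)) \<le> (of_int \<lfloor>2 ^ k * x\<rfloor> :: real)" by simp
    also have "\<dots> \<longleftrightarrow> - (2^n * 2^k) \<le> \<lfloor>2 ^ k * x\<rfloor>" by (rule of_int_le_iff)
    also have "\<dots> \<longleftrightarrow> 2 ^ k * (- (2 ^ n)) \<le> 2 ^ k * x" by (simp add: le_floor_iff mult.commute)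
    also have "\<dots> \<longleftrightarrow> - (2 ^ n) \<le> x" by (rule mult_le_cancel_left_pos) simp
    finally show ?thesis .
  qed
  moreover have "of_int \<lfloor>2 ^ k * x\<rfloor> / (2::real) ^ k < 2 ^ n \<longleftrightarrow> x < 2 ^ n" for x :: real
  proof -
    have "of_int \<lfloor>2 ^ k * x\<rfloor> / (2::real) ^ k < 2 ^ n \<longleftrightarrow> of_int \<lfloor>2 ^ k * x\<rfloor> < (2^n * 2^k::real)"
      by (simp add: field_simps)
    also have "\<dots> \<longleftrightarrow> of_int \<lfloor>2 ^ k * x\<rfloor> < (of_int (2^n*2^k) :: real)" by simp
    also have "\<dots> \<longleftrightarrow> \<lfloor>2 ^ k * x\<rfloor> < 2^n * 2^k" by (rule of_int_less_iff)
    also have "\<dots> \<longleftrightarrow> x < 2^n" by (simp add: floor_less_iff field_simps)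
    finally show ?thesis .
  qed
  ultimately show ?thesis by (simp add: gridbox_def gridcell_def)
qed

lemma gridpoint_mem_gridbox: "gridpoint n z \<in> gridbox n \<longleftrightarrow> z \<in> gridindex n"
proof -
  have e: "(4::int)^n = 2^n * 2^n" by (simp flip: power_mult_distrib)
  have "- (2 ^ n) \<le> of_int y / (2::real) ^ n \<longleftrightarrow> - (4 ^ n) \<le> y" for y
  proof -
    have "- (2 ^ n) \<le> of_int y / (2::real) ^ n \<longleftrightarrow> of_int (- (2^n*2^n)) \<le> (of_int y :: real)"
      by (simp add: field_simps)
    also have "\<dots> \<longleftrightarrow> - (4 ^ n) \<le> y" by (simp only: of_int_le_iff e)
    finally show ?thesis .
  qed
  moreover have "of_int y / (2::real) ^ n < 2 ^ n \<longleftrightarrow> y < 4 ^ n" for y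
  proof -
    have "of_int y / (2::real) ^ n < 2 ^ n \<longleftrightarrow> of_int y < (of_int (2^n*2^n) :: real)"
      by (simp add: field_simps)
    also have "\<dots> \<longleftrightarrow> y < 4 ^ n" by (simp only: of_int_less_iff e)
    finally show ?thesis .
  qed
  ultimately show ?thesis by (simp add: gridbox_def gridindex_def gridpoint_def)
qed

lemma gridcell_eq_gridpoint: "gridcell n u = gridpoint n (\<chi> i. \<lfloor>2 ^ n * u $ i\<rfloor>)"
  by (simp add: gridcell_def gridpoint_def)

text \<open>A Riemann sum is the integral of a step function, and all limits of Riemann sums become
  instances of dominated convergence.\<close>

lemma
  fixes F :: "real^'n::finite \<Rightarrow> 'b::{banach,second_countable_topology}"
  shows integrable_grid_step: "integrable lborel (\<lambda>u. indicator (gridbox n) u *\<^sub>R F (gridcell n u))"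
    and integral_grid_step: "(LINT u|lborel. indicator (gridbox n) u *\<^sub>R F (gridcell n u)) =
       (\<Sum>z\<in>gridindex n. (1 / 2 ^ n) ^ CARD('n) *\<^sub>R F (gridpoint n z))"
proof -
  define I where "I z i = {of_int (z $ i) / 2 ^ n ..< (of_int (z $ i) + 1) / 2 ^ n :: real}" for z :: "int^'n" and i
  have cell: "gridcell n u = gridpoint n z \<longleftrightarrow> (\<forall>i. u $ i \<in> I z i)" for u :: "real^'n" and z
  proof -
    have "gridcell n u = gridpoint n z \<longleftrightarrow> (\<forall>i. \<lfloor>2 ^ n * u $ i\<rfloor> = z $ i)"
      unfolding gridcell_eq_gridpoint gridpoint_inj by (simp add: vec_eq_iff)
    also have "\<dots> \<longleftrightarrow> (\<forall>i. u $ i \<in> I z i)"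
      by (auto simp: I_def floor_eq_iff field_simps)
    finally show ?thesis .
  qed
  define c where "c z u = (\<Prod>i\<in>UNIV. indicator (I z i) (u $ i) :: real)" for z and u :: "real^'n"
  have c: "c z u = (if gridcell n u = gridpoint n z then 1 else 0)" for z u
    unfolding cell c_def by (auto simp: indicator_def prod_eq_1_iff)
  have ne: "real_of_int (z $ i) / 2 ^ n \<le> (real_of_int (z $ i) + 1) / 2 ^ n" for z :: "int^'n" and i
    by (simp add: divide_right_mono)
  have Iint: "integrable lborel (indicator (I z i) :: real \<Rightarrow> real)" for z i
    using ne by (simp add: I_def)
  have Ival: "(LINT t|lborel. indicator (I z i) t :: real) = 1 / 2^n" for z i
    using ne[of z i] by (simp add: I_def diff_divide_distrib[symmetric])
  have cint: "integrable lborel (c z)" for z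
    unfolding c_def by (rule integrable_vec_prod) (rule Iint)
  have cval: "(LINT u|lborel. c z u) = (1/2^n)^CARD('n)" for z
    unfolding c_def by (subst integral_vec_prod) (use Iint Ival in auto)
  have eq: "indicator (gridbox n) u *\<^sub>R F (gridcell n u) = (\<Sum>z\<in>gridindex n. c z u *\<^sub>R F (gridpoint n z))" for u
  proof (cases "u \<in> gridbox n")
    case True
    define z where "z = (\<chi> i. \<lfloor>2 ^ n * u $ i\<rfloor>)"
    have z: "gridcell n u = gridpoint n z" by (simp add: gridcell_eq_gridpoint z_def)
    then have zi: "z \<in> gridindex n" using True gridcell_mem_gridbox_iff[of n n u] gridpoint_mem_gridbox by auto
    have "(\<Sum>z\<in>gridindex n. c z u *\<^sub>R F (gridpoint n z)) = (\<Sum>z'\<in>gridindex n. if z' = z then F (gridpoint n z) else 0)"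
      by (rule sum.cong) (auto simp: c z gridpoint_inj)
    then show ?thesis using True zi sum.delta[OF finite_gridindex[of n], of z "\<lambda>_. F (gridpoint n z)"] by (simp add: z)
  next
    case False
    then have "c z u = 0" if "z \<in> gridindex n" for z
      using that gridcell_mem_gridbox_iff[of n n u] gridpoint_mem_gridbox[of n z] by (auto simp: c)
    then show ?thesis using False by simp
  qed
  show "integrable lborel (\<lambda>u. indicator (gridbox n) u *\<^sub>R F (gridcell n u))"
    unfolding eq using cint by simp
  show "(LINT u|lborel. indicator (gridbox n) u *\<^sub>R F (gridcell n u)) =
       (\<Sum>z\<in>gridindex n. (1 / 2 ^ n) ^ CARD('n) *\<^sub>R F (gridpoint n z))"
    unfolding eq using cint by (subst Bochner_Integration.integral_sum) (auto simp: cval)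
qed

lemma
  fixes F :: "real^'n::finite \<Rightarrow> 'b::{banach,second_countable_topology}"
  assumes F: "\<And>u. (\<lambda>n. F (gridcell n u)) \<longlonglongrightarrow> F u"
    and G: "\<And>n u. norm (F (gridcell n u)) \<le> G u" "integrable lborel G"
  shows integrable_grid_limit: "integrable lborel F"
    and grid_sum_tendsto_integral:
      "(\<lambda>n. \<Sum>z\<in>gridindex n. (1 / 2 ^ n) ^ CARD('n) *\<^sub>R F (gridpoint n z)) \<longlonglongrightarrow> (LINT u|lborel. F u)"
proof -
  let ?s = "\<lambda>n u. indicator (gridbox n) u *\<^sub>R F (gridcell n u)"
  have lim: "(\<lambda>n. ?s n u) \<longlonglongrightarrow> F u" for u
  proof (rule Lim_transform_eventually[OF F])
    show "\<forall>\<^sub>F n in sequentially. F (gridcell n u) = ?s n u"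
      using eventually_gridbox[of u] by eventually_elim simp
  qed
  have meas: "?s n \<in> borel_measurable lborel" for n
    by (rule borel_measurable_integrable[OF integrable_grid_step])
  have Fm: "F \<in> borel_measurable lborel"
    using lim meas by (rule borel_measurable_LIMSEQ_metric[rotated])
  have bd: "norm (?s n u) \<le> G u" for n u
    using G(1)[of n u] order_trans[OF norm_ge_zero G(1)[of n u]] by (auto simp: indicator_def)
  show "integrable lborel F"
    by (rule integrable_dominated_convergence[where s="?s", OF Fm meas G(2)]) (use lim bd in auto)
  have "(\<lambda>n. LINT u|lborel. ?s n u) \<longlonglongrightarrow> (LINT u|lborel. F u)"
    by (rule integral_dominated_convergence[where s="?s", OF Fm meas G(2)]) (use lim bd in auto)
  then show "(\<lambda>n. \<Sum>z\<in>gridindex n. (1 / 2 ^ n) ^ CARD('n) *\<^sub>R F (gridpoint n z)) \<longlonglongrightarrow> (LINT u|lborel. F u)"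
    by (simp only: integral_grid_step)
qed

definition grid_sum :: "nat \<Rightarrow> (real^'n::finite \<Rightarrow> real^'n \<Rightarrow> complex) \<Rightarrow> real^'n \<Rightarrow> complex" where
  "grid_sum n V x = (\<Sum>z\<in>gridindex n. (1 / 2 ^ n) ^ CARD('n) *\<^sub>R V (gridpoint n z) x)"

section \<open>Translation-invariant Banach spaces of functions\<close>

locale translation_space =
  fixes B :: "(real ^ 'n::finite \<Rightarrow> complex) set"
    and N :: "(real ^ 'n \<Rightarrow> complex) \<Rightarrow> real"
  assumes zero_mem: "(\<lambda>x. 0) \<in> B"
    and add_mem: "f \<in> B \<Longrightarrow> g \<in> B \<Longrightarrow> (\<lambda>x. f x + g x) \<in> B"
    and N_add: "f \<in> B \<Longrightarrow> g \<in> B \<Longrightarrow> N (\<lambda>x. f x + g x) \<le> N f + N g"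
    and scale_mem: "f \<in> B \<Longrightarrow> (\<lambda>x. c *\<^sub>R f x) \<in> B"
    and N_scale: "f \<in> B \<Longrightarrow> N (\<lambda>x. c *\<^sub>R f x) = \<bar>c\<bar> * N f"
    and N_nonneg: "f \<in> B \<Longrightarrow> 0 \<le> N f"
    and N_eq_0_iff: "f \<in> B \<Longrightarrow> N f = 0 \<longleftrightarrow> (AE x in lebesgue. f x = 0)"
    and N_complete: "(\<And>n::nat. X n \<in> B) \<Longrightarrow>
        (\<forall>e>0. \<exists>M. \<forall>i\<ge>M. \<forall>j\<ge>M. N (\<lambda>x. X i x - X j x) < e) \<Longrightarrow>
        \<exists>f\<in>B. (\<lambda>n. N (\<lambda>x. X n x - f x)) \<longlonglongrightarrow> 0"
    and shift_mem: "f \<in> B \<Longrightarrow> (\<lambda>x. f (x + \<xi>)) \<in> B"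
    and N_shift: "f \<in> B \<Longrightarrow> N (\<lambda>x. f (x + \<xi>)) = N f"
    and N_shift_cont: "f \<in> B \<Longrightarrow> ((\<lambda>h. N (\<lambda>x. f (x + h) - f x)) \<longlongrightarrow> 0) (at 0)"
begin

lemma minus_mem: "f \<in> B \<Longrightarrow> (\<lambda>x. - f x) \<in> B"
  using scale_mem[of f "-1"] by simp

lemma diff_mem: "f \<in> B \<Longrightarrow> g \<in> B \<Longrightarrow> (\<lambda>x. f x - g x) \<in> B"
  using add_mem[of f "\<lambda>x. - g x"] minus_mem[of g] by simp

lemma sum_mem: "(\<And>i. i \<in> A \<Longrightarrow> F i \<in> B) \<Longrightarrow> (\<lambda>x. \<Sum>i\<in>A. F i x) \<in> B"
  by (induction A rule: infinite_finite_induct) (auto intro: zero_mem add_mem)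

lemma N_zero: "N (\<lambda>x. 0) = 0"
  using N_scale[OF zero_mem, of 0] by simp

lemma N_minus: "f \<in> B \<Longrightarrow> N (\<lambda>x. - f x) = N f"
  using N_scale[of f "-1"] by simp

lemma N_diff: "f \<in> B \<Longrightarrow> g \<in> B \<Longrightarrow> N (\<lambda>x. f x - g x) \<le> N f + N g"
  using N_add[of f "\<lambda>x. - g x"] minus_mem[of g] N_minus[of g] by simp

lemma N_diff_commute: "f \<in> B \<Longrightarrow> g \<in> B \<Longrightarrow> N (\<lambda>x. f x - g x) = N (\<lambda>x. g x - f x)"
  using N_minus[OF diff_mem[of f g]] by simp

lemma N_sum: "(\<And>i. i \<in> A \<Longrightarrow> F i \<in> B) \<Longrightarrow> N (\<lambda>x. \<Sum>i\<in>A. F i x) \<le> (\<Sum>i\<in>A. N (F i))"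
proof (induction A rule: infinite_finite_induct)
  case (insert a A)
  have "N (\<lambda>x. F a x + (\<Sum>i\<in>A. F i x)) \<le> N (F a) + N (\<lambda>x. \<Sum>i\<in>A. F i x)"
    using insert by (intro N_add sum_mem) auto
  then show ?case using insert by (simp add: N_zero)
qed (auto simp: N_zero)

lemma N_triangle:
  assumes "f \<in> B" "g \<in> B" "h \<in> B"
  shows "N (\<lambda>x. f x - h x) \<le> N (\<lambda>x. f x - g x) + N (\<lambda>x. g x - h x)"
  using N_add[OF diff_mem[OF assms(1,2)] diff_mem[OF assms(2,3)]] by simp

lemma N_le: "f \<in> B \<Longrightarrow> g \<in> B \<Longrightarrow> N f \<le> N g + N (\<lambda>x. f x - g x)"
  using N_add[of g "\<lambda>x. f x - g x"] diff_mem[of f g] by simp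

lemma abs_N_diff_le: "f \<in> B \<Longrightarrow> g \<in> B \<Longrightarrow> \<bar>N f - N g\<bar> \<le> N (\<lambda>x. f x - g x)"
  using N_le[of f g] N_le[of g f] N_diff_commute[of f g] by linarith

text \<open>Convergence in \<open>B\<close> is expressed throughout by \<open>N (X n - g) \<longlonglongrightarrow> 0\<close>; the next lemmas are its
  rules of calculation.\<close>

lemma tendsto_N:
  assumes "\<And>n. X n \<in> B" "f \<in> B" "((\<lambda>n. N (\<lambda>x. X n x - f x)) \<longlongrightarrow> 0) F"
  shows "((\<lambda>n. N (X n)) \<longlongrightarrow> N f) F"
proof (rule LIM_zero_cancel, rule Lim_null_comparison[OF _ assms(3)])
  show "\<forall>\<^sub>F n in F. norm (N (X n) - N f) \<le> N (\<lambda>x. X n x - f x)"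
    using abs_N_diff_le[OF assms(1,2)] by auto
qed

lemma tendsto_N_add:
  assumes "\<And>n. X n \<in> B" "f \<in> B" "((\<lambda>n. N (\<lambda>x. X n x - f x)) \<longlongrightarrow> 0) F"
    and "\<And>n. Y n \<in> B" "g \<in> B" "((\<lambda>n. N (\<lambda>x. Y n x - g x)) \<longlongrightarrow> 0) F"
  shows "((\<lambda>n. N (\<lambda>x. (X n x + Y n x) - (f x + g x))) \<longlongrightarrow> 0) F"
proof (rule Lim_null_comparison)
  show "((\<lambda>n. N (\<lambda>x. X n x - f x) + N (\<lambda>x. Y n x - g x)) \<longlongrightarrow> 0) F"
    using tendsto_add[OF assms(3,6)] by simp
  have "N (\<lambda>x. (X n x + Y n x) - (f x + g x)) \<le> N (\<lambda>x. X n x - f x) + N (\<lambda>x. Y n x - g x)" for n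
    using N_add[OF diff_mem[OF assms(1,2)] diff_mem[OF assms(4,5)], of n n] by (simp add: algebra_simps)
  moreover have "0 \<le> N (\<lambda>x. (X n x + Y n x) - (f x + g x))" for n
    by (intro N_nonneg diff_mem add_mem assms)
  ultimately show "\<forall>\<^sub>F n in F. norm (N (\<lambda>x. (X n x + Y n x) - (f x + g x))) \<le> N (\<lambda>x. X n x - f x) + N (\<lambda>x. Y n x - g x)"
    by (auto intro!: always_eventually)
qed

lemma tendsto_N_scale:
  assumes X: "\<And>n. X n \<in> B" "f \<in> B" "((\<lambda>n. N (\<lambda>x. X n x - f x)) \<longlongrightarrow> 0) F"
    and c: "(c \<longlongrightarrow> d) F"
  shows "((\<lambda>n. N (\<lambda>x. c n *\<^sub>R X n x - d *\<^sub>R f x)) \<longlongrightarrow> 0) F"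
proof (rule Lim_null_comparison)
  have "((\<lambda>n. \<bar>c n\<bar> * N (\<lambda>x. X n x - f x) + \<bar>c n - d\<bar> * N f) \<longlongrightarrow> \<bar>d\<bar> * 0 + \<bar>d - d\<bar> * N f) F"
    by (intro tendsto_intros c X)
  then show "((\<lambda>n. \<bar>c n\<bar> * N (\<lambda>x. X n x - f x) + \<bar>c n - d\<bar> * N f) \<longlongrightarrow> 0) F" by simp
  have "N (\<lambda>x. c n *\<^sub>R X n x - d *\<^sub>R f x) \<le> \<bar>c n\<bar> * N (\<lambda>x. X n x - f x) + \<bar>c n - d\<bar> * N f" for n
  proof -
    have "(\<lambda>x. c n *\<^sub>R X n x - d *\<^sub>R f x) = (\<lambda>x. c n *\<^sub>R (X n x - f x) + (c n - d) *\<^sub>R f x)"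
      by (simp add: algebra_simps)
    moreover have "N (\<lambda>x. c n *\<^sub>R (X n x - f x) + (c n - d) *\<^sub>R f x) \<le> \<bar>c n\<bar> * N (\<lambda>x. X n x - f x) + \<bar>c n - d\<bar> * N f"
      using N_add[OF scale_mem[OF diff_mem[OF X(1,2)]] scale_mem[OF X(2)], of "c n" n "c n - d"]
      by (simp add: N_scale diff_mem X)
    ultimately show ?thesis by simp
  qed
  moreover have "0 \<le> N (\<lambda>x. c n *\<^sub>R X n x - d *\<^sub>R f x)" for n
    by (intro N_nonneg diff_mem scale_mem X)
  ultimately show "\<forall>\<^sub>F n in F. norm (N (\<lambda>x. c n *\<^sub>R X n x - d *\<^sub>R f x)) \<le> \<bar>c n\<bar> * N (\<lambda>x. X n x - f x) + \<bar>c n - d\<bar> * N f"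
    by (auto intro!: always_eventually)
qed

lemma tendsto_N_sum:
  assumes "\<And>i n. i \<in> A \<Longrightarrow> X i n \<in> B" "\<And>i. i \<in> A \<Longrightarrow> f i \<in> B"
    "\<And>i. i \<in> A \<Longrightarrow> ((\<lambda>n. N (\<lambda>x. X i n x - f i x)) \<longlongrightarrow> 0) F"
  shows "((\<lambda>n. N (\<lambda>x. (\<Sum>i\<in>A. X i n x) - (\<Sum>i\<in>A. f i x))) \<longlongrightarrow> 0) F"
  using assms
proof (induction A rule: infinite_finite_induct)
  case (insert a A)
  show ?case unfolding sum.insert[OF insert(1,2)]
    by (rule tendsto_N_add) (use insert in \<open>auto intro: sum_mem\<close>)
qed (auto simp: N_zero)

text \<open>Limits in \<open>B\<close> are unique only up to null functions.\<close>

lemma N_limit_unique: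
  assumes "\<And>n. X n \<in> B" "f \<in> B" "g \<in> B"
    "((\<lambda>n. N (\<lambda>x. X n x - f x)) \<longlongrightarrow> 0) F" "((\<lambda>n. N (\<lambda>x. X n x - g x)) \<longlongrightarrow> 0) F" "F \<noteq> bot"
  shows "AE x in lebesgue. f x = g x"
proof -
  have "((\<lambda>n. N (\<lambda>x. X n x - f x) + N (\<lambda>x. X n x - g x)) \<longlongrightarrow> 0) F"
    using tendsto_add[OF assms(4,5)] by simp
  moreover have "N (\<lambda>x. f x - g x) \<le> N (\<lambda>x. X n x - f x) + N (\<lambda>x. X n x - g x)" for n
    using N_triangle[OF assms(2,1,3), of n] N_diff_commute[OF assms(2,1), of n] by simp
  ultimately have "N (\<lambda>x. f x - g x) \<le> 0"
    using assms(6) by (intro tendsto_lowerbound[of _ 0 F]) (auto intro!: always_eventually)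
  then have "N (\<lambda>x. f x - g x) = 0" using N_nonneg[OF diff_mem[OF assms(2,3)]] by simp
  then show ?thesis using N_eq_0_iff[OF diff_mem[OF assms(2,3)]] by simp
qed

lemma N_shift_tendsto:
  assumes f: "f \<in> B" and h: "(h \<longlongrightarrow> v) F"
  shows "((\<lambda>n. N (\<lambda>x. f (x + h n) - f (x + v))) \<longlongrightarrow> 0) F"
proof -
  have "N (\<lambda>x. f (x + h n) - f (x + v)) = N (\<lambda>x. f (x + (h n - v)) - f x)" for n
    using N_shift[OF diff_mem[OF shift_mem[OF f, of "h n - v"] f], of v] by (simp add: algebra_simps)
  moreover have "((\<lambda>n. N (\<lambda>x. f (x + (h n - v)) - f x)) \<longlongrightarrow> 0) F"
  proof (rule tendsto_compose_at[where f="\<lambda>n. h n - v" and g="\<lambda>k. N (\<lambda>x. f (x + k) - f x)", unfolded o_def])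
    show "((\<lambda>n. h n - v) \<longlongrightarrow> 0) F" using h by (simp add: LIM_zero_iff)
    show "((\<lambda>k. N (\<lambda>x. f (x + k) - f x)) \<longlongrightarrow> 0) (at 0)" by (rule N_shift_cont[OF f])
    show "\<forall>\<^sub>F y in F. h y - v = 0 \<longrightarrow> N (\<lambda>x. f (x + 0) - f x) = 0" by (simp add: N_zero)
  qed
  ultimately show ?thesis by simp
qed

lemma grid_sum_mem: "(\<And>u. V u \<in> B) \<Longrightarrow> grid_sum n V \<in> B"
  unfolding grid_sum_def by (intro sum_mem scale_mem)

text \<open>A dominated convergence theorem for functions with values in \<open>B\<close>. Both Riemann sums in a
  difference are integrals of step functions \<open>W n\<close>, \<open>W k\<close> on the finer grid, so its norm is at most
  the integral of \<open>N (W n u - W k u)\<close>, hence at most the sum of the integrals of \<open>e n u\<close> and \<open>e k u\<close>,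
  the distances to \<open>V u\<close>; these tend to \<open>0\<close> by dominated convergence, and completeness gives a limit.
  No integration theory for functions with values in \<open>B\<close> is required, only integrals of the real functions \<open>e n\<close>.\<close>

lemma grid_sum_limit_exists:
  assumes V: "\<And>u. V u \<in> B"
    and cont: "\<And>u. (\<lambda>n. N (\<lambda>x. V (gridcell n u) x - V u x)) \<longlonglongrightarrow> 0"
    and G: "\<And>u. N (V u) \<le> G u" "\<And>n u. N (V (gridcell n u)) \<le> G u" "integrable lborel G"
  shows "\<exists>\<phi>\<in>B. (\<lambda>n. N (\<lambda>x. grid_sum n V x - \<phi> x)) \<longlonglongrightarrow> 0"
proof -
  define W where "W n u = (\<lambda>x. indicator (gridbox n) u *\<^sub>R V (gridcell n u) x)" for n u
  have W: "W n u \<in> B" for n u unfolding W_def by (intro scale_mem V)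
  have W0: "W n u = (\<lambda>x. 0)" if "u \<notin> gridbox n" for n u
    using that by (simp add: W_def)
  have Wref: "W n (gridcell k u) = W n u" if "n \<le> k" for n k u
    using gridcell_mem_gridbox_iff[OF that, of u] by (simp add: W_def gridcell_gridcell[OF that] indicator_def)
  define D where "D n k u = N (\<lambda>x. W n u x - W k u x)" for n k u
  have Deq: "D n k u = indicator (gridbox k) u *\<^sub>R D n k (gridcell k u)" if "n \<le> k" for n k u
  proof (cases "u \<in> gridbox k")
    case True
    then show ?thesis using Wref[OF that, of u] Wref[of k k u] by (simp add: D_def)
  next
    case False
    then have "u \<notin> gridbox n" using gridbox_mono[OF that] by blast
    then show ?thesis using False by (simp add: D_def W0 N_zero)
  qed
  have Dint: "integrable lborel (D n k)" if "n \<le> k" for n k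
    using integrable_grid_step[of k "D n k"] 
    by (rule Bochner_Integration.integrable_cong[THEN iffD2, OF refl, rotated]) (rule Deq[OF that])
  have key: "N (\<lambda>x. grid_sum n V x - grid_sum k V x) \<le> (LINT u|lborel. D n k u)" if "n \<le> k" for n k
  proof -
    have gs: "grid_sum n' V x = (\<Sum>z\<in>gridindex k. (1 / 2 ^ k) ^ CARD('n) *\<^sub>R W n' (gridpoint k z) x)" if "n' \<le> k" for x n'
    proof -
      have "grid_sum n' V x = (LINT u|lborel. W n' u x)"
        unfolding grid_sum_def W_def by (subst integral_grid_step[symmetric]) simp
      also have "(\<lambda>u. W n' u x) = (\<lambda>u. indicator (gridbox k) u *\<^sub>R W n' (gridcell k u) x)"
      proof
        fix u
        show "W n' u x = indicator (gridbox k) u *\<^sub>R W n' (gridcell k u) x"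
        proof (cases "u \<in> gridbox k")
          case False
          then have "u \<notin> gridbox n'" using gridbox_mono[OF that] by blast
          then show ?thesis using False W0[of u n'] by simp
        qed (simp add: Wref[OF that])
      qed
      also have "(LINT u|lborel. \<dots> u) = (\<Sum>z\<in>gridindex k. (1 / 2 ^ k) ^ CARD('n) *\<^sub>R W n' (gridpoint k z) x)"
        by (rule integral_grid_step)
      finally show ?thesis .
    qed
    have "N (\<lambda>x. grid_sum n V x - grid_sum k V x) =
        N (\<lambda>x. \<Sum>z\<in>gridindex k. (1 / 2 ^ k) ^ CARD('n) *\<^sub>R (W n (gridpoint k z) x - W k (gridpoint k z) x))"
      using gs[OF that] gs[of k] by (simp add: sum_subtractf scaleR_diff_right)
    also have "\<dots> \<le> (\<Sum>z\<in>gridindex k. N (\<lambda>x. (1 / 2 ^ k) ^ CARD('n) *\<^sub>R (W n (gridpoint k z) x - W k (gridpoint k z) x)))"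
      by (intro N_sum scale_mem diff_mem W)
    also have "\<dots> = (\<Sum>z\<in>gridindex k. (1 / 2 ^ k) ^ CARD('n) *\<^sub>R D n k (gridpoint k z))"
      by (intro sum.cong refl) (simp add: N_scale diff_mem W D_def)
    also have "\<dots> = (LINT u|lborel. indicator (gridbox k) u *\<^sub>R D n k (gridcell k u))"
      by (rule integral_grid_step[symmetric])
    also have "\<dots> = (LINT u|lborel. D n k u)"
      by (rule Bochner_Integration.integral_cong[OF refl]) (rule Deq[OF that, symmetric])
    finally show ?thesis .
  qed
  define e where "e n u = N (\<lambda>x. W n u x - V u x)" for n u
  have Wlim: "(\<lambda>n. e n u) \<longlonglongrightarrow> 0" for u
  proof (rule Lim_transform_eventually[OF cont])
    show "\<forall>\<^sub>F n in sequentially. N (\<lambda>x. V (gridcell n u) x - V u x) = e n u"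
      using eventually_gridbox[of u] by eventually_elim (simp add: e_def W_def)
  qed
  have Dlim: "(\<lambda>k. D n k u) \<longlonglongrightarrow> e n u" for n u
  proof -
    have "(\<lambda>k. N (\<lambda>x. (W n u x - W k u x) - (W n u x - V u x))) \<longlonglongrightarrow> 0"
    proof (rule Lim_transform_eventually[OF Wlim[of u]])
      show "\<forall>\<^sub>F k in sequentially. e k u = N (\<lambda>x. W n u x - W k u x - (W n u x - V u x))"
        unfolding e_def using N_diff_commute[OF W V] by (intro always_eventually) simp
    qed
    then show ?thesis unfolding D_def e_def
      by (rule tendsto_N[OF diff_mem[OF W W] diff_mem[OF W V]])
  qed
  (* e n itself is not a step function; it is measurable as the limit of D n k, a step function in u. *)
  have em: "e n \<in> borel_measurable lborel" for n
  proof (rule borel_measurable_LIMSEQ_metric)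
    show "(\<lambda>k. D n (n + k) u) \<longlonglongrightarrow> e n u" for u
      using LIMSEQ_ignore_initial_segment[OF Dlim[of n u], of n] by (simp add: add.commute)
    show "D n (n + k) \<in> borel_measurable lborel" for k
      by (rule borel_measurable_integrable[OF Dint]) simp
  qed
  have NW: "N (W n u) \<le> G u" for n u
    using G(2)[of n u] N_nonneg[OF V[of "gridcell n u"]] by (auto simp: W_def N_scale V indicator_def N_zero)
  have ele: "\<bar>e n u\<bar> \<le> 2 * G u" for n u
    using N_diff[OF W[of n u] V[of u]] NW[of n u] G(1)[of u] N_nonneg[OF diff_mem[OF W[of n u] V[of u]]]
    by (simp add: e_def)
  have G2: "integrable lborel (\<lambda>u. 2 * G u)" using G(3) by simp
  have eint: "integrable lborel (e n)" for n
    by (rule Bochner_Integration.integrable_bound[OF G2 em]) (rule AE_I2, use ele in \<open>simp add: order_trans[OF _ abs_ge_self]\<close>)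
  have elim: "(\<lambda>n. LINT u|lborel. e n u) \<longlonglongrightarrow> (LINT u::real^'n|lborel. 0)"
    by (rule integral_dominated_convergence[where s=e and w="\<lambda>u. 2 * G u"]) (use Wlim ele em G2 in auto)
  have key2: "N (\<lambda>x. grid_sum n V x - grid_sum k V x) \<le> (LINT u|lborel. e n u) + (LINT u|lborel. e k u)" if "n \<le> k" for n k
  proof -
    have "(LINT u|lborel. D n k u) \<le> (LINT u|lborel. e n u + e k u)"
    proof (rule integral_mono[OF Dint[OF that]])
      show "D n k u \<le> e n u + e k u" for u
        using N_triangle[OF W[of n u] V[of u] W[of k u]] N_diff_commute[OF V[of u] W[of k u]] by (simp add: D_def e_def)
    qed (use eint in simp)
    also have "\<dots> = (LINT u|lborel. e n u) + (LINT u|lborel. e k u)"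
      using eint by simp
    finally show ?thesis using key[OF that] by linarith
  qed
  have key3: "N (\<lambda>x. grid_sum n V x - grid_sum k V x) \<le> (LINT u|lborel. e n u) + (LINT u|lborel. e k u)" for n k
    using key2[of n k] key2[of k n] N_diff_commute[OF grid_sum_mem[of V n] grid_sum_mem[of V k]] V
    by (cases "n \<le> k") auto
  have "\<forall>\<epsilon>>0. \<exists>M. \<forall>i\<ge>M. \<forall>j\<ge>M. N (\<lambda>x. grid_sum i V x - grid_sum j V x) < \<epsilon>"
  proof (intro allI impI)
    fix \<epsilon> :: real assume "\<epsilon> > 0"
    then have "\<forall>\<^sub>F n in sequentially. (LINT u|lborel. e n u) < \<epsilon> / 2"
      using elim by (intro order_tendstoD(2)) auto
    then obtain M where "\<And>n. n \<ge> M \<Longrightarrow> (LINT u|lborel. e n u) < \<epsilon> / 2"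
      unfolding eventually_sequentially by blast
    then show "\<exists>M. \<forall>i\<ge>M. \<forall>j\<ge>M. N (\<lambda>x. grid_sum i V x - grid_sum j V x) < \<epsilon>"
    proof (intro exI[of _ M] allI impI)
      fix i j assume "M \<le> i" "M \<le> j"
      then have "(LINT u|lborel. e i u) < \<epsilon> / 2" "(LINT u|lborel. e j u) < \<epsilon> / 2"
        using \<open>\<And>n. n \<ge> M \<Longrightarrow> (LINT u|lborel. e n u) < \<epsilon> / 2\<close> by blast+
      then show "N (\<lambda>x. grid_sum i V x - grid_sum j V x) < \<epsilon>"
        using key3[of i j] by linarith
    qed
  qed
  from N_complete[of "\<lambda>n. grid_sum n V", OF grid_sum_mem[OF V] this]
  show ?thesis .
qed

end

section \<open>Finite differences\<close>

lemma fdiff_power_expand: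
  fixes f :: "real^'n::finite \<Rightarrow> complex"
  shows "(fdiff h ^^ r) f x = (\<Sum>l\<le>r. ((-1) ^ (r - l) * real (r choose l)) *\<^sub>R f (x + real l *\<^sub>R h))"
proof (induction r arbitrary: x)
  case 0
  show ?case by simp
next
  case (Suc r)
  let ?c = "\<lambda>r l. (-1) ^ (r - l) * real (r choose l)"
  have "(fdiff h ^^ Suc r) f x = (\<Sum>l\<le>r. ?c r l *\<^sub>R f (x + real (Suc l) *\<^sub>R h)) - (\<Sum>l\<le>r. ?c r l *\<^sub>R f (x + real l *\<^sub>R h))"
  proof -
    have "(fdiff h ^^ Suc r) f x = (fdiff h ^^ r) f (x + h) - (fdiff h ^^ r) f x"
      by (simp add: fdiff_def)
    moreover have "x + h + real l *\<^sub>R h = x + real (Suc l) *\<^sub>R h" for l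
      by (simp add: scaleR_left_distrib add.assoc)
    ultimately show ?thesis by (simp only: Suc.IH)
  qed
  also have "(\<Sum>l\<le>r. ?c r l *\<^sub>R f (x + real (Suc l) *\<^sub>R h)) = 
      (\<Sum>l\<in>{1..Suc r}. ((-1) ^ (Suc r - l) * real (r choose (l - 1))) *\<^sub>R f (x + real l *\<^sub>R h))"
    by (rule sum.reindex_bij_witness[of _ "\<lambda>l. l - 1" Suc]) auto
  also have "\<dots> = (\<Sum>l\<le>Suc r. (if l = 0 then 0 else (-1) ^ (Suc r - l) * real (r choose (l - 1))) *\<^sub>R f (x + real l *\<^sub>R h))"
    by (rule sum.mono_neutral_cong_left) auto
  also have "(\<Sum>l\<le>r. ?c r l *\<^sub>R f (x + real l *\<^sub>R h)) = 
      (\<Sum>l\<le>Suc r. (- ((-1) ^ (Suc r - l) * real (r choose l))) *\<^sub>R f (x + real l *\<^sub>R h))"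
    by (rule sum.mono_neutral_cong_left) (auto simp: Suc_diff_le not_le less_Suc_eq_le)
  also have "(\<Sum>l\<le>Suc r. (if l = 0 then 0 else (-1) ^ (Suc r - l) * real (r choose (l - 1))) *\<^sub>R f (x + real l *\<^sub>R h)) - \<dots>
     = (\<Sum>l\<le>Suc r. ?c (Suc r) l *\<^sub>R f (x + real l *\<^sub>R h))"
    unfolding sum_subtractf[symmetric]
  proof (rule sum.cong[OF refl])
    fix l 
    show "(if l = 0 then 0 else (-1) ^ (Suc r - l) * real (r choose (l - 1))) *\<^sub>R f (x + real l *\<^sub>R h)
       - (- ((-1) ^ (Suc r - l) * real (r choose l))) *\<^sub>R f (x + real l *\<^sub>R h) = ?c (Suc r) l *\<^sub>R f (x + real l *\<^sub>R h)"
      unfolding scaleR_left_diff_distrib[symmetric]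
      by (rule arg_cong[where f="\<lambda>c. c *\<^sub>R f (x + real l *\<^sub>R h)"]) (cases l, simp_all add: algebra_simps)
  qed
  finally show ?case .
qed

lemma fdiff_power_shift: "(fdiff h ^^ r) (\<lambda>x. f (x + v)) = (\<lambda>x. (fdiff h ^^ r) f (x + v))"
  by (rule ext) (simp add: fdiff_power_expand algebra_simps)

lemma fdiff_power_scale: "(fdiff h ^^ r) (\<lambda>x. c *\<^sub>R f x) = (\<lambda>x. c *\<^sub>R (fdiff h ^^ r) f x)"
  by (rule ext) (simp add: fdiff_power_expand scaleR_sum_right mult.commute)

lemma fdiff_power_sum: "(fdiff h ^^ r) (\<lambda>x. \<Sum>i\<in>A. F i x) = (\<lambda>x. \<Sum>i\<in>A. (fdiff h ^^ r) (F i) x)"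
proof (rule ext)
  fix x
  show "(fdiff h ^^ r) (\<lambda>x. \<Sum>i\<in>A. F i x) x = (\<Sum>i\<in>A. (fdiff h ^^ r) (F i) x)"
    unfolding fdiff_power_expand scaleR_sum_right by (rule sum.swap)
qed

text \<open>This is \<open>(T\<^sub>h + 1) / 2\<close>, a contraction by translation invariance; the factorisation
  \<open>\<Delta>\<^bsub>2h\<^esub> = 2 ((T\<^sub>h + 1) / 2) \<Delta>\<^sub>h\<close> is the link between the steps \<open>h\<close> and \<open>2h\<close>.\<close>

definition shift_mean :: "real^'n::finite \<Rightarrow> (real^'n \<Rightarrow> complex) \<Rightarrow> real^'n \<Rightarrow> complex" where
  "shift_mean h f = (\<lambda>x. (1/2) *\<^sub>R (f (x + h) + f x))"

lemma fdiff_double: "fdiff (2 *\<^sub>R h) f = (\<lambda>x. 2 *\<^sub>R shift_mean h (fdiff h f) x)"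
  by (rule ext) (simp add: fdiff_def shift_mean_def scaleR_2 add.assoc)

lemma shift_mean_fdiff: "shift_mean h (fdiff v f) = fdiff v (shift_mean h f)"
  by (rule ext) (simp add: fdiff_def shift_mean_def scaleR_right_distrib scaleR_diff_right add.commute add.left_commute)

lemma shift_mean_power_fdiff: "(shift_mean h ^^ r) (fdiff v f) = fdiff v ((shift_mean h ^^ r) f)"
  by (induction r) (simp_all add: shift_mean_fdiff)

lemma fdiff_double_power:
  "(fdiff (2 *\<^sub>R h) ^^ r) f = (\<lambda>x. (2 ^ r) *\<^sub>R (shift_mean h ^^ r) ((fdiff h ^^ r) f) x)"
proof (induction r)
  case (Suc r)
  have "(fdiff (2 *\<^sub>R h) ^^ Suc r) f = fdiff (2 *\<^sub>R h) (\<lambda>x. (2 ^ r) *\<^sub>R (shift_mean h ^^ r) ((fdiff h ^^ r) f) x)"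
    using Suc by simp
  also have "\<dots> = (\<lambda>x. 2 ^ r *\<^sub>R fdiff (2 *\<^sub>R h) ((shift_mean h ^^ r) ((fdiff h ^^ r) f)) x)"
    using fdiff_power_scale[where r=1 and h="2 *\<^sub>R h"] by simp
  also have "\<dots> = (\<lambda>x. (2 ^ Suc r) *\<^sub>R shift_mean h (fdiff h ((shift_mean h ^^ r) ((fdiff h ^^ r) f))) x)"
    unfolding fdiff_double by (simp add: mult.commute)
  also have "fdiff h ((shift_mean h ^^ r) ((fdiff h ^^ r) f)) = (shift_mean h ^^ r) ((fdiff h ^^ Suc r) f)"
    by (simp add: shift_mean_power_fdiff)
  finally show ?case by simp
qed simp

context translation_space
begin

lemma fdiff_mem: "f \<in> B \<Longrightarrow> fdiff h f \<in> B"
  unfolding fdiff_def by (intro diff_mem shift_mem)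

lemma fdiff_power_mem: "f \<in> B \<Longrightarrow> (fdiff h ^^ r) f \<in> B"
  by (induction r) (auto intro: fdiff_mem)

lemma N_fdiff_power_le: "f \<in> B \<Longrightarrow> N ((fdiff h ^^ r) f) \<le> 2 ^ r * N f"
proof (induction r)
  case (Suc r)
  have "N ((fdiff h ^^ Suc r) f) \<le> 2 * N ((fdiff h ^^ r) f)"
    using N_diff[OF shift_mem[where \<xi>=h] , OF fdiff_power_mem[where h=h and r=r] fdiff_power_mem[where h=h and r=r], OF Suc.prems Suc.prems] 
      N_shift[OF fdiff_power_mem[OF Suc.prems, where h=h and r=r], of h]
    by (simp add: fdiff_def)
  then show ?case using Suc by simp
qed simp

text \<open>Telescoping writes \<open>\<Delta>\<^bsub>nh\<^esub>\<close> as \<open>\<Delta>\<^sub>h\<close> followed by a sum of \<open>n\<close> translations.\<close>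

lemma N_fdiff_power_multiple:
  assumes "f \<in> B"
  shows "N ((fdiff (real n *\<^sub>R h) ^^ r) f) \<le> real n ^ r * N ((fdiff h ^^ r) f)"
  using assms
proof (induction r arbitrary: f)
  case (Suc r)
  have tele: "fdiff (real n *\<^sub>R h) f = (\<lambda>x. \<Sum>i<n. fdiff h f (x + real i *\<^sub>R h))"
  proof (rule ext)
    fix x
    have "(\<Sum>i<n. f (x + real (Suc i) *\<^sub>R h) - f (x + real i *\<^sub>R h)) = f (x + real n *\<^sub>R h) - f (x + real 0 *\<^sub>R h)"
      by (rule sum_lessThan_telescope)
    then show "fdiff (real n *\<^sub>R h) f x = (\<Sum>i<n. fdiff h f (x + real i *\<^sub>R h))"
      by (simp add: fdiff_def algebra_simps)
  qed
  have "N ((fdiff (real n *\<^sub>R h) ^^ Suc r) f) = N ((fdiff (real n *\<^sub>R h) ^^ r) (fdiff (real n *\<^sub>R h) f))"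
    by (simp add: funpow_swap1)
  also have "\<dots> \<le> real n ^ r * N ((fdiff h ^^ r) (fdiff (real n *\<^sub>R h) f))"
    by (rule Suc.IH) (intro fdiff_mem Suc.prems)
  also have "N ((fdiff h ^^ r) (fdiff (real n *\<^sub>R h) f)) \<le> real n * N ((fdiff h ^^ Suc r) f)"
  proof -
    have "N ((fdiff h ^^ r) (fdiff (real n *\<^sub>R h) f)) = N (\<lambda>x. \<Sum>i<n. (fdiff h ^^ Suc r) f (x + real i *\<^sub>R h))"
      unfolding tele fdiff_power_sum fdiff_power_shift by (simp add: funpow_swap1)
    also have "\<dots> \<le> (\<Sum>i<n. N (\<lambda>x. (fdiff h ^^ Suc r) f (x + real i *\<^sub>R h)))"
      by (intro N_sum shift_mem fdiff_power_mem Suc.prems)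
    also have "\<dots> = real n * N ((fdiff h ^^ Suc r) f)"
      using N_shift[OF fdiff_power_mem[OF Suc.prems, where h=h and r="Suc r"]] by simp
    finally show ?thesis .
  qed
  finally show ?case by (simp add: mult_left_mono mult.assoc mult.left_commute)
qed simp

lemma shift_mean_mem: "f \<in> B \<Longrightarrow> shift_mean h f \<in> B"
  unfolding shift_mean_def by (intro scale_mem add_mem shift_mem)

lemma N_shift_mean: "f \<in> B \<Longrightarrow> N (shift_mean h f) \<le> N f"
  using N_add[OF shift_mem[of f h], of f] N_scale[OF add_mem[OF shift_mem[of f h], of f], of "1/2"] N_shift[of f h]
  by (simp add: shift_mean_def)

lemma N_shift_mean_power: "f \<in> B \<Longrightarrow> (shift_mean h ^^ r) f \<in> B \<and> N ((shift_mean h ^^ r) f) \<le> N f"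
  by (induction r) (auto intro: shift_mean_mem order_trans[OF N_shift_mean])

lemma bdd_above_modulus: "f \<in> B \<Longrightarrow> bdd_above ((\<lambda>h. N ((fdiff h ^^ r) f)) ` A)"
  by (rule bdd_aboveI2[where M="2 ^ r * N f"]) (rule N_fdiff_power_le)

lemma N_fdiff_le_modulus: "f \<in> B \<Longrightarrow> norm h \<le> t \<Longrightarrow> N ((fdiff h ^^ r) f) \<le> modulus N r f t"
  unfolding modulus_def by (rule cSUP_upper) (auto intro: bdd_above_modulus)

lemma modulus_nonneg: "f \<in> B \<Longrightarrow> 0 \<le> t \<Longrightarrow> 0 \<le> modulus N r f t"
  by (rule order_trans[OF N_nonneg[OF fdiff_power_mem[where h=0 and r=r]] N_fdiff_le_modulus[where h=0]]) auto

text \<open>The step \<open>t u\<close> is split into \<open>k \<approx> 1 + \<bar>u\<bar>\<close> steps of length at most \<open>t\<close>.\<close>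

lemma N_fdiff_le_weight_modulus:
  assumes f: "f \<in> B" and t: "0 \<le> t"
  shows "N ((fdiff (t *\<^sub>R u) ^^ r) f) \<le> weight u ^ r * modulus N r f t"
proof -
  define k where "k = Suc (nat \<lfloor>norm u\<rfloor>)"
  have k: "norm u \<le> real k" "real k \<le> 1 + norm u" unfolding k_def by (simp_all, linarith+)
  have kp: "0 < real k" by (simp only: of_nat_0_less_iff k_def zero_less_Suc)
  have "N ((fdiff (t *\<^sub>R u) ^^ r) f) = N ((fdiff (real k *\<^sub>R ((t / real k) *\<^sub>R u)) ^^ r) f)"
    using kp by simp
  also have "\<dots> \<le> real k ^ r * N ((fdiff ((t / real k) *\<^sub>R u) ^^ r) f)"
    by (rule N_fdiff_power_multiple[OF f])
  also have "\<dots> \<le> real k ^ r * modulus N r f t"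
  proof (intro mult_left_mono N_fdiff_le_modulus f)
    have "t * norm u \<le> t * real k" using k t by (intro mult_left_mono) auto
    then show "norm ((t / real k) *\<^sub>R u) \<le> t" using kp t by (simp add: field_simps)
  qed simp
  also have "\<dots> \<le> weight u ^ r * modulus N r f t"
    using k(2) one_plus_norm_le_weight[of u] modulus_nonneg[OF f t]
    by (intro mult_right_mono power_mono) auto
  finally show ?thesis .
qed

lemma continuous_N_fdiff:
  assumes f: "f \<in> B"
  shows "continuous_on UNIV (\<lambda>u. N ((fdiff (a *\<^sub>R u) ^^ r) f))"
proof (rule continuous_at_imp_continuous_on, rule ballI)
  fix v :: "real^'n"
  have "((\<lambda>u. N (\<lambda>x. (fdiff (a *\<^sub>R u) ^^ r) f x - (fdiff (a *\<^sub>R v) ^^ r) f x)) \<longlongrightarrow> 0) (at v)"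
    unfolding fdiff_power_expand
    by (intro tendsto_N_sum tendsto_N_scale N_shift_tendsto f shift_mem scale_mem tendsto_intros)
  then show "isCont (\<lambda>u. N ((fdiff (a *\<^sub>R u) ^^ r) f)) v"
    unfolding isCont_def by (rule tendsto_N[OF fdiff_power_mem[OF f] fdiff_power_mem[OF f]])
qed

lemma measurable_N_fdiff[measurable]:
  "f \<in> B \<Longrightarrow> (\<lambda>u. N ((fdiff (a *\<^sub>R u) ^^ r) f)) \<in> borel_measurable borel"
  by (intro borel_measurable_continuous_onI continuous_N_fdiff)

section \<open>Kernel means\<close>

lemma kernel_mean_exists:
  assumes k: "\<And>u. (\<lambda>n. k (gridcell n u)) \<longlonglongrightarrow> k u" "\<And>n u. \<bar>k (gridcell n u)\<bar> \<le> G u"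
    and G: "integrable lborel G" and f: "f \<in> B"
  shows "\<exists>\<phi>\<in>B. (\<lambda>n. N (\<lambda>x. grid_sum n (\<lambda>u x. k u *\<^sub>R f (x + b *\<^sub>R u)) x - \<phi> x)) \<longlonglongrightarrow> 0"
proof (rule grid_sum_limit_exists)
  have kG: "\<bar>k u\<bar> \<le> G u" for u
    by (rule tendsto_upperbound[OF tendsto_rabs[OF k(1)]]) (use k(2) in \<open>auto intro!: always_eventually\<close>)
  show "(\<lambda>x. k u *\<^sub>R f (x + b *\<^sub>R u)) \<in> B" for u by (intro scale_mem shift_mem f)
  show "(\<lambda>n. N (\<lambda>x. k (gridcell n u) *\<^sub>R f (x + b *\<^sub>R gridcell n u) - k u *\<^sub>R f (x + b *\<^sub>R u))) \<longlonglongrightarrow> 0" for u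
    by (intro tendsto_N_scale shift_mem f N_shift_tendsto k tendsto_intros tendsto_gridcell)
  show "N (\<lambda>x. k u *\<^sub>R f (x + b *\<^sub>R u)) \<le> G u * N f" for u
    using kG[of u] by (simp add: N_scale shift_mem f N_shift mult_right_mono N_nonneg)
  show "N (\<lambda>x. k (gridcell n u) *\<^sub>R f (x + b *\<^sub>R gridcell n u)) \<le> G u * N f" for n u
    using k(2)[of n u] by (simp add: N_scale shift_mem f N_shift mult_right_mono N_nonneg)
  show "integrable lborel (\<lambda>u. G u * N f)" using G by simp
qed

text \<open>With these coefficients \<open>f(x)\<close> minus the sum of \<open>mean_coeff R l f(x + l v)\<close> over
  \<open>1 \<le> l \<le> R\<close> is \<open>(-1)\<^sup>R \<Delta>\<^sub>v\<^sup>R f(x)\<close>.\<close>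

definition mean_coeff :: "nat \<Rightarrow> nat \<Rightarrow> real" where
  "mean_coeff R l = (-1) ^ (l + 1) * real (R choose l)"

text \<open>The identity for \<open>mean_coeff\<close>, multiplied by \<open>k(u)\<close> and integrated, expresses the error as a mean
  of differences. It is used for the Riemann sums, where \<open>f\<close> appears with the Riemann sum \<open>\<kappa> n\<close> of \<open>k\<close>
  as its coefficient; \<open>\<kappa> n\<close> tends to \<open>1\<close>.\<close>

lemma kernel_mean_error:
  assumes k: "\<And>u. (\<lambda>n. k (gridcell n u)) \<longlonglongrightarrow> k u" "\<And>n u. \<bar>k (gridcell n u)\<bar> \<le> G u"
    and G: "integrable lborel G" and f: "f \<in> B" and k1: "(LINT u|lborel. k u) = 1"
    and \<Phi>: "\<And>l. \<Phi> l \<in> B"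
      "\<And>l. l \<in> {1..R} \<Longrightarrow> (\<lambda>n. N (\<lambda>x. grid_sum n (\<lambda>u x. k u *\<^sub>R f (x + (real l * b) *\<^sub>R u)) x - \<Phi> l x)) \<longlonglongrightarrow> 0"
  shows "N (\<lambda>x. f x - (\<Sum>l\<in>{1..R}. mean_coeff R l *\<^sub>R \<Phi> l x)) \<le> (LINT u|lborel. \<bar>k u\<bar> * N ((fdiff (b *\<^sub>R u) ^^ R) f))"
proof -
  let ?w = "\<lambda>n::nat. (1 / 2 ^ n) ^ CARD('n) :: real"
  let ?V = "\<lambda>l u x. k u *\<^sub>R f (x + (real l * b) *\<^sub>R u)"
  let ?D = "\<lambda>u. (fdiff (b *\<^sub>R u) ^^ R) f"
  let ?\<phi> = "\<lambda>x. \<Sum>l\<in>{1..R}. mean_coeff R l *\<^sub>R \<Phi> l x"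
  have V: "?V l u \<in> B" for l u by (intro scale_mem shift_mem f)
  define S where "S n = (\<lambda>x. \<Sum>l\<in>{1..R}. mean_coeff R l *\<^sub>R grid_sum n (?V l) x)" for n
  define \<kappa> where "\<kappa> n = (\<Sum>z\<in>gridindex n. ?w n *\<^sub>R k (gridpoint n z))" for n
  have SB: "S n \<in> B" for n unfolding S_def by (intro sum_mem scale_mem grid_sum_mem V)
  have \<phi>B: "?\<phi> \<in> B" by (intro sum_mem scale_mem \<Phi>)
  have Slim: "(\<lambda>n. N (\<lambda>x. S n x - ?\<phi> x)) \<longlonglongrightarrow> 0"
    unfolding S_def by (intro tendsto_N_sum tendsto_N_scale scale_mem grid_sum_mem V \<Phi> tendsto_const) auto
  have \<kappa>lim: "\<kappa> \<longlonglongrightarrow> 1"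
    unfolding \<kappa>_def using grid_sum_tendsto_integral[of k G] k G k1 by simp
  have D: "(-1) ^ R *\<^sub>R ?D u x = f x - (\<Sum>l\<in>{1..R}. mean_coeff R l *\<^sub>R f (x + (real l * b) *\<^sub>R u))" for u x
  proof -
    have "(-1) ^ R *\<^sub>R ?D u x = (\<Sum>l\<le>R. ((-1)^l * real (R choose l)) *\<^sub>R f (x + (real l * b) *\<^sub>R u))"
      unfolding fdiff_power_expand scaleR_sum_right
    proof (rule sum.cong[OF refl])
      fix l assume "l \<in> {..R}"
      then obtain j where "R = l + j" using le_Suc_ex by auto
      then have "(-1::real) ^ R * (-1) ^ (R - l) = (-1) ^ l"
        by (simp add: power_add mult.assoc)
      then show "(- 1) ^ R *\<^sub>R ((- 1) ^ (R - l) * real (R choose l)) *\<^sub>R f (x + real l *\<^sub>R b *\<^sub>R u) =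
         ((- 1) ^ l * real (R choose l)) *\<^sub>R f (x + (real l * b) *\<^sub>R u)"
        by (simp add: mult.assoc[symmetric])
    qed
    also have "{..R} = insert 0 {1..R}" by auto
    finally show ?thesis by (simp add: mean_coeff_def sum_negf)
  qed
  have est: "N (\<lambda>x. \<kappa> n *\<^sub>R f x - S n x) \<le> (\<Sum>z\<in>gridindex n. ?w n *\<^sub>R (\<bar>k (gridpoint n z)\<bar> * N (?D (gridpoint n z))))" for n
  proof -
    have "N (\<lambda>x. \<kappa> n *\<^sub>R f x - S n x) = N (\<lambda>x. \<Sum>z\<in>gridindex n. (?w n * k (gridpoint n z) * (-1) ^ R) *\<^sub>R ?D (gridpoint n z) x)"
    proof (rule arg_cong[where f=N], rule ext)
      fix x
      have "S n x = (\<Sum>z\<in>gridindex n. (?w n * k (gridpoint n z)) *\<^sub>R (\<Sum>l\<in>{1..R}. mean_coeff R l *\<^sub>R f (x + (real l * b) *\<^sub>R gridpoint n z)))"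
        unfolding S_def grid_sum_def scaleR_sum_right
        by (subst sum.swap) (simp add: mult_ac)
      then show "\<kappa> n *\<^sub>R f x - S n x = (\<Sum>z\<in>gridindex n. (?w n * k (gridpoint n z) * (-1) ^ R) *\<^sub>R ?D (gridpoint n z) x)"
        unfolding scaleR_scaleR[symmetric] D by (simp add: \<kappa>_def scaleR_sum_left sum_subtractf scaleR_diff_right)
    qed
    also have "\<dots> \<le> (\<Sum>z\<in>gridindex n. N (\<lambda>x. (?w n * k (gridpoint n z) * (-1) ^ R) *\<^sub>R ?D (gridpoint n z) x))"
      by (intro N_sum scale_mem fdiff_power_mem f)
    also have "\<dots> = (\<Sum>z\<in>gridindex n. ?w n *\<^sub>R (\<bar>k (gridpoint n z)\<bar> * N (?D (gridpoint n z))))"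
      by (intro sum.cong refl) (simp add: N_scale fdiff_power_mem f abs_mult power_abs)
    finally show ?thesis .
  qed
  have lim: "(\<lambda>n. \<Sum>z\<in>gridindex n. ?w n *\<^sub>R (\<bar>k (gridpoint n z)\<bar> * N (?D (gridpoint n z)))) \<longlonglongrightarrow> (LINT u|lborel. \<bar>k u\<bar> * N (?D u))"
  proof (rule grid_sum_tendsto_integral)
    show "(\<lambda>n. \<bar>k (gridcell n u)\<bar> * N (?D (gridcell n u))) \<longlonglongrightarrow> \<bar>k u\<bar> * N (?D u)" for u
    proof (intro tendsto_mult tendsto_rabs k)
      have "isCont (\<lambda>u. N (?D u)) u"
        using continuous_N_fdiff[OF f, where a=b and r=R] by (simp add: continuous_on_eq_continuous_at)
      then show "(\<lambda>n. N (?D (gridcell n u))) \<longlonglongrightarrow> N (?D u)"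
        using tendsto_gridcell by (rule isCont_tendsto_compose)
    qed
    show "norm (\<bar>k (gridcell n u)\<bar> * N (?D (gridcell n u))) \<le> G u * (2 ^ R * N f)" for n u
      using N_nonneg[OF fdiff_power_mem[OF f]] N_fdiff_power_le[OF f] k(2)[of n u]
      by (auto simp: abs_mult intro!: mult_mono) 
    show "integrable lborel (\<lambda>u. G u * (2 ^ R * N f))" using G by simp
  qed
  have lim2: "(\<lambda>n. N (\<lambda>x. \<kappa> n *\<^sub>R f x - S n x)) \<longlonglongrightarrow> N (\<lambda>x. f x - ?\<phi> x)"
  proof (rule tendsto_N)
    show "(\<lambda>n. N (\<lambda>x. \<kappa> n *\<^sub>R f x - S n x - (f x - ?\<phi> x))) \<longlonglongrightarrow> 0"
    proof -
      have 1: "(\<lambda>n. N (\<lambda>x. \<kappa> n *\<^sub>R f x - 1 *\<^sub>R f x)) \<longlonglongrightarrow> 0"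
        by (intro tendsto_N_scale f \<kappa>lim) (simp add: N_zero)
      have 2: "(\<lambda>n. N (\<lambda>x. (-1) *\<^sub>R S n x - (-1) *\<^sub>R ?\<phi> x)) \<longlonglongrightarrow> 0"
        by (intro tendsto_N_scale SB \<phi>B Slim tendsto_const)
      have "(\<lambda>n. N (\<lambda>x. (\<kappa> n *\<^sub>R f x + (-1) *\<^sub>R S n x) - (1 *\<^sub>R f x + (-1) *\<^sub>R ?\<phi> x))) \<longlonglongrightarrow> 0"
        by (rule tendsto_N_add[OF _ _ 1 _ _ 2]) (intro scale_mem f SB \<phi>B)+
      then show ?thesis by simp
    qed
  qed (intro diff_mem scale_mem f SB \<phi>B)+
  show ?thesis
    by (rule LIMSEQ_le[OF lim2 lim]) (use est in blast)
qed

end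

section \<open>Convexity of the norm and doubling of the step\<close>

lemma powr_above_tangent:
  fixes x c s :: real
  assumes "0 \<le> x" "0 < c" "1 \<le> s"
  shows "c powr s + s * c powr (s - 1) * (x - c) \<le> x powr s"
proof (cases "x = 0")
  case True
  have "c powr (s - 1) * c = c powr s"
    using assms powr_add[of c "s - 1" 1] by simp
  then have "c powr s + s * c powr (s - 1) * (x - c) = (1 - s) * c powr s"
    using True by (simp add: algebra_simps)
  then show ?thesis using assms True by (simp add: mult_nonpos_nonneg)
next
  case False
  have "s * c powr (s - 1) * (x - c) \<le> x powr s - c powr s"
  proof (rule convex_on_imp_above_tangent[where A="{0<..}"])
    show "convex_on {0<..} (\<lambda>x. x powr s)" by (rule powr_convex[OF assms(3)])
    show "((\<lambda>x. x powr s) has_field_derivative s * c powr (s - 1)) (at c within {0<..})"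
      using assms by (intro has_field_derivative_at_within[OF has_real_derivative_powr]) auto
  qed (use assms False in \<open>auto simp: interior_open\<close>)
  then show ?thesis by simp
qed

text \<open>Jensen's inequality for the convex function \<open>x\<^sup>s\<close> and the measure with density \<open>w\<close>, by
  integrating the tangent line at the mean.\<close>

lemma weighted_power_mean:
  fixes w g :: "'a \<Rightarrow> real"
  assumes w: "integrable M w" "\<And>x. 0 \<le> w x" "0 < (LINT x|M. w x)"
    and g: "integrable M (\<lambda>x. w x * g x)" "integrable M (\<lambda>x. w x * g x powr s)" "\<And>x. 0 \<le> g x"
    and s: "1 \<le> s"
  shows "(LINT x|M. w x * g x) powr s \<le> (LINT x|M. w x) powr (s - 1) * (LINT x|M. w x * g x powr s)"
proof -
  define W where "W = (LINT x|M. w x)"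
  define I where "I = (LINT x|M. w x * g x)"
  have I0: "0 \<le> I" unfolding I_def by (intro integral_nonneg_AE) (use w g in auto)
  have W0: "0 < W" using w(3) by (simp add: W_def)
  show ?thesis
  proof (cases "I = 0")
    case True
    have "0 \<le> (LINT x|M. w x * g x powr s)" by (intro integral_nonneg_AE) (use w in auto)
    then show ?thesis using True W0 unfolding I_def[symmetric] W_def[symmetric] by simp
  next
    case False
    define c where "c = I / W"
    have c: "0 < c" using False I0 W0 by (simp add: c_def)
    have "W * c powr s = (LINT x|M. c powr s * w x + s * c powr (s - 1) * (w x * g x - c * w x))"
      using w g W0 by (simp add: W_def[symmetric] I_def[symmetric] c_def)
    also have "\<dots> \<le> (LINT x|M. w x * g x powr s)"
    proof (rule integral_mono)
      fix x
      have "w x * (c powr s + s * c powr (s - 1) * (g x - c)) \<le> w x * g x powr s"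
        by (intro mult_left_mono powr_above_tangent g w c s)
      then show "c powr s * w x + s * c powr (s - 1) * (w x * g x - c * w x) \<le> w x * g x powr s"
        by (simp add: algebra_simps)
    qed (use w g in auto)
    finally have *: "W * c powr s \<le> (LINT x|M. w x * g x powr s)" .
    have "I powr s = (W * c) powr s" using W0 by (simp add: c_def)
    also have "\<dots> = W powr s * c powr s" using W0 c by (simp add: powr_mult)
    also have "\<dots> = W powr (s - 1) * (W * c powr s)"
      using W0 powr_add[of W "s - 1" 1] by simp
    also have "\<dots> \<le> W powr (s - 1) * (LINT x|M. w x * g x powr s)"
      by (rule mult_left_mono[OF *]) simp
    finally show ?thesis by (simp add: W_def I_def)
  qed
qed

locale convex_translation_space = translation_space B N
  for B :: "(real ^ 'n::finite \<Rightarrow> complex) set" and N +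
  fixes s m :: real
  assumes s_ge_1: "1 \<le> s" and m_pos: "0 < m"
    and convexity: "F \<in> B \<Longrightarrow> G \<in> B \<Longrightarrow>
       (N F powr s + m * N G powr s) powr (1 / s) \<le> max (N (\<lambda>x. F x + G x)) (N (\<lambda>x. F x - G x))"
begin

text \<open>The convexity hypothesis with \<open>F = (T\<^sub>h g + g) / 2\<close> and \<open>G = (T\<^sub>h g - g) / 2\<close>.\<close>

lemma N_split:
  assumes g: "g \<in> B"
  shows "N (shift_mean h g) powr s + m / 2 powr s * N (fdiff h g) powr s \<le> N g powr s"
proof -
  define G where "G = (\<lambda>x. (1/2) *\<^sub>R fdiff h g x)"
  have G: "G \<in> B" unfolding G_def by (intro scale_mem fdiff_mem g)
  have F: "shift_mean h g \<in> B" by (rule shift_mean_mem[OF g])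
  have "(\<lambda>x. shift_mean h g x + G x) = (\<lambda>x. g (x + h))"
    by (rule ext) (simp add: shift_mean_def G_def fdiff_def scaleR_right_distrib[symmetric] scaleR_2[symmetric] del: scaleR_right_distrib)
  moreover have "(\<lambda>x. shift_mean h g x - G x) = g"
    by (rule ext) (simp add: shift_mean_def G_def fdiff_def scaleR_diff_right[symmetric] scaleR_2[symmetric] del: scaleR_right_distrib)
  ultimately have le: "(N (shift_mean h g) powr s + m * N G powr s) powr (1 / s) \<le> N g"
    using convexity[OF F G] N_shift[OF g] by simp
  have nn: "0 \<le> N (shift_mean h g) powr s + m * N G powr s"
    using m_pos by (intro add_nonneg_nonneg mult_nonneg_nonneg) auto
  have "N (shift_mean h g) powr s + m * N G powr s = ((N (shift_mean h g) powr s + m * N G powr s) powr (1 / s)) powr s"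
    using s_ge_1 nn by (simp add: powr_powr)
  also have "\<dots> \<le> N g powr s"
    using le s_ge_1 by (intro powr_mono2) auto
  finally have "N (shift_mean h g) powr s + m * N G powr s \<le> N g powr s" .
  moreover have "N G powr s = N (fdiff h g) powr s / 2 powr s"
    unfolding G_def N_scale[OF fdiff_mem[OF g]] by (simp add: powr_divide N_nonneg fdiff_mem g)
  ultimately show ?thesis by simp
qed

text \<open>Apply \<open>N_split\<close> to \<open>g = \<Delta>\<^sub>h\<^sup>r f\<close>. Of the \<open>r\<close> contractions in
  \<open>\<Delta>\<^bsub>2h\<^esub>\<^sup>r = 2\<^sup>r ((T\<^sub>h + 1) / 2)\<^sup>r \<Delta>\<^sub>h\<^sup>r\<close> one is kept and the others are dropped, which is possible since
  \<open>r \<ge> 1\<close>.\<close>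

lemma fdiff_doubling:
  assumes f: "f \<in> B" and r: "1 \<le> r"
  shows "2 powr (- real r * s) * N ((fdiff (2 *\<^sub>R h) ^^ r) f) powr s + m / 2 powr s * N ((fdiff h ^^ Suc r) f) powr s
     \<le> N ((fdiff h ^^ r) f) powr s"
proof -
  let ?g = "(fdiff h ^^ r) f"
  have g: "?g \<in> B" by (rule fdiff_power_mem[OF f])
  obtain r' where r': "r = Suc r'" using r by (cases r) auto
  have mem: "(shift_mean h ^^ r) ?g \<in> B" using N_shift_mean_power[OF g] by blast
  have "N ((shift_mean h ^^ r) ?g) \<le> N (shift_mean h ?g)"
    using N_shift_mean_power[OF shift_mean_mem[OF g, of h], where h=h and r=r'] by (simp add: r' funpow_swap1)
  moreover have "N ((fdiff (2 *\<^sub>R h) ^^ r) f) = 2 ^ r * N ((shift_mean h ^^ r) ?g)"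
    unfolding fdiff_double_power using mem by (simp add: N_scale)
  ultimately have "N ((fdiff (2 *\<^sub>R h) ^^ r) f) \<le> 2 ^ r * N (shift_mean h ?g)" by simp
  then have "N ((fdiff (2 *\<^sub>R h) ^^ r) f) powr s \<le> (2 ^ r * N (shift_mean h ?g)) powr s"
    using s_ge_1 by (intro powr_mono2 N_nonneg fdiff_power_mem f) auto
  also have "\<dots> = 2 powr (real r * s) * N (shift_mean h ?g) powr s"
    using N_nonneg[OF shift_mean_mem[OF g]] by (simp add: powr_mult powr_powr flip: powr_realpow)
  finally have "2 powr (- real r * s) * N ((fdiff (2 *\<^sub>R h) ^^ r) f) powr s \<le> N (shift_mean h ?g) powr s"
    by (simp add: powr_minus field_simps)
  then show ?thesis using N_split[OF g, of h] by simp
qed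

text \<open>Apply \<open>fdiff_doubling\<close> to \<open>h, 2h, 4h, \<dots>\<close>; the terms with differences of order \<open>r\<close> telescope.\<close>

lemma fdiff_doubling_sum:
  assumes f: "f \<in> B" and r: "1 \<le> r"
  shows "(\<Sum>j<J. 2 powr (- real j * real r * s) * (m / 2 powr s) * N ((fdiff ((2 ^ j) *\<^sub>R h) ^^ Suc r) f) powr s)
     \<le> N ((fdiff h ^^ r) f) powr s"
proof -
  have "(\<Sum>j<J. 2 powr (- real j * real r * s) * (m / 2 powr s) * N ((fdiff ((2 ^ j) *\<^sub>R h) ^^ Suc r) f) powr s)
     + 2 powr (- real J * real r * s) * N ((fdiff ((2 ^ J) *\<^sub>R h) ^^ r) f) powr s \<le> N ((fdiff h ^^ r) f) powr s"
  proof (induction J)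
    case (Suc J)
    let ?a = "2 powr (- real J * real r * s)"
    have "?a * (2 powr (- real r * s) * N ((fdiff (2 *\<^sub>R ((2 ^ J) *\<^sub>R h)) ^^ r) f) powr s + m / 2 powr s * N ((fdiff ((2 ^ J) *\<^sub>R h) ^^ Suc r) f) powr s)
       \<le> ?a * N ((fdiff ((2 ^ J) *\<^sub>R h) ^^ r) f) powr s"
      by (intro mult_left_mono fdiff_doubling f r) simp
    moreover have "?a * 2 powr (- real r * s) = 2 powr (- real (Suc J) * real r * s)"
      unfolding powr_add[symmetric] by (simp add: algebra_simps)
    ultimately have "2 powr (- real (Suc J) * real r * s) * N ((fdiff ((2 ^ Suc J) *\<^sub>R h) ^^ r) f) powr s
      + ?a * (m / 2 powr s) * N ((fdiff ((2 ^ J) *\<^sub>R h) ^^ Suc r) f) powr s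
       \<le> ?a * N ((fdiff ((2 ^ J) *\<^sub>R h) ^^ r) f) powr s"
      by (simp only: distrib_left mult.assoc[symmetric] scaleR_scaleR power_Suc)
    with Suc.IH show ?case by (simp only: sum.lessThan_Suc)
  qed simp
  moreover have "0 \<le> 2 powr (- real J * real r * s) * N ((fdiff ((2 ^ J) *\<^sub>R h) ^^ r) f) powr s" by simp
  ultimately show ?thesis by linarith
qed

end

context convex_translation_space
begin

text \<open>Any functional \<open>E\<close> with the averaged Jackson inequality satisfies the lower bound. After Jensen's
  inequality the sum over \<open>j\<close> is taken inside the integral and bounded for each \<open>u\<close> by
  \<open>fdiff_doubling_sum\<close> with \<open>h = t u\<close>; what is left is the integral of \<open>weight(u)\<^bsup>rs-p\<^esup>\<close>.\<close>

theorem sharp_lower_bound: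
  fixes E :: "real \<Rightarrow> (real^'n \<Rightarrow> complex) \<Rightarrow> real"
  assumes r: "1 \<le> r"
    and E0: "\<And>a f. 0 < a \<Longrightarrow> f \<in> B \<Longrightarrow> 0 \<le> E (1 / a) f"
    and p: "real r * s + 2 \<le> real p"
    and E: "\<And>a f. 0 < a \<Longrightarrow> f \<in> B \<Longrightarrow>
        E (1 / a) f \<le> A * (LINT u|lborel. 1 / weight u ^ p * N ((fdiff (a *\<^sub>R u) ^^ Suc r) f))"
  shows "\<exists>C>0. \<forall>f\<in>B. \<forall>t>0.
       summable (\<lambda>j. 2 powr (- real (Suc j) * real r * s) * E (1 / (t * 2 ^ Suc j)) f powr s) \<and>
       C * (\<Sum>j. 2 powr (- real (Suc j) * real r * s) * E (1 / (t * 2 ^ Suc j)) f powr s) powr (1 / s)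
         \<le> modulus N r f t"
proof -
  define w where "w u = 1 / weight u ^ p" for u :: "real^'n"
  (* A is not assumed to be positive. *)
  define A' where "A' = max A 1"
  have p2: "2 \<le> p"
  proof -
    have "0 \<le> real r * s" using s_ge_1 by simp
    then have "2 \<le> real p" using p by linarith
    then show ?thesis by simp
  qed
  have wint: "integrable lborel w" unfolding w_def by (rule integrable_inverse_weight[OF p2])
  have wm[measurable]: "w \<in> borel_measurable borel" using borel_measurable_integrable[OF wint] by simp
  have wpos: "0 < w u" for u by (simp add: w_def weight_pos)
  have w0: "0 \<le> w u" for u using wpos[of u] by simp
  define W where "W = (LINT u|lborel. w u)"
  have W: "0 < W"
  proof -
    have "W \<noteq> 0"
    proof
      assume "W = 0"
      then have "AE u in lborel. w u = 0" unfolding W_def using integral_nonneg_eq_0_iff_AE[OF wint] w0 by auto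
      moreover have "w u \<noteq> 0" for u using wpos[of u] by simp
      ultimately have "AE u::real^'n in lborel. False" by simp
      then show False by (simp add: eventually_False ae_filter_eq_bot_iff)
    qed
    moreover have "0 \<le> W" unfolding W_def by (intro integral_nonneg_AE) (use w0 in auto)
    ultimately show ?thesis by simp
  qed
  define g where "g f a u = N ((fdiff (a *\<^sub>R u) ^^ Suc r) f)" for f a u
  have g0: "0 \<le> g f a u" if "f \<in> B" for f a u unfolding g_def by (intro N_nonneg fdiff_power_mem that)
  have gle: "g f a u \<le> 2 ^ Suc r * N f" if "f \<in> B" for f a u unfolding g_def by (intro N_fdiff_power_le that)
  have gm[measurable]: "g f a \<in> borel_measurable borel" if "f \<in> B" for f a
    unfolding g_def[abs_def] by (rule measurable_N_fdiff[OF that])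
  have gint: "integrable lborel (\<lambda>u. w u * g f a u)" if f: "f \<in> B" for f a
  proof (rule Bochner_Integration.integrable_bound)
    show "integrable lborel (\<lambda>u. w u * (2 ^ Suc r * N f))" using wint by simp
    show "(\<lambda>u. w u * g f a u) \<in> borel_measurable lborel" using gm[OF f] by measurable
    show "AE u in lborel. norm (w u * g f a u) \<le> norm (w u * (2 ^ Suc r * N f))"
      using gle[OF f] g0[OF f] w0 N_nonneg[OF f] by (auto simp: abs_mult intro!: AE_I2 mult_left_mono)
  qed
  have gsint: "integrable lborel (\<lambda>u. w u * g f a u powr s)" if f: "f \<in> B" for f a
  proof (rule Bochner_Integration.integrable_bound)
    show "integrable lborel (\<lambda>u. w u * (2 ^ Suc r * N f) powr s)" using wint by simp
    show "(\<lambda>u. w u * g f a u powr s) \<in> borel_measurable lborel" using gm[OF f] by measurable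
    show "AE u in lborel. norm (w u * g f a u powr s) \<le> norm (w u * (2 ^ Suc r * N f) powr s)"
      using gle[OF f] g0[OF f] w0 s_ge_1 by (auto simp: abs_mult intro!: AE_I2 mult_left_mono powr_mono2)
  qed
  define C1 where "C1 = A' powr s * W powr (s - 1)"
  have C1: "0 < C1" using W by (simp add: C1_def A'_def)
  have step: "E (1 / a) f powr s \<le> C1 * (LINT u|lborel. w u * g f a u powr s)" if f: "f \<in> B" and a: "0 < a" for f a
  proof -
    define I where "I = (LINT u|lborel. w u * g f a u)"
    have I0: "0 \<le> I" unfolding I_def by (intro integral_nonneg_AE) (use w0 g0[OF f] in auto)
    have "E (1 / a) f \<le> A * I" using E[OF a f] by (simp add: I_def w_def g_def)
    also have "\<dots> \<le> A' * I" using I0 by (intro mult_right_mono) (auto simp: A'_def)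
    finally have "E (1 / a) f powr s \<le> (A' * I) powr s"
      using s_ge_1 E0[OF a f] by (intro powr_mono2) auto
    also have "\<dots> = A' powr s * I powr s" by (rule powr_mult)
    also have "I powr s \<le> W powr (s - 1) * (LINT u|lborel. w u * g f a u powr s)"
      unfolding I_def W_def
      by (rule weighted_power_mean) (use wint w0 W gint[OF f] gsint[OF f] g0[OF f] s_ge_1 in \<open>auto simp: W_def\<close>)
    finally show ?thesis by (simp add: C1_def mult.assoc mult_left_mono)
  qed
  define W2 where "W2 = (LINT u|lborel. 1 / weight (u::real^'n) ^ 2)"
  have w2int: "integrable lborel (\<lambda>u::real^'n. 1 / weight u ^ 2)" by (rule integrable_inverse_weight) simp
  have W20: "0 \<le> W2" unfolding W2_def by (intro integral_nonneg_AE) (auto simp: weight_nonneg)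
  define C2 where "C2 = C1 * (2 powr s / m) * (W2 + 1)"
  have C2: "0 < C2" using C1 m_pos W20 by (simp add: C2_def)
  define T where "T f t j = 2 powr (- real (Suc j) * real r * s) * E (1 / (t * 2 ^ Suc j)) f powr s" for f t j
  have T0: "0 \<le> T f t j" for f t j by (simp add: T_def)
  have part: "(\<Sum>j<J. T f t j) \<le> C2 * modulus N r f t powr s" if f: "f \<in> B" and t: "0 < t" for f t J
  proof -
    let ?\<omega> = "modulus N r f t"
    let ?c = "\<lambda>j. 2 powr (- real j * real r * s)"
    have \<omega>0: "0 \<le> ?\<omega>" using modulus_nonneg[OF f] t by simp
    have "(\<Sum>j<J. T f t j) \<le> (\<Sum>j<J. ?c (Suc j) * (C1 * (LINT u|lborel. w u * g f (t * 2 ^ Suc j) u powr s)))"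
      unfolding T_def using t by (intro sum_mono mult_left_mono step f) auto
    (* The series begins with the step 2t; adding the term j = 0 makes it the sum in fdiff_doubling_sum. *)
    also have "\<dots> = C1 * (\<Sum>j\<in>Suc ` {..<J}. ?c j * (LINT u|lborel. w u * g f (t * 2 ^ j) u powr s))"
    proof -
      have ri: "(\<Sum>j\<in>Suc ` {..<J}. h j) = (\<Sum>j<J. h (Suc j))" for h :: "nat \<Rightarrow> real"
        by (simp add: sum.reindex)
      show ?thesis unfolding ri sum_distrib_left by (intro sum.cong refl) (rule mult.left_commute)
    qed
    also have "\<dots> \<le> C1 * (\<Sum>j<Suc J. ?c j * (LINT u|lborel. w u * g f (t * 2 ^ j) u powr s))"
    proof (intro mult_left_mono sum_mono2)
      show "0 \<le> ?c j * (LINT u|lborel. w u * g f (t * 2 ^ j) u powr s)" for j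
        by (intro mult_nonneg_nonneg integral_nonneg_AE) (use w0 in auto)
    qed (use C1 in auto)
    also have "(\<Sum>j<Suc J. ?c j * (LINT u|lborel. w u * g f (t * 2 ^ j) u powr s)) = 
        (LINT u|lborel. (\<Sum>j<Suc J. ?c j * (w u * g f (t * 2 ^ j) u powr s)))"
      using gsint[OF f] by (subst Bochner_Integration.integral_sum) auto
    also have "\<dots> \<le> (LINT u::real^'n|lborel. (2 powr s / m) * ?\<omega> powr s * (1 / weight u ^ 2))"
    proof (rule integral_mono)
      show "integrable lborel (\<lambda>u. \<Sum>j<Suc J. ?c j * (w u * g f (t * 2 ^ j) u powr s))"
        using gsint[OF f] by (intro Bochner_Integration.integrable_sum) auto
      show "integrable lborel (\<lambda>u::real^'n. (2 powr s / m) * ?\<omega> powr s * (1 / weight u ^ 2))"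
        using w2int by (rule integrable_mult_right)
      fix u :: "real^'n"
      have "(\<Sum>j<Suc J. ?c j * g f (t * 2 ^ j) u powr s) = 
          (2 powr s / m) * (\<Sum>j<Suc J. ?c j * (m / 2 powr s) * N ((fdiff ((2 ^ j) *\<^sub>R (t *\<^sub>R u)) ^^ Suc r) f) powr s)"
        using m_pos unfolding sum_distrib_left by (intro sum.cong refl) (simp add: g_def mult.commute[of t])
      also have "\<dots> \<le> (2 powr s / m) * N ((fdiff (t *\<^sub>R u) ^^ r) f) powr s"
        using m_pos by (intro mult_left_mono fdiff_doubling_sum f r) auto
      finally have s1: "(\<Sum>j<Suc J. ?c j * g f (t * 2 ^ j) u powr s) \<le> (2 powr s / m) * N ((fdiff (t *\<^sub>R u) ^^ r) f) powr s" .
      have "N ((fdiff (t *\<^sub>R u) ^^ r) f) powr s \<le> (weight u ^ r * ?\<omega>) powr s"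
        using s_ge_1 t by (intro powr_mono2 N_fdiff_le_weight_modulus N_nonneg fdiff_power_mem f) auto
      also have "\<dots> = weight u powr (real r * s) * ?\<omega> powr s"
        using weight_pos[of u] \<omega>0 by (simp add: powr_mult powr_powr flip: powr_realpow)
      finally have s2: "N ((fdiff (t *\<^sub>R u) ^^ r) f) powr s \<le> weight u powr (real r * s) * ?\<omega> powr s" .
      have "(\<Sum>j<Suc J. ?c j * g f (t * 2 ^ j) u powr s) \<le> (2 powr s / m) * (weight u powr (real r * s) * ?\<omega> powr s)"
        by (rule order_trans[OF s1 mult_left_mono[OF s2]]) (use m_pos in simp)
      then have "w u * (\<Sum>j<Suc J. ?c j * g f (t * 2 ^ j) u powr s) \<le> w u * ((2 powr s / m) * (weight u powr (real r * s) * ?\<omega> powr s))"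
        by (rule mult_left_mono[OF _ w0])
      also have "\<dots> = (2 powr s / m) * ?\<omega> powr s * (w u * weight u powr (real r * s))" by simp
      also have "\<dots> \<le> (2 powr s / m) * ?\<omega> powr s * (1 / weight u ^ 2)"
      proof (intro mult_left_mono)
        have "w u * weight u powr (real r * s) = weight u powr (real r * s - real p)"
          using weight_pos[of u] by (simp add: w_def powr_diff powr_realpow)
        also have "\<dots> \<le> weight u powr (- 2)"
          using p weight_ge_1[of u] by (intro powr_mono) auto
        also have "\<dots> = 1 / weight u ^ 2" 
          using weight_pos[of u] by (simp add: powr_minus_divide powr_numeral)
        finally show "w u * weight u powr (real r * s) \<le> 1 / weight u ^ 2" .
      qed (use m_pos in auto)
      finally show "(\<Sum>j<Suc J. ?c j * (w u * g f (t * 2 ^ j) u powr s)) \<le> (2 powr s / m) * ?\<omega> powr s * (1 / weight u ^ 2)"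
        by (simp only: sum_distrib_left mult.left_commute[of "w u"])
    qed
    also have "\<dots> = (2 powr s / m) * ?\<omega> powr s * W2"
      unfolding W2_def by (rule integral_mult_right_zero)
    also have "C1 * ((2 powr s / m) * ?\<omega> powr s * W2) \<le> C2 * ?\<omega> powr s"
    proof -
      have "C1 * ((2 powr s / m) * ?\<omega> powr s * W2) = (C1 * (2 powr s / m) * W2) * ?\<omega> powr s" by simp
      also have "\<dots> \<le> C2 * ?\<omega> powr s"
        unfolding C2_def using C1 m_pos by (intro mult_right_mono mult_left_mono) auto
      finally show ?thesis .
    qed
    finally show ?thesis using C1 by (simp add: mult_left_mono)
  qed
  show ?thesis
  proof (intro exI[of _ "C2 powr (- 1 / s)"] conjI ballI allI impI)
    show "0 < C2 powr (- 1 / s)" using C2 by simp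
    fix f t assume f: "f \<in> B" and t: "0 < (t::real)"
    have sm: "summable (T f t)"
      by (rule summableI_nonneg_bounded) (use T0 part[OF f t] in auto)
    then show "summable (\<lambda>j. 2 powr (- real (Suc j) * real r * s) * E (1 / (t * 2 ^ Suc j)) f powr s)"
      by (simp add: T_def[abs_def])
    let ?\<omega> = "modulus N r f t"
    have \<omega>0: "0 \<le> ?\<omega>" using modulus_nonneg[OF f] t by simp
    have "(\<Sum>j. T f t j) \<le> C2 * ?\<omega> powr s"
      by (rule suminf_le_const[OF sm part[OF f t]])
    then have "(\<Sum>j. T f t j) powr (1 / s) \<le> (C2 * ?\<omega> powr s) powr (1 / s)"
      using s_ge_1 T0 by (intro powr_mono2 suminf_nonneg sm) auto
    also have "\<dots> = C2 powr (1 / s) * ?\<omega>"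
      using C2 \<omega>0 s_ge_1 by (simp add: powr_mult powr_powr)
    finally have "C2 powr (- 1 / s) * (\<Sum>j. T f t j) powr (1 / s) \<le> C2 powr (- 1 / s) * (C2 powr (1 / s) * ?\<omega>)"
      by (intro mult_left_mono) auto
    also have "\<dots> = ?\<omega>" using C2 by (simp add: mult.assoc[symmetric] powr_add[symmetric])
    finally show "C2 powr (- 1 / s) * (\<Sum>j. 2 powr (- real (Suc j) * real r * s) * E (1 / (t * 2 ^ Suc j)) f powr s) powr (1 / s) \<le> ?\<omega>"
      by (simp add: T_def[abs_def])
  qed
qed

end

section \<open>Trigonometric kernels on the torus\<close>

definition integer_vector :: "real^'n::finite \<Rightarrow> bool" where
  "integer_vector \<kappa> \<longleftrightarrow> (\<forall>i. \<kappa> $ i \<in> \<int>)"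

text \<open>The period is \<open>1\<close> in each variable, so that the period cells are unions of dyadic grid cells.\<close>

definition trigpoly :: "real \<Rightarrow> (real^'n::finite \<Rightarrow> complex) \<Rightarrow> bool" where
  "trigpoly b f \<longleftrightarrow> (\<exists>F c. finite F \<and> (\<forall>\<kappa>\<in>F. integer_vector \<kappa> \<and> norm \<kappa> \<le> b) \<and>
     f = (\<lambda>v. \<Sum>\<kappa>\<in>F. c \<kappa> * cis (2 * pi * (\<kappa> \<bullet> v))))"

lemma trigpolyI:
  assumes "finite I" "\<And>i. i \<in> I \<Longrightarrow> integer_vector (k i) \<and> norm (k i) \<le> b"
    and f: "\<And>v. f v = (\<Sum>i\<in>I. c i * cis (2 * pi * (k i \<bullet> v)))"
  shows "trigpoly b f"
  unfolding trigpoly_def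
proof (intro exI conjI)
  show "f = (\<lambda>v. \<Sum>\<kappa>\<in>k ` I. (\<Sum>i\<in>{i\<in>I. k i = \<kappa>}. c i) * cis (2 * pi * (\<kappa> \<bullet> v)))"
  proof
    fix v
    have "f v = (\<Sum>\<kappa>\<in>k ` I. \<Sum>i\<in>{i\<in>I. k i = \<kappa>}. c i * cis (2 * pi * (k i \<bullet> v)))"
      unfolding f by (rule sum.image_gen[OF assms(1)])
    then show "f v = (\<Sum>\<kappa>\<in>k ` I. (\<Sum>i\<in>{i\<in>I. k i = \<kappa>}. c i) * cis (2 * pi * (\<kappa> \<bullet> v)))"
      by (simp add: sum_distrib_right)
  qed
qed (use assms in auto)

lemma trigpoly_const: "0 \<le> b \<Longrightarrow> trigpoly b (\<lambda>v. c)"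
  by (rule trigpolyI[of "{()}" "\<lambda>_. 0" b _ "\<lambda>_. c"]) (auto simp: integer_vector_def)

lemma trigpoly_mult:
  assumes "trigpoly b f" "trigpoly b' g"
  shows "trigpoly (b + b') (\<lambda>v. f v * g v)"
proof -
  obtain F c where F: "finite F" "\<forall>\<kappa>\<in>F. integer_vector \<kappa> \<and> norm \<kappa> \<le> b"
    "f = (\<lambda>v. \<Sum>\<kappa>\<in>F. c \<kappa> * cis (2 * pi * (\<kappa> \<bullet> v)))" using assms(1) unfolding trigpoly_def by blast
  obtain G d where G: "finite G" "\<forall>\<kappa>\<in>G. integer_vector \<kappa> \<and> norm \<kappa> \<le> b'"
    "g = (\<lambda>v. \<Sum>\<kappa>\<in>G. d \<kappa> * cis (2 * pi * (\<kappa> \<bullet> v)))" using assms(2) unfolding trigpoly_def by blast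
  show ?thesis
  proof (rule trigpolyI[of "F \<times> G" "\<lambda>(k,l). k + l" _ _ "\<lambda>(k,l). c k * d l"])
    show "f v * g v = (\<Sum>i\<in>F \<times> G. (case i of (k, l) \<Rightarrow> c k * d l) * cis (2 * pi * ((case i of (k, l) \<Rightarrow> k + l) \<bullet> v)))" for v
      unfolding F(3) G(3) sum_product
      by (subst sum.cartesian_product, rule sum.cong[OF refl])
        (simp add: case_prod_beta inner_add_left distrib_left cis_mult[symmetric] mult_ac del: cis_mult)
    show "integer_vector (case i of (k, l) \<Rightarrow> k + l) \<and> norm (case i of (k, l) \<Rightarrow> k + l) \<le> b + b'" if i0: "i \<in> F \<times> G" for i
    proof -
      obtain k l where i: "i = (k, l)" "k \<in> F" "l \<in> G" using i0 by auto
      have "integer_vector (k + l)" using i F(2) G(2) by (auto simp: integer_vector_def)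
      moreover have "norm (k + l) \<le> b + b'" 
        by (rule order_trans[OF norm_triangle_ineq add_mono]) (use i F(2) G(2) in auto)
      ultimately show ?thesis by (simp add: i)
    qed
  qed (use F G in auto)
qed

lemma trigpoly_power: "trigpoly b f \<Longrightarrow> 0 \<le> b \<Longrightarrow> trigpoly (real n * b) (\<lambda>v. f v ^ n)"
proof (induction n)
  case (Suc n)
  from trigpoly_mult[OF Suc(2) Suc.IH[OF Suc(2,3)]] show ?case
    by (simp add: algebra_simps)
qed (simp add: trigpoly_const)

lemma trigpoly_prod:
  "finite A \<Longrightarrow> (\<And>i. i \<in> A \<Longrightarrow> trigpoly b (f i)) \<Longrightarrow> 0 \<le> b \<Longrightarrow> trigpoly (real (card A) * b) (\<lambda>v. \<Prod>i\<in>A. f i v)"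
proof (induction A rule: finite_induct)
  case (insert a A)
  from trigpoly_mult[OF insert.prems(1)[of a] insert.IH] insert show ?case
    by (simp add: algebra_simps)
qed (simp add: trigpoly_const)

definition dirichlet :: "nat \<Rightarrow> real \<Rightarrow> complex" where
  "dirichlet n v = (\<Sum>k<n. cis (2 * pi * real k * v))"

lemma norm_axis: "norm (axis i c :: real^'n::finite) = \<bar>c\<bar>"
  by (simp add: norm_eq_sqrt_inner inner_axis_axis)

lemma trigpoly_dirichlet:
  fixes i :: "'n::finite"
  shows "trigpoly (real (n - 1)) (\<lambda>v::real^'n. dirichlet n (v $ i))"
    and "trigpoly (real (n - 1)) (\<lambda>v::real^'n. cnj (dirichlet n (v $ i)))"
proof -
  have ax: "integer_vector (axis i c :: real^'n) \<longleftrightarrow> c \<in> \<int>" for c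
    by (auto simp: integer_vector_def axis_def)
  show "trigpoly (real (n - 1)) (\<lambda>v::real^'n. dirichlet n (v $ i))"
    by (rule trigpolyI[of "{..<n}" "\<lambda>k. axis i (real k)" _ _ "\<lambda>_. 1"])
       (auto simp: ax dirichlet_def norm_axis inner_axis' mult_ac)
  show "trigpoly (real (n - 1)) (\<lambda>v::real^'n. cnj (dirichlet n (v $ i)))"
    by (rule trigpolyI[of "{..<n}" "\<lambda>k. axis i (- real k)" _ _ "\<lambda>_. 1"])
       (auto simp: ax dirichlet_def norm_axis inner_axis' cis_cnj mult_ac)
qed

lemma sin_ge_half:
  assumes "0 \<le> x" "x \<le> pi / 2"
  shows "x / 2 \<le> sin x"
proof (cases "x \<le> pi / 3")
  case True
  have "sin 0 - 0 / 2 \<le> sin x - x / 2"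
  proof (rule DERIV_nonneg_imp_nondecreasing[OF assms(1)])
    fix y assume y: "0 \<le> y" "y \<le> x"
    have "cos (pi / 3) \<le> cos y" using y True by (intro cos_monotone_0_pi_le) auto
    then show "\<exists>z. ((\<lambda>x. sin x - x / 2) has_real_derivative z) (at y) \<and> 0 \<le> z"
      by (intro exI[of _ "cos y - 1/2"] conjI derivative_eq_intros) (auto simp: cos_60)
  qed
  then show ?thesis by simp
next
  case False
  have "sin (pi / 3) \<le> sin x" using False assms by (intro sin_monotone_2pi_le) auto
  moreover have "pi / 4 \<le> sqrt 3 / 2"
  proof -
    have "1.7 \<le> sqrt (3::real)" by (rule real_le_rsqrt) (simp add: power2_eq_square)
    then show ?thesis using pi_less_4 pi_approx by simp
  qed
  ultimately show ?thesis using assms by (simp add: sin_60)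
qed

lemma norm_cis_minus_1: "norm (cis (2 * x) - 1) = 2 * \<bar>sin x\<bar>"
proof -
  have "(norm (cis (2 * x) - 1))\<^sup>2 = (cos (2 * x) - 1)\<^sup>2 + (sin (2 * x))\<^sup>2"
    by (simp add: cmod_power2)
  also have "\<dots> = (2 * sin x * sin x)\<^sup>2 + (2 * sin x * cos x)\<^sup>2"
    by (simp add: cos_double_sin sin_double power2_eq_square)
  also have "\<dots> = (2 * \<bar>sin x\<bar>)\<^sup>2 * ((sin x)\<^sup>2 + (cos x)\<^sup>2)"
    by (simp only: power_mult_distrib distrib_left power2_abs mult.assoc)
  finally have "(norm (cis (2 * x) - 1))\<^sup>2 = (2 * \<bar>sin x\<bar>)\<^sup>2"
    by (simp only: sin_cos_squared_add mult_1_right)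
  then show ?thesis by (rule power2_eq_imp_eq) auto
qed

lemma norm_dirichlet_le: "norm (dirichlet n v) \<le> real n"
  unfolding dirichlet_def by (rule order_trans[OF norm_sum]) simp

text \<open>Multiplication by \<open>e\<^bsup>2 \<pi> i v\<^esup> - 1\<close> makes the geometric sum telescope.\<close>

lemma norm_dirichlet_decay:
  assumes "\<bar>v\<bar> \<le> 1 / 2"
  shows "norm (dirichlet n v) * \<bar>v\<bar> \<le> 1"
proof -
  have "(cis (2 * pi * v) - 1) * dirichlet n v = (\<Sum>k<n. cis (2 * pi * real (Suc k) * v) - cis (2 * pi * real k * v))"
    unfolding dirichlet_def sum_distrib_left
    by (intro sum.cong refl) (simp add: cis_mult algebra_simps)
  also have "\<dots> = cis (2 * pi * real n * v) - 1"
    by (subst sum_lessThan_telescope) simp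
  finally have "norm (cis (2 * pi * v) - 1) * norm (dirichlet n v) \<le> 2"
    using norm_triangle_ineq4[of "cis (2 * pi * real n * v)" 1] by (simp flip: norm_mult)
  moreover have "norm (cis (2 * pi * v) - 1) \<ge> 2 * \<bar>v\<bar>"
  proof -
    have "pi * \<bar>v\<bar> / 2 \<le> sin (pi * \<bar>v\<bar>)" using assms by (intro sin_ge_half) (auto simp: field_simps)
    also have "\<dots> \<le> \<bar>sin (pi * v)\<bar>" by (cases "0 \<le> v") auto
    finally have "pi * \<bar>v\<bar> \<le> norm (cis (2 * (pi * v)) - 1)" by (simp only: norm_cis_minus_1)
    moreover have "2 * \<bar>v\<bar> \<le> pi * \<bar>v\<bar>" using pi_ge_two by (intro mult_right_mono) auto
    ultimately show ?thesis by (simp add: mult.assoc)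
  qed
  ultimately have "2 * \<bar>v\<bar> * norm (dirichlet n v) \<le> 2"
    by (meson mult_right_mono norm_ge_zero order_trans)
  then show ?thesis by (simp add: mult_ac)
qed

text \<open>For \<open>\<bar>v\<bar> \<le> 1 / (8 n)\<close> all terms have real part at least \<open>1/2\<close>.\<close>

lemma norm_dirichlet_ge:
  assumes "\<bar>v\<bar> * real n \<le> 1 / 8"
  shows "real n / 2 \<le> norm (dirichlet n v)"
proof -
  have "(\<Sum>k<n. 1 / 2) \<le> (\<Sum>k<n. cos (2 * pi * real k * v))"
  proof (rule sum_mono)
    fix k assume "k \<in> {..<n}"
    then have "\<bar>v\<bar> * real k \<le> \<bar>v\<bar> * real n" by (intro mult_left_mono) auto
    then have "\<bar>real k * v\<bar> \<le> 1 / 8" using assms by (simp add: abs_mult mult.commute)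
    then have "2 * pi * \<bar>real k * v\<bar> \<le> 2 * pi * (1 / 8)" by (intro mult_left_mono) auto
    then have "\<bar>2 * pi * real k * v\<bar> \<le> pi / 3" by (simp add: abs_mult mult.assoc)
    then have "cos (pi / 3) \<le> cos \<bar>2 * pi * real k * v\<bar>" by (intro cos_monotone_0_pi_le) auto
    then show "1 / 2 \<le> cos (2 * pi * real k * v)" by (simp add: cos_60)
  qed
  also have "\<dots> = Re (dirichlet n v)" by (simp add: dirichlet_def)
  also have "\<dots> \<le> norm (dirichlet n v)" by (rule complex_Re_le_cmod)
  finally show ?thesis by simp
qed

definition halfopen :: "real set" where "halfopen = {- (1/2) ..< 1/2}"

text \<open>The even power makes the kernel a trigonometric polynomial, namely \<open>(D cnj(D))\<^sup>M\<close> for the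
  Dirichlet kernel \<open>D\<close>, and a large \<open>M\<close> gives any required decay.\<close>

definition jackson1 :: "nat \<Rightarrow> nat \<Rightarrow> real \<Rightarrow> real" where
  "jackson1 M n v = norm (dirichlet n v) ^ (2 * M)"

definition jackson1_mass :: "nat \<Rightarrow> nat \<Rightarrow> real" where
  "jackson1_mass M n = (LINT v|lborel. indicator halfopen v * jackson1 M n v)"

lemma continuous_on_dirichlet[continuous_intros]:
  "continuous_on S f \<Longrightarrow> continuous_on S (\<lambda>x. dirichlet n (f x))"
  unfolding dirichlet_def cis_conv_exp by (intro continuous_intros)

lemma jackson1_measurable[measurable]: "jackson1 M n \<in> borel_measurable borel"
  unfolding jackson1_def[abs_def] by (intro borel_measurable_continuous_onI continuous_intros)

lemma halfopen_measurable[measurable]: "halfopen \<in> sets borel"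
  by (simp add: halfopen_def)

lemma jackson1_integrable: "integrable lborel (\<lambda>v. indicator halfopen v * jackson1 M n v)"
proof (rule Bochner_Integration.integrable_bound)
  show "integrable lborel (\<lambda>v. indicator {-1/2..<1/2::real} v * real n ^ (2 * M))" by simp
  show "AE v in lborel. norm (indicator halfopen v * jackson1 M n v) \<le> norm (indicator {-1/2..<1/2::real} v * real n ^ (2 * M))"
    by (auto intro!: AE_I2 power_mono norm_dirichlet_le simp: jackson1_def halfopen_def indicator_def)
qed measurable

lemma jackson1_mass_ge:
  assumes "1 \<le> n"
  shows "(real n / 2) ^ (2 * M) / (4 * real n) \<le> jackson1_mass M n"
proof -
  let ?J = "{- 1 / (8 * real n) .. 1 / (8 * real n)}"
  have n: "1 / (8 * real n) \<le> 1 / 8" using assms by (simp add: field_simps)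
  have le: "- 1 / (8 * real n) \<le> 1 / (8 * real n)" by simp
  have "(LINT v|lborel. indicator ?J v * (real n / 2) ^ (2 * M)) = (2 / (8 * real n)) * (real n / 2) ^ (2 * M)"
    using le by simp
  also have "\<dots> = (real n / 2) ^ (2 * M) / (4 * real n)" by simp
  finally have "(real n / 2) ^ (2 * M) / (4 * real n) = (LINT v|lborel. indicator ?J v * (real n / 2) ^ (2 * M))" by simp
  also have "\<dots> \<le> jackson1_mass M n"
    unfolding jackson1_mass_def
  proof (rule integral_mono[OF _ jackson1_integrable])
    show "integrable lborel (\<lambda>v. indicator ?J v * (real n / 2) ^ (2 * M))" using le by simp
    fix v :: real
    show "indicator ?J v * (real n / 2) ^ (2 * M) \<le> indicator halfopen v * jackson1 M n v"
    proof (cases "v \<in> ?J")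
      case True
      then have v: "\<bar>v\<bar> \<le> 1 / (8 * real n)" by auto
      then have "\<bar>v\<bar> * real n \<le> 1 / 8" using assms by (simp add: field_simps)
      moreover have "v \<in> halfopen" using v n unfolding halfopen_def by auto
      ultimately show ?thesis using True by (auto simp: jackson1_def intro!: power_mono norm_dirichlet_ge)
    qed (simp add: jackson1_def)
  qed
  finally show ?thesis .
qed

lemma jackson1_mass_pos: "1 \<le> n \<Longrightarrow> 0 < jackson1_mass M n"
  by (rule less_le_trans[OF _ jackson1_mass_ge]) auto

lemma jackson1_decay:
  assumes n: "1 \<le> n" and v: "v \<in> halfopen"
  shows "jackson1 M n v / jackson1_mass M n \<le> 4 * real n * (4 / (1 + real n * \<bar>v\<bar>)) ^ (2 * M)"
proof -
  have "norm (dirichlet n v) * (1 + real n * \<bar>v\<bar>) \<le> real n + real n * 1"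
  proof -
    have "\<bar>v\<bar> \<le> 1 / 2" using v by (auto simp: halfopen_def)
    then have "real n * (norm (dirichlet n v) * \<bar>v\<bar>) \<le> real n * 1" by (intro mult_left_mono norm_dirichlet_decay) auto
    then show ?thesis using norm_dirichlet_le[of n v] by (simp add: algebra_simps)
  qed
  then have "norm (dirichlet n v) \<le> 2 * real n / (1 + real n * \<bar>v\<bar>)"
    by (subst pos_le_divide_eq) (auto simp: add_pos_nonneg)
  then have "jackson1 M n v \<le> (2 * real n / (1 + real n * \<bar>v\<bar>)) ^ (2 * M)"
    unfolding jackson1_def by (rule power_mono) simp
  also have "\<dots> = (real n / 2) ^ (2 * M) / (4 * real n) * (4 * real n * (4 / (1 + real n * \<bar>v\<bar>)) ^ (2 * M))"
    using n by (simp add: power_mult_distrib[symmetric] power_divide[symmetric] del: power_mult_distrib)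
  also have "\<dots> \<le> jackson1_mass M n * (4 * real n * (4 / (1 + real n * \<bar>v\<bar>)) ^ (2 * M))"
    by (intro mult_right_mono jackson1_mass_ge n) auto
  finally show ?thesis using jackson1_mass_pos[OF n, of M] by (simp add: field_simps)
qed

definition jackson :: "nat \<Rightarrow> nat \<Rightarrow> real^'n::finite \<Rightarrow> real" where
  "jackson M n v = (\<Prod>i\<in>UNIV. jackson1 M n (v $ i) / jackson1_mass M n)"

definition halfopen_cube :: "(real^'n::finite) set" where
  "halfopen_cube = {v. \<forall>i. v $ i \<in> halfopen}"

lemma indicator_halfopen_cube:
  "indicator halfopen_cube (v::real^'n::finite) = (\<Prod>i\<in>UNIV. indicator halfopen (v $ i) :: real)"
  by (auto simp: halfopen_cube_def indicator_def)

lemma jackson_nonneg: "0 \<le> jackson M n v"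
  unfolding jackson_def by (intro prod_nonneg) 
    (auto simp: jackson1_def jackson1_mass_def indicator_def intro!: divide_nonneg_nonneg integral_nonneg_AE)

lemma jackson_integral:
  assumes "1 \<le> n"
  shows "(LINT v|lborel. indicator (halfopen_cube :: (real^'n::finite) set) v * jackson M n v) = 1"
proof -
  have "(LINT v|lborel. indicator (halfopen_cube :: (real^'n) set) v * jackson M n v) =
     (LINT v|lborel. (\<Prod>i\<in>UNIV. (\<lambda>t. indicator halfopen t * jackson1 M n t / jackson1_mass M n) ((v::real^'n) $ i)))"
    by (simp add: indicator_halfopen_cube jackson_def prod.distrib[symmetric])
  also have "\<dots> = (\<Prod>i\<in>(UNIV::'n set). (LINT t|lborel. indicator halfopen t * jackson1 M n t / jackson1_mass M n))"
    by (rule integral_vec_prod) (use jackson1_integrable in simp)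
  also have "(LINT t|lborel. indicator halfopen t * jackson1 M n t / jackson1_mass M n) = 1"
    using jackson1_mass_pos[OF assms, of M] by (simp add: jackson1_mass_def[symmetric])
  finally show ?thesis by simp
qed

lemma jackson_trigpoly:
  "trigpoly (2 * real CARD('n) * real M * real (n - 1)) (\<lambda>v::real^'n::finite. of_real (jackson M n v))"
proof -
  let ?b = "real (n - 1)"
  have 1: "trigpoly (real M * (?b + ?b)) (\<lambda>v::real^'n. (dirichlet n (v $ i) * cnj (dirichlet n (v $ i))) ^ M)" for i
    by (intro trigpoly_power trigpoly_mult trigpoly_dirichlet) auto
  have "trigpoly (0 + real M * (?b + ?b)) (\<lambda>v::real^'n. of_real (1 / jackson1_mass M n) * (dirichlet n (v $ i) * cnj (dirichlet n (v $ i))) ^ M)" for i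
    by (intro trigpoly_mult 1 trigpoly_const) simp
  then have "trigpoly (real CARD('n) * (0 + real M * (?b + ?b))) (\<lambda>v::real^'n. \<Prod>i\<in>UNIV. of_real (1 / jackson1_mass M n) * (dirichlet n (v $ i) * cnj (dirichlet n (v $ i))) ^ M)"
    by (intro trigpoly_prod) auto
  moreover have "(\<Prod>i\<in>UNIV. of_real (1 / jackson1_mass M n) * (dirichlet n (v $ i) * cnj (dirichlet n (v $ i))) ^ M) = of_real (jackson M n v)" for v :: "real^'n"
    unfolding jackson_def of_real_prod
    by (intro prod.cong refl) (simp add: jackson1_def complex_norm_square[symmetric] power_mult power2_eq_square[symmetric])
  moreover have "real CARD('n) * (0 + real M * (?b + ?b)) = 2 * real CARD('n) * real M * real (n - 1)" by simp
  ultimately show ?thesis by (simp only:)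
qed

text \<open>At scale \<open>c\<close> comparable to \<open>1 / n\<close> the kernel is dominated by a constant times a power of
  \<open>1 / weight u\<close>, with a constant that does not depend on \<open>n\<close>.\<close>

lemma jackson_decay:
  fixes u :: "real^'n::finite"
  assumes n: "1 \<le> n" and c: "0 < c" "c * real n \<le> 1" and \<gamma>: "0 < \<gamma>" "\<gamma> \<le> 1" "\<gamma> \<le> c * real n"
    and u: "c *\<^sub>R u \<in> halfopen_cube"
  shows "c ^ CARD('n) * jackson M n (c *\<^sub>R u) \<le> (4 * (4 / \<gamma>) ^ (2 * M)) ^ CARD('n) * (1 / weight u ^ (2 * M))"
proof -
  have "c * (jackson1 M n (c * u $ i) / jackson1_mass M n) \<le> 4 * (4 / \<gamma>) ^ (2 * M) * (1 / (1 + \<bar>u $ i\<bar>) ^ (2 * M))" for i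
  proof -
    have ui: "c * u $ i \<in> halfopen" using u by (simp add: halfopen_cube_def)
    have "\<gamma> * (1 + \<bar>u $ i\<bar>) \<le> 1 + real n * \<bar>c * u $ i\<bar>"
      using \<gamma> c mult_right_mono[OF \<gamma>(3), of "\<bar>u $ i\<bar>"] by (simp add: abs_mult algebra_simps)
    then have "4 / (1 + real n * \<bar>c * u $ i\<bar>) \<le> 4 / (\<gamma> * (1 + \<bar>u $ i\<bar>))"
      using \<gamma> by (intro divide_left_mono) (auto intro!: mult_pos_pos add_pos_nonneg)
    then have "(4 / (1 + real n * \<bar>c * u $ i\<bar>)) ^ (2 * M) \<le> (4 / (\<gamma> * (1 + \<bar>u $ i\<bar>))) ^ (2 * M)"
      by (rule power_mono) (simp add: add_nonneg_nonneg)
    then have "4 * real n * (4 / (1 + real n * \<bar>c * u $ i\<bar>)) ^ (2 * M) \<le> 4 * real n * (4 / (\<gamma> * (1 + \<bar>u $ i\<bar>))) ^ (2 * M)"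
      by (intro mult_left_mono) auto
    with jackson1_decay[OF n ui, of M] have "jackson1 M n (c * u $ i) / jackson1_mass M n \<le> 4 * real n * (4 / (\<gamma> * (1 + \<bar>u $ i\<bar>))) ^ (2 * M)"
      by linarith
    then have "c * (jackson1 M n (c * u $ i) / jackson1_mass M n) \<le> c * (4 * real n * (4 / (\<gamma> * (1 + \<bar>u $ i\<bar>))) ^ (2 * M))"
      using c by (intro mult_left_mono) auto
    also have "\<dots> = (c * real n) * (4 * (4 / (\<gamma> * (1 + \<bar>u $ i\<bar>))) ^ (2 * M))" by simp
    also have "\<dots> \<le> 1 * (4 * (4 / (\<gamma> * (1 + \<bar>u $ i\<bar>))) ^ (2 * M))"
      using c \<gamma> by (intro mult_right_mono) auto
    also have "\<dots> = 4 * (4 / \<gamma>) ^ (2 * M) * (1 / (1 + \<bar>u $ i\<bar>) ^ (2 * M))"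
      by (simp add: power_divide power_mult_distrib)
    finally show ?thesis .
  qed
  moreover have "0 \<le> jackson1 M n v / jackson1_mass M n" for v
    by (auto simp: jackson1_def intro!: divide_nonneg_nonneg less_imp_le[OF jackson1_mass_pos[OF n]])
  ultimately have "(\<Prod>i\<in>UNIV. c * (jackson1 M n (c * u $ i) / jackson1_mass M n)) \<le>
      (\<Prod>i\<in>(UNIV::'n set). 4 * (4 / \<gamma>) ^ (2 * M) * (1 / (1 + \<bar>u $ i\<bar>) ^ (2 * M)))"
    using c by (intro prod_mono) (auto simp del: times_divide_eq_right)
  moreover have "(\<Prod>i\<in>UNIV. c * (jackson1 M n (c * u $ i) / jackson1_mass M n)) = c ^ CARD('n) * jackson M n (c *\<^sub>R u)"
    by (simp only: prod.distrib prod_constant jackson_def vector_scaleR_component real_scaleR_def)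
  moreover have "(\<Prod>i\<in>(UNIV::'n set). 4 * (4 / \<gamma>) ^ (2 * M) * (1 / (1 + \<bar>u $ i\<bar>) ^ (2 * M))) = (4 * (4 / \<gamma>) ^ (2 * M)) ^ CARD('n) * (1 / weight u ^ (2 * M))"
    by (simp only: prod.distrib prod_constant weight_def prod_dividef prod_power_distrib[symmetric] prod.neutral_const power_mult_distrib power_one)
  ultimately show ?thesis by simp
qed

section \<open>Trigonometric approximants on the torus\<close>

lemma integral_scaleR_lborel:
  fixes h :: "real^'n::finite \<Rightarrow> real"
  assumes h[measurable]: "h \<in> borel_measurable borel" and c: "0 < c"
  shows "(LINT x|lborel. h x) = c ^ CARD('n) * (LINT x|lborel. h (c *\<^sub>R x))"
proof -
  have "(LINT x|lborel. h x) = (LINT x|density (distr lborel borel (\<lambda>x. 0 + c *\<^sub>R x)) (\<lambda>_. \<bar>c\<bar> ^ DIM(real^'n)). h x)"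
    by (rule arg_cong[where f="\<lambda>M. integral\<^sup>L M h"], rule lborel_affine) (use c in simp)
  also have "\<dots> = (LINT x|distr lborel borel (\<lambda>x. 0 + c *\<^sub>R x). \<bar>c\<bar> ^ DIM(real^'n) *\<^sub>R h x)"
    by (rule integral_density) auto
  also have "\<dots> = (LINT x|lborel. \<bar>c\<bar> ^ DIM(real^'n) *\<^sub>R h (0 + c *\<^sub>R x))"
    by (rule integral_distr) auto
  finally show ?thesis using c by simp
qed

lemma AE_lborel_affine:
  fixes t :: "real^'n::finite"
  assumes c: "c \<noteq> 0" and P: "AE x in lborel. P x"
  shows "AE x in lborel. P (t + c *\<^sub>R x)"
proof -
  obtain S where S: "S \<in> null_sets lborel" "{x \<in> space lborel. \<not> P x} \<subseteq> S"
    using P by (auto elim!: AE_E intro: that)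
  have Sb[measurable]: "S \<in> sets borel" using S by auto
  have "AE x in lborel. x \<notin> S" using S(1) by (rule AE_not_in)
  moreover have "(AE x in lborel. x \<notin> S) =
     (AE x in density (distr lborel borel (\<lambda>x. t + c *\<^sub>R x)) (\<lambda>_. ennreal (\<bar>c\<bar> ^ DIM(real^'n))). x \<notin> S)"
    by (rule arg_cong[where f="\<lambda>M. AE x in M. x \<notin> S"], rule lborel_affine[OF c])
  ultimately have "AE x in density (distr lborel borel (\<lambda>x. t + c *\<^sub>R x)) (\<lambda>_. ennreal (\<bar>c\<bar> ^ DIM(real^'n))). x \<notin> S"
    by blast
  then have "AE x in lborel. t + c *\<^sub>R x \<notin> S"
    using c by (simp add: AE_density AE_distr_iff)
  then show ?thesis using S(2) by (auto elim!: eventually_mono)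
qed

lemma lebesgue_measurable_AE_eq_borel:
  fixes f :: "real^'n::finite \<Rightarrow> complex"
  assumes "f \<in> borel_measurable lebesgue"
  shows "\<exists>g\<in>borel_measurable borel. AE x in lborel. f x = g x"
proof -
  have "(\<lambda>x. Re (f x)) \<in> borel_measurable lebesgue" "(\<lambda>x. Im (f x)) \<in> borel_measurable lebesgue"
    using assms by auto
  from this[THEN completion_ex_borel_measurable_real]
  obtain a b where a: "a \<in> borel_measurable lborel" "AE x in lborel. Re (f x) = a x"
    and b: "b \<in> borel_measurable lborel" "AE x in lborel. Im (f x) = b x" by blast
  have meas: "(\<lambda>x. Complex (a x) (b x)) \<in> borel_measurable borel"
    using a(1) b(1) unfolding Complex_eq by simp
  have "AE x in lborel. f x = Complex (a x) (b x)"
    using a(2) b(2) by eventually_elim (simp add: complex_eq_iff)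
  then show ?thesis using meas by (rule bexI)
qed

lemma AE_lebesgue_iff: "(AE x in lebesgue. P x) \<longleftrightarrow> (AE x in lborel. P x)"
  by (rule AE_completion_iff)

lemma AE_lborel_imp_ex: "AE x::real^'n::finite in lborel. P x \<Longrightarrow> \<exists>x. P x"
proof (rule ccontr)
  assume "AE x::real^'n in lborel. P x" "\<nexists>x. P x"
  then have "AE x::real^'n in lborel. False" by simp
  then show False by (simp add: eventually_False ae_filter_eq_bot_iff)
qed

text \<open>A function all of whose translates are combinations of fixed functions, with coefficients
  that depend only on the translation, is itself such a combination of its coefficients: by Fubini
  the relation holds at some fixed point for almost every translation.\<close>

lemma translates_determine_function:
  fixes \<phi> :: "real^'n::finite \<Rightarrow> complex" and A :: "'k \<Rightarrow> real^'n \<Rightarrow> complex" and q :: "'k \<Rightarrow> real^'n \<Rightarrow> real"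
  assumes F: "finite F" and b: "b \<noteq> 0"
    and \<phi>: "\<phi> \<in> borel_measurable lebesgue" and A: "\<And>\<kappa>. \<kappa> \<in> F \<Longrightarrow> A \<kappa> \<in> borel_measurable lebesgue"
    and q[measurable]: "\<And>\<kappa>. \<kappa> \<in> F \<Longrightarrow> q \<kappa> \<in> borel_measurable borel"
    and eq: "\<And>\<zeta>. AE x in lebesgue. \<phi> (x + b *\<^sub>R \<zeta>) = (\<Sum>\<kappa>\<in>F. q \<kappa> \<zeta> *\<^sub>R A \<kappa> x)"
  shows "\<exists>x0 \<alpha>. AE y in lebesgue. \<phi> y = (\<Sum>\<kappa>\<in>F. q \<kappa> ((1 / b) *\<^sub>R (y - x0)) *\<^sub>R \<alpha> \<kappa>)"
proof -
  obtain \<phi>' where \<phi>'[measurable]: "\<phi>' \<in> borel_measurable borel" and \<phi>eq: "AE x in lborel. \<phi> x = \<phi>' x"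
    using lebesgue_measurable_AE_eq_borel[OF \<phi>] by blast
  have "\<forall>\<kappa>\<in>F. \<exists>g. g \<in> borel_measurable borel \<and> (AE x in lborel. A \<kappa> x = g x)"
    using lebesgue_measurable_AE_eq_borel[OF A] by blast
  then obtain A' where A'[measurable]: "\<And>\<kappa>. \<kappa> \<in> F \<Longrightarrow> A' \<kappa> \<in> borel_measurable borel"
    and Aeq: "\<And>\<kappa>. \<kappa> \<in> F \<Longrightarrow> AE x in lborel. A \<kappa> x = A' \<kappa> x"
    using bchoice[of F "\<lambda>\<kappa> g. g \<in> borel_measurable borel \<and> (AE x in lborel. A \<kappa> x = g x)"] by blast
  let ?P = "\<lambda>\<zeta> x. \<phi>' (x + b *\<^sub>R \<zeta>) = (\<Sum>\<kappa>\<in>F. q \<kappa> \<zeta> *\<^sub>R A' \<kappa> x)"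
  have "AE x in lborel. ?P \<zeta> x" for \<zeta>
  proof -
    have 1: "AE x in lborel. \<phi> (x + b *\<^sub>R \<zeta>) = \<phi>' (x + b *\<^sub>R \<zeta>)"
      using AE_lborel_affine[OF _ \<phi>eq, of 1 "b *\<^sub>R \<zeta>"] by (simp add: add.commute)
    have 2: "AE x in lborel. \<forall>\<kappa>\<in>F. A \<kappa> x = A' \<kappa> x"
      using Aeq F by (subst AE_ball_countable) (auto simp: countable_finite)
    have 3: "AE x in lborel. \<phi> (x + b *\<^sub>R \<zeta>) = (\<Sum>\<kappa>\<in>F. q \<kappa> \<zeta> *\<^sub>R A \<kappa> x)"
      using eq[of \<zeta>] by (simp only: AE_lebesgue_iff)
    show ?thesis using 1 2 3 by eventually_elim simp
  qed
  then have ae: "AE \<zeta> in lborel. AE x in lborel. ?P \<zeta> x" by simp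
  have meas: "{z \<in> space (lborel \<Otimes>\<^sub>M lborel). ?P (fst z) (snd z)} \<in> sets (lborel \<Otimes>\<^sub>M lborel)"
  proof -
    have m1: "(\<lambda>z. \<phi>' (snd z + b *\<^sub>R fst z)) \<in> borel_measurable (lborel \<Otimes>\<^sub>M lborel)"
      by (rule measurable_compose[OF _ \<phi>']) measurable
    have m2: "(\<lambda>z. \<Sum>\<kappa>\<in>F. q \<kappa> (fst z) *\<^sub>R A' \<kappa> (snd z)) \<in> borel_measurable (lborel \<Otimes>\<^sub>M lborel)"
    proof (rule borel_measurable_sum)
      fix \<kappa> assume k: "\<kappa> \<in> F"
      have [measurable]: "(\<lambda>z. q \<kappa> (fst z)) \<in> borel_measurable (lborel \<Otimes>\<^sub>M lborel)"
        by (rule measurable_compose[OF _ q[OF k]]) measurable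
      have [measurable]: "(\<lambda>z. A' \<kappa> (snd z)) \<in> borel_measurable (lborel \<Otimes>\<^sub>M lborel)"
        by (rule measurable_compose[OF _ A'[OF k]]) measurable
      show "(\<lambda>z. q \<kappa> (fst z) *\<^sub>R A' \<kappa> (snd z)) \<in> borel_measurable (lborel \<Otimes>\<^sub>M lborel)" by measurable
    qed
    show ?thesis by (rule measurable_equality_set[OF m1 m2])
  qed
  have "AE x in lborel. AE \<zeta> in lborel. ?P \<zeta> x"
    using lborel_pair.AE_commute[of ?P, OF meas] ae by simp
  then obtain x0 where x0: "AE \<zeta> in lborel. ?P \<zeta> x0" using AE_lborel_imp_ex by blast
  have "AE y in lborel. ?P (- (1 / b) *\<^sub>R x0 + (1 / b) *\<^sub>R y) x0"
    by (rule AE_lborel_affine[OF _ x0]) (use b in simp)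
  then have "AE y in lborel. \<phi> y = (\<Sum>\<kappa>\<in>F. q \<kappa> ((1 / b) *\<^sub>R (y - x0)) *\<^sub>R A' \<kappa> x0)"
    using \<phi>eq
  proof eventually_elim
    case (elim y)
    have "- (1 / b) *\<^sub>R x0 + (1 / b) *\<^sub>R y = (1 / b) *\<^sub>R (y - x0)" by (simp add: scaleR_diff_right)
    moreover have "x0 + b *\<^sub>R ((1 / b) *\<^sub>R (y - x0)) = y" using b by simp
    ultimately show ?case using elim by (simp only:)
  qed
  then show ?thesis
    by (intro exI[of _ x0] exI[of _ "\<lambda>\<kappa>. A' \<kappa> x0"]) (simp add: AE_lebesgue_iff)
qed

definition rvec :: "int^'n \<Rightarrow> real^'n::finite" where "rvec z = (\<chi> i. of_int (z $ i))"

lemma rvec_add: "rvec (y + z) = rvec y + rvec z"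
  by (simp add: rvec_def vec_eq_iff)

lemma gridpoint_rvec: "gridpoint n z = (1 / 2 ^ n) *\<^sub>R rvec z"
  by (simp add: gridpoint_def rvec_def vec_eq_iff)

lemma periodic_integer_shift:
  fixes f :: "real^'n::finite \<Rightarrow> complex"
  assumes "periodic f"
  shows "f (x + (2 * pi) *\<^sub>R rvec z) = f x"
proof -
  have ax: "axis i c = c *\<^sub>R (axis i 1 :: real^'n)" for i c by (simp add: vec_eq_iff axis_def)
  have 1: "f (x + (2 * pi * of_int k) *\<^sub>R axis i 1) = f x" for x i k
  proof (induction k rule: int_induct[where k=0])
    case (step1 k)
    have "x + (2 * pi * of_int (k + 1)) *\<^sub>R axis i 1 = (x + (2 * pi * of_int k) *\<^sub>R axis i 1) + axis i (2 * pi)"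
      by (simp add: ax[of i "2 * pi"] distrib_left scaleR_left_distrib add.assoc)
    then show ?case using assms step1 unfolding periodic_def by metis
  next
    case (step2 k)
    have "x + (2 * pi * of_int k) *\<^sub>R axis i 1 = (x + (2 * pi * of_int (k - 1)) *\<^sub>R axis i 1) + axis i (2 * pi)"
      by (simp add: ax[of i "2 * pi"] right_diff_distrib scaleR_left_diff_distrib)
    then show ?case using assms step2 unfolding periodic_def by metis
  qed simp
  have all: "f (x + (\<Sum>i\<in>A. (2 * pi * of_int (z $ i)) *\<^sub>R axis i 1)) = f x" if "finite A" for A
    using that
  proof (induction A)
    case (insert i A)
    have "x + (\<Sum>i\<in>insert i A. (2 * pi * of_int (z $ i)) *\<^sub>R axis i 1) = (x + (\<Sum>i\<in>A. (2 * pi * of_int (z $ i)) *\<^sub>R axis i 1)) + (2 * pi * of_int (z $ i)) *\<^sub>R axis i 1"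
      using insert by (simp add: add_ac)
    then show ?case by (simp only: 1 insert.IH)
  qed simp
  moreover have "(\<Sum>i\<in>UNIV. (2 * pi * of_int (z $ i)) *\<^sub>R (axis i 1 :: real^'n)) = (2 * pi) *\<^sub>R rvec z"
    by (simp add: rvec_def vec_eq_iff axis_def if_distrib cong: if_cong)
  ultimately show ?thesis using all[of UNIV] by simp
qed

lemma cis_integer_shift:
  assumes "integer_vector \<kappa>"
  shows "cis (2 * pi * (\<kappa> \<bullet> (v + rvec z))) = cis (2 * pi * (\<kappa> \<bullet> v))"
proof -
  have "\<kappa> \<bullet> rvec z \<in> \<int>" using assms
    by (auto simp: inner_vec_def rvec_def integer_vector_def intro!: Ints_sum Ints_mult)
  then have "cis (2 * pi * (\<kappa> \<bullet> rvec z)) = 1" by (rule cis_multiple_2pi)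
  then show ?thesis by (simp add: inner_add_right distrib_left flip: cis_mult)
qed

definition int_cube :: "int \<Rightarrow> int \<Rightarrow> (int^'n::finite) set" where
  "int_cube a L = {z. \<forall>i. a \<le> z $ i \<and> z $ i < a + L}"

lemma finite_int_cube: "finite (int_cube a L)"
  using finite_vec_set[of "\<lambda>_. {a..<a + L}"] by (simp add: int_cube_def)

text \<open>Reduction of \<open>z + y\<close> modulo \<open>L\<close> permutes the cube.\<close>

lemma sum_periodic_shift:
  fixes H :: "int^'n::finite \<Rightarrow> 'b::comm_monoid_add"
  assumes L: "0 < L" and H: "\<And>z w. H (z + (\<chi> i. L * w $ i)) = H z"
  shows "(\<Sum>z\<in>int_cube a L. H (z + y)) = (\<Sum>z\<in>int_cube a L. H z)"
proof -
  define \<rho> where "\<rho> z = (\<chi> i. a + (z $ i + y $ i - a) mod L)" for z :: "int^'n"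
  have H\<rho>: "H (z + y) = H (\<rho> z)" for z
  proof -
    have "z + y = \<rho> z + (\<chi> i. L * (\<chi> i. (z $ i + y $ i - a) div L) $ i)"
      unfolding vec_eq_iff \<rho>_def
    proof
      fix i
      show "(z + y) $ i = ((\<chi> i. a + (z $ i + y $ i - a) mod L) + (\<chi> i. L * (\<chi> i. (z $ i + y $ i - a) div L) $ i)) $ i"
        using mult_div_mod_eq[of L "z $ i + y $ i - a"] by simp
    qed
    then show ?thesis using H by metis
  qed
  have maps: "\<rho> ` int_cube a L \<subseteq> int_cube a L"
    using L by (auto simp: \<rho>_def int_cube_def)
  have inj: "inj_on \<rho> (int_cube a L)"
  proof
    fix z w :: "int^'n" assume z: "z \<in> int_cube a L" and w: "w \<in> int_cube a L" and eq: "\<rho> z = \<rho> w"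
    have "z $ i = w $ i" for i
    proof -
      have "(z $ i + y $ i - a) mod L = (w $ i + y $ i - a) mod L"
        using eq by (simp add: \<rho>_def vec_eq_iff)
      then have "L dvd (z $ i - w $ i)" by (simp add: mod_eq_dvd_iff)
      moreover have "a \<le> z $ i" "z $ i < a + L" "a \<le> w $ i" "w $ i < a + L"
        using z w by (auto simp: int_cube_def)
      then have "\<bar>z $ i - w $ i\<bar> < \<bar>L\<bar>" by linarith
      ultimately show ?thesis using dvd_imp_le_int[of "z $ i - w $ i" L] by linarith
    qed
    then show "z = w" by (simp add: vec_eq_iff)
  qed
  have "\<rho> ` int_cube a L = int_cube a L"
    by (rule endo_inj_surj[OF finite_int_cube maps inj])
  then have "(\<Sum>z\<in>int_cube a L. H z) = (\<Sum>z\<in>int_cube a L. H (\<rho> z))"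
    using sum.reindex[OF inj, of H] by (simp add: o_def)
  then show ?thesis by (simp add: H\<rho>)
qed

lemma gridcell_mem_halfopen_cube_iff:
  assumes "1 \<le> n"
  shows "gridcell n u \<in> halfopen_cube \<longleftrightarrow> u \<in> halfopen_cube"
proof -
  obtain m where n: "n = Suc m" using assms by (cases n) auto
  have "- (1/2) \<le> of_int \<lfloor>2 ^ n * x\<rfloor> / (2::real) ^ n \<longleftrightarrow> - (1/2) \<le> x" for x :: real
  proof -
    have "- (1/2) \<le> of_int \<lfloor>2 ^ n * x\<rfloor> / (2::real) ^ n \<longleftrightarrow> of_int (- (2 ^ m)) \<le> (of_int \<lfloor>2 ^ n * x\<rfloor> :: real)"
      by (simp add: n field_simps)
    also have "\<dots> \<longleftrightarrow> - (2 ^ m) \<le> \<lfloor>2 ^ n * x\<rfloor>" by (rule of_int_le_iff)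
    also have "\<dots> \<longleftrightarrow> - (2 ^ m) \<le> 2 ^ n * x" by (simp add: le_floor_iff)
    also have "\<dots> \<longleftrightarrow> 2 ^ m * (- 1) \<le> 2 ^ m * (2 * x)" by (simp add: n mult_ac)
    also have "\<dots> \<longleftrightarrow> - 1 \<le> 2 * x" by (rule mult_le_cancel_left_pos) simp
    also have "\<dots> \<longleftrightarrow> - (1/2) \<le> x" by linarith
    finally show ?thesis .
  qed
  moreover have "of_int \<lfloor>2 ^ n * x\<rfloor> / (2::real) ^ n < 1/2 \<longleftrightarrow> x < 1/2" for x :: real
  proof -
    have "of_int \<lfloor>2 ^ n * x\<rfloor> / (2::real) ^ n < 1/2 \<longleftrightarrow> of_int \<lfloor>2 ^ n * x\<rfloor> < (of_int (2 ^ m) :: real)"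
      by (simp add: n field_simps)
    also have "\<dots> \<longleftrightarrow> \<lfloor>2 ^ n * x\<rfloor> < 2 ^ m" by (rule of_int_less_iff)
    also have "\<dots> \<longleftrightarrow> 2 ^ n * x < 2 ^ m" by (simp add: floor_less_iff)
    also have "\<dots> \<longleftrightarrow> 2 ^ m * (2 * x) < 2 ^ m * 1" by (simp add: n mult_ac)
    also have "\<dots> \<longleftrightarrow> 2 * x < 1" by (rule mult_less_cancel_left_pos) simp
    also have "\<dots> \<longleftrightarrow> x < 1/2" by linarith
    finally show ?thesis .
  qed
  ultimately show ?thesis by (simp add: halfopen_cube_def halfopen_def gridcell_def)
qed

lemma gridpoint_mem_halfopen_cube_iff:
  assumes "1 \<le> n"
  shows "gridpoint n z \<in> halfopen_cube \<longleftrightarrow> z \<in> int_cube (- (2 ^ (n - 1))) (2 ^ n)"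
proof -
  obtain m where n: "n = Suc m" using assms by (cases n) auto
  have "- (1/2) \<le> of_int y / (2::real) ^ n \<longleftrightarrow> - (2 ^ m) \<le> y" for y
  proof -
    have "- (1/2) \<le> of_int y / (2::real) ^ n \<longleftrightarrow> of_int (- (2 ^ m)) \<le> (of_int y :: real)"
      by (simp add: n field_simps)
    also have "\<dots> \<longleftrightarrow> - (2 ^ m) \<le> y" by (rule of_int_le_iff)
    finally show ?thesis .
  qed
  moreover have "of_int y / (2::real) ^ n < 1/2 \<longleftrightarrow> y < - (2 ^ m) + 2 ^ n" for y
  proof -
    have "of_int y / (2::real) ^ n < 1/2 \<longleftrightarrow> of_int y < (of_int (2 ^ m) :: real)"
      by (simp add: n field_simps)
    also have "\<dots> \<longleftrightarrow> y < 2 ^ m" by (rule of_int_less_iff)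
    finally show ?thesis by (simp add: n)
  qed
  ultimately show ?thesis by (simp add: halfopen_cube_def halfopen_def gridpoint_def int_cube_def n)
qed

lemma int_cube_subset_gridindex: "1 \<le> n \<Longrightarrow> int_cube (- (2 ^ (n - 1))) (2 ^ n) \<subseteq> gridindex n"
proof -
  assume n: "1 \<le> n"
  have 1: "(2::int) ^ (n - 1) \<le> 4 ^ n"
    by (rule order_trans[of _ "2 ^ n"]) (auto intro: power_increasing power_mono)
  have 2: "(2::int) ^ n - 2 ^ (n - 1) \<le> 4 ^ n"
    by (rule order_trans[of _ "2 ^ n"]) (auto intro: power_mono)
  show ?thesis using 1 2 unfolding int_cube_def gridindex_def by (auto simp: subset_iff) (smt (verit))+
qed

definition cube_kernel :: "(real^'n::finite \<Rightarrow> real) \<Rightarrow> real^'n \<Rightarrow> real" where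
  "cube_kernel p u = indicator halfopen_cube u * p u"

lemma cube_kernel_tendsto:
  assumes "continuous_on UNIV p"
  shows "(\<lambda>n. cube_kernel p (gridcell n u)) \<longlonglongrightarrow> cube_kernel p u"
proof -
  have "isCont p u" using assms by (simp add: continuous_on_eq_continuous_at)
  then have "(\<lambda>n. p (gridcell n u)) \<longlonglongrightarrow> p u"
    using tendsto_gridcell by (rule isCont_tendsto_compose)
  then have "(\<lambda>n. indicator halfopen_cube u * p (gridcell n u)) \<longlonglongrightarrow> indicator halfopen_cube u * p u"
    by (rule tendsto_mult_left)
  then show ?thesis unfolding cube_kernel_def
  proof (rule Lim_transform_eventually)
    show "\<forall>\<^sub>F n in sequentially. indicator halfopen_cube u * p (gridcell n u) = indicator halfopen_cube (gridcell n u) * p (gridcell n u)"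
      using eventually_ge_at_top[of 1]
      by eventually_elim (simp add: indicator_def gridcell_mem_halfopen_cube_iff)
  qed
qed

lemma cube_kernel_bound:
  fixes p :: "real^'n::finite \<Rightarrow> real"
  assumes "continuous_on UNIV p"
  shows "\<exists>G. integrable lborel G \<and> (\<forall>n u. \<bar>cube_kernel p (gridcell n u)\<bar> \<le> G u)"
proof -
  let ?Q = "cbox (\<chi> i. -2) (\<chi> i. 2) :: (real^'n) set"
  have "compact (p ` ?Q)" using assms by (intro compact_continuous_image continuous_on_subset[OF assms]) auto
  then obtain S where S: "\<And>v. v \<in> ?Q \<Longrightarrow> \<bar>p v\<bar> \<le> S" by (metis (no_types, lifting) bounded_real compact_imp_bounded imageI)
  show ?thesis
  proof (intro exI[of _ "\<lambda>u. S * indicator ?Q u"] conjI allI)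
    show "integrable lborel (\<lambda>u. S * indicator ?Q u)"
      by (rule integrable_mult_right, rule integrable_real_indicator, simp, rule emeasure_lborel_cbox_finite)
    fix n and u :: "real^'n"
    show "\<bar>cube_kernel p (gridcell n u)\<bar> \<le> S * indicator ?Q u"
    proof (cases "gridcell n u \<in> halfopen_cube")
      case True
      have b: "\<bar>gridcell n u $ i\<bar> \<le> 1/2" for i using True by (auto simp: halfopen_cube_def halfopen_def abs_le_iff dest!: spec[of _ i])
      have c: "\<bar>gridcell n u $ i - u $ i\<bar> \<le> 1" for i
        by (rule order_trans[OF gridcell_close]) simp
      have "\<bar>u $ i\<bar> \<le> 2" for i using b[of i] c[of i] by linarith
      then have u: "u \<in> ?Q" by (simp add: mem_box_cart abs_le_iff minus_le_iff)
      have "\<bar>gridcell n u $ i\<bar> \<le> 2" for i using b[of i] by linarith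
      then have "gridcell n u \<in> ?Q" by (simp add: mem_box_cart abs_le_iff minus_le_iff)
      then show ?thesis using S u True by (simp add: cube_kernel_def)
    next
      case False
      have "0 \<le> S" using S[of 0] by (simp add: mem_box_cart)
      then show ?thesis using False by (simp add: cube_kernel_def)
    qed
  qed
qed

lemma grid_sum_cube:
  assumes "1 \<le> n"
  shows "grid_sum n (\<lambda>u x. cube_kernel p u *\<^sub>R g u x) x =
     (\<Sum>z\<in>int_cube (- (2 ^ (n - 1))) (2 ^ n). (1 / 2 ^ n) ^ CARD('n) *\<^sub>R p (gridpoint n z) *\<^sub>R g (gridpoint n (z::int^'n::finite)) x)"
  unfolding grid_sum_def
  using int_cube_subset_gridindex[OF assms] finite_gridindex[of n]
  by (intro sum.mono_neutral_cong_right) 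
     (auto simp: cube_kernel_def gridpoint_mem_halfopen_cube_iff[OF assms] indicator_def)

lemma locally_integrable_measurable:
  fixes f :: "real^'n::finite \<Rightarrow> complex"
  assumes "locally_integrable f"
  shows "f \<in> borel_measurable lebesgue"
proof (rule borel_measurable_LIMSEQ_metric)
  fix k :: nat
  have "f absolutely_integrable_on cball 0 (real k)" using assms by (simp add: locally_integrable_def)
  then show "(\<lambda>x. indicator (cball 0 (real k)) x *\<^sub>R f x) \<in> borel_measurable lebesgue"
    unfolding set_integrable_def by (rule borel_measurable_integrable)
next
  fix x :: "real^'n"
  show "(\<lambda>k. indicator (cball 0 (real k)) x *\<^sub>R f x) \<longlonglongrightarrow> f x"
  proof (rule tendsto_eventually)
    obtain k0 :: nat where "norm x \<le> real k0" using real_arch_simple by blast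
    then show "\<forall>\<^sub>F k in sequentially. indicator (cball 0 (real k)) x *\<^sub>R f x = f x"
      unfolding eventually_sequentially by (intro exI[of _ k0]) (auto simp: indicator_def)
  qed
qed

lemma finite_integer_vectors: "finite {\<kappa>::real^'n::finite. (\<forall>i. \<kappa> $ i \<in> \<int>) \<and> norm \<kappa> < \<sigma>}"
proof (rule finite_subset)
  show "{\<kappa>::real^'n. (\<forall>i. \<kappa> $ i \<in> \<int>) \<and> norm \<kappa> < \<sigma>} \<subseteq> {\<kappa>. \<forall>i. \<kappa> $ i \<in> {k \<in> \<int>. \<bar>k\<bar> \<le> \<sigma>}}"
    by (auto intro!: order_trans[OF component_le_norm_cart])
qed (rule finite_vec_set, rule finite_abs_int_segment)

lemma integer_vector_inner_rvec: "integer_vector \<kappa> \<Longrightarrow> \<kappa> \<bullet> rvec z \<in> \<int>"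
  by (auto simp: inner_vec_def rvec_def integer_vector_def intro!: Ints_sum Ints_mult)

text \<open>Shifting the cube in a coordinate in which \<open>\<kappa> / q\<close> is not an integer multiplies the sum by a
  root of unity other than \<open>1\<close>, but does not change it.\<close>

lemma sum_roots_of_unity_vec:
  fixes \<kappa> :: "real^'n::finite"
  assumes \<kappa>: "integer_vector \<kappa>" and q: "1 \<le> q" and n: "\<not> integer_vector ((1 / real q) *\<^sub>R \<kappa>)"
  shows "(\<Sum>z\<in>int_cube 0 (int q). cis (2 * pi * ((\<kappa> \<bullet> rvec z) / real q))) = 0"
proof -
  obtain i where i: "\<kappa> $ i / real q \<notin> \<int>" using n by (auto simp: integer_vector_def)
  define e where "e = (\<chi> j. if j = i then (1::int) else 0)"
  define H where "H z = cis (2 * pi * ((\<kappa> \<bullet> rvec z) / real q))" for z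
  have inner_e: "\<kappa> \<bullet> rvec e = \<kappa> $ i"
    by (simp add: inner_vec_def rvec_def e_def if_distrib cong: if_cong)
  have per: "H (z + (\<chi> j. int q * w $ j)) = H z" for z w
  proof -
    have "rvec (\<chi> j. int q * w $ j) = real q *\<^sub>R rvec w" by (simp add: rvec_def vec_eq_iff)
    then have "(\<kappa> \<bullet> rvec (z + (\<chi> j. int q * w $ j))) / real q = (\<kappa> \<bullet> rvec z) / real q + \<kappa> \<bullet> rvec w"
      using q by (simp add: rvec_add inner_add_right add_divide_distrib)
    moreover have "\<kappa> \<bullet> rvec w \<in> \<int>" by (rule integer_vector_inner_rvec[OF \<kappa>])
    ultimately show ?thesis unfolding H_def by (simp add: distrib_left cis_multiple_2pi flip: cis_mult)
  qed
  have "(\<Sum>z\<in>int_cube 0 (int q). H (z + e)) = (\<Sum>z\<in>int_cube 0 (int q). H z)"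
    by (rule sum_periodic_shift) (use q per in auto)
  moreover have "H (z + e) = cis (2 * pi * (\<kappa> $ i / real q)) * H z" for z
    by (simp add: H_def rvec_add inner_add_right inner_e cis_mult add_divide_distrib distrib_left add.commute)
  ultimately have "cis (2 * pi * (\<kappa> $ i / real q)) * (\<Sum>z\<in>int_cube 0 (int q). H z) = (\<Sum>z\<in>int_cube 0 (int q). H z)"
    by (simp add: sum_distrib_left)
  moreover have "cis (2 * pi * (\<kappa> $ i / real q)) \<noteq> 1"
  proof
    assume "cis (2 * pi * (\<kappa> $ i / real q)) = 1"
    then have "cos (2 * pi * (\<kappa> $ i / real q)) = 1" by (simp add: complex_eq_iff)
    then obtain k :: int where "2 * pi * (\<kappa> $ i / real q) = of_int k * 2 * pi"
      using cos_one_2pi_int by auto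
    then have "2 * pi * (\<kappa> $ i / real q) = 2 * pi * of_int k" by (simp only: mult_ac)
    then have "\<kappa> $ i / real q = of_int k" by (rule mult_left_cancel[THEN iffD1, rotated]) simp
    then show False using i by simp
  qed
  ultimately show ?thesis by (simp add: H_def)
qed

lemma card_int_cube: "card (int_cube 0 (int q) :: (int^'n::finite) set) \<noteq> 0" if "1 \<le> q"
proof -
  have "0 \<in> (int_cube 0 (int q) :: (int^'n) set)" using that by (simp add: int_cube_def)
  moreover have "finite (int_cube 0 (int q) :: (int^'n) set)" by (rule finite_int_cube)
  ultimately show ?thesis by (auto simp: card_eq_0_iff)
qed

text \<open>Averaging over the translations by the integer vectors in a cube of side \<open>q\<close> removes the
  frequencies that are not integral, and does not change a periodic function.\<close>

lemma periodic_trig_sum_approximant: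
  fixes \<phi> :: "real^'n::finite \<Rightarrow> complex"
  assumes per: "periodic \<phi>" and q: "1 \<le> q" and F: "finite F" "\<And>\<kappa>. \<kappa> \<in> F \<Longrightarrow> integer_vector \<kappa> \<and> norm \<kappa> < \<sigma> * real q"
    and eq: "AE y in lebesgue. \<phi> y = (\<Sum>\<kappa>\<in>F. c \<kappa> * cis ((\<kappa> \<bullet> y) / real q))"
  shows "approximant Torus \<sigma> \<phi>"
proof -
  let ?Q = "int_cube 0 (int q) :: (int^'n) set"
  let ?S = "\<lambda>y. \<Sum>\<kappa>\<in>F. c \<kappa> * cis ((\<kappa> \<bullet> y) / real q)"
  define F0 where "F0 = {\<kappa>\<in>F. integer_vector ((1 / real q) *\<^sub>R \<kappa>)}"
  have ae1: "AE y in lborel. \<phi> y = ?S y" using eq by (simp add: AE_lebesgue_iff)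
  have ae2: "AE y in lborel. \<phi> (y + (2 * pi) *\<^sub>R rvec z) = ?S (y + (2 * pi) *\<^sub>R rvec z)" for z
    using AE_lborel_affine[OF _ ae1, of 1 "(2 * pi) *\<^sub>R rvec z"] by (simp add: add.commute)
  have "AE y in lborel. \<forall>z\<in>?Q. \<phi> (y + (2 * pi) *\<^sub>R rvec z) = ?S (y + (2 * pi) *\<^sub>R rvec z)"
    using ae2 finite_int_cube by (subst AE_ball_countable) (auto simp: countable_finite)
  then have "AE y in lborel. \<phi> y = (\<Sum>\<kappa>\<in>F0. c \<kappa> * cis ((\<kappa> \<bullet> y) / real q))"
  proof eventually_elim
    case (elim y)
    have "of_nat (card ?Q) * \<phi> y = (\<Sum>z\<in>?Q. \<phi> (y + (2 * pi) *\<^sub>R rvec z))"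
      by (simp add: periodic_integer_shift[OF per])
    also have "\<dots> = (\<Sum>z\<in>?Q. ?S (y + (2 * pi) *\<^sub>R rvec z))" using elim by simp
    also have "\<dots> = (\<Sum>\<kappa>\<in>F. \<Sum>z\<in>?Q. c \<kappa> * cis ((\<kappa> \<bullet> (y + (2 * pi) *\<^sub>R rvec z)) / real q))"
      by (rule sum.swap)
    also have "\<dots> = (\<Sum>\<kappa>\<in>F. c \<kappa> * cis ((\<kappa> \<bullet> y) / real q) * (\<Sum>z\<in>?Q. cis (2 * pi * ((\<kappa> \<bullet> rvec z) / real q))))"
      unfolding sum_distrib_left
      by (intro sum.cong refl) (simp add: inner_add_right add_divide_distrib cis_mult)
    also have "\<dots> = (\<Sum>\<kappa>\<in>F. if integer_vector ((1 / real q) *\<^sub>R \<kappa>) then of_nat (card ?Q) * (c \<kappa> * cis ((\<kappa> \<bullet> y) / real q)) else 0)"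
    proof (rule sum.cong[OF refl])
      fix \<kappa> assume k: "\<kappa> \<in> F"
      show "c \<kappa> * cis ((\<kappa> \<bullet> y) / real q) * (\<Sum>z\<in>?Q. cis (2 * pi * ((\<kappa> \<bullet> rvec z) / real q))) =
        (if integer_vector ((1 / real q) *\<^sub>R \<kappa>) then of_nat (card ?Q) * (c \<kappa> * cis ((\<kappa> \<bullet> y) / real q)) else 0)"
      proof (cases "integer_vector ((1 / real q) *\<^sub>R \<kappa>)")
        case True
        have "cis (2 * pi * ((\<kappa> \<bullet> rvec z) / real q)) = 1" for z
        proof (rule cis_multiple_2pi)
          have "(\<kappa> \<bullet> rvec z) / real q = ((1 / real q) *\<^sub>R \<kappa>) \<bullet> rvec z" by simp
          also have "\<dots> \<in> \<int>" by (rule integer_vector_inner_rvec[OF True])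
          finally show "(\<kappa> \<bullet> rvec z) / real q \<in> \<int>" .
        qed
        then show ?thesis using True by simp
      next
        case False
        then show ?thesis using sum_roots_of_unity_vec[OF _ q False] F(2)[OF k] by simp
      qed
    qed
    also have "\<dots> = of_nat (card ?Q) * (\<Sum>\<kappa>\<in>F0. c \<kappa> * cis ((\<kappa> \<bullet> y) / real q))"
      unfolding F0_def sum_distrib_left using F(1) by (simp add: sum.inter_filter)
    finally show ?case using card_int_cube[OF q, where 'n='n] by simp
  qed
  then have "AE y in lebesgue. \<phi> y = (\<Sum>n\<in>{n. (\<forall>i. n $ i \<in> \<int>) \<and> norm n < \<sigma>}. (if real q *\<^sub>R n \<in> F0 then c (real q *\<^sub>R n) else 0) * cis (n \<bullet> y))"
    unfolding AE_lebesgue_iff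
  proof eventually_elim
    case (elim y)
    have q0: "real q \<noteq> 0" using q by simp
    have "(\<Sum>\<kappa>\<in>F0. c \<kappa> * cis ((\<kappa> \<bullet> y) / real q)) = (\<Sum>n\<in>{n. (\<forall>i. n $ i \<in> \<int>) \<and> norm n < \<sigma> \<and> real q *\<^sub>R n \<in> F0}. c (real q *\<^sub>R n) * cis (n \<bullet> y))"
    proof (rule sum.reindex_bij_witness[of _ "\<lambda>n. real q *\<^sub>R n" "\<lambda>\<kappa>. (1 / real q) *\<^sub>R \<kappa>"])
      fix \<kappa> assume k: "\<kappa> \<in> F0"
      then have "norm \<kappa> < \<sigma> * real q" "integer_vector ((1 / real q) *\<^sub>R \<kappa>)" using F(2) by (auto simp: F0_def)
      then show "(1 / real q) *\<^sub>R \<kappa> \<in> {n. (\<forall>i. n $ i \<in> \<int>) \<and> norm n < \<sigma> \<and> real q *\<^sub>R n \<in> F0}"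
        using k q by (auto simp: integer_vector_def field_simps)
    qed (use q0 in auto)
    also have "\<dots> = (\<Sum>n\<in>{n. (\<forall>i. n $ i \<in> \<int>) \<and> norm n < \<sigma>}. (if real q *\<^sub>R n \<in> F0 then c (real q *\<^sub>R n) else 0) * cis (n \<bullet> y))"
      by (rule sum.mono_neutral_cong_left) (auto intro: finite_integer_vectors)
    finally show ?case using elim by simp
  qed
  then show ?thesis by auto
qed

lemma approximant_Torus_sum:
  assumes "\<And>l. l \<in> I \<Longrightarrow> approximant Torus \<sigma> (\<Phi> l)" "finite I"
  shows "approximant Torus \<sigma> (\<lambda>x. \<Sum>l\<in>I. a l *\<^sub>R \<Phi> l x)"
proof -
  have "\<exists>c. \<forall>l\<in>I. AE x in lebesgue. \<Phi> l x = (\<Sum>n\<in>{n. (\<forall>i. n $ i \<in> \<int>) \<and> norm n < \<sigma>}. c l n * cis (n \<bullet> x))"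
    using assms(1) by (intro bchoice) auto
  then obtain c where "\<And>l. l \<in> I \<Longrightarrow> AE x in lebesgue. \<Phi> l x = (\<Sum>n\<in>{n. (\<forall>i. n $ i \<in> \<int>) \<and> norm n < \<sigma>}. c l n * cis (n \<bullet> x))"
    by blast
  then have "AE x in lebesgue. \<forall>l\<in>I. \<Phi> l x = (\<Sum>n\<in>{n. (\<forall>i. n $ i \<in> \<int>) \<and> norm n < \<sigma>}. c l n * cis (n \<bullet> x))"
    using assms(2) by (subst AE_ball_countable) (auto simp: countable_finite)
  then have "AE x in lebesgue. (\<Sum>l\<in>I. a l *\<^sub>R \<Phi> l x) = (\<Sum>n\<in>{n. (\<forall>i. n $ i \<in> \<int>) \<and> norm n < \<sigma>}. (\<Sum>l\<in>I. a l *\<^sub>R c l n) * cis (n \<bullet> x))"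
  proof eventually_elim
    case (elim x)
    then have "(\<Sum>l\<in>I. a l *\<^sub>R \<Phi> l x) = (\<Sum>l\<in>I. \<Sum>n\<in>{n. (\<forall>i. n $ i \<in> \<int>) \<and> norm n < \<sigma>}. a l *\<^sub>R c l n * cis (n \<bullet> x))"
      by (simp add: scaleR_sum_right)
    also have "\<dots> = (\<Sum>n\<in>{n. (\<forall>i. n $ i \<in> \<int>) \<and> norm n < \<sigma>}. \<Sum>l\<in>I. a l *\<^sub>R c l n * cis (n \<bullet> x))"
      by (rule sum.swap)
    finally show ?case by (simp add: sum_distrib_right)
  qed
  then show ?thesis by auto
qed

context translation_space
begin

lemma cube_mean_exists:
  assumes p: "continuous_on UNIV p" and f: "f \<in> B"
  shows "\<exists>\<phi>\<in>B. (\<lambda>n. N (\<lambda>x. grid_sum n (\<lambda>u x. cube_kernel p u *\<^sub>R f (x + b *\<^sub>R u)) x - \<phi> x)) \<longlonglongrightarrow> 0"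
proof -
  obtain G where "integrable lborel G" "\<And>n u. \<bar>cube_kernel p (gridcell n u)\<bar> \<le> G u"
    using cube_kernel_bound[OF p] by blast
  then show ?thesis by (intro kernel_mean_exists cube_kernel_tendsto p f)
qed

text \<open>The mean is over \<open>q\<close> periods of \<open>f\<close> in each variable. A translation of the Riemann sum by a grid
  vector can be moved to the kernel, exactly and not only in the limit, since the integrand is
  periodic on the grid. As \<open>p(v - \<zeta>)\<close> is a finite sum of products
  \<open>Q i \<zeta> P i v\<close>, the translates of the limit are combinations of the means with the kernels \<open>P i\<close>.
  By \<open>translates_determine_function\<close> the limit is then a trigonometric sum with frequencies
  \<open>\<kappa> / q\<close>, among which periodicity leaves only the integral ones.\<close>

lemma cube_mean_trigonometric:
  fixes F :: "(real^'n) set" and c :: "real^'n \<Rightarrow> complex" and q :: nat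
  defines "p \<equiv> \<lambda>v. Re (\<Sum>\<kappa>\<in>F. c \<kappa> * cis (2 * pi * (\<kappa> \<bullet> v)))"
  assumes per: "\<And>f. f \<in> B \<Longrightarrow> locally_integrable f \<and> periodic f"
    and F: "finite F" "\<And>\<kappa>. \<kappa> \<in> F \<Longrightarrow> integer_vector \<kappa> \<and> norm \<kappa> < \<sigma> * real q"
    and q: "1 \<le> q" and f: "f \<in> B" and \<phi>: "\<phi> \<in> B"
    and lim: "(\<lambda>n. N (\<lambda>x. grid_sum n (\<lambda>u x. cube_kernel p u *\<^sub>R f (x + (2 * pi * real q) *\<^sub>R u)) x - \<phi> x)) \<longlonglongrightarrow> 0"
  shows "approximant Torus \<sigma> \<phi>"
proof -
  let ?b = "2 * pi * real q"
  (* Real and imaginary parts are separated because only real scalars act on B; the boolean selects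
     the cosine or the sine in Re (w cis (-t)) = cos t Re w + sin t Im w. *)
  define P where "P i v = (if snd i then Re (c (fst i) * cis (2 * pi * (fst i \<bullet> v))) else Im (c (fst i) * cis (2 * pi * (fst i \<bullet> v))))"
    for i :: "(real^'n) \<times> bool" and v
  define Q where "Q i \<zeta> = (if snd i then cos (2 * pi * (fst i \<bullet> \<zeta>)) else sin (2 * pi * (fst i \<bullet> \<zeta>)))"
    for i :: "(real^'n) \<times> bool" and \<zeta>
  let ?I = "F \<times> (UNIV :: bool set)"
  have Pcont: "continuous_on UNIV (P i)" for i
    unfolding P_def[abs_def] cis_conv_exp by (cases "snd i") (auto intro!: continuous_intros)
  have Qcont: "continuous_on UNIV (Q i)" for i
    unfolding Q_def[abs_def] by (cases "snd i") (auto intro!: continuous_intros)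
  have pdiff: "p (v - \<zeta>) = (\<Sum>i\<in>?I. Q i \<zeta> * P i v)" for v \<zeta>
  proof -
    have "p (v - \<zeta>) = (\<Sum>\<kappa>\<in>F. Re (c \<kappa> * cis (2 * pi * (\<kappa> \<bullet> v)) * cis (- (2 * pi * (\<kappa> \<bullet> \<zeta>)))))"
      unfolding p_def Re_sum by (intro sum.cong refl) (simp add: mult.assoc cis_mult inner_diff_right right_diff_distrib del: times_complex.sel)
    also have "\<dots> = (\<Sum>\<kappa>\<in>F. \<Sum>t\<in>UNIV. Q (\<kappa>, t) \<zeta> * P (\<kappa>, t) v)"
    proof (intro sum.cong refl)
      fix \<kappa>
      have "Re (w * cis (- t)) = cos t * Re w + sin t * Im w" for w t by simp
      then show "Re (c \<kappa> * cis (2 * pi * (\<kappa> \<bullet> v)) * cis (- (2 * pi * (\<kappa> \<bullet> \<zeta>)))) = (\<Sum>t\<in>UNIV. Q (\<kappa>, t) \<zeta> * P (\<kappa>, t) v)"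
        unfolding UNIV_bool by (simp add: Q_def P_def del: times_complex.sel)
    qed
    finally show ?thesis by (simp add: sum.cartesian_product)
  qed
  have pper: "p (v + rvec w) = p v" for v w
    unfolding p_def using F(2) by (intro arg_cong[where f=Re] sum.cong refl) (simp add: cis_integer_shift)
  have fper: "f (x + ?b *\<^sub>R (v + rvec w)) = f (x + ?b *\<^sub>R v)" for x v w
  proof -
    have "x + ?b *\<^sub>R (v + rvec w) = (x + ?b *\<^sub>R v) + (2 * pi) *\<^sub>R rvec (\<chi> i. int q * w $ i)"
      by (simp add: vec_eq_iff rvec_def algebra_simps)
    then show ?thesis using periodic_integer_shift per[OF f] by metis
  qed
  define L where "L i \<phi> \<longleftrightarrow> \<phi> \<in> B \<and>
     (\<lambda>n. N (\<lambda>x. grid_sum n (\<lambda>u x. cube_kernel (P i) u *\<^sub>R f (x + ?b *\<^sub>R u)) x - \<phi> x)) \<longlonglongrightarrow> 0" for i \<phi>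
  have "\<exists>\<phi>. L i \<phi>" for i
    using cube_mean_exists[OF Pcont[of i] f, of ?b] unfolding L_def by (simp only: Bex_def)
  then obtain A where LA: "\<And>i. L i (A i)" using choice[of L] by blast
  have A: "A i \<in> B"
    "(\<lambda>n. N (\<lambda>x. grid_sum n (\<lambda>u x. cube_kernel (P i) u *\<^sub>R f (x + ?b *\<^sub>R u)) x - A i x)) \<longlonglongrightarrow> 0" for i
    using LA[of i] by (simp_all only: L_def)
  let ?S = "\<lambda>n p. grid_sum n (\<lambda>u x. cube_kernel p u *\<^sub>R f (x + ?b *\<^sub>R u))"
  have SB: "?S n p \<in> B" for n p by (intro grid_sum_mem scale_mem shift_mem f)
  have shifted: "?S n p (x + ?b *\<^sub>R gridcell n \<zeta>) = (\<Sum>i\<in>?I. Q i (gridcell n \<zeta>) *\<^sub>R ?S n (P i) x)"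
    if n: "1 \<le> n" for n x \<zeta>
  proof -
    let ?C = "int_cube (- (2 ^ (n - 1))) (2 ^ n) :: (int^'n) set"
    let ?w = "(1 / 2 ^ n) ^ CARD('n) :: real"
    define y where "y = (\<chi> i. \<lfloor>2 ^ n * \<zeta> $ i\<rfloor>)"
    have y: "gridcell n \<zeta> = gridpoint n y" by (simp add: y_def gridcell_eq_gridpoint)
    define H where "H z = ?w *\<^sub>R p (gridpoint n z - gridpoint n y) *\<^sub>R f (x + ?b *\<^sub>R gridpoint n z)" for z
    have gadd: "gridpoint n (z + z') = gridpoint n z + gridpoint n z'" for z z' :: "int^'n"
      by (simp add: gridpoint_rvec rvec_add scaleR_right_distrib)
    have Hper: "H (z + (\<chi> i. 2 ^ n * w $ i)) = H z" for z w
    proof -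
      have "gridpoint n (z + (\<chi> i. 2 ^ n * w $ i)) = gridpoint n z + rvec w"
        by (simp add: gridpoint_def rvec_def vec_eq_iff add_divide_distrib)
      moreover have "p (gridpoint n z + rvec w - gridpoint n y) = p (gridpoint n z - gridpoint n y)"
        using pper[of "gridpoint n z - gridpoint n y" w] by (simp add: algebra_simps)
      ultimately show ?thesis unfolding H_def by (simp only: fper)
    qed
    have "?S n p (x + ?b *\<^sub>R gridcell n \<zeta>) = (\<Sum>z\<in>?C. H (z + y))"
      unfolding grid_sum_cube[OF n] H_def gadd y
      by (intro sum.cong refl) (simp add: algebra_simps)
    also have "\<dots> = (\<Sum>z\<in>?C. H z)" by (rule sum_periodic_shift) (use Hper in auto)
    also have "\<dots> = (\<Sum>z\<in>?C. \<Sum>i\<in>?I. Q i (gridpoint n y) *\<^sub>R ?w *\<^sub>R P i (gridpoint n z) *\<^sub>R f (x + ?b *\<^sub>R gridpoint n z))"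
      unfolding H_def pdiff scaleR_sum_left scaleR_sum_right
      by (intro sum.cong refl) (simp add: mult_ac)
    also have "\<dots> = (\<Sum>i\<in>?I. \<Sum>z\<in>?C. Q i (gridpoint n y) *\<^sub>R ?w *\<^sub>R P i (gridpoint n z) *\<^sub>R f (x + ?b *\<^sub>R gridpoint n z))"
      by (rule sum.swap)
    also have "\<dots> = (\<Sum>i\<in>?I. Q i (gridcell n \<zeta>) *\<^sub>R ?S n (P i) x)"
      unfolding grid_sum_cube[OF n] y scaleR_sum_right ..
    finally show ?thesis .
  qed
  have trans: "AE x in lebesgue. \<phi> (x + ?b *\<^sub>R \<zeta>) = (\<Sum>i\<in>?I. Q i \<zeta> *\<^sub>R A i x)" for \<zeta>
  proof -
    define X where "X n = (\<lambda>x. ?S n p (x + ?b *\<^sub>R gridcell n \<zeta>))" for n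
    have XB: "X n \<in> B" for n unfolding X_def by (rule shift_mem[OF SB])
    have A\<zeta>: "(\<lambda>x. \<Sum>i\<in>?I. Q i \<zeta> *\<^sub>R A i x) \<in> B" by (intro sum_mem scale_mem A)
    have "(\<lambda>n. N (\<lambda>x. X n x - \<phi> (x + ?b *\<^sub>R \<zeta>))) \<longlonglongrightarrow> 0"
    proof (rule Lim_null_comparison)
      show "(\<lambda>n. N (\<lambda>x. ?S n p x - \<phi> x) + N (\<lambda>x. \<phi> (x + ?b *\<^sub>R gridcell n \<zeta>) - \<phi> (x + ?b *\<^sub>R \<zeta>))) \<longlonglongrightarrow> 0"
        using tendsto_add[OF lim N_shift_tendsto[OF \<phi>, of "\<lambda>n. ?b *\<^sub>R gridcell n \<zeta>" "?b *\<^sub>R \<zeta>" sequentially]]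
        by (simp add: tendsto_scaleR tendsto_gridcell)
      have "N (\<lambda>x. X n x - \<phi> (x + ?b *\<^sub>R \<zeta>)) \<le> N (\<lambda>x. ?S n p x - \<phi> x) + N (\<lambda>x. \<phi> (x + ?b *\<^sub>R gridcell n \<zeta>) - \<phi> (x + ?b *\<^sub>R \<zeta>))" for n
      proof -
        have "N (\<lambda>x. X n x - \<phi> (x + ?b *\<^sub>R gridcell n \<zeta>)) = N (\<lambda>x. ?S n p x - \<phi> x)"
          unfolding X_def by (rule N_shift[OF diff_mem[OF SB \<phi>]])
        then show ?thesis
          using N_triangle[OF XB shift_mem[OF \<phi>, of "?b *\<^sub>R gridcell n \<zeta>"] shift_mem[OF \<phi>, of "?b *\<^sub>R \<zeta>"], of n] by simp
      qed
      then show "\<forall>\<^sub>F n in sequentially. norm (N (\<lambda>x. X n x - \<phi> (x + ?b *\<^sub>R \<zeta>))) \<le> N (\<lambda>x. ?S n p x - \<phi> x) + N (\<lambda>x. \<phi> (x + ?b *\<^sub>R gridcell n \<zeta>) - \<phi> (x + ?b *\<^sub>R \<zeta>))"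
        using N_nonneg[OF diff_mem[OF XB shift_mem[OF \<phi>]]] by (intro always_eventually) simp
    qed
    moreover have "(\<lambda>n. N (\<lambda>x. X n x - (\<Sum>i\<in>?I. Q i \<zeta> *\<^sub>R A i x))) \<longlonglongrightarrow> 0"
    proof (rule Lim_transform_eventually)
      show "(\<lambda>n. N (\<lambda>x. (\<Sum>i\<in>?I. Q i (gridcell n \<zeta>) *\<^sub>R ?S n (P i) x) - (\<Sum>i\<in>?I. Q i \<zeta> *\<^sub>R A i x))) \<longlonglongrightarrow> 0"
      proof (intro tendsto_N_sum tendsto_N_scale scale_mem SB A)
        fix i assume "i \<in> ?I"
        have "isCont (Q i) \<zeta>" using Qcont[of i] by (simp add: continuous_on_eq_continuous_at)
        then show "(\<lambda>n. Q i (gridcell n \<zeta>)) \<longlonglongrightarrow> Q i \<zeta>"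
          using tendsto_gridcell by (rule isCont_tendsto_compose)
      qed
      show "\<forall>\<^sub>F n in sequentially. N (\<lambda>x. (\<Sum>i\<in>?I. Q i (gridcell n \<zeta>) *\<^sub>R ?S n (P i) x) - (\<Sum>i\<in>?I. Q i \<zeta> *\<^sub>R A i x)) = N (\<lambda>x. X n x - (\<Sum>i\<in>?I. Q i \<zeta> *\<^sub>R A i x))"
        using eventually_ge_at_top[of 1] unfolding X_def by eventually_elim (simp only: shifted)
    qed
    ultimately show ?thesis
      by (intro N_limit_unique[OF XB shift_mem[OF \<phi>] A\<zeta>]) auto
  qed
  have "\<exists>x0 \<alpha>. AE y in lebesgue. \<phi> y = (\<Sum>i\<in>?I. Q i ((1 / ?b) *\<^sub>R (y - x0)) *\<^sub>R \<alpha> i)"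
  proof (rule translates_determine_function[OF _ _ _ _ _ trans])
    show "Q i \<in> borel_measurable borel" for i
      by (rule borel_measurable_continuous_onI[OF Qcont])
  qed (use F q per[OF \<phi>] per[OF A(1)] locally_integrable_measurable in auto)
  then obtain x0 \<alpha> where ae: "AE y in lebesgue. \<phi> y = (\<Sum>i\<in>?I. Q i ((1 / ?b) *\<^sub>R (y - x0)) *\<^sub>R \<alpha> i)" by blast
  define c1 where "c1 \<kappa> = cis (- (\<kappa> \<bullet> x0) / real q) * ((\<alpha> (\<kappa>, True) - \<i> * \<alpha> (\<kappa>, False)) / 2)" for \<kappa>
  define c2 where "c2 \<kappa> = cis ((\<kappa> \<bullet> x0) / real q) * ((\<alpha> (\<kappa>, True) + \<i> * \<alpha> (\<kappa>, False)) / 2)" for \<kappa>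
  have term_eq: "(\<Sum>t\<in>UNIV. Q (\<kappa>, t) ((1 / ?b) *\<^sub>R (y - x0)) *\<^sub>R \<alpha> (\<kappa>, t)) = c1 \<kappa> * cis ((\<kappa> \<bullet> y) / real q) + c2 \<kappa> * cis ((- \<kappa> \<bullet> y) / real q)" for \<kappa> y
  proof -
    define \<theta> where "\<theta> = (\<kappa> \<bullet> (y - x0)) / real q"
    have "2 * pi * (\<kappa> \<bullet> ((1 / ?b) *\<^sub>R (y - x0))) = \<theta>" using q by (simp add: \<theta>_def)
    then have "(\<Sum>t\<in>UNIV. Q (\<kappa>, t) ((1 / ?b) *\<^sub>R (y - x0)) *\<^sub>R \<alpha> (\<kappa>, t)) = cos \<theta> *\<^sub>R \<alpha> (\<kappa>, True) + sin \<theta> *\<^sub>R \<alpha> (\<kappa>, False)"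
      unfolding UNIV_bool by (simp add: Q_def)
    also have "\<dots> = cis \<theta> * ((\<alpha> (\<kappa>, True) - \<i> * \<alpha> (\<kappa>, False)) / 2) + cis (- \<theta>) * ((\<alpha> (\<kappa>, True) + \<i> * \<alpha> (\<kappa>, False)) / 2)"
      by (simp add: complex_eq_iff) (simp add: field_simps)
    also have "cis \<theta> = cis (- (\<kappa> \<bullet> x0) / real q) * cis ((\<kappa> \<bullet> y) / real q)"
      by (simp add: \<theta>_def cis_mult inner_diff_right diff_divide_distrib)
    also have "cis (- \<theta>) = cis ((\<kappa> \<bullet> x0) / real q) * cis ((- \<kappa> \<bullet> y) / real q)"
      by (simp add: \<theta>_def cis_mult inner_diff_right diff_divide_distrib)
    finally show ?thesis by (simp add: c1_def c2_def mult_ac)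
  qed
  define c3 where "c3 \<kappa> = (if \<kappa> \<in> F then c1 \<kappa> else 0) + (if - \<kappa> \<in> F then c2 (- \<kappa>) else 0)" for \<kappa>
  let ?F = "F \<union> uminus ` F"
  have neg: "\<kappa> \<in> uminus ` F \<longleftrightarrow> - \<kappa> \<in> F" for \<kappa>
    by (auto intro: image_eqI[of \<kappa> uminus "- \<kappa>"])
  have sum_eq: "(\<Sum>i\<in>?I. Q i ((1 / ?b) *\<^sub>R (y - x0)) *\<^sub>R \<alpha> i) = (\<Sum>\<kappa>\<in>?F. c3 \<kappa> * cis ((\<kappa> \<bullet> y) / real q))" for y
  proof -
    have "(\<Sum>i\<in>?I. Q i ((1 / ?b) *\<^sub>R (y - x0)) *\<^sub>R \<alpha> i) = (\<Sum>\<kappa>\<in>F. c1 \<kappa> * cis ((\<kappa> \<bullet> y) / real q) + c2 \<kappa> * cis ((- \<kappa> \<bullet> y) / real q))"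
    proof -
      have "(\<Sum>i\<in>?I. Q i ((1 / ?b) *\<^sub>R (y - x0)) *\<^sub>R \<alpha> i) = (\<Sum>\<kappa>\<in>F. \<Sum>t\<in>UNIV. Q (\<kappa>, t) ((1 / ?b) *\<^sub>R (y - x0)) *\<^sub>R \<alpha> (\<kappa>, t))"
        by (simp add: sum.cartesian_product)
      then show ?thesis by (simp only: term_eq)
    qed
    also have "\<dots> = (\<Sum>\<kappa>\<in>F. c1 \<kappa> * cis ((\<kappa> \<bullet> y) / real q)) + (\<Sum>\<kappa>\<in>uminus ` F. c2 (- \<kappa>) * cis ((\<kappa> \<bullet> y) / real q))"
      by (simp add: sum.distrib sum.reindex)
    also have "(\<Sum>\<kappa>\<in>F. c1 \<kappa> * cis ((\<kappa> \<bullet> y) / real q)) = (\<Sum>\<kappa>\<in>?F. (if \<kappa> \<in> F then c1 \<kappa> else 0) * cis ((\<kappa> \<bullet> y) / real q))"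
      by (rule sum.mono_neutral_cong_left) (use F in auto)
    also have "(\<Sum>\<kappa>\<in>uminus ` F. c2 (- \<kappa>) * cis ((\<kappa> \<bullet> y) / real q)) = (\<Sum>\<kappa>\<in>?F. (if - \<kappa> \<in> F then c2 (- \<kappa>) else 0) * cis ((\<kappa> \<bullet> y) / real q))"
      by (rule sum.mono_neutral_cong_left) (use F in \<open>auto simp: neg\<close>)
    finally show ?thesis by (simp add: c3_def distrib_right sum.distrib)
  qed
  show ?thesis
  proof (rule periodic_trig_sum_approximant[of _ q ?F _ c3])
    show "AE y in lebesgue. \<phi> y = (\<Sum>\<kappa>\<in>?F. c3 \<kappa> * cis ((\<kappa> \<bullet> y) / real q))"
      using ae by (simp only: sum_eq)
    show "integer_vector \<kappa> \<and> norm \<kappa> < \<sigma> * real q" if "\<kappa> \<in> ?F" for \<kappa>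
      using that F(2) by (auto simp: integer_vector_def)
  qed (use per[OF \<phi>] q F in auto)
qed

end

section \<open>The averaged Jackson inequality on the torus\<close>

context translation_space
begin

lemma best_approx_le:
  assumes "f \<in> B" "\<phi> \<in> B" "approximant D \<sigma> \<phi>"
  shows "best_approx D B N \<sigma> f \<le> N (\<lambda>x. f x - \<phi> x)"
  unfolding best_approx_def
proof (rule cINF_lower)
  show "bdd_below ((\<lambda>\<phi>. N (\<lambda>x. f x - \<phi> x)) ` {\<phi> \<in> B. approximant D \<sigma> \<phi>})"
    by (rule bdd_belowI2[of _ 0]) (auto intro: N_nonneg diff_mem assms)
qed (use assms in auto)

lemma best_approx_nonneg:
  assumes "f \<in> B" "\<phi> \<in> B" "approximant D \<sigma> \<phi>"
  shows "0 \<le> best_approx D B N \<sigma> f"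
  unfolding best_approx_def
  by (rule cINF_greatest) (use assms in \<open>auto intro: N_nonneg diff_mem\<close>)

lemma integrable_weight_N_fdiff:
  assumes f: "f \<in> B" and p: "2 \<le> p"
  shows "integrable lborel (\<lambda>u. 1 / weight u ^ p * N ((fdiff (a *\<^sub>R u) ^^ R) f))"
proof (rule Bochner_Integration.integrable_bound)
  show "integrable lborel (\<lambda>u::real^'n. 1 / weight u ^ p * (2 ^ R * N f))"
    by (rule integrable_mult_left[OF integrable_inverse_weight[OF p]])
  show "(\<lambda>u. 1 / weight u ^ p * N ((fdiff (a *\<^sub>R u) ^^ R) f)) \<in> borel_measurable lborel"
    using measurable_N_fdiff[OF f] by measurable
  show "AE u in lborel. norm (1 / weight u ^ p * N ((fdiff (a *\<^sub>R u) ^^ R) f)) \<le> norm (1 / weight u ^ p * (2 ^ R * N f))"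
    using N_fdiff_power_le[OF f] N_nonneg[OF fdiff_power_mem[OF f]] N_nonneg[OF f]
    by (intro AE_I2) (simp add: abs_mult weight_nonneg divide_right_mono)
qed

text \<open>The kernel has to live at scale \<open>a\<close> and have frequencies below \<open>1 / a\<close>. For large \<open>a\<close> a kernel on
  a single period cannot spread over the distance \<open>a\<close>; therefore the mean is taken over \<open>l0 \<ge> a\<close>
  periods in each variable. In the rescaled variable, in which these form the unit cube, frequencies
  up to \<open>l0 / a\<close> are allowed and the scale of the kernel is \<open>c = a / (2 \<pi> l0)\<close>.\<close>

lemma torus_jackson:
  assumes per: "\<And>f. f \<in> B \<Longrightarrow> locally_integrable f \<and> periodic f"
  shows "\<exists>A p. p0 \<le> real p \<and> (\<forall>a>0. \<forall>f\<in>B. \<exists>\<phi>\<in>B. approximant Torus (1 / a) \<phi> \<and>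
     N (\<lambda>x. f x - \<phi> x) \<le> A * (LINT u|lborel. 1 / weight u ^ p * N ((fdiff (a *\<^sub>R u) ^^ R) f)))"
proof -
  obtain M0 :: nat where M0: "p0 \<le> real M0" using real_arch_simple by blast
  define M where "M = Suc M0"
  define d where "d = CARD('n)"
  have d: "1 \<le> d" unfolding d_def using zero_less_card_finite[where 'a='n] by linarith
  have dM: "1 \<le> real d * real M" using d mult_mono[of 1 "real d" 1 "real M"] by (simp add: M_def)
  define \<gamma> where "\<gamma> = 1 / (4 * pi * (real d * real M))"
  have \<gamma>: "0 < \<gamma>" "\<gamma> \<le> 1"
  proof -
    show "0 < \<gamma>" using dM by (simp add: \<gamma>_def)
    have "1 * 1 \<le> (4 * pi) * (real d * real M)" using dM pi_ge_two by (intro mult_mono) auto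
    moreover have "1 / x \<le> 1" if "1 * 1 \<le> x" for x :: real using that by simp
    ultimately show "\<gamma> \<le> 1" unfolding \<gamma>_def by blast
  qed
  define A where "A = (4 * (4 / \<gamma>) ^ (2 * M)) ^ CARD('n)"
  have "\<exists>\<phi>\<in>B. approximant Torus (1 / a) \<phi> \<and>
     N (\<lambda>x. f x - \<phi> x) \<le> A * (LINT u|lborel. 1 / weight u ^ (2 * M) * N ((fdiff (a *\<^sub>R u) ^^ R) f))"
    if a: "0 < a" and f: "f \<in> B" for a f
  proof -
    define l0 where "l0 = nat \<lceil>a\<rceil>"
    have l0: "a \<le> real l0" "1 \<le> l0" using a unfolding l0_def by linarith+
    (* The largest order for which the degree 2 d M (n - 1) of the kernel stays below l0 / a; then
       c n lies between the fixed number gamma and 1, whatever a is. *)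
    define n where "n = nat \<lceil>real l0 / (2 * (real d * real M) * a)\<rceil>"
    have pos: "0 < real l0 / (2 * (real d * real M) * a)" using l0 a d by (intro divide_pos_pos mult_pos_pos) (auto simp: M_def)
    have n: "1 \<le> n" "real l0 / (2 * (real d * real M) * a) \<le> real n" "real n < real l0 / (2 * (real d * real M) * a) + 1"
      unfolding n_def using pos by linarith+
    define c where "c = a / (2 * pi * real l0)"
    have c0: "0 < c" using a l0 by (simp add: c_def)
    have cl: "c * (real l0 / (2 * (real d * real M) * a)) = \<gamma>"
      using a l0 dM by (simp add: c_def \<gamma>_def field_simps)
    have c1: "\<gamma> \<le> c * real n" using n(2) c0 cl by (metis mult_left_mono less_imp_le)
    have c2: "c * real n \<le> 1"
    proof -
      have "c * real n \<le> c * (real l0 / (2 * (real d * real M) * a) + 1)" using n(3) c0 by (intro mult_left_mono) auto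
      also have "\<dots> = \<gamma> + c" by (simp only: distrib_left cl mult_1_right)
      also have "\<gamma> \<le> 1 / 4" 
      proof -
        have "4 * 1 * 1 \<le> 4 * pi * (real d * real M)" using dM pi_ge_two by (intro mult_mono) auto
        then show ?thesis unfolding \<gamma>_def by (intro divide_left_mono) auto
      qed
      also have "c \<le> 1 / 2"
      proof -
        have "2 * a \<le> 2 * pi * real l0" using l0 a pi_ge_two by (intro mult_mono) auto
        then show ?thesis using l0 by (simp add: c_def field_simps)
      qed
      finally show ?thesis by simp
    qed
    define p where "p = (jackson M n :: real^'n \<Rightarrow> real)"
    obtain F cF where F: "finite F" "\<forall>\<kappa>\<in>F. integer_vector \<kappa> \<and> norm \<kappa> \<le> 2 * real CARD('n) * real M * real (n - 1)"
      and cF: "(\<lambda>v::real^'n. complex_of_real (jackson M n v)) = (\<lambda>v. \<Sum>\<kappa>\<in>F. cF \<kappa> * cis (2 * pi * (\<kappa> \<bullet> v)))"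
      using jackson_trigpoly[where 'n='n, of M n] unfolding trigpoly_def by blast
    have p_eq: "p = (\<lambda>v. Re (\<Sum>\<kappa>\<in>F. cF \<kappa> * cis (2 * pi * (\<kappa> \<bullet> v))))"
      using fun_cong[OF cF] unfolding p_def by (metis Re_complex_of_real)
    have pcont: "continuous_on UNIV p"
      unfolding p_eq cis_conv_exp by (intro continuous_intros)
    have freq: "2 * real CARD('n) * real M * real (n - 1) < real l0 / a"
    proof -
      have dd: "0 < 2 * (real d * real M)" using dM by simp
      have "real (n - 1) < real l0 / (2 * (real d * real M) * a)" using n by simp
      then have "2 * (real d * real M) * real (n - 1) < 2 * (real d * real M) * (real l0 / (2 * (real d * real M) * a))"
        using dd by (rule mult_strict_left_mono)
      also have "\<dots> = real l0 / a"
      proof -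
        have "X * (x / (X * a)) = x / a" if "0 < X" for X x :: real using that by simp
        then show ?thesis using dd by blast
      qed
      finally show ?thesis by (simp add: d_def mult.assoc)
    qed
    let ?K = "cube_kernel p"
    let ?b = "2 * pi * real l0"
    have "\<forall>l. \<exists>\<phi>. \<phi> \<in> B \<and> (\<lambda>n. N (\<lambda>x. grid_sum n (\<lambda>u x. ?K u *\<^sub>R f (x + (2 * pi * real (l * l0)) *\<^sub>R u)) x - \<phi> x)) \<longlonglongrightarrow> 0"
      using cube_mean_exists[OF pcont f] by (simp only: Bex_def) blast
    from choice[OF this] obtain \<Phi> where \<Phi>: "\<And>l. \<Phi> l \<in> B"
      "\<And>l. (\<lambda>n. N (\<lambda>x. grid_sum n (\<lambda>u x. ?K u *\<^sub>R f (x + (2 * pi * real (l * l0)) *\<^sub>R u)) x - \<Phi> l x)) \<longlonglongrightarrow> 0" by blast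
    have approx: "approximant Torus (1 / a) (\<Phi> l)" if l: "l \<in> {1..R}" for l
    proof (rule cube_mean_trigonometric[OF per F(1) _ _ f \<Phi>(1), of _ "l * l0" cF])
      show "1 \<le> l * l0" using l l0 by (simp add: Suc_le_eq)
      show "(\<lambda>n. N (\<lambda>x. grid_sum n (\<lambda>u x. cube_kernel (\<lambda>v. Re (\<Sum>\<kappa>\<in>F. cF \<kappa> * cis (2 * pi * (\<kappa> \<bullet> v)))) u *\<^sub>R
          f (x + (2 * pi * real (l * l0)) *\<^sub>R u)) x - \<Phi> l x)) \<longlonglongrightarrow> 0"
        using \<Phi>(2)[of l] unfolding p_eq .
      fix \<kappa> assume k: "\<kappa> \<in> F"
      have "norm \<kappa> < real l0 / a" using F(2) k freq by (meson le_less_trans)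
      also have "\<dots> \<le> real (l * l0) / a"
      proof -
        have "l0 \<le> l * l0" using l by simp
        then have "real l0 \<le> real (l * l0)" by (rule of_nat_mono)
        then show ?thesis using a by (intro divide_right_mono) auto
      qed
      finally show "integer_vector \<kappa> \<and> norm \<kappa> < 1 / a * real (l * l0)" using F(2) k by simp
    qed
    let ?\<phi> = "\<lambda>x. \<Sum>l\<in>{1..R}. mean_coeff R l *\<^sub>R \<Phi> l x"
    obtain G where G: "integrable lborel G" "\<And>n u. \<bar>?K (gridcell n u)\<bar> \<le> G u"
      using cube_kernel_bound[OF pcont] by blast
    have err: "N (\<lambda>x. f x - ?\<phi> x) \<le> (LINT u|lborel. \<bar>?K u\<bar> * N ((fdiff (?b *\<^sub>R u) ^^ R) f))"
    proof (rule kernel_mean_error[OF cube_kernel_tendsto[OF pcont] G(2) G(1) f _ \<Phi>(1)])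
      show "(LINT u|lborel. ?K u) = 1"
        unfolding cube_kernel_def p_def by (rule jackson_integral[OF n(1)])
      show "(\<lambda>n. N (\<lambda>x. grid_sum n (\<lambda>u x. ?K u *\<^sub>R f (x + (real l * ?b) *\<^sub>R u)) x - \<Phi> l x)) \<longlonglongrightarrow> 0" for l
        using \<Phi>(2)[of l] by (simp add: mult_ac)
    qed
    have pm[measurable]: "p \<in> borel_measurable borel" by (rule borel_measurable_continuous_onI[OF pcont])
    have cubem[measurable]: "(halfopen_cube :: (real^'n) set) \<in> sets borel"
    proof -
      have "halfopen_cube = (\<Inter>i. {v::real^'n. v $ i \<in> halfopen})" by (auto simp: halfopen_cube_def)
      also have "\<dots> \<in> sets borel" by measurable
      finally show ?thesis .
    qed
    have "(LINT u|lborel. \<bar>?K u\<bar> * N ((fdiff (?b *\<^sub>R u) ^^ R) f)) = c ^ CARD('n) * (LINT u|lborel. \<bar>?K (c *\<^sub>R u)\<bar> * N ((fdiff (?b *\<^sub>R (c *\<^sub>R u)) ^^ R) f))"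
    proof (rule integral_scaleR_lborel[OF _ c0])
      show "(\<lambda>u. \<bar>?K u\<bar> * N ((fdiff (?b *\<^sub>R u) ^^ R) f)) \<in> borel_measurable borel"
        unfolding cube_kernel_def using measurable_N_fdiff[OF f] by measurable
    qed
    also have "\<dots> = (LINT u|lborel. c ^ CARD('n) * \<bar>?K (c *\<^sub>R u)\<bar> * N ((fdiff (a *\<^sub>R u) ^^ R) f))"
    proof -
      have "?b * c = a" using l0 by (simp add: c_def)
      then show ?thesis by (simp add: mult.assoc)
    qed
    also have "\<dots> \<le> (LINT u|lborel. A * (1 / weight u ^ (2 * M) * N ((fdiff (a *\<^sub>R u) ^^ R) f)))"
    proof (rule integral_mono')
      show "integrable lborel (\<lambda>u. A * (1 / weight u ^ (2 * M) * N ((fdiff (a *\<^sub>R u) ^^ R) f)))"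
        by (intro integrable_mult_right integrable_weight_N_fdiff f) (simp add: M_def)
      fix u :: "real^'n"
      have N0: "0 \<le> N ((fdiff (a *\<^sub>R u) ^^ R) f)" by (intro N_nonneg fdiff_power_mem f)
      show "0 \<le> A * (1 / weight u ^ (2 * M) * N ((fdiff (a *\<^sub>R u) ^^ R) f))"
        using N0 \<gamma> by (simp add: A_def weight_nonneg)
      have "c ^ CARD('n) * \<bar>?K (c *\<^sub>R u)\<bar> \<le> A * (1 / weight u ^ (2 * M))"
      proof (cases "c *\<^sub>R u \<in> halfopen_cube")
        case True
        then show ?thesis
          using jackson_decay[OF n(1) c0 c2 \<gamma> c1 True, of M] jackson_nonneg[of M n "c *\<^sub>R u"]
          by (simp add: cube_kernel_def p_def A_def)
      next
        case False
        then show ?thesis using \<gamma> by (simp add: cube_kernel_def A_def weight_nonneg)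
      qed
      then show "c ^ CARD('n) * \<bar>?K (c *\<^sub>R u)\<bar> * N ((fdiff (a *\<^sub>R u) ^^ R) f) \<le> A * (1 / weight u ^ (2 * M) * N ((fdiff (a *\<^sub>R u) ^^ R) f))"
        using mult_right_mono[OF _ N0] by (simp only: mult.assoc[symmetric])
    qed
    also have "\<dots> = A * (LINT u|lborel. 1 / weight u ^ (2 * M) * N ((fdiff (a *\<^sub>R u) ^^ R) f))"
      by (rule integral_mult_right_zero)
    finally have "N (\<lambda>x. f x - ?\<phi> x) \<le> A * (LINT u|lborel. 1 / weight u ^ (2 * M) * N ((fdiff (a *\<^sub>R u) ^^ R) f))"
      using err by linarith
    moreover have "?\<phi> \<in> B" by (intro sum_mem scale_mem \<Phi>)
    moreover have "approximant Torus (1 / a) ?\<phi>"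
      by (rule approximant_Torus_sum) (use approx in auto)
    ultimately show ?thesis by blast
  qed
  moreover have "p0 \<le> real (2 * M)" using M0 by (simp add: M_def)
  ultimately show ?thesis by blast
qed

end

section \<open>Smooth functions\<close>

definition pd :: "'n::finite \<Rightarrow> (real^'n \<Rightarrow> complex) \<Rightarrow> real^'n \<Rightarrow> complex" where
  "pd i f = (\<lambda>x. frechet_derivative f (at x) (axis i 1))"

lemma partials_Cons: "partials (i # is) f = pd i (partials is f)"
  by (simp add: pd_def)

lemma partials_append: "partials (is @ js) f = partials is (partials js f)"
  by (induction "is") auto

lemma partials_snoc: "partials (is @ [i]) f = partials is (pd i f)"
  by (simp add: partials_append pd_def)

lemma pd_eqI: "(f has_derivative f') (at x) \<Longrightarrow> pd i f x = f' (axis i 1)"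
  unfolding pd_def using frechet_derivative_at by metis

text \<open>Smoothness is shown by exhibiting a set of differentiable functions closed under partial
  derivatives; this replaces inductions over lists of derivatives.\<close>

lemma smooth_coinduct:
  assumes "f \<in> X" "\<And>g x. g \<in> X \<Longrightarrow> g differentiable at x" "\<And>g i. g \<in> X \<Longrightarrow> pd i g \<in> X"
  shows "smooth f"
proof -
  have "partials is f \<in> X" for "is"
    by (induction "is") (simp_all only: partials.simps(1) partials_Cons assms)
  then show ?thesis using assms(2) by (auto simp: smooth_def)
qed

lemma smooth_differentiable: "smooth f \<Longrightarrow> f differentiable at x"
  unfolding smooth_def by (metis partials.simps(1))

lemma smooth_pd: "smooth f \<Longrightarrow> smooth (pd i f)"
  unfolding smooth_def by (metis partials_snoc)

lemma smooth_partials: "smooth f \<Longrightarrow> smooth (partials is f)"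
  unfolding smooth_def by (metis partials_append)

lemma differentiable_has_derivative_pd:
  assumes "f differentiable at x"
  shows "(f has_derivative (\<lambda>h. \<Sum>i\<in>UNIV. h $ i *\<^sub>R pd i f x)) (at x)"
proof -
  have d: "(f has_derivative frechet_derivative f (at x)) (at x)"
    using assms by (simp add: frechet_derivative_works)
  then interpret linear "frechet_derivative f (at x)"
    by (rule has_derivative_linear)
  have "frechet_derivative f (at x) h = (\<Sum>i\<in>UNIV. h $ i *\<^sub>R pd i f x)" for h
  proof -
    have "h = (\<Sum>i\<in>UNIV. h $ i *\<^sub>R axis i 1)" by (simp add: basis_expansion flip: scalar_mult_eq_scaleR)
    then have "frechet_derivative f (at x) h = frechet_derivative f (at x) (\<Sum>i\<in>UNIV. h $ i *\<^sub>R axis i 1)" by simp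
    then show ?thesis by (simp add: sum scaleR pd_def)
  qed
  then have "frechet_derivative f (at x) = (\<lambda>h. \<Sum>i\<in>UNIV. h $ i *\<^sub>R pd i f x)" by (rule ext)
  then show ?thesis using d by (simp only:)
qed

lemma smooth_continuous_on: "smooth f \<Longrightarrow> continuous_on S f"
  by (intro continuous_at_imp_continuous_on ballI differentiable_imp_continuous_within smooth_differentiable)

lemma smooth_measurable: "smooth f \<Longrightarrow> f \<in> borel_measurable borel"
  by (intro borel_measurable_continuous_onI smooth_continuous_on)

lemma pd_const: "pd i (\<lambda>x. c) = (\<lambda>x. 0)"
  by (rule ext) (rule pd_eqI[of _ "\<lambda>_. 0", simplified], simp)

lemma smooth_const: "smooth (\<lambda>x. c)"
  by (rule smooth_coinduct[of _ "{\<lambda>x. c, \<lambda>x. 0}"]) (auto simp: pd_const)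

lemma pd_add: "f differentiable at x \<Longrightarrow> g differentiable at x \<Longrightarrow> pd i (\<lambda>x. f x + g x) x = pd i f x + pd i g x"
  unfolding frechet_derivative_works
  by (drule (1) has_derivative_add, drule pd_eqI[of _ _ _ i]) (simp add: pd_def)

lemma pd_mult: "f differentiable at x \<Longrightarrow> g differentiable at x \<Longrightarrow> pd i (\<lambda>x. f x * g x) x = pd i f x * g x + f x * pd i g x"
  unfolding frechet_derivative_works
  by (drule (1) has_derivative_mult, drule pd_eqI[of _ _ _ i]) (simp add: pd_def)

lemma smooth_add:
  assumes "smooth f" "smooth g" shows "smooth (\<lambda>x. f x + g x)"
proof (rule smooth_coinduct[of _ "{\<lambda>x. f x + g x | f g. smooth f \<and> smooth g}"])
  show "(\<lambda>x. f x + g x) \<in> {\<lambda>x. f x + g x | f g. smooth f \<and> smooth g}" using assms by blast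
next
  fix h x assume "h \<in> {\<lambda>x. f x + g x :: complex | f g. smooth f \<and> smooth g}"
  then show "h differentiable at x" using smooth_differentiable by (auto intro!: derivative_intros)
next
  fix h i assume "h \<in> {\<lambda>x. f x + g x :: complex | f g. smooth f \<and> smooth g}"
  then obtain f g where h: "h = (\<lambda>x. f x + g x)" "smooth f" "smooth g" by blast
  have "pd i h = (\<lambda>x. pd i f x + pd i g x)"
    unfolding h(1) by (rule ext) (intro pd_add smooth_differentiable h)
  then show "pd i h \<in> {\<lambda>x. f x + g x | f g. smooth f \<and> smooth g}" using h smooth_pd by blast
qed

lemma partials_add:
  assumes "smooth f" "smooth g"
  shows "partials is (\<lambda>x. f x + g x) = (\<lambda>x. partials is f x + partials is g x)"
proof (induction "is")
  case (Cons i "is")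
  show ?case unfolding partials_Cons Cons.IH
    by (rule ext) (intro pd_add smooth_differentiable smooth_partials assms)
qed simp

text \<open>The smallest class that contains the products of smooth functions and is closed under sums, and
  thus, by Leibniz' rule, under partial derivatives.\<close>

inductive_set products :: "(real^'n::finite \<Rightarrow> complex) set" where
  product: "smooth f \<Longrightarrow> smooth g \<Longrightarrow> (\<lambda>x. f x * g x) \<in> products"
| plus: "a \<in> products \<Longrightarrow> b \<in> products \<Longrightarrow> (\<lambda>x. a x + b x) \<in> products"

lemma smooth_mult:
  assumes "smooth f" "smooth g" shows "smooth (\<lambda>x. f x * g x)"
proof (rule smooth_coinduct[of _ products])
  show "(\<lambda>x. f x * g x) \<in> products" using assms by (rule products.product)
next
  fix h x assume "h \<in> (products :: (real^'a \<Rightarrow> complex) set)"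
  then show "h differentiable at x"
    by induction (auto intro!: differentiable_mult[OF smooth_differentiable smooth_differentiable] differentiable_add)
next
  fix h i assume "h \<in> (products :: (real^'a \<Rightarrow> complex) set)"
  then have "(\<forall>x. h differentiable at x) \<and> pd i h \<in> products"
  proof induction
    case (product f g)
    have "pd i (\<lambda>x. f x * g x) = (\<lambda>x. pd i f x * g x + f x * pd i g x)"
      by (rule ext) (intro pd_mult smooth_differentiable product)
    moreover have "(\<lambda>x. f x * g x) differentiable at x" for x
      by (rule differentiable_mult) (intro smooth_differentiable product)+
    ultimately show ?case using product by (auto intro!: products.intros smooth_pd)
  next
    case (plus a b)
    then have "pd i (\<lambda>x. a x + b x) = (\<lambda>x. pd i a x + pd i b x)"
      by (intro ext pd_add) auto
    then show ?case using plus by (auto intro!: products.plus derivative_intros)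
  qed
  then show "pd i h \<in> products" by blast
qed

lemma smooth_cmult: "smooth f \<Longrightarrow> smooth (\<lambda>x. c * f x)"
  by (intro smooth_mult smooth_const)

lemma smooth_uminus: "smooth f \<Longrightarrow> smooth (\<lambda>x. - f x)"
  using smooth_cmult[of f "-1"] by simp

lemma smooth_diff: "smooth f \<Longrightarrow> smooth g \<Longrightarrow> smooth (\<lambda>x. f x - g x)"
  using smooth_add[of f "\<lambda>x. - g x"] smooth_uminus[of g] by simp

lemma smooth_prod: "(\<And>i. i \<in> A \<Longrightarrow> smooth (f i)) \<Longrightarrow> smooth (\<lambda>x. \<Prod>i\<in>A. f i x)"
  by (induction A rule: infinite_finite_induct) (auto intro: smooth_const smooth_mult)

lemma pd_cmult: "smooth f \<Longrightarrow> pd i (\<lambda>x. c * f x) = (\<lambda>x. c * pd i f x)"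
  by (rule ext) (subst pd_mult, auto simp: pd_const intro: smooth_differentiable)

lemma smooth_coord: "smooth (\<lambda>x::real^'n::finite. complex_of_real (x $ j))"
  and pd_coord: "pd i (\<lambda>x::real^'n::finite. complex_of_real (x $ j)) = (\<lambda>x. if i = j then 1 else 0)"
proof -
  have d: "((\<lambda>x::real^'n. complex_of_real (x $ j)) has_derivative (\<lambda>h. complex_of_real (h $ j))) (at x)" for x
    by (auto intro!: derivative_eq_intros bounded_linear.has_derivative[OF bounded_linear_vec_nth])
  show pd: "pd i (\<lambda>x::real^'n. complex_of_real (x $ j)) = (\<lambda>x. if i = j then 1 else 0)" for i
    by (rule ext) (subst pd_eqI[OF d], simp add: axis_def eq_commute)
  show "smooth (\<lambda>x::real^'n::finite. complex_of_real (x $ j))"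
  proof (rule smooth_coinduct[of _ "insert (\<lambda>x. complex_of_real (x $ j)) (range (\<lambda>c x. c))"])
    fix g and x :: "real^'n" assume "g \<in> insert (\<lambda>x. complex_of_real (x $ j)) (range (\<lambda>c x. c))"
    then show "g differentiable at x" using d[of x] unfolding differentiable_def by (auto intro: has_derivative_const)
  next
    fix g i assume g: "g \<in> insert (\<lambda>x. complex_of_real (x $ j)) (range (\<lambda>c x. c))"
    have "(\<lambda>x. if i = j then 1 else 0 :: complex) \<in> range (\<lambda>c (x::real^'n). c)" by auto
    moreover have "(\<lambda>x. 0 :: complex) \<in> range (\<lambda>c (x::real^'n). c)" by auto
    ultimately show "pd i g \<in> insert (\<lambda>x. complex_of_real (x $ j)) (range (\<lambda>c x. c))"
      using g by (auto simp: pd pd_const)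
  qed simp
qed

lemma pd_affine:
  assumes "f differentiable at (c *\<^sub>R x + v)"
  shows "(\<lambda>x. f (c *\<^sub>R x + v)) differentiable at x" "pd i (\<lambda>x. f (c *\<^sub>R x + v)) x = c *\<^sub>R pd i f (c *\<^sub>R x + v)"
proof -
  have a: "((\<lambda>x. c *\<^sub>R x + v) has_derivative (\<lambda>h. c *\<^sub>R h)) (at x)"
    by (auto intro!: derivative_eq_intros)
  have f: "(f has_derivative frechet_derivative f (at (c *\<^sub>R x + v))) (at (c *\<^sub>R x + v))"
    using assms by (simp add: frechet_derivative_works)
  from diff_chain_at[OF a f] have d: "((\<lambda>x. f (c *\<^sub>R x + v)) has_derivative (\<lambda>h. frechet_derivative f (at (c *\<^sub>R x + v)) (c *\<^sub>R h))) (at x)"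
    by (simp add: o_def)
  then show "(\<lambda>x. f (c *\<^sub>R x + v)) differentiable at x" unfolding differentiable_def by blast
  show "pd i (\<lambda>x. f (c *\<^sub>R x + v)) x = c *\<^sub>R pd i f (c *\<^sub>R x + v)"
    using linear_scale[OF has_derivative_linear[OF f]] by (simp add: pd_eqI[OF d]) (simp add: pd_def)
qed

lemma smooth_affine:
  assumes "smooth f" shows "smooth (\<lambda>x. f (c *\<^sub>R x + v))"
proof (rule smooth_coinduct[of _ "{\<lambda>x. g (c *\<^sub>R x + v) | g. smooth g}"])
  fix h x assume "h \<in> {\<lambda>x. g (c *\<^sub>R x + v) | g. smooth g}"
  then show "h differentiable at x" by (auto intro!: pd_affine(1)[OF smooth_differentiable])
next
  fix h i assume "h \<in> {\<lambda>x. g (c *\<^sub>R x + v) | g. smooth g}"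
  then obtain g where h: "h = (\<lambda>x. g (c *\<^sub>R x + v))" "smooth g" by blast
  have "pd i h = (\<lambda>x. (\<lambda>y. of_real c * pd i g y) (c *\<^sub>R x + v))"
    unfolding h(1) by (rule ext) (simp add: pd_affine(2) smooth_differentiable h(2) scaleR_conv_of_real[where 'a=complex])
  moreover have "smooth (\<lambda>y. of_real c * pd i g y)" by (intro smooth_cmult smooth_pd h)
  ultimately show "pd i h \<in> {\<lambda>x. g (c *\<^sub>R x + v) | g. smooth g}"
    by (intro CollectI exI[of _ "\<lambda>y. of_real c * pd i g y"] conjI)
qed (use assms in blast)

lemma partials_affine:
  assumes "smooth f"
  shows "partials is (\<lambda>x. f (c *\<^sub>R x + v)) = (\<lambda>x. c ^ length is *\<^sub>R partials is f (c *\<^sub>R x + v))"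
proof (induction "is")
  case (Cons i "is")
  show ?case
  proof
    fix x
    have "pd i (\<lambda>x. of_real (c ^ length is) * partials is f (c *\<^sub>R x + v)) x = of_real (c ^ length is) * (c *\<^sub>R pd i (partials is f) (c *\<^sub>R x + v))"
      using smooth_affine[OF smooth_partials[OF assms, of "is"], of c v]
      by (simp add: pd_cmult pd_affine(2) smooth_differentiable smooth_partials assms)
    then show "partials (i # is) (\<lambda>x. f (c *\<^sub>R x + v)) x = c ^ length (i # is) *\<^sub>R partials (i # is) f (c *\<^sub>R x + v)"
      unfolding partials_Cons Cons.IH by (simp add: scaleR_conv_of_real[where 'a=complex] mult_ac)
  qed
qed simp

lemma partials_shift: "smooth f \<Longrightarrow> partials is (\<lambda>x. f (x + v)) = (\<lambda>x. partials is f (x + v))"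
  using partials_affine[of f "is" 1 v] by simp

lemma smooth_shift: "smooth f \<Longrightarrow> smooth (\<lambda>x. f (x + v))"
  using smooth_affine[of f 1 v] by simp

lemma smooth_scale: "smooth f \<Longrightarrow> smooth (\<lambda>x. f (c *\<^sub>R x))"
  using smooth_affine[of f c 0] by simp

text \<open>The crude form of Leibniz' formula: each derivative doubles the number of terms.\<close>

lemma norm_partials_mult_le:
  assumes "smooth f" "smooth g"
    and "\<And>js. length js \<le> length is \<Longrightarrow> norm (partials js f x) \<le> \<alpha>"
    and "\<And>js. length js \<le> length is \<Longrightarrow> norm (partials js g x) \<le> \<beta>"
  shows "norm (partials is (\<lambda>x. f x * g x) x) \<le> 2 ^ length is * (\<alpha> * \<beta>)"
  using assms
proof (induction "is" arbitrary: f g rule: rev_induct)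
  case Nil
  show ?case using Nil(3,4)[of "[]"] by (simp add: norm_mult mult_mono')
next
  case (snoc i "is")
  have eq: "pd i (\<lambda>x. f x * g x) = (\<lambda>x. pd i f x * g x + f x * pd i g x)"
    by (rule ext) (intro pd_mult smooth_differentiable snoc)
  have "norm (partials is (\<lambda>x. pd i f x * g x) x) \<le> 2 ^ length is * (\<alpha> * \<beta>)"
    using snoc.prems(3)[of "_ @ [i]"] snoc.prems(4)
    by (intro snoc.IH smooth_pd snoc.prems) (auto simp: partials_snoc)
  moreover have "norm (partials is (\<lambda>x. f x * pd i g x) x) \<le> 2 ^ length is * (\<alpha> * \<beta>)"
    using snoc.prems(4)[of "_ @ [i]"] snoc.prems(3)
    by (intro snoc.IH smooth_pd snoc.prems) (auto simp: partials_snoc)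
  ultimately show ?case
    unfolding partials_snoc eq
    by (subst partials_add) (auto intro!: smooth_mult smooth_pd snoc.prems order_trans[OF norm_triangle_ineq])
qed

section \<open>Test functions\<close>

lemma locally_zero_has_derivative:
  assumes "open U" "x \<in> U" "\<And>y. y \<in> U \<Longrightarrow> f y = (0::complex)"
  shows "(f has_derivative (\<lambda>h. 0)) (at x)"
  by (rule has_derivative_transform_within_open[of "\<lambda>_. 0" _ _ _ U]) (use assms in auto)

lemma supp_pd: "supp (pd i f) \<subseteq> supp f"
proof -
  have "pd i f x = 0" if "x \<notin> supp f" for x
  proof -
    have "(f has_derivative (\<lambda>h. 0)) (at x)"
    proof (rule locally_zero_has_derivative[of "- supp f"])
      show "f y = 0" if "y \<in> - supp f" for y
        using that closure_subset[of "{x. f x \<noteq> 0}"] by (auto simp: supp_def)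
    qed (use that in \<open>auto simp: supp_def\<close>)
    then show ?thesis by (simp add: pd_eqI)
  qed
  then have "{x. pd i f x \<noteq> 0} \<subseteq> supp f" by blast
  then show ?thesis unfolding supp_def[of "pd i f"] by (rule closure_minimal) (simp add: supp_def)
qed

lemma not_supp: "x \<notin> supp f \<Longrightarrow> f x = 0"
  using closure_subset[of "{x. f x \<noteq> 0}"] by (auto simp: supp_def)

lemma supp_subset: "(\<And>x. g x = 0 \<Longrightarrow> f x = 0) \<Longrightarrow> supp f \<subseteq> supp g"
  unfolding supp_def by (rule closure_mono) auto

lemma compact_supp_subset: "compact (supp g) \<Longrightarrow> supp f \<subseteq> supp g \<Longrightarrow> compact (supp f)"
  by (metis closed_closure compact_Int_closed inf.absorb_iff2 supp_def)

lemma test_function_mult: "test_function f \<Longrightarrow> smooth g \<Longrightarrow> test_function (\<lambda>x. g x * f x)"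
  unfolding test_function_def using smooth_mult compact_supp_subset[of f] supp_subset[of f "\<lambda>x. g x * f x"] by auto

lemma test_function_pd: "test_function f \<Longrightarrow> test_function (pd i f)"
  unfolding test_function_def using smooth_pd compact_supp_subset supp_pd by blast

lemma test_function_partials: "test_function f \<Longrightarrow> test_function (partials is f)"
  by (induction "is") (simp_all only: partials.simps(1) partials_Cons test_function_pd)

lemma test_function_bounded_support:
  assumes "test_function f" obtains r where "0 < r" "\<And>x. r < norm x \<Longrightarrow> f x = 0"
proof -
  have "bounded (supp f)" using assms compact_imp_bounded by (auto simp: test_function_def)
  then obtain r where "0 < r" "\<And>x. x \<in> supp f \<Longrightarrow> norm x \<le> r" unfolding bounded_pos by blast
  then show ?thesis using that not_supp by (metis not_le)
qed

lemma test_functionI: "smooth f \<Longrightarrow> (\<And>x. r < norm x \<Longrightarrow> f x = 0) \<Longrightarrow> test_function f"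
proof -
  assume s: "smooth f" and z: "\<And>x. r < norm x \<Longrightarrow> f x = 0"
  have "{x. f x \<noteq> 0} \<subseteq> cball 0 r" using z by (auto simp: not_less[symmetric])
  then have "bounded {x. f x \<noteq> 0}" using bounded_subset bounded_cball by blast
  then show ?thesis using s by (simp add: test_function_def supp_def bounded_closure compact_eq_bounded_closed)
qed

lemma test_function_shift:
  fixes f :: "real^'n::finite \<Rightarrow> complex"
  assumes "test_function f" shows "test_function (\<lambda>x. f (x + v))"
proof -
  obtain r where r: "\<And>x. r < norm x \<Longrightarrow> f x = 0" using test_function_bounded_support[OF assms] by blast
  show ?thesis
  proof (rule test_functionI[of _ "r + norm v"])
    show "smooth (\<lambda>x. f (x + v))" using assms by (intro smooth_shift) (simp add: test_function_def)
    fix x :: "real^'n" assume "r + norm v < norm x"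
    moreover have "norm x \<le> norm (x + v) + norm v" using norm_triangle_ineq4[of "x + v" v] by simp
    ultimately show "f (x + v) = 0" by (intro r) linarith
  qed
qed

lemma test_function_scale:
  fixes f :: "real^'n::finite \<Rightarrow> complex"
  assumes "test_function f" "0 < c" shows "test_function (\<lambda>x. f (c *\<^sub>R x))"
proof -
  obtain r where r: "\<And>x. r < norm x \<Longrightarrow> f x = 0" using test_function_bounded_support[OF assms(1)] by blast
  show ?thesis
  proof (rule test_functionI[of _ "r / c"])
    show "smooth (\<lambda>x. f (c *\<^sub>R x))" using assms by (intro smooth_scale) (simp add: test_function_def)
    fix x :: "real^'n" assume "r / c < norm x"
    then show "f (c *\<^sub>R x) = 0" using assms(2) by (intro r) (simp add: field_simps)
  qed
qed

lemma test_function_bounded: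
  assumes "test_function f" obtains C where "0 < C" "\<And>x. norm (f x) \<le> C"
proof -
  obtain r where r: "\<And>x. r < norm x \<Longrightarrow> f x = 0" using test_function_bounded_support[OF assms] by blast
  have "compact (f ` cball 0 r)" using assms
    by (intro compact_continuous_image smooth_continuous_on) (auto simp: test_function_def)
  from compact_imp_bounded[OF this] obtain C where "0 < C" "\<forall>y\<in>f ` cball 0 r. norm y \<le> C"
    unfolding bounded_pos by blast
  then have C: "0 < C" "\<And>x. x \<in> cball 0 r \<Longrightarrow> norm (f x) \<le> C" by auto
  have "norm (f x) \<le> C" for x using C r[of x] by (cases "r < norm x") auto
  then show ?thesis using C that by blast
qed

lemma test_function_decay:
  assumes "test_function f" obtains C where "0 < C" "\<And>x. norm (f x) \<le> C / (1 + norm x) ^ k"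
proof -
  obtain r where r: "0 < r" "\<And>x. r < norm x \<Longrightarrow> f x = 0" using test_function_bounded_support[OF assms] by blast
  obtain C where C: "0 < C" "\<And>x. norm (f x) \<le> C" using test_function_bounded[OF assms] by blast
  have "norm (f x) \<le> (C * (1 + r) ^ k) / (1 + norm x) ^ k" for x
  proof (cases "r < norm x")
    case False
    then have "norm (f x) * (1 + norm x) ^ k \<le> C * (1 + r) ^ k"
      using C r by (intro mult_mono power_mono) auto
    then show ?thesis by (subst pos_le_divide_eq) (auto intro!: zero_less_power add_pos_nonneg)
  qed (use r C in \<open>auto intro!: divide_nonneg_nonneg\<close>)
  then show ?thesis using that[of "C * (1 + r) ^ k"] C r by simp
qed

lemma decay_integrable:
  fixes f :: "real^'n::finite \<Rightarrow> complex"
  assumes "f \<in> borel_measurable borel" "\<And>x. norm (f x) \<le> C / (1 + norm x) ^ (2 * CARD('n))"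
  shows "integrable lborel f"
proof (rule Bochner_Integration.integrable_bound)
  show "integrable lborel (\<lambda>x::real^'n. C * (1 / weight x ^ 2))"
    by (rule integrable_mult_right[OF integrable_inverse_weight]) simp
  have "norm (f x) \<le> norm (C * (1 / weight x ^ 2))" for x
  proof -
    have "weight x ^ 2 \<le> ((1 + norm x) ^ CARD('n)) ^ 2"
      by (intro power_mono weight_le_power weight_nonneg)
    then have w: "weight x ^ 2 \<le> (1 + norm x) ^ (2 * CARD('n))" by (simp add: power_mult[symmetric] mult.commute)
    have "0 \<le> C / (1 + norm x) ^ (2 * CARD('n))" using assms(2)[of x] norm_ge_zero order_trans by blast
    moreover have "0 < (1 + norm x) ^ (2 * CARD('n))" by (intro zero_less_power) (simp add: add_pos_nonneg)
    ultimately have C: "0 \<le> C" by (simp add: zero_le_divide_iff)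
    have "C / (1 + norm x) ^ (2 * CARD('n)) \<le> C / weight x ^ 2"
      using w C weight_pos[of x] by (intro divide_left_mono) (auto intro!: mult_pos_pos zero_less_power add_pos_nonneg)
    then show ?thesis using assms(2)[of x] C by simp
  qed
  then show "AE x in lborel. norm (f x) \<le> norm (C * (1 / weight x ^ 2))" by simp
qed (use assms in simp)

lemma test_function_integrable: "test_function f \<Longrightarrow> integrable lborel (f :: real^'n::finite \<Rightarrow> complex)"
  by (rule test_function_decay[of f "2 * CARD('n)"])
     (auto intro!: decay_integrable smooth_measurable simp: test_function_def)

text \<open>The functions \<open>p(1/t) e\<^bsup>-1/t\<^esup>\<close>, extended by \<open>0\<close> to \<open>t \<le> 0\<close>; with the polynomial as a parameter
  they are closed under differentiation.\<close>

definition exp_inv :: "real poly \<Rightarrow> real \<Rightarrow> real" where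
  "exp_inv p t = (if 0 < t then poly p (1 / t) * exp (- (1 / t)) else 0)"

lemma tendsto_poly_exp_minus: "((\<lambda>x. poly p x * exp (- x)) \<longlongrightarrow> (0::real)) at_top"
proof -
  have "((\<lambda>x. x ^ k * poly p x * exp (- x)) \<longlongrightarrow> (0::real)) at_top" for k
  proof (induction p arbitrary: k)
    case (pCons a p)
    have "((\<lambda>x. x ^ k * exp (- x)) \<longlongrightarrow> (0::real)) at_top"
      using tendsto_power_div_exp_0[of k] by (simp add: exp_minus divide_inverse)
    then have "((\<lambda>x. a * (x ^ k * exp (- x)) + x ^ Suc k * poly p x * exp (- x)) \<longlongrightarrow> a * 0 + 0) at_top"
      by (intro tendsto_intros pCons.IH)
    then show ?case by (simp add: algebra_simps)
  qed simp
  from this[of 0] show ?thesis by simp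
qed

lemma exp_inv_tendsto_0: "((\<lambda>t. exp_inv p t / t) \<longlongrightarrow> 0) (at 0)"
proof (rule filterlim_split_at)
  show "((\<lambda>t. exp_inv p t / t) \<longlongrightarrow> 0) (at_left 0)"
  proof (rule tendsto_eventually)
    show "\<forall>\<^sub>F t in at_left 0. exp_inv p t / t = 0"
      unfolding eventually_at_filter by (simp add: exp_inv_def)
  qed
  have "((\<lambda>x. poly (pCons 0 p) x * exp (- x)) \<longlongrightarrow> 0) at_top" by (rule tendsto_poly_exp_minus)
  then have "((\<lambda>t. poly (pCons 0 p) (inverse t) * exp (- inverse t)) \<longlongrightarrow> 0) (at_right 0)"
    by (rule filterlim_compose[OF _ filterlim_inverse_at_top_right])
  then show "((\<lambda>t. exp_inv p t / t) \<longlongrightarrow> 0) (at_right 0)"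
  proof (rule Lim_transform_eventually)
    show "\<forall>\<^sub>F t in at_right 0. poly (pCons 0 p) (inverse t) * exp (- inverse t) = exp_inv p t / t"
      unfolding eventually_at_filter by (simp add: exp_inv_def inverse_eq_divide)
  qed
qed

lemma exp_inv_derivative:
  "(exp_inv p has_real_derivative exp_inv ([:0, 0, 1:] * (p - pderiv p)) t) (at t)"
proof -
  let ?q = "[:0, 0, 1:] * (p - pderiv p)"
  consider "0 < t" | "t < 0" | "t = 0" by linarith
  then show ?thesis
  proof cases
    case 1
    have "((\<lambda>t. poly p (1 / t) * exp (- (1 / t))) has_real_derivative exp_inv ?q t) (at t)"
    proof -
      have i: "((\<lambda>t. 1 / t) has_real_derivative - (1 / t\<^sup>2)) (at t)"
        using DERIV_inverse[of t] 1 by (simp add: inverse_eq_divide power2_eq_square)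
      have P: "((\<lambda>t. poly p (1 / t)) has_real_derivative poly (pderiv p) (1 / t) * - (1 / t\<^sup>2)) (at t)"
        by (rule DERIV_chain2[OF poly_DERIV i])
      have E: "((\<lambda>t. exp (- (1 / t))) has_real_derivative exp (- (1 / t)) * - (- (1 / t\<^sup>2))) (at t)"
        by (rule DERIV_chain2[OF DERIV_exp DERIV_minus[OF i]])
      have "poly (pderiv p) (1 / t) * - (1 / t\<^sup>2) * exp (- (1 / t)) + exp (- (1 / t)) * - (- (1 / t\<^sup>2)) * poly p (1 / t) = exp_inv ?q t"
        using 1 by (simp add: exp_inv_def power2_eq_square) (simp add: algebra_simps diff_divide_distrib)
      with DERIV_mult[OF P E] show ?thesis by simp
    qed
    then show ?thesis
      by (rule has_field_derivative_transform_within_open[of _ _ _ "{0<..}"]) (use 1 in \<open>auto simp: exp_inv_def\<close>)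
  next
    case 2
    have "((\<lambda>t. 0) has_real_derivative exp_inv ?q t) (at t)" using 2 by (simp add: exp_inv_def)
    then show ?thesis
      by (rule has_field_derivative_transform_within_open[of _ _ _ "{..<0}"]) (use 2 in \<open>auto simp: exp_inv_def\<close>)
  next
    case 3
    then show ?thesis using exp_inv_tendsto_0[of p] by (simp add: DERIV_def exp_inv_def)
  qed
qed

lemma smooth_exp_inv_coord:
  fixes j :: "'n::finite"
  shows "smooth (\<lambda>x::real^'n. complex_of_real (exp_inv p (\<alpha> + \<beta> * x $ j)))"
proof (rule smooth_coinduct[of _ "{\<lambda>x. complex_of_real (c * exp_inv p (\<alpha> + \<beta> * x $ j)) | c p. True}"])
  have d: "((\<lambda>x::real^'n. complex_of_real (c * exp_inv p (\<alpha> + \<beta> * x $ j))) has_derivative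
      (\<lambda>h. complex_of_real (c * (exp_inv ([:0, 0, 1:] * (p - pderiv p)) (\<alpha> + \<beta> * x $ j) * (\<beta> * h $ j))))) (at x)" for c p x
  proof -
    have i: "((\<lambda>x::real^'n. \<alpha> + \<beta> * x $ j) has_derivative (\<lambda>h. \<beta> * h $ j)) (at x)"
      by (auto intro!: derivative_eq_intros bounded_linear.has_derivative[OF bounded_linear_vec_nth])
    from diff_chain_at[OF i exp_inv_derivative[unfolded has_field_derivative_def]]
    have "((\<lambda>x::real^'n. exp_inv p (\<alpha> + \<beta> * x $ j)) has_derivative (\<lambda>h. exp_inv ([:0, 0, 1:] * (p - pderiv p)) (\<alpha> + \<beta> * x $ j) * (\<beta> * h $ j))) (at x)"
      by (simp add: o_def)
    from has_derivative_of_real[OF has_derivative_mult_right[OF this, of c]] show ?thesis .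
  qed
  show "g differentiable at x" if "g \<in> {\<lambda>x. complex_of_real (c * exp_inv p (\<alpha> + \<beta> * x $ j)) | c p. True}" for g and x :: "real^'n"
    using that d unfolding differentiable_def by blast
  show "pd i g \<in> {\<lambda>x. complex_of_real (c * exp_inv p (\<alpha> + \<beta> * x $ j)) | c p. True}"
    if gX: "g \<in> {\<lambda>x. complex_of_real (c * exp_inv p (\<alpha> + \<beta> * x $ j)) | c p. True}" for g i
  proof -
    obtain c p where g: "g = (\<lambda>x. complex_of_real (c * exp_inv p (\<alpha> + \<beta> * x $ j)))" using gX by blast
    have "pd i g = (\<lambda>x. complex_of_real ((c * \<beta> * (if i = j then 1 else 0)) * exp_inv ([:0, 0, 1:] * (p - pderiv p)) (\<alpha> + \<beta> * x $ j)))"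
      unfolding g by (rule ext) (subst pd_eqI[OF d], simp add: axis_def)
    then show ?thesis by (intro CollectI exI conjI TrueI)
  qed
  show "(\<lambda>x::real^'n. complex_of_real (exp_inv p (\<alpha> + \<beta> * x $ j))) \<in> {\<lambda>x. complex_of_real (c * exp_inv p (\<alpha> + \<beta> * x $ j)) | c p. True}"
    by (intro CollectI exI[of _ 1] exI[of _ p]) simp
qed

text \<open>A tensor product of the one-dimensional bumps \<open>exp(2 - 1/(1 - t) - 1/(1 + t))\<close>.\<close>

lemma bump_exists:
  "\<exists>\<eta>::real^'n::finite \<Rightarrow> complex. test_function \<eta> \<and> \<eta> 0 = 1 \<and> (\<forall>x. \<eta> x = of_real (Re (\<eta> x)) \<and> 0 \<le> Re (\<eta> x)) \<and>
     (\<forall>x i. \<eta> x \<noteq> 0 \<longrightarrow> \<bar>x $ i\<bar> \<le> 1)"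
proof -
  define g where "g t = exp 2 * (exp_inv 1 (1 + (-1) * t) * exp_inv 1 (1 + 1 * t))" for t :: real
  define \<eta> where "\<eta> x = (\<Prod>i\<in>UNIV. complex_of_real (g (x $ i)))" for x :: "real^'n"
  have g0: "0 \<le> g t" for t by (simp add: g_def exp_inv_def)
  have gz: "g t = 0" if "1 \<le> \<bar>t\<bar>" for t using that by (auto simp: g_def exp_inv_def)
  have real: "\<eta> x = of_real (\<Prod>i\<in>UNIV. g (x $ i))" for x by (simp add: \<eta>_def)
  have z: "\<bar>x $ i\<bar> \<le> 1" if "\<eta> x \<noteq> 0" for x i
  proof (rule ccontr)
    assume "\<not> \<bar>x $ i\<bar> \<le> 1"
    then have "g (x $ i) = 0" by (intro gz) simp
    then have "\<eta> x = 0" unfolding \<eta>_def by (intro prod_zero bexI[of _ i]) auto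
    then show False using that by simp
  qed
  have "smooth \<eta>"
    unfolding \<eta>_def g_def of_real_mult by (intro smooth_prod smooth_mult smooth_const smooth_exp_inv_coord)
  moreover have "\<eta> x = 0" if "real CARD('n) < norm x" for x
  proof (rule ccontr)
    assume "\<eta> x \<noteq> 0"
    then have "(\<Sum>i\<in>UNIV. \<bar>x $ i\<bar>) \<le> (\<Sum>i\<in>(UNIV::'n set). 1)" using z by (intro sum_mono) auto
    then show False using norm_le_l1_cart[of x] that by simp
  qed
  ultimately have "test_function \<eta>" by (rule test_functionI)
  moreover have "\<eta> 0 = 1"
  proof -
    have "g 0 = 1" by (simp add: g_def exp_inv_def flip: exp_add)
    then show ?thesis by (simp add: \<eta>_def)
  qed
  moreover have "0 \<le> (\<Prod>i\<in>UNIV. g (x $ i))" for x :: "real^'n" by (intro prod_nonneg) (simp add: g0)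
  then have "\<eta> x = of_real (Re (\<eta> x)) \<and> 0 \<le> Re (\<eta> x)" for x
    by (simp only: real Re_complex_of_real)
  ultimately show ?thesis using z by (intro exI[of _ \<eta>] conjI allI impI) blast+
qed

section \<open>The Fourier transform of a test function\<close>

lemma continuous_on_cis_inner: "continuous_on S (\<lambda>x. cis (- (x \<bullet> y)))" "continuous_on S (\<lambda>x. cis (- (y \<bullet> x)))"
  unfolding cis_conv_exp by (intro continuous_intros)+

lemma measurable_cis_inner[measurable]: "(\<lambda>x::real^'n::finite. cis (- (x \<bullet> y))) \<in> borel_measurable borel"
  by (intro borel_measurable_continuous_onI continuous_on_cis_inner)

lemma test_function_measurable: "test_function f \<Longrightarrow> f \<in> borel_measurable borel"
  by (intro smooth_measurable) (simp add: test_function_def)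

lemma fourier_lborel:
  assumes "test_function \<psi>"
  shows "fourier \<psi> y = (LINT x|lborel. cis (- (x \<bullet> y)) * \<psi> x)"
proof -
  have [measurable]: "\<psi> \<in> borel_measurable borel" by (rule test_function_measurable[OF assms])
  show ?thesis unfolding fourier_def by (rule integral_completion) measurable
qed

lemma integrable_cis_mult:
  assumes "integrable lborel \<psi>"
  shows "integrable lborel (\<lambda>x::real^'n::finite. cis (- (x \<bullet> y)) * \<psi> x)"
proof (rule Bochner_Integration.integrable_bound[OF assms])
  have [measurable]: "\<psi> \<in> borel_measurable borel" using borel_measurable_integrable[OF assms] by simp
  show "(\<lambda>x. cis (- (x \<bullet> y)) * \<psi> x) \<in> borel_measurable lborel" by measurable
qed (simp add: norm_mult)

lemma norm_cis_taylor: "norm (cis t - 1 - \<i> * of_real t) \<le> t\<^sup>2"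
proof -
  have "norm (cis t - 1 - \<i> * of_real t) \<le> \<bar>t\<bar>\<^sup>2 / 2"
    using iexp_approx1[of t 1] by (simp add: cis_conv_exp power2_eq_square algebra_simps)
  also have "\<dots> \<le> t\<^sup>2" by simp
  finally show ?thesis .
qed

lemma test_function_coord_mult: "test_function \<psi> \<Longrightarrow> test_function (\<lambda>x. c * of_real (x $ i) * \<psi> x)"
  by (rule test_function_mult) (auto intro: smooth_cmult smooth_coord)

text \<open>Differentiation under the integral sign, by the second order Taylor estimate for \<open>e\<^bsup>it\<^esup>\<close> and
  the bounded support of \<open>\<psi>\<close>.\<close>

lemma fourier_has_derivative:
  fixes \<psi> :: "real^'n::finite \<Rightarrow> complex"
  assumes \<psi>: "test_function \<psi>"
  shows "(fourier \<psi> has_derivative (\<lambda>k. \<Sum>i\<in>UNIV. k $ i *\<^sub>R fourier (\<lambda>x. - \<i> * of_real (x $ i) * \<psi> x) y)) (at y)"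
proof -
  let ?L = "\<lambda>k. \<Sum>i\<in>UNIV. k $ i *\<^sub>R fourier (\<lambda>x. - \<i> * of_real (x $ i) * \<psi> x) y"
  obtain r where r: "0 < r" "\<And>x. r < norm x \<Longrightarrow> \<psi> x = 0" using test_function_bounded_support[OF \<psi>] by blast
  define C where "C = (LINT x|lborel. r\<^sup>2 * norm (\<psi> x))"
  have Ci: "integrable lborel (\<lambda>x. r\<^sup>2 * norm (\<psi> x))" using test_function_integrable[OF \<psi>] by simp
  have tf: "test_function (\<lambda>x. - \<i> * of_real (x $ i) * \<psi> x)" for i
    by (rule test_function_coord_mult[OF \<psi>])
  have L: "?L k = (LINT x|lborel. cis (- (x \<bullet> y)) * (- \<i> * of_real (x \<bullet> k) * \<psi> x))"
    and Li: "integrable lborel (\<lambda>x. cis (- (x \<bullet> y)) * (- \<i> * of_real (x \<bullet> k) * \<psi> x))" for k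
  proof -
    have eq: "cis (- (x \<bullet> y)) * (- \<i> * of_real (x \<bullet> k) * \<psi> x) =
       (\<Sum>i\<in>UNIV. k $ i *\<^sub>R (cis (- (x \<bullet> y)) * (- \<i> * of_real (x $ i) * \<psi> x)))" for x
      by (simp add: inner_vec_def scaleR_conv_of_real[where 'a=complex] sum_distrib_left sum_distrib_right mult_ac sum_negf)
    have int: "integrable lborel (\<lambda>x. k $ i *\<^sub>R (cis (- (x \<bullet> y)) * (- \<i> * of_real (x $ i) * \<psi> x)))" for i
      by (intro integrable_scaleR_right integrable_cis_mult test_function_integrable tf)
    show "integrable lborel (\<lambda>x. cis (- (x \<bullet> y)) * (- \<i> * of_real (x \<bullet> k) * \<psi> x))"
      unfolding eq by (intro Bochner_Integration.integrable_sum int)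
    show "?L k = (LINT x|lborel. cis (- (x \<bullet> y)) * (- \<i> * of_real (x \<bullet> k) * \<psi> x))"
      unfolding eq Bochner_Integration.integral_sum[OF int] integral_scaleR_right fourier_lborel[OF tf] ..
  qed
  have bound: "norm (fourier \<psi> (y + k) - fourier \<psi> y - ?L k) \<le> C * (norm k)\<^sup>2" for k
  proof -
    have i1: "integrable lborel (\<lambda>x. cis (- (x \<bullet> z)) * \<psi> x)" for z
      by (rule integrable_cis_mult[OF test_function_integrable[OF \<psi>]])
    have "fourier \<psi> (y + k) - fourier \<psi> y - ?L k = (LINT x|lborel. cis (- (x \<bullet> (y + k))) * \<psi> x - cis (- (x \<bullet> y)) * \<psi> x
         - cis (- (x \<bullet> y)) * (- \<i> * of_real (x \<bullet> k) * \<psi> x))"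
      unfolding L fourier_lborel[OF \<psi>]
      using i1 Li by (simp only: Bochner_Integration.integral_diff Bochner_Integration.integrable_diff)
    also have "norm \<dots> \<le> (LINT x|lborel. (norm k)\<^sup>2 * (r\<^sup>2 * norm (\<psi> x)))"
    proof (rule Bochner_Integration.integral_norm_bound_integral)
      fix x
      have "cis (- (x \<bullet> (y + k))) = cis (- (x \<bullet> y)) * cis (- (x \<bullet> k))"
        by (simp add: cis_mult inner_add_right)
      then have "cis (- (x \<bullet> (y + k))) * \<psi> x - cis (- (x \<bullet> y)) * \<psi> x - cis (- (x \<bullet> y)) * (- \<i> * of_real (x \<bullet> k) * \<psi> x)
         = cis (- (x \<bullet> y)) * (cis (- (x \<bullet> k)) - 1 - \<i> * of_real (- (x \<bullet> k))) * \<psi> x"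
        by (simp add: algebra_simps)
      then have "norm (cis (- (x \<bullet> (y + k))) * \<psi> x - cis (- (x \<bullet> y)) * \<psi> x - cis (- (x \<bullet> y)) * (- \<i> * of_real (x \<bullet> k) * \<psi> x))
         = norm (cis (- (x \<bullet> k)) - 1 - \<i> * of_real (- (x \<bullet> k))) * norm (\<psi> x)"
        by (simp add: norm_mult)
      also have "\<dots> \<le> (norm k)\<^sup>2 * (r\<^sup>2 * norm (\<psi> x))"
      proof (cases "r < norm x")
        case False
        have "norm (cis (- (x \<bullet> k)) - 1 - \<i> * of_real (- (x \<bullet> k))) \<le> (- (x \<bullet> k))\<^sup>2" by (rule norm_cis_taylor)
        also have "\<dots> = \<bar>x \<bullet> k\<bar>\<^sup>2" by simp
        also have "\<dots> \<le> (r * norm k)\<^sup>2"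
          using False by (intro power_mono order_trans[OF Cauchy_Schwarz_ineq2] mult_right_mono) auto
        finally have "norm (cis (- (x \<bullet> k)) - 1 - \<i> * of_real (- (x \<bullet> k))) \<le> (r * norm k)\<^sup>2" .
        from mult_right_mono[OF this norm_ge_zero[of "\<psi> x"]] show ?thesis
          by (simp only: power_mult_distrib mult_ac)
      qed (use r in simp)
      finally show "norm (cis (- (x \<bullet> (y + k))) * \<psi> x - cis (- (x \<bullet> y)) * \<psi> x - cis (- (x \<bullet> y)) * (- \<i> * of_real (x \<bullet> k) * \<psi> x))
         \<le> (norm k)\<^sup>2 * (r\<^sup>2 * norm (\<psi> x))" .
    qed (use i1 Li Ci in \<open>auto intro!: Bochner_Integration.integrable_diff\<close>)
    also have "\<dots> = C * (norm k)\<^sup>2" by (simp add: C_def)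
    finally show ?thesis .
  qed
  show ?thesis
    unfolding has_derivative_at
  proof
    show "bounded_linear ?L"
      by (intro bounded_linear_sum bounded_linear_scaleR_const bounded_linear_vec_nth)
    show "(\<lambda>k. norm (fourier \<psi> (y + k) - fourier \<psi> y - ?L k) / norm k) \<midarrow>0\<rightarrow> 0"
    proof (rule Lim_null_comparison)
      have "((\<lambda>k::real^'n. C * norm k) \<longlongrightarrow> C * norm (0::real^'n)) (at 0)" by (intro tendsto_intros)
      then show "((\<lambda>k::real^'n. C * norm k) \<longlongrightarrow> 0) (at 0)" by simp
      show "\<forall>\<^sub>F k in at 0. norm (norm (fourier \<psi> (y + k) - fourier \<psi> y - ?L k) / norm k) \<le> C * norm k"
      proof (rule eventually_at_filter[THEN iffD2], intro always_eventually allI impI)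
        fix k :: "real^'n" assume "k \<noteq> 0"
        then show "norm (norm (fourier \<psi> (y + k) - fourier \<psi> y - ?L k) / norm k) \<le> C * norm k"
          using bound[of k] by (simp add: field_simps power2_eq_square)
      qed
    qed
  qed
qed

lemma pd_fourier:
  assumes "test_function \<psi>"
  shows "pd i (fourier \<psi>) = fourier (\<lambda>x. - \<i> * of_real (x $ i) * \<psi> x)"
proof
  fix y
  have "pd i (fourier \<psi>) y = (\<Sum>j\<in>UNIV. (axis i 1 :: real^_) $ j *\<^sub>R fourier (\<lambda>x. - \<i> * of_real (x $ j) * \<psi> x) y)"
    by (rule pd_eqI[OF fourier_has_derivative[OF assms]])
  also have "\<dots> = (\<Sum>j\<in>UNIV. if j = i then fourier (\<lambda>x. - \<i> * of_real (x $ j) * \<psi> x) y else 0)"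
    by (intro sum.cong refl) (simp add: axis_def)
  finally show "pd i (fourier \<psi>) y = fourier (\<lambda>x. - \<i> * of_real (x $ i) * \<psi> x) y" by simp
qed

lemma partials_fourier: "test_function \<psi> \<Longrightarrow> \<exists>\<psi>'. test_function \<psi>' \<and> supp \<psi>' \<subseteq> supp \<psi> \<and> partials is (fourier \<psi>) = fourier \<psi>'"
proof (induction "is")
  case (Cons i "is")
  then obtain \<psi>' where p: "test_function \<psi>'" "supp \<psi>' \<subseteq> supp \<psi>" "partials is (fourier \<psi>) = fourier \<psi>'" by blast
  have "supp (\<lambda>x. - \<i> * of_real (x $ i) * \<psi>' x) \<subseteq> supp \<psi>'" by (rule supp_subset) simp
  then show ?case unfolding partials_Cons p(3) pd_fourier[OF p(1)]
    using p test_function_coord_mult[OF p(1), of "-\<i>" i] by blast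
qed auto

lemma smooth_fourier:
  fixes \<psi> :: "real^'n::finite \<Rightarrow> complex"
  assumes "test_function \<psi>" shows "smooth (fourier \<psi>)"
proof (rule smooth_coinduct[of _ "fourier ` {\<psi>. test_function \<psi>}"])
  show "g differentiable at x" if "g \<in> fourier ` {\<psi>. test_function \<psi>}" for g and x :: "real^'n"
    using that fourier_has_derivative unfolding differentiable_def by blast
  show "pd i g \<in> fourier ` {\<psi>. test_function \<psi>}" if "g \<in> fourier ` {\<psi>. test_function \<psi>}" for g i
    using that test_function_coord_mult[of _ "- \<i>" i] by (auto simp: pd_fourier)
qed (use assms in auto)

lemma increment_along_axis:
  fixes F :: "real^'n::finite \<Rightarrow> complex"
  assumes d: "\<And>x. F differentiable at x" and B: "\<And>s. 0 \<le> s \<Longrightarrow> s \<le> 1 \<Longrightarrow> norm (pd i F (x + s *\<^sub>R axis i 1)) \<le> B"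
    and t: "0 \<le> t" "t \<le> 1"
  shows "norm (F (x + t *\<^sub>R axis i 1) - F x) \<le> B * t"
proof -
  let ?g = "\<lambda>s. F (x + s *\<^sub>R axis i 1)"
  have B0: "0 \<le> B" using B[of 0] norm_ge_zero order_trans by (metis order_refl zero_le_one)
  have g: "(?g has_derivative (\<lambda>k. k *\<^sub>R pd i F (x + s *\<^sub>R axis i 1))) (at s within {0..1})" for s
  proof -
    have F: "(F has_derivative frechet_derivative F (at (x + s *\<^sub>R axis i 1))) (at (x + s *\<^sub>R axis i 1))"
      using d by (simp add: frechet_derivative_works)
    have a: "((\<lambda>s. x + s *\<^sub>R axis i 1) has_derivative (\<lambda>k. k *\<^sub>R axis i 1)) (at s)"
      by (auto intro!: derivative_eq_intros)
    have "(?g has_derivative (\<lambda>k. frechet_derivative F (at (x + s *\<^sub>R axis i 1)) (k *\<^sub>R axis i 1))) (at s)"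
      using diff_chain_at[OF a F] by (simp add: o_def)
    then have "(?g has_derivative (\<lambda>k. k *\<^sub>R pd i F (x + s *\<^sub>R axis i 1))) (at s)"
      using linear_scale[OF has_derivative_linear[OF F]] by (simp add: pd_def)
    then show ?thesis by (rule has_derivative_at_withinI)
  qed
  have "norm (?g t - ?g 0) \<le> B * norm (t - 0)"
  proof (rule differentiable_bound[OF _ g])
    show "onorm (\<lambda>k. k *\<^sub>R pd i F (x + s *\<^sub>R axis i 1)) \<le> B" if "s \<in> {0..1}" for s
      using that B[of s] B0 by (intro onorm_bound) (auto simp: mult.commute[of B] intro!: mult_left_mono)
  qed (use t in auto)
  then show ?thesis using t by simp
qed

lemma lborel_integral_shift:
  fixes F :: "real^'n::finite \<Rightarrow> complex"
  assumes "integrable lborel F"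
  shows "integrable lborel (\<lambda>x. F (x + v))" "(LINT x|lborel. F (x + v)) = (LINT x|lborel. F x)"
proof -
  have eq: "distr lborel borel (\<lambda>x. x + v) = (lborel :: (real^'n) measure)"
  proof -
    have "(\<lambda>x. x + v) = (+) v" by (rule ext) (rule add.commute)
    then show ?thesis using lborel_distr_plus[of v] by (simp only:)
  qed
  have m: "(\<lambda>x::real^'n. x + v) \<in> measurable lborel borel" by measurable
  have Fm: "F \<in> borel_measurable borel" using borel_measurable_integrable[OF assms] by simp
  show "integrable lborel (\<lambda>x. F (x + v))"
    using integrable_distr_eq[OF m, of F] Fm assms unfolding eq by simp
  show "(LINT x|lborel. F (x + v)) = (LINT x|lborel. F x)"
    using integral_distr[OF m, of F] Fm unfolding eq by simp
qed

text \<open>The difference quotients along the axis have integral \<open>0\<close> by translation invariance of Lebesgue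
  measure, and converge dominatedly.\<close>

lemma integral_pd_eq_0:
  fixes F :: "real^'n::finite \<Rightarrow> complex"
  assumes d: "\<And>x. F differentiable at x" and F: "integrable lborel F"
    and B: "\<And>x. norm (pd i F x) \<le> C / (1 + norm x) ^ (2 * CARD('n))"
  shows "(LINT x|lborel. pd i F x) = 0"
proof -
  let ?e = "axis i 1 :: real^'n"
  let ?h = "\<lambda>n::nat. 1 / real (Suc n)"
  let ?k = "2 * CARD('n)"
  define D where "D n x = real (Suc n) *\<^sub>R (F (x + ?h n *\<^sub>R ?e) - F x)" for n x
  have D0: "(LINT x|lborel. D n x) = 0" for n
    unfolding D_def using lborel_integral_shift[OF F, of "?h n *\<^sub>R ?e"] F by simp
  have Fm: "F \<in> borel_measurable borel" using borel_measurable_integrable[OF F] by simp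
  have Dm: "D n \<in> borel_measurable lborel" for n
    unfolding D_def[abs_def] using F lborel_integral_shift(1)[OF F, of "?h n *\<^sub>R ?e"] by auto
  have Dlim: "(\<lambda>n. D n x) \<longlonglongrightarrow> pd i F x" for x
  proof -
    have "((\<lambda>s. F (x + s *\<^sub>R ?e)) has_derivative (\<lambda>s. s *\<^sub>R pd i F x)) (at 0)"
    proof -
      have F': "(F has_derivative frechet_derivative F (at x)) (at (x + 0 *\<^sub>R ?e))"
        using d by (simp add: frechet_derivative_works)
      have a: "((\<lambda>s. x + s *\<^sub>R ?e) has_derivative (\<lambda>k. k *\<^sub>R ?e)) (at 0)"
        by (auto intro!: derivative_eq_intros)
      show ?thesis
        using diff_chain_at[OF a F'] linear_scale[OF has_derivative_linear[OF F']]
        by (simp add: o_def pd_def)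
    qed
    then have "(\<lambda>s. (F (x + s *\<^sub>R ?e) - F x) /\<^sub>R s) \<midarrow>0\<rightarrow> pd i F x"
    proof -
      assume "((\<lambda>s. F (x + s *\<^sub>R ?e)) has_derivative (\<lambda>s. s *\<^sub>R pd i F x)) (at 0)"
      then have "(\<lambda>s. norm (F (x + s *\<^sub>R ?e) - F x - s *\<^sub>R pd i F x) / norm s) \<midarrow>0\<rightarrow> 0"
        by (simp add: has_derivative_at)
      then have "(\<lambda>s. norm ((F (x + s *\<^sub>R ?e) - F x) /\<^sub>R s - pd i F x)) \<midarrow>0\<rightarrow> 0"
      proof (rule Lim_transform_eventually)
        have "norm (w - s *\<^sub>R D) / norm s = norm (w /\<^sub>R s - D)" if "s \<noteq> 0" for w D :: complex and s :: real
        proof -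
          have "w /\<^sub>R s - D = (w - s *\<^sub>R D) /\<^sub>R s" using that by (simp add: scaleR_diff_right)
          then show ?thesis by (simp add: divide_inverse mult.commute)
        qed
        then show "\<forall>\<^sub>F s in at 0. norm (F (x + s *\<^sub>R ?e) - F x - s *\<^sub>R pd i F x) / norm s = norm ((F (x + s *\<^sub>R ?e) - F x) /\<^sub>R s - pd i F x)"
          unfolding eventually_at_filter by (intro always_eventually) blast
      qed
      then show ?thesis by (rule LIM_zero_cancel[OF tendsto_norm_zero_cancel])
    qed
    moreover have "filterlim ?h (at 0) sequentially"
      by (rule filterlim_atI) (use LIMSEQ_inverse_real_of_nat in \<open>simp_all only: inverse_eq_divide\<close>, simp)
    ultimately have "(\<lambda>n. (F (x + ?h n *\<^sub>R ?e) - F x) /\<^sub>R ?h n) \<longlonglongrightarrow> pd i F x"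
      by (rule filterlim_compose)
    then show ?thesis by (simp add: D_def)
  qed
  have C0: "0 \<le> C" using B[of 0] by (auto intro: order_trans[OF norm_ge_zero])
  have Db: "norm (D n x) \<le> C * 2 ^ ?k * (1 / (1 + norm x) ^ ?k)" for n x
  proof -
    have "norm (F (x + ?h n *\<^sub>R ?e) - F x) \<le> (C * 2 ^ ?k * (1 / (1 + norm x) ^ ?k)) * ?h n"
    proof (rule increment_along_axis[OF d])
      fix s :: real assume s: "0 \<le> s" "s \<le> 1"
      have "norm x \<le> norm (x + s *\<^sub>R ?e) + norm (s *\<^sub>R ?e)" using norm_triangle_ineq4[of "x + s *\<^sub>R ?e" "s *\<^sub>R ?e"] by simp
      moreover have "norm (s *\<^sub>R ?e) = s" using s by simp
      ultimately have "1 + norm x \<le> 2 + 2 * norm (x + s *\<^sub>R ?e)"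
        using s norm_ge_zero[of "x + s *\<^sub>R ?e"] by linarith
      then have "1 + norm x \<le> 2 * (1 + norm (x + s *\<^sub>R ?e))" by simp
      then have "(1 + norm x) ^ ?k \<le> (2 * (1 + norm (x + s *\<^sub>R ?e))) ^ ?k" by (intro power_mono) auto
      then have p: "(1 + norm x) ^ ?k \<le> 2 ^ ?k * (1 + norm (x + s *\<^sub>R ?e)) ^ ?k" by (simp only: power_mult_distrib)
      have pos: "0 < (1 + norm y) ^ ?k" for y :: "real^'n" by (intro zero_less_power) (simp add: add_pos_nonneg)
      have "C / (1 + norm (x + s *\<^sub>R ?e)) ^ ?k \<le> C * 2 ^ ?k * (1 / (1 + norm x) ^ ?k)"
        using mult_left_mono[OF p C0] pos[of x] pos[of "x + s *\<^sub>R ?e"] by (simp add: field_simps)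
      then show "norm (pd i F (x + s *\<^sub>R ?e)) \<le> C * 2 ^ ?k * (1 / (1 + norm x) ^ ?k)"
        using B[of "x + s *\<^sub>R ?e"] by linarith
    qed auto
    then have "real (Suc n) * norm (F (x + ?h n *\<^sub>R ?e) - F x) \<le> real (Suc n) * ((C * 2 ^ ?k * (1 / (1 + norm x) ^ ?k)) * ?h n)"
      by (rule mult_left_mono) simp
    then show ?thesis by (simp add: D_def)
  qed
  have gint: "integrable lborel (\<lambda>x::real^'n. C * 2 ^ ?k * (1 / (1 + norm x) ^ ?k))"
  proof (rule integrable_mult_right)
    have "integrable lborel (\<lambda>x::real^'n. complex_of_real (1 / (1 + norm x) ^ ?k))"
      by (rule decay_integrable[of _ 1]) (auto simp: norm_divide norm_power simp del: of_real_add)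
    then show "integrable lborel (\<lambda>x::real^'n. 1 / (1 + norm x) ^ ?k)" by (rule complex_of_real_integrable_eq[THEN iffD1])
  qed
  have pm: "pd i F \<in> borel_measurable lborel"
    using Dlim Dm by (rule borel_measurable_LIMSEQ_metric[rotated])
  have "(\<lambda>n. LINT x|lborel. D n x) \<longlonglongrightarrow> (LINT x|lborel. pd i F x)"
    by (rule integral_dominated_convergence[where s=D, OF pm Dm gint]) (use Dlim Db in auto)
  then show ?thesis unfolding D0 using LIMSEQ_unique tendsto_const by blast
qed

lemma exp_inner_smooth:
  fixes y :: "real^'n::finite"
  shows "smooth (\<lambda>x. cis (- (x \<bullet> y)))" "pd i (\<lambda>x. cis (- (x \<bullet> y))) = (\<lambda>x. - \<i> * of_real (y $ i) * cis (- (x \<bullet> y)))"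
proof -
  have d: "((\<lambda>x. c * cis (- (x \<bullet> y))) has_derivative (\<lambda>h. c * (cis (- (x \<bullet> y)) * (- \<i> * of_real (h \<bullet> y))))) (at x)" for c x
  proof -
    have a: "((\<lambda>x. \<i> * of_real (- (x \<bullet> y))) has_derivative (\<lambda>h. - \<i> * of_real (h \<bullet> y))) (at x)"
      by (auto intro!: derivative_eq_intros)
    have e: "(exp has_derivative (\<lambda>z. exp (\<i> * of_real (- (x \<bullet> y))) * z)) (at (\<i> * of_real (- (x \<bullet> y))))"
      using DERIV_exp[of "\<i> * of_real (- (x \<bullet> y))"] by (simp only: has_field_derivative_def)
    have "((\<lambda>x. cis (- (x \<bullet> y))) has_derivative (\<lambda>h. cis (- (x \<bullet> y)) * (- \<i> * of_real (h \<bullet> y)))) (at x)"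
      using diff_chain_at[OF a e] by (simp only: o_def cis_conv_exp)
    then show ?thesis by (rule has_derivative_mult_right)
  qed
  have p: "pd i (\<lambda>x. c * cis (- (x \<bullet> y))) = (\<lambda>x. (- \<i> * of_real (y $ i) * c) * cis (- (x \<bullet> y)))" for c i
    by (rule ext) (subst pd_eqI[OF d], simp add: inner_axis')
  show "pd i (\<lambda>x. cis (- (x \<bullet> y))) = (\<lambda>x. - \<i> * of_real (y $ i) * cis (- (x \<bullet> y)))"
    using p[of i 1] by simp
  show "smooth (\<lambda>x. cis (- (x \<bullet> y)))"
  proof (rule smooth_coinduct[of _ "range (\<lambda>c x. c * cis (- (x \<bullet> y)))"])
    show "(\<lambda>x. cis (- (x \<bullet> y))) \<in> range (\<lambda>c x. c * cis (- (x \<bullet> y)))" by (rule image_eqI[of _ _ 1]) auto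
    show "g differentiable at x" if "g \<in> range (\<lambda>c x. c * cis (- (x \<bullet> y)))" for g x
      using that d unfolding differentiable_def by blast
    show "pd i g \<in> range (\<lambda>c x. c * cis (- (x \<bullet> y)))" if gX: "g \<in> range (\<lambda>c x. c * cis (- (x \<bullet> y)))" for g i
    proof -
      obtain c where "g = (\<lambda>x. c * cis (- (x \<bullet> y)))" using gX by blast
      then have "pd i g = (\<lambda>x. (- \<i> * of_real (y $ i) * c) * cis (- (x \<bullet> y)))" by (simp only: p)
      then show ?thesis by (rule range_eqI)
    qed
  qed
qed

lemma fourier_pd:
  fixes \<psi> :: "real^'n::finite \<Rightarrow> complex"
  assumes \<psi>: "test_function \<psi>"
  shows "fourier (pd i \<psi>) y = \<i> * of_real (y $ i) * fourier \<psi> y"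
proof -
  let ?F = "\<lambda>x. cis (- (x \<bullet> y)) * \<psi> x"
  have s: "smooth \<psi>" using \<psi> by (simp add: test_function_def)
  have tF: "test_function ?F" by (rule test_function_mult[OF \<psi> exp_inner_smooth(1)])
  have eq: "pd i ?F x = cis (- (x \<bullet> y)) * pd i \<psi> x - \<i> * of_real (y $ i) * (cis (- (x \<bullet> y)) * \<psi> x)" for x
    by (subst pd_mult) (auto intro: smooth_differentiable exp_inner_smooth(1) s simp: exp_inner_smooth(2))
  obtain C where "\<And>x. norm (pd i ?F x) \<le> C / (1 + norm x) ^ (2 * CARD('n))"
    using test_function_decay[OF test_function_pd[OF tF]] by blast
  then have "(LINT x|lborel. pd i ?F x) = 0"
    using tF by (intro integral_pd_eq_0) (auto intro!: smooth_differentiable test_function_integrable simp: test_function_def)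
  moreover have "(LINT x|lborel. pd i ?F x) = fourier (pd i \<psi>) y - \<i> * of_real (y $ i) * fourier \<psi> y"
    unfolding eq fourier_lborel[OF \<psi>] fourier_lborel[OF test_function_pd[OF \<psi>]]
    using integrable_cis_mult[OF test_function_integrable[OF \<psi>], of y] integrable_cis_mult[OF test_function_integrable[OF test_function_pd[OF \<psi>, of i]], of y]
    by (subst Bochner_Integration.integral_diff) auto
  ultimately show ?thesis by simp
qed

text \<open>Each derivative of \<open>\<psi>\<close> gains a factor \<open>y\<^sub>i\<close>, so the decay follows by induction on its order.\<close>

lemma fourier_decay:
  fixes \<psi> :: "real^'n::finite \<Rightarrow> complex"
  assumes "test_function \<psi>"
  shows "\<exists>C>0. \<forall>y. norm (fourier \<psi> y) \<le> C / (1 + norm y) ^ k"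
  using assms
proof (induction k arbitrary: \<psi>)
  case 0
  have "norm (fourier \<psi> y) \<le> (LINT x|lborel. norm (\<psi> x)) + 1" for y
  proof -
    have "norm (fourier \<psi> y) \<le> (LINT x|lborel. norm (cis (- (x \<bullet> y)) * \<psi> x))"
      unfolding fourier_lborel[OF 0] by (rule integral_norm_bound)
    then show ?thesis by (simp add: norm_mult)
  qed
  moreover have "0 < (LINT x|lborel. norm (\<psi> x)) + 1" by (simp add: add_nonneg_pos)
  ultimately show ?case by auto
next
  case (Suc k)
  obtain C0 where C0: "0 < C0" "\<And>y. norm (fourier \<psi> y) \<le> C0 / (1 + norm y) ^ k" using Suc by blast
  have "\<forall>i. \<exists>C>0. \<forall>y. norm (fourier (pd i \<psi>) y) \<le> C / (1 + norm y) ^ k" using Suc test_function_pd by blast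
  then obtain C where C: "\<And>i. 0 < C i" "\<And>i y. norm (fourier (pd i \<psi>) y) \<le> C i / (1 + norm y) ^ k" by metis
  define K where "K = C0 + (\<Sum>i\<in>UNIV. C i)"
  have K: "0 < K" unfolding K_def using C0 C(1) by (intro add_pos_nonneg sum_nonneg) (auto intro: less_imp_le)
  have "norm (fourier \<psi> y) \<le> K / (1 + norm y) ^ Suc k" for y
  proof -
    have "(1 + norm y) * norm (fourier \<psi> y) \<le> norm (fourier \<psi> y) + (\<Sum>i\<in>UNIV. \<bar>y $ i\<bar>) * norm (fourier \<psi> y)"
      using mult_right_mono[OF norm_le_l1_cart[of y] norm_ge_zero[of "fourier \<psi> y"]] by (simp add: distrib_right)
    also have "(\<Sum>i\<in>UNIV. \<bar>y $ i\<bar>) * norm (fourier \<psi> y) = (\<Sum>i\<in>UNIV. norm (fourier (pd i \<psi>) y))"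
      by (simp add: fourier_pd[OF Suc.prems] norm_mult sum_distrib_right)
    also have "norm (fourier \<psi> y) + (\<Sum>i\<in>UNIV. norm (fourier (pd i \<psi>) y)) \<le> C0 / (1 + norm y) ^ k + (\<Sum>i\<in>UNIV. C i / (1 + norm y) ^ k)"
      by (intro add_mono sum_mono C0 C)
    also have "\<dots> = K / (1 + norm y) ^ k" by (simp add: K_def add_divide_distrib sum_divide_distrib)
    finally have le: "(1 + norm y) * norm (fourier \<psi> y) \<le> K / (1 + norm y) ^ k" .
    have pos: "0 < 1 + norm y" by (simp add: add_pos_nonneg)
    then have "norm (fourier \<psi> y) \<le> K / (1 + norm y) ^ k / (1 + norm y)"
      using le by (subst pos_le_divide_eq) (simp_all add: mult.commute)
    then show ?thesis by (simp add: mult.commute)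
  qed
  then show ?case using K by blast
qed

lemma schwartz_fourier:
  fixes \<psi> :: "real^'n::finite \<Rightarrow> complex"
  assumes "test_function \<psi>" shows "schwartz (fourier \<psi>)"
  unfolding schwartz_def
proof (intro conjI allI)
  show "smooth (fourier \<psi>)" by (rule smooth_fourier[OF assms])
  fix "is" :: "'n list" and k
  obtain \<psi>' where p: "test_function \<psi>'" "partials is (fourier \<psi>) = fourier \<psi>'"
    using partials_fourier[OF assms] by blast
  obtain C where C: "0 < C" "\<And>y. norm (fourier \<psi>' y) \<le> C / (1 + norm y) ^ k" using fourier_decay[OF p(1)] by blast
  have "norm x ^ k * norm (partials is (fourier \<psi>) x) \<le> C" for x
  proof -
    have pos: "0 < (1 + norm x) ^ k" by (intro zero_less_power) (simp add: add_pos_nonneg)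
    have "norm x ^ k * norm (fourier \<psi>' x) \<le> (1 + norm x) ^ k * (C / (1 + norm x) ^ k)"
      by (intro mult_mono power_mono C) auto
    moreover have "a * (C / a) = C" if "0 < a" for a using that by simp
    ultimately show ?thesis using pos by (simp only: p(2))
  qed
  then show "\<exists>C. \<forall>x. norm x ^ k * norm (partials is (fourier \<psi>) x) \<le> C" by blast
qed

section \<open>A rapidly decreasing kernel with compactly supported Fourier transform\<close>

text \<open>The denominator vanishes only off the support of \<open>g\<close>. The functions \<open>g(x) (x\<^sub>i - w)\<^bsup>-m\<^esup>\<close> form a class
  closed under derivatives; at \<open>x\<^sub>i = w\<close> both sides are \<open>0\<close> since \<open>inverse 0 = 0\<close>.\<close>

lemma test_function_divide_coord:
  fixes g :: "real^'n::finite \<Rightarrow> complex"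
  assumes g: "test_function g" "\<And>x. g x \<noteq> 0 \<Longrightarrow> \<bar>x $ i\<bar> \<le> \<rho>" and w: "\<rho> < \<bar>w\<bar>"
  shows "test_function (\<lambda>x. g x * inverse (of_real (x $ i - w)))"
proof -
  define P where "P g \<longleftrightarrow> test_function g \<and> (\<forall>x::real^'n. g x \<noteq> 0 \<longrightarrow> \<bar>x $ i\<bar> \<le> \<rho>)" for g
  define q where "q x = inverse (complex_of_real (x $ i - w))" for x :: "real^'n"
  let ?X = "{\<lambda>x. g x * q x ^ m | g m. P g}"
  have P_pd: "P (pd j g)" if gP: "P g" for g j
  proof -
    have "closed {x::real^'n. \<bar>x $ i\<bar> \<le> \<rho>}" by (intro closed_Collect_le continuous_intros)
    moreover have "{x. g x \<noteq> 0} \<subseteq> {x. \<bar>x $ i\<bar> \<le> \<rho>}" using gP by (auto simp: P_def)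
    ultimately have "supp g \<subseteq> {x. \<bar>x $ i\<bar> \<le> \<rho>}" unfolding supp_def by (rule closure_minimal[rotated])
    then have "pd j g x \<noteq> 0 \<Longrightarrow> \<bar>x $ i\<bar> \<le> \<rho>" for x using supp_pd[of j g] not_supp[of x "pd j g"] by blast
    then show ?thesis using gP test_function_pd by (auto simp: P_def)
  qed
  have deriv: "(\<lambda>x. g x * q x ^ m) differentiable at x"
     "pd j (\<lambda>x. g x * q x ^ m) x = (of_real (x $ i - w) * pd j g x - (if j = i then of_nat m * g x else 0)) * q x ^ Suc m"
    if gP: "P g" for g m j x
  proof -
    have "(\<lambda>x. g x * q x ^ m) differentiable at x \<and>
     pd j (\<lambda>x. g x * q x ^ m) x = (of_real (x $ i - w) * pd j g x - (if j = i then of_nat m * g x else 0)) * q x ^ Suc m"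
    proof (cases "x $ i = w")
      case True
      have "((\<lambda>x. g x * q x ^ m) has_derivative (\<lambda>h. 0)) (at x)"
      proof (rule locally_zero_has_derivative[of "{y. \<rho> < \<bar>y $ i\<bar>}"])
        show "open {y::real^'n. \<rho> < \<bar>y $ i\<bar>}" by (intro open_Collect_less continuous_intros)
      qed (use True w gP in \<open>auto simp: P_def\<close>)
      then show ?thesis using True unfolding differentiable_def by (auto simp: pd_eqI q_def)
    next
      case False
      then have D: "complex_of_real (x $ i - w) \<noteq> 0" by simp
      have a: "((\<lambda>x::real^'n. complex_of_real (x $ i - w)) has_derivative (\<lambda>k. of_real (k $ i))) (at x)"
        by (auto intro!: derivative_eq_intros bounded_linear.has_derivative[OF bounded_linear_vec_nth])
      have q: "((\<lambda>y. q y ^ m) has_derivative (\<lambda>k. of_nat m * - (q x * of_real (k $ i) * q x) * q x ^ (m - 1))) (at x)"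
        unfolding q_def using has_derivative_power[OF Deriv.has_derivative_inverse[OF D a], of m] by (simp add: mult_ac)
      have qd: "(\<lambda>y. q y ^ m) differentiable at x" using q unfolding differentiable_def by blast
      have gd: "g differentiable at x" using gP by (auto simp: P_def test_function_def intro: smooth_differentiable)
      have pdq: "pd j (\<lambda>y. q y ^ m) x = - (if j = i then of_nat m else 0) * q x ^ Suc m"
        by (subst pd_eqI[OF q]) (cases m, auto simp: axis_def)
      have Dq: "of_real (x $ i - w) * q x = 1" using D by (simp add: q_def del: of_real_diff)
      have "q x ^ m = (of_real (x $ i - w) * q x) * q x ^ m" by (simp only: Dq mult_1_left)
      also have "\<dots> = of_real (x $ i - w) * q x ^ Suc m" by simp
      finally have qm: "q x ^ m = of_real (x $ i - w) * q x ^ Suc m" .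
      have "pd j (\<lambda>x. g x * q x ^ m) x = pd j g x * q x ^ m + g x * pd j (\<lambda>y. q y ^ m) x"
        by (rule pd_mult[OF gd qd])
      also have "\<dots> = (of_real (x $ i - w) * pd j g x - (if j = i then of_nat m * g x else 0)) * q x ^ Suc m"
        unfolding pdq by (subst qm) (simp add: algebra_simps)
      finally show ?thesis using differentiable_mult[OF gd qd] by blast
    qed
    then show "(\<lambda>x. g x * q x ^ m) differentiable at x"
     "pd j (\<lambda>x. g x * q x ^ m) x = (of_real (x $ i - w) * pd j g x - (if j = i then of_nat m * g x else 0)) * q x ^ Suc m" by blast+
  qed
  have "smooth (\<lambda>x. g x * q x)"
  proof (rule smooth_coinduct[of _ ?X])
    show "(\<lambda>x. g x * q x) \<in> ?X" using g by (intro CollectI exI[of _ g] exI[of _ 1]) (auto simp: P_def)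
    show "h differentiable at x" if "h \<in> ?X" for h x using that deriv(1) by auto
    show "pd j h \<in> ?X" if hX: "h \<in> ?X" for h j
    proof -
      obtain g m where h: "h = (\<lambda>x. g x * q x ^ m)" "P g" using hX by blast
      define g' where "g' x = (of_real (x $ i) - of_real w) * pd j g x + (if j = i then - of_nat m else 0) * g x" for x
      have tg: "test_function (pd j g)" "test_function g" using h(2) P_pd[OF h(2)] by (auto simp: P_def)
      obtain r1 where r1: "\<And>x. r1 < norm x \<Longrightarrow> pd j g x = 0" using test_function_bounded_support[OF tg(1)] by blast
      obtain r2 where r2: "\<And>x. r2 < norm x \<Longrightarrow> g x = 0" using test_function_bounded_support[OF tg(2)] by blast
      have "test_function g'"
      proof (rule test_functionI[of _ "max r1 r2"])
        show "g' x = 0" if "max r1 r2 < norm x" for x using that r1 r2 by (simp add: g'_def)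
        show "smooth g'" unfolding g'_def[abs_def] using tg
          by (intro smooth_add smooth_mult smooth_diff smooth_coord smooth_const) (auto simp: test_function_def)
      qed
      moreover have "\<bar>x $ i\<bar> \<le> \<rho>" if "g' x \<noteq> 0" for x
      proof -
        have "g x \<noteq> 0 \<or> pd j g x \<noteq> 0" using that by (auto simp: g'_def)
        then show ?thesis using h(2) P_pd[OF h(2), of j] unfolding P_def by blast
      qed
      ultimately have "P g'" by (simp add: P_def)
      moreover have "pd j h = (\<lambda>x. g' x * q x ^ Suc m)"
        unfolding h(1) by (rule ext) (simp add: deriv(2)[OF h(2)] g'_def)
      ultimately show ?thesis by blast
    qed
  qed
  then show ?thesis using g(1) compact_supp_subset[of g] supp_subset[of g "\<lambda>x. g x * q x"]
    by (simp add: test_function_def q_def)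
qed

text \<open>By Fourier inversion the integral is a multiple of \<open>\<kappa>(w) = 0\<close>; there is a direct proof. If \<open>\<kappa>(x) = (x\<^sub>i - w\<^sub>i) \<kappa>'(x)\<close>, the integrand is, up to a constant factor, the partial derivative of \<open>e\<^bsup>iuw\<^esup>\<close> times
  the Fourier transform of \<open>\<kappa>'\<close>; so its integral is \<open>0\<close>.\<close>

lemma fourier_integral_vanishes:
  fixes \<kappa> :: "real^'n::finite \<Rightarrow> complex"
  assumes k: "test_function \<kappa>" "\<And>x. \<kappa> x \<noteq> 0 \<Longrightarrow> \<bar>x $ i\<bar> \<le> \<rho>" and w: "\<rho> < \<bar>w $ i\<bar>"
  shows "(LINT u|lborel. fourier \<kappa> u * cis (u \<bullet> w)) = 0"
proof -
  define \<kappa>' where "\<kappa>' x = \<kappa> x * inverse (of_real (x $ i - w $ i))" for x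
  have k': "test_function \<kappa>'" unfolding \<kappa>'_def[abs_def] by (rule test_function_divide_coord[OF k w])
  define F where "F u = cis (- (u \<bullet> (- w))) * fourier \<kappa>' u" for u
  have sF: "smooth F" unfolding F_def[abs_def] by (intro smooth_mult exp_inner_smooth smooth_fourier k')
  have k'i: "test_function (\<lambda>x. - \<i> * of_real (x $ i) * \<kappa>' x)" by (rule test_function_coord_mult[OF k'])
  have pdF: "pd i F u = - \<i> * (fourier \<kappa> u * cis (u \<bullet> w))" for u
  proof -
    have "pd i F u = \<i> * of_real (w $ i) * cis (u \<bullet> w) * fourier \<kappa>' u + cis (u \<bullet> w) * fourier (\<lambda>x. - \<i> * of_real (x $ i) * \<kappa>' x) u"
    proof -
      have "pd i F u = pd i (\<lambda>u. cis (- (u \<bullet> (- w)))) u * fourier \<kappa>' u + cis (- (u \<bullet> (- w))) * pd i (fourier \<kappa>') u"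
        unfolding F_def[abs_def]
        by (rule pd_mult[OF smooth_differentiable[OF exp_inner_smooth(1)] smooth_differentiable[OF smooth_fourier[OF k']]])
      then show ?thesis unfolding exp_inner_smooth(2) pd_fourier[OF k'] by simp
    qed
    also have "\<dots> = cis (u \<bullet> w) * (\<i> * of_real (w $ i) * fourier \<kappa>' u + fourier (\<lambda>x. - \<i> * of_real (x $ i) * \<kappa>' x) u)"
      by (simp add: algebra_simps)
    also have "\<i> * of_real (w $ i) * fourier \<kappa>' u + fourier (\<lambda>x. - \<i> * of_real (x $ i) * \<kappa>' x) u = 
        (LINT x|lborel. \<i> * of_real (w $ i) * (cis (- (x \<bullet> u)) * \<kappa>' x) + cis (- (x \<bullet> u)) * (- \<i> * of_real (x $ i) * \<kappa>' x))"
      unfolding fourier_lborel[OF k'] fourier_lborel[OF k'i]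
      using integrable_cis_mult[OF test_function_integrable[OF k'], of u] integrable_cis_mult[OF test_function_integrable[OF k'i], of u]
      by (subst Bochner_Integration.integral_add) auto
    also have "\<dots> = (LINT x|lborel. - \<i> * (cis (- (x \<bullet> u)) * \<kappa> x))"
    proof (rule Bochner_Integration.integral_cong[OF refl])
      fix x :: "real^'n"
      have "of_real (x $ i - w $ i) * \<kappa>' x = \<kappa> x"
      proof (cases "x $ i = w $ i")
        case True
        then have "\<kappa> x = 0" using k(2)[of x] w by auto
        then show ?thesis by (simp add: \<kappa>'_def)
      qed (simp add: \<kappa>'_def del: of_real_diff)
      then have "- \<i> * (cis (- (x \<bullet> u)) * \<kappa> x) = - \<i> * (cis (- (x \<bullet> u)) * (of_real (x $ i - w $ i) * \<kappa>' x))" by simp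
      then show "\<i> * of_real (w $ i) * (cis (- (x \<bullet> u)) * \<kappa>' x) + cis (- (x \<bullet> u)) * (- \<i> * of_real (x $ i) * \<kappa>' x) = - \<i> * (cis (- (x \<bullet> u)) * \<kappa> x)"
        by (simp add: algebra_simps)
    qed
    also have "\<dots> = - \<i> * fourier \<kappa> u" unfolding fourier_lborel[OF k(1)] by (rule integral_mult_right_zero)
    finally show ?thesis by (simp add: mult_ac)
  qed
  obtain C where C: "\<And>y. norm (fourier \<kappa> y) \<le> C / (1 + norm y) ^ (2 * CARD('n))"
    using fourier_decay[OF k(1)] by blast
  obtain C' where C': "\<And>y. norm (fourier \<kappa>' y) \<le> C' / (1 + norm y) ^ (2 * CARD('n))"
    using fourier_decay[OF k'] by blast
  have "integrable lborel F"
    by (rule decay_integrable[of _ C']) (use C' smooth_measurable[OF sF] in \<open>auto simp: F_def norm_mult\<close>)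
  then have "(LINT u|lborel. pd i F u) = 0"
    by (rule integral_pd_eq_0[OF smooth_differentiable[OF sF], of _ C]) (use C in \<open>simp add: pdF norm_mult\<close>)
  then show ?thesis by (simp add: pdF)
qed

lemma lborel_Fubini_dominated:
  fixes F :: "(real^'n::finite) \<times> (real^'n) \<Rightarrow> complex" and f g :: "real^'n \<Rightarrow> real"
  assumes F[measurable]: "F \<in> borel_measurable (lborel \<Otimes>\<^sub>M lborel)"
    and fg: "integrable lborel f" "integrable lborel g" "\<And>x y. norm (F (x, y)) \<le> f x * g y"
  shows "(LINT x|lborel. LINT y|lborel. F (x, y)) = (LINT y|lborel. LINT x|lborel. F (x, y))"
proof -
  have [measurable]: "f \<in> borel_measurable borel" "g \<in> borel_measurable borel"
    using borel_measurable_integrable[OF fg(1)] borel_measurable_integrable[OF fg(2)] by auto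
  have "integrable (lborel \<Otimes>\<^sub>M lborel) (\<lambda>z. f (fst z) * g (snd z))"
  proof (rule lborel_pair.Fubini_integrable)
    show "(\<lambda>z. f (fst z) * g (snd z)) \<in> borel_measurable (lborel \<Otimes>\<^sub>M lborel)" by measurable
    show "integrable lborel (\<lambda>x. LINT y|lborel. norm (f (fst (x, y)) * g (snd (x, y))))"
      using fg(1) by (simp add: abs_mult)
    show "AE x in lborel. integrable lborel (\<lambda>y. f (fst (x, y)) * g (snd (x, y)))" using fg(2) by simp
  qed
  then have "integrable (lborel \<Otimes>\<^sub>M lborel) F"
    by (rule Bochner_Integration.integrable_bound[OF _ F])
       (use fg(3) in \<open>auto intro!: AE_I2 order_trans[OF fg(3) abs_ge_self]\<close>)
  then have "integrable (lborel \<Otimes>\<^sub>M lborel) (\<lambda>(x, y). F (x, y))" by simp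
  from lborel_pair.Fubini_integral[OF this] show ?thesis by simp
qed

lemma continuous_imp_measurable_pair:
  fixes F :: "(real^'n::finite) \<times> (real^'n) \<Rightarrow> complex"
  assumes "continuous_on UNIV F"
  shows "F \<in> borel_measurable (lborel \<Otimes>\<^sub>M lborel)"
proof -
  have "F \<in> borel_measurable borel" by (rule borel_measurable_continuous_onI[OF assms])
  moreover have "sets (lborel \<Otimes>\<^sub>M lborel) = sets (borel :: ((real^'n) \<times> (real^'n)) measure)"
    by (simp only: lborel_prod sets_lborel)
  ultimately show ?thesis by (simp add: measurable_def space_pair_measure)
qed

text \<open>The kernel is a multiple of the squared modulus of the Fourier transform of a bump \<open>\<kappa>\<close> supported
  in a small cube. Its own Fourier transform is an autocorrelation of \<open>\<kappa>\<close>, which lives on the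
  difference set of that cube. A square rather than the transform itself has the advantage that it
  is nonnegative and nonzero, so that it can be normalised.\<close>

lemma band_limited_kernel_exists:
  "\<exists>K::real^'n::finite \<Rightarrow> real. continuous_on UNIV K \<and> (\<forall>p. \<exists>C>0. \<forall>u. \<bar>K u\<bar> \<le> C / weight u ^ p) \<and>
     (LINT u|lborel. K u) = 1 \<and> (\<forall>w. 1 < norm w \<longrightarrow> (LINT u|lborel. of_real (K u) * cis (u \<bullet> w)) = 0)"
proof -
  let ?d = "real CARD('n)"
  have d: "1 \<le> ?d" using zero_less_card_finite[where 'a='n] by linarith
  obtain \<eta> :: "real^'n \<Rightarrow> complex" where \<eta>: "test_function \<eta>" "\<eta> 0 = 1" "\<And>x. \<eta> x = of_real (Re (\<eta> x))" "\<And>x. 0 \<le> Re (\<eta> x)"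
      "\<And>x i. \<eta> x \<noteq> 0 \<Longrightarrow> \<bar>x $ i\<bar> \<le> 1"
    using bump_exists by blast
  (* A vector of norm greater than 1 has a coordinate greater than 1 / d = 2 rho in modulus, by the
     l1 estimate of the norm; the difference set of the cube of half side rho is within 2 rho. *)
  define \<rho> where "\<rho> = 1 / (2 * ?d)"
  define \<kappa> where "\<kappa> x = \<eta> ((2 * ?d) *\<^sub>R x)" for x
  have \<kappa>: "test_function \<kappa>" unfolding \<kappa>_def[abs_def] by (rule test_function_scale[OF \<eta>(1)]) (use d in simp)
  have \<kappa>s: "\<bar>x $ i\<bar> \<le> \<rho>" if "\<kappa> x \<noteq> 0" for x i
    using \<eta>(5)[of "(2 * ?d) *\<^sub>R x" i] that d by (simp add: \<kappa>_def \<rho>_def abs_mult field_simps)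
  define K0 where "K0 u = (norm (fourier \<kappa> u))\<^sup>2" for u :: "real^'n"
  have fc: "continuous_on UNIV (fourier \<kappa>)" by (rule smooth_continuous_on[OF smooth_fourier[OF \<kappa>]])
  have K0c: "continuous_on UNIV K0" unfolding K0_def[abs_def] by (intro continuous_intros fc)
  have K0n: "0 \<le> K0 u" for u by (simp add: K0_def)
  obtain C1 where C1: "0 < C1" "\<And>u. norm (fourier \<kappa> u) \<le> C1" using fourier_decay[OF \<kappa>, of 0] by auto
  have K0d: "\<exists>C>0. \<forall>u. K0 u \<le> C / weight u ^ p" for p
  proof -
    obtain C where C: "0 < C" "\<And>u. norm (fourier \<kappa> u) \<le> C / (1 + norm u) ^ (CARD('n) * p)" using fourier_decay[OF \<kappa>] by blast
    have "K0 u \<le> (C1 * C) / weight u ^ p" for u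
    proof -
      have "weight u ^ p \<le> ((1 + norm u) ^ CARD('n)) ^ p" by (intro power_mono weight_le_power weight_nonneg)
      then have "C / (1 + norm u) ^ (CARD('n) * p) \<le> C / weight u ^ p"
        using C(1) weight_pos[of u] by (intro divide_left_mono) (auto simp: power_mult add_pos_nonneg)
      then have "norm (fourier \<kappa> u) \<le> C / weight u ^ p" using C(2)[of u] by linarith
      then have "norm (fourier \<kappa> u) * norm (fourier \<kappa> u) \<le> C1 * (C / weight u ^ p)"
        using C1 by (intro mult_mono) auto
      then show ?thesis by (simp add: K0_def power2_eq_square)
    qed
    then show ?thesis using C1(1) C(1) by (intro exI[of _ "C1 * C"]) simp
  qed
  have K0int: "integrable lborel K0"
  proof -
    obtain C where C: "0 < C" "\<And>u. K0 u \<le> C / weight u ^ 2" using K0d by blast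
    show ?thesis
    proof (rule Bochner_Integration.integrable_bound[OF integrable_mult_right[OF integrable_inverse_weight[of 2]]])
      show "K0 \<in> borel_measurable lborel" using borel_measurable_continuous_onI[OF K0c] by simp
      show "AE u in lborel. norm (K0 u) \<le> norm (C * (1 / weight u ^ 2))"
        using C K0n by (intro AE_I2) (simp add: abs_mult)
    qed simp
  qed
  have AE0: "h = (\<lambda>x. 0)" if hc: "continuous_on UNIV h" and ae: "AE x in lborel. h x = 0" for h :: "real^'n \<Rightarrow> real"
  proof -
    have o: "open {x. h x \<noteq> 0}" using hc by (intro open_Collect_neq) auto
    have "{x. h x \<noteq> 0} \<in> null_sets lborel"
      using ae o AE_iff_null_sets[of "{x. h x \<noteq> 0}" lborel] by simp
    then have "negligible {x. h x \<noteq> 0}" by (simp add: negligible_iff_null_sets null_sets_completionI)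
    then have "{x. h x \<noteq> 0} = {}" using o open_not_negligible by blast
    then show ?thesis by auto
  qed
  have f0: "fourier \<kappa> 0 \<noteq> 0"
  proof
    assume "fourier \<kappa> 0 = 0"
    then have "(LINT x|lborel. \<kappa> x) = 0" by (simp add: fourier_lborel[OF \<kappa>])
    moreover have \<kappa>re: "\<kappa> x = of_real (Re (\<kappa> x))" for x unfolding \<kappa>_def by (rule \<eta>(3))
    ultimately have "(LINT x|lborel. complex_of_real (Re (\<kappa> x))) = 0" by simp
    then have z: "(LINT x|lborel. Re (\<kappa> x)) = 0" by (simp only: integral_complex_of_real of_real_eq_0_iff)
    have i: "integrable lborel (\<lambda>x. Re (\<kappa> x))" using test_function_integrable[OF \<kappa>] by simp
    have "AE x in lborel. Re (\<kappa> x) = 0"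
      using integral_nonneg_eq_0_iff_AE[OF i] z \<eta>(4) by (simp add: \<kappa>_def)
    moreover have "continuous_on UNIV (\<lambda>x. Re (\<kappa> x))" using \<kappa> by (intro continuous_intros smooth_continuous_on) (simp add: test_function_def)
    ultimately have "(\<lambda>x. Re (\<kappa> x)) = (\<lambda>x. 0)" using AE0 by blast
    then have "Re (\<kappa> 0) = 0" by (rule fun_cong)
    then show False using \<eta>(2) by (simp add: \<kappa>_def)
  qed
  define I where "I = (LINT u|lborel. K0 u)"
  have I: "0 < I"
  proof -
    have "0 \<le> I" unfolding I_def by (intro integral_nonneg_AE) (simp add: K0n)
    moreover have "I \<noteq> 0"
    proof
      assume "I = 0"
      then have "AE x in lborel. K0 x = 0" using integral_nonneg_eq_0_iff_AE[OF K0int] K0n by (simp add: I_def)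
      then have "K0 = (\<lambda>x. 0)" by (rule AE0[OF K0c])
      then have "K0 0 = 0" by (rule fun_cong)
      then show False using f0 by (simp add: K0_def)
    qed
    ultimately show ?thesis by simp
  qed
  have van: "(LINT u|lborel. of_real (K0 u) * cis (u \<bullet> w)) = 0" if w: "1 < norm w" for w
  proof -
    obtain i where i: "1 / ?d < \<bar>w $ i\<bar>"
    proof (rule ccontr)
      assume "\<not> thesis"
      then have "\<bar>w $ i\<bar> \<le> 1 / ?d" for i using that by (meson not_le)
      then have "(\<Sum>i\<in>UNIV. \<bar>w $ i\<bar>) \<le> (\<Sum>i\<in>(UNIV::'n set). 1 / ?d)" by (intro sum_mono) auto
      then show False using norm_le_l1_cart[of w] w by simp
    qed
    let ?F = "\<lambda>z. fourier \<kappa> (fst z) * cis (fst z \<bullet> w) * cnj (cis (- (snd z \<bullet> fst z)) * \<kappa> (snd z))"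
    obtain C where C: "\<And>u. norm (fourier \<kappa> u) \<le> C / (1 + norm u) ^ (2 * CARD('n))" using fourier_decay[OF \<kappa>] by blast
    have fint: "integrable lborel (fourier \<kappa>)"
      by (rule decay_integrable[OF borel_measurable_continuous_onI[OF fc] C])
    have "of_real (K0 u) * cis (u \<bullet> w) = (LINT x|lborel. ?F (u, x))" for u
    proof -
      have "(LINT x|lborel. ?F (u, x)) = fourier \<kappa> u * cis (u \<bullet> w) * (LINT x|lborel. cnj (cis (- (x \<bullet> u)) * \<kappa> x))"
        unfolding fst_conv snd_conv by (rule integral_mult_right_zero)
      also have "(LINT x|lborel. cnj (cis (- (x \<bullet> u)) * \<kappa> x)) = cnj (fourier \<kappa> u)"
        unfolding fourier_lborel[OF \<kappa>] 
        by (rule integral_bounded_linear[OF bounded_linear_cnj integrable_cis_mult[OF test_function_integrable[OF \<kappa>]]])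
      also have "fourier \<kappa> u * cis (u \<bullet> w) * cnj (fourier \<kappa> u) = of_real (K0 u) * cis (u \<bullet> w)"
        unfolding K0_def complex_norm_square by (simp only: mult_ac)
      finally show ?thesis by simp
    qed
    then have "(LINT u|lborel. of_real (K0 u) * cis (u \<bullet> w)) = (LINT u|lborel. LINT x|lborel. ?F (u, x))" by (simp only:)
    also have "\<dots> = (LINT x|lborel. LINT u|lborel. ?F (u, x))"
    proof (rule lborel_Fubini_dominated)
      have kc: "continuous_on UNIV \<kappa>" using \<kappa> by (intro smooth_continuous_on) (simp add: test_function_def)
      have "continuous_on UNIV (\<lambda>z::(real^'n)\<times>(real^'n). fourier \<kappa> (fst z))" "continuous_on UNIV (\<lambda>z::(real^'n)\<times>(real^'n). \<kappa> (snd z))"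
        by (rule continuous_on_compose2[OF fc], auto intro: continuous_intros)
           (rule continuous_on_compose2[OF kc], auto intro: continuous_intros)
      then show "?F \<in> borel_measurable (lborel \<Otimes>\<^sub>M lborel)"
        unfolding cis_conv_exp by (intro continuous_imp_measurable_pair continuous_intros)
      show "integrable lborel (\<lambda>u. norm (fourier \<kappa> u))" using fint by simp
      show "integrable lborel (\<lambda>x. norm (\<kappa> x))" using test_function_integrable[OF \<kappa>] by simp
      show "norm (?F (u, x)) \<le> norm (fourier \<kappa> u) * norm (\<kappa> x)" for u x by (simp add: norm_mult)
    qed
    also have "\<dots> = (LINT x::real^'n|lborel. 0)"
    proof (rule Bochner_Integration.integral_cong[OF refl])
      fix x :: "real^'n"
      have "?F (u, x) = cnj (\<kappa> x) * (fourier \<kappa> u * cis (u \<bullet> (x + w)))" for u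
        by (simp add: cis_cnj cis_mult inner_add_right inner_commute mult_ac flip: cis_mult)
      then have "(LINT u|lborel. ?F (u, x)) = (LINT u|lborel. cnj (\<kappa> x) * (fourier \<kappa> u * cis (u \<bullet> (x + w))))"
        by (simp only:)
      also have "\<dots> = cnj (\<kappa> x) * (LINT u|lborel. fourier \<kappa> u * cis (u \<bullet> (x + w)))"
        by (rule integral_mult_right_zero)
      also have "\<dots> = 0"
      proof (cases "\<kappa> x = 0")
        case False
        have "\<rho> < \<bar>(x + w) $ i\<bar>"
        proof -
          have "2 * \<rho> < \<bar>w $ i\<bar>" using i d by (simp add: \<rho>_def)
          moreover have "\<bar>w $ i\<bar> \<le> \<bar>(x + w) $ i\<bar> + \<bar>x $ i\<bar>" by simp
          ultimately show ?thesis using \<kappa>s[OF False, of i] by linarith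
        qed
        then show ?thesis using fourier_integral_vanishes[OF \<kappa> \<kappa>s] by simp
      qed simp
      finally show "(LINT u|lborel. ?F (u, x)) = 0" .
    qed
    finally show ?thesis by simp
  qed
  show ?thesis
  proof (intro exI[of _ "\<lambda>u. K0 u / I"] conjI allI impI)
    show "continuous_on UNIV (\<lambda>u. K0 u / I)" using I by (intro continuous_intros K0c) auto
    show "(LINT u|lborel. K0 u / I) = 1" using I by (simp add: I_def[symmetric])
    show "\<exists>C>0. \<forall>u. \<bar>K0 u / I\<bar> \<le> C / weight u ^ p" for p
    proof -
      obtain C where C: "0 < C" "\<And>u. K0 u \<le> C / weight u ^ p" using K0d by blast
      have "\<bar>K0 u / I\<bar> \<le> (C / I) / weight u ^ p" for u
        using divide_right_mono[OF C(2)[of u], of I] I K0n[of u] by (simp add: mult.commute)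
      then show ?thesis using C(1) I by (intro exI[of _ "C / I"]) simp
    qed
    show "(LINT u|lborel. of_real (K0 u / I) * cis (u \<bullet> w)) = 0" if "1 < norm w" for w
      using van[OF that] by simp
  qed
qed

section \<open>Schwartz seminorms\<close>

text \<open>A bound for the seminorms of order at most \<open>n\<close> at once, with the weight \<open>1 + \<bar>x\<bar>\<close> in place of the
  powers of \<open>\<bar>x\<bar>\<close>, which is better adapted to translations.\<close>

definition seminorm_le :: "nat \<Rightarrow> (real^'n::finite \<Rightarrow> complex) \<Rightarrow> real \<Rightarrow> bool" where
  "seminorm_le n \<psi> M \<longleftrightarrow> (\<forall>is x. length is \<le> n \<longrightarrow> (1 + norm x) ^ n * norm (partials is \<psi> x) \<le> M)"

lemma seminorm_leD: "seminorm_le n \<psi> M \<Longrightarrow> length is \<le> n \<Longrightarrow> norm (partials is \<psi> x) \<le> M / (1 + norm x) ^ n"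
  unfolding seminorm_le_def by (subst pos_le_divide_eq) (auto simp: mult.commute intro!: zero_less_power add_pos_nonneg)

lemma seminorm_le_nonneg: "seminorm_le n \<psi> M \<Longrightarrow> 0 \<le> M"
  unfolding seminorm_le_def by (drule spec[of _ "[]"], drule spec[of _ 0]) (auto intro: order_trans[OF norm_ge_zero])

lemma one_plus_power_le:
  fixes a :: real
  assumes "0 \<le> a" shows "(1 + a) ^ n \<le> 2 ^ n * (1 + a ^ n)"
proof (cases "a \<le> 1")
  case True
  have "(1 + a) ^ n \<le> 2 ^ n * 1" using True assms power_mono[of "1 + a" 2 n] by simp
  also have "\<dots> \<le> 2 ^ n * (1 + a ^ n)" using assms by (intro mult_left_mono) auto
  finally show ?thesis .
next
  case False
  have "(1 + a) ^ n \<le> (2 * a) ^ n" using False by (intro power_mono) auto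
  also have "\<dots> \<le> 2 ^ n * (1 + a ^ n)" by (simp add: power_mult_distrib)
  finally show ?thesis .
qed

lemma schwartz_seminorm:
  fixes \<psi> :: "real^'n::finite \<Rightarrow> complex"
  assumes "schwartz \<psi>" obtains M where "seminorm_le n \<psi> M"
proof -
  have "\<exists>C. \<forall>x. (1 + norm x) ^ n * norm (partials is \<psi> x) \<le> C" for "is"
  proof -
    obtain A where A: "\<And>x. norm x ^ n * norm (partials is \<psi> x) \<le> A" using assms unfolding schwartz_def by blast
    obtain A0 where A0: "\<And>x. norm x ^ 0 * norm (partials is \<psi> x) \<le> A0" using assms unfolding schwartz_def by blast
    have "(1 + norm x) ^ n * norm (partials is \<psi> x) \<le> 2 ^ n * (A0 + A)" for x
    proof -
      have "(1 + norm x) ^ n * norm (partials is \<psi> x) \<le> 2 ^ n * (1 + norm x ^ n) * norm (partials is \<psi> x)"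
        by (intro mult_right_mono one_plus_power_le) auto
      also have "\<dots> = 2 ^ n * (norm (partials is \<psi> x) + norm x ^ n * norm (partials is \<psi> x))"
        by (simp add: distrib_left distrib_right mult.assoc)
      also have "\<dots> \<le> 2 ^ n * (A0 + A)" using A[of x] A0[of x] by (intro mult_left_mono add_mono) auto
      finally show ?thesis .
    qed
    then show ?thesis by blast
  qed
  then obtain C where C: "\<And>is x. (1 + norm x) ^ n * norm (partials is \<psi> x) \<le> C is" by metis
  have fin: "finite {is::'n list. set is \<subseteq> UNIV \<and> length is \<le> n}" by (rule finite_lists_length_le) simp
  have "seminorm_le n \<psi> (Max (C ` {is. set is \<subseteq> UNIV \<and> length is \<le> n}))"
    unfolding seminorm_le_def
    using fin by (auto intro!: order_trans[OF C] Max_ge finite_imageI)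
  then show ?thesis by (rule that)
qed

lemma schwartzI:
  assumes "smooth \<psi>" "\<And>n. \<exists>M. seminorm_le n \<psi> M"
  shows "schwartz \<psi>"
  unfolding schwartz_def
proof (intro conjI allI)
  fix "is" :: "'a list" and k
  obtain M where M: "seminorm_le (max k (length is)) \<psi> M" using assms(2) by blast
  have "norm x ^ k * norm (partials is \<psi> x) \<le> M" for x
  proof -
    have "norm x ^ k \<le> (1 + norm x) ^ k" by (intro power_mono) auto
    also have "\<dots> \<le> (1 + norm x) ^ max k (length is)" by (intro power_increasing) auto
    finally have "norm x ^ k * norm (partials is \<psi> x) \<le> (1 + norm x) ^ max k (length is) * norm (partials is \<psi> x)"
      by (intro mult_right_mono) auto
    also have "\<dots> \<le> M" using M by (simp add: seminorm_le_def)
    finally show ?thesis .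
  qed
  then show "\<exists>C. \<forall>x. norm x ^ k * norm (partials is \<psi> x) \<le> C" by blast
qed (rule assms(1))

lemma schwartz_smooth: "schwartz \<psi> \<Longrightarrow> smooth \<psi>"
  by (simp add: schwartz_def)

lemma tempered_bound:
  fixes u :: "(real^'n::finite \<Rightarrow> complex) \<Rightarrow> complex"
  assumes "tempered_distribution u"
  obtains n C where "0 \<le> C" "\<And>\<psi> M. schwartz \<psi> \<Longrightarrow> seminorm_le n \<psi> M \<Longrightarrow> norm (u \<psi>) \<le> C * M"
proof -
  obtain n C where C: "\<And>\<psi> M. schwartz \<psi> \<Longrightarrow>
        (\<forall>is k x. length is \<le> n \<longrightarrow> k \<le> n \<longrightarrow> norm x ^ k * norm (partials is \<psi> x) \<le> M) \<Longrightarrow> norm (u \<psi>) \<le> C * M"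
    using assms unfolding tempered_distribution_def by blast
  have "norm (u \<psi>) \<le> max C 0 * M" if s: "schwartz \<psi>" and M: "seminorm_le n \<psi> M" for \<psi> M
  proof -
    have "norm x ^ k * norm (partials is \<psi> x) \<le> M" if l: "length is \<le> n" and k: "k \<le> n" for "is" k x
    proof -
      have "norm x ^ k \<le> (1 + norm x) ^ k" by (intro power_mono) auto
      also have "\<dots> \<le> (1 + norm x) ^ n" using k by (intro power_increasing) auto
      finally have "norm x ^ k * norm (partials is \<psi> x) \<le> (1 + norm x) ^ n * norm (partials is \<psi> x)"
        by (intro mult_right_mono) auto
      also have "\<dots> \<le> M" using M l by (simp add: seminorm_le_def)
      finally show ?thesis .
    qed
    then have "norm (u \<psi>) \<le> C * M" using C[OF s] by blast
    also have "\<dots> \<le> max C 0 * M" using seminorm_le_nonneg[OF M] by (intro mult_right_mono) auto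
    finally show ?thesis .
  qed
  then show ?thesis using that[of "max C 0" n] by simp
qed

lemma seminorm_le_shift:
  fixes \<psi> :: "real^'n::finite \<Rightarrow> complex"
  assumes s: "smooth \<psi>" and M: "seminorm_le n \<psi> M"
  shows "seminorm_le n (\<lambda>x. \<psi> (x + v)) ((1 + norm v) ^ n * M)"
  unfolding seminorm_le_def
proof (intro allI impI)
  fix "is" :: "'n list" and x :: "real^'n" assume l: "length is \<le> n"
  have "norm x \<le> norm (x + v) + norm v" using norm_triangle_ineq4[of "x + v" v] by simp
  then have "1 + norm x \<le> (1 + norm v) * (1 + norm (x + v))"
  proof -
    have "(1 + a) * (1 + b) = 1 + a + b + a * b" for a b :: real by (simp add: algebra_simps)
    moreover have "0 \<le> norm v * norm (x + v)" by simp
    ultimately show ?thesis using \<open>norm x \<le> norm (x + v) + norm v\<close> by (simp only:)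
  qed
  then have "(1 + norm x) ^ n \<le> ((1 + norm v) * (1 + norm (x + v))) ^ n" by (intro power_mono) auto
  then have p: "(1 + norm x) ^ n \<le> (1 + norm v) ^ n * (1 + norm (x + v)) ^ n" by (simp only: power_mult_distrib)
  have "(1 + norm x) ^ n * norm (partials is \<psi> (x + v)) \<le> (1 + norm v) ^ n * (1 + norm (x + v)) ^ n * norm (partials is \<psi> (x + v))"
    by (rule mult_right_mono[OF p]) simp
  also have "\<dots> = (1 + norm v) ^ n * ((1 + norm (x + v)) ^ n * norm (partials is \<psi> (x + v)))" by (rule mult.assoc)
  also have "\<dots> \<le> (1 + norm v) ^ n * M"
    using M l unfolding seminorm_le_def by (intro mult_left_mono) auto
  finally show "(1 + norm x) ^ n * norm (partials is (\<lambda>x. \<psi> (x + v)) x) \<le> (1 + norm v) ^ n * M"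
    by (simp add: partials_shift[OF s])
qed

lemma seminorm_le_mult:
  fixes \<psi> g :: "real^'n::finite \<Rightarrow> complex"
  assumes s: "smooth \<psi>" "smooth g" and M: "seminorm_le (n + k) \<psi> M"
    and g: "\<And>is x. length is \<le> n \<Longrightarrow> norm (partials is g x) \<le> A * (1 + norm x) ^ k"
  shows "seminorm_le n (\<lambda>x. g x * \<psi> x) (2 ^ n * (A * M))"
  unfolding seminorm_le_def
proof (intro allI impI)
  fix "is" :: "'n list" and x :: "real^'n" assume l: "length is \<le> n"
  have pos: "0 < 1 + norm x" by (simp add: add_pos_nonneg)
  have AM: "0 \<le> A * M"
  proof -
    have "0 \<le> A" using g[of "[]" 0] by (auto intro: order_trans[OF norm_ge_zero])
    then show ?thesis using seminorm_le_nonneg[OF M] by simp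
  qed
  have "norm (partials is (\<lambda>x. g x * \<psi> x) x) \<le> 2 ^ length is * ((A * (1 + norm x) ^ k) * (M / (1 + norm x) ^ (n + k)))"
    by (rule norm_partials_mult_le[OF s(2,1)]) (use g seminorm_leD[OF M] l in auto)
  also have "(A * (1 + norm x) ^ k) * (M / (1 + norm x) ^ (n + k)) = A * M / (1 + norm x) ^ n"
    using pos by (simp add: power_add)
  also have "2 ^ length is * (A * M / (1 + norm x) ^ n) \<le> 2 ^ n * (A * M / (1 + norm x) ^ n)"
    using l AM pos by (intro mult_right_mono power_increasing divide_nonneg_nonneg) auto
  finally have "(1 + norm x) ^ n * norm (partials is (\<lambda>x. g x * \<psi> x) x) \<le> (1 + norm x) ^ n * (2 ^ n * (A * M / (1 + norm x) ^ n))"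
    using pos by (intro mult_left_mono) auto
  also have "\<dots> = 2 ^ n * (A * M)"
  proof -
    have "a * (b * (c / a)) = b * c" if "0 < a" for a b c :: real using that by simp
    then show ?thesis using zero_less_power[OF pos] by blast
  qed
  finally show "(1 + norm x) ^ n * norm (partials is (\<lambda>x. g x * \<psi> x) x) \<le> 2 ^ n * (A * M)" .
qed

lemma test_function_partials_bound:
  fixes \<eta> :: "real^'n::finite \<Rightarrow> complex"
  assumes "test_function \<eta>"
  obtains A where "0 < A" "\<And>is x. length is \<le> n \<Longrightarrow> norm (partials is \<eta> x) \<le> A"
proof -
  have "\<exists>C. \<forall>x. norm (partials is \<eta> x) \<le> C" for "is"
    using test_function_bounded[OF test_function_partials[OF assms]] by metis
  then obtain C where C: "\<And>is x. norm (partials is \<eta> x) \<le> C is" by metis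
  have fin: "finite {is::'n list. set is \<subseteq> UNIV \<and> length is \<le> n}" by (rule finite_lists_length_le) simp
  have "norm (partials is \<eta> x) \<le> max 1 (Max (C ` {is. set is \<subseteq> UNIV \<and> length is \<le> n}))" if "length is \<le> n" for "is" x
    using fin that by (intro order_trans[OF C] max.coboundedI2 Max_ge finite_imageI) auto
  then show ?thesis using that[of "max 1 (Max (C ` {is. set is \<subseteq> UNIV \<and> length is \<le> n}))"] by simp
qed

lemma schwartz_mult_test:
  assumes "schwartz \<psi>" "test_function \<eta>" shows "schwartz (\<lambda>x. \<eta> x * \<psi> x)"
proof (rule schwartzI)
  have s: "smooth \<psi>" "smooth \<eta>" using assms by (auto simp: schwartz_def test_function_def)
  then show "smooth (\<lambda>x. \<eta> x * \<psi> x)" by (intro smooth_mult)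
  fix n
  obtain A where A: "\<And>is x. length is \<le> n \<Longrightarrow> norm (partials is \<eta> x) \<le> A" using test_function_partials_bound[OF assms(2)] by blast
  obtain M where M: "seminorm_le n \<psi> M" using schwartz_seminorm[OF assms(1)] by blast
  show "\<exists>M. seminorm_le n (\<lambda>x. \<eta> x * \<psi> x) M"
    using seminorm_le_mult[OF s, of n 0 M A] M A by auto
qed

lemma schwartz_shift:
  assumes "schwartz \<psi>" shows "schwartz (\<lambda>x. \<psi> (x + v))"
proof (rule schwartzI)
  show "smooth (\<lambda>x. \<psi> (x + v))" by (rule smooth_shift[OF schwartz_smooth[OF assms]])
  fix n
  obtain M where "seminorm_le n \<psi> M" using schwartz_seminorm[OF assms] by blast
  then show "\<exists>M. seminorm_le n (\<lambda>x. \<psi> (x + v)) M" using seminorm_le_shift[OF schwartz_smooth[OF assms]] by blast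
qed

lemma tempered_diff:
  assumes "tempered_distribution u" "schwartz \<psi>" "schwartz \<eta>" "schwartz (\<lambda>x. \<psi> x - \<eta> x)"
  shows "u (\<lambda>x. \<psi> x - \<eta> x) = u \<psi> - u \<eta>"
proof -
  have "u (\<lambda>x. (\<psi> x - \<eta> x) + \<eta> x) = u (\<lambda>x. \<psi> x - \<eta> x) + u \<eta>"
    using assms unfolding tempered_distribution_def by blast
  then show ?thesis by simp
qed

text \<open>The cutoffs \<open>\<eta>(x / R)\<close> converge to \<open>1\<close> only locally uniformly; one extra power of the weight
  makes up for that.\<close>

lemma cutoff_bound:
  fixes \<eta> :: "real^'n::finite \<Rightarrow> complex"
  assumes \<eta>: "test_function \<eta>" "\<eta> 0 = 1"
  obtains A where "0 < A" "\<And>R is x. 1 \<le> R \<Longrightarrow> length is \<le> n \<Longrightarrow> norm (partials is (\<lambda>x. \<eta> ((1 / R) *\<^sub>R x)) x) \<le> A"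
    "\<And>R is x. 1 \<le> R \<Longrightarrow> length is \<le> n \<Longrightarrow> norm (partials is (\<lambda>x. \<eta> ((1 / R) *\<^sub>R x) + (-1)) x) \<le> A / R * (1 + norm x) ^ 1"
proof -
  obtain A where A: "0 < A" "\<And>is x. length is \<le> Suc n \<Longrightarrow> norm (partials is \<eta> x) \<le> A"
    using test_function_partials_bound[OF \<eta>(1)] by blast
  have s: "smooth \<eta>" using \<eta>(1) by (simp add: test_function_def)
  have p: "partials is (\<lambda>x. \<eta> ((1 / R) *\<^sub>R x)) = (\<lambda>x. (1 / R) ^ length is *\<^sub>R partials is \<eta> ((1 / R) *\<^sub>R x))" for R "is"
    using partials_affine[OF s, of "is" "1 / R" 0] by simp
  have pc: "partials is (\<lambda>x::real^'n. c) = (\<lambda>x. if is = [] then c else 0)" for c "is"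
    by (induction "is") (auto simp: partials_Cons pd_const simp del: partials.simps(2))
  let ?A = "real CARD('n) * A + A"
  have lip: "norm (\<eta> x - 1) \<le> (real CARD('n) * A) * norm x" for x
  proof -
    have "norm (\<eta> x - \<eta> 0) \<le> (real CARD('n) * A) * norm (x - 0)"
    proof (rule differentiable_bound[of UNIV])
      fix y :: "real^'n"
      show "(\<eta> has_derivative (\<lambda>h. \<Sum>i\<in>UNIV. h $ i *\<^sub>R pd i \<eta> y)) (at y within UNIV)"
        using differentiable_has_derivative_pd[OF smooth_differentiable[OF s]] by simp
      show "onorm (\<lambda>h. \<Sum>i\<in>UNIV. h $ i *\<^sub>R pd i \<eta> y) \<le> real CARD('n) * A"
      proof (rule onorm_bound)
        fix h :: "real^'n"
        have "norm (\<Sum>i\<in>UNIV. h $ i *\<^sub>R pd i \<eta> y) \<le> (\<Sum>i\<in>(UNIV::'n set). norm h * A)"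
        proof (rule sum_norm_le)
          fix i :: 'n
          have "norm (pd i \<eta> y) \<le> A" using A(2)[of "[i]" y] by (simp add: pd_def)
          then show "norm (h $ i *\<^sub>R pd i \<eta> y) \<le> norm h * A"
            using component_le_norm_cart[of h i] A(1) by (simp add: mult_mono)
        qed
        then show "norm (\<Sum>i\<in>UNIV. h $ i *\<^sub>R pd i \<eta> y) \<le> real CARD('n) * A * norm h" by (simp add: mult_ac)
      qed (use A(1) in simp)
    qed auto
    then show ?thesis using \<eta>(2) by simp
  qed
  show ?thesis
  proof (rule that[of ?A])
    show "0 < ?A" using A(1) by (simp add: add_nonneg_pos)
    fix R :: real and "is" :: "'n list" and x :: "real^'n" assume R: "1 \<le> R" and l: "length is \<le> n"
    have R1: "(1 / R) ^ length is \<le> 1" using R by (intro power_le_one) auto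
    have pA: "norm (partials is \<eta> ((1 / R) *\<^sub>R x)) \<le> A" using A(2) l by simp
    have "(1 / R) ^ length is * norm (partials is \<eta> ((1 / R) *\<^sub>R x)) \<le> 1 * A"
      using R1 pA R by (intro mult_mono) auto
    also have "\<dots> \<le> ?A" using A(1) by simp
    finally show "norm (partials is (\<lambda>x. \<eta> ((1 / R) *\<^sub>R x)) x) \<le> ?A" using R by (simp add: p)
    have split: "partials is (\<lambda>x. \<eta> ((1 / R) *\<^sub>R x) + (-1)) x = partials is (\<lambda>x. \<eta> ((1 / R) *\<^sub>R x)) x + (if is = [] then -1 else 0)"
      using partials_add[OF smooth_scale[OF s, of "1 / R"] smooth_const[of "-1"], of "is"] pc[of "is" "-1"] by simp
    show "norm (partials is (\<lambda>x. \<eta> ((1 / R) *\<^sub>R x) + (-1)) x) \<le> ?A / R * (1 + norm x) ^ 1"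
    proof (cases "is")
      case Nil
      have "norm (\<eta> ((1 / R) *\<^sub>R x) - 1) \<le> (real CARD('n) * A) * norm ((1 / R) *\<^sub>R x)" by (rule lip)
      also have "\<dots> = (real CARD('n) * A) / R * norm x" using R by simp
      also have "\<dots> \<le> ?A / R * (1 + norm x) ^ 1"
        using A(1) R by (intro mult_mono divide_right_mono) auto
      finally show ?thesis unfolding split by (simp add: Nil)
    next
      case (Cons i js)
      have "(1 / R) ^ length is \<le> 1 / R"
        using R power_decreasing[of 1 "length is" "1 / R"] by (simp add: Cons)
      then have "(1 / R) ^ length is * norm (partials is \<eta> ((1 / R) *\<^sub>R x)) \<le> 1 / R * A"
        using pA R by (intro mult_mono) auto
      also have "\<dots> \<le> ?A / R * 1" using A(1) R by (simp add: divide_right_mono)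
      also have "\<dots> \<le> ?A / R * (1 + norm x) ^ 1" using A(1) R by (intro mult_left_mono) auto
      finally show ?thesis unfolding split p using R by (simp add: Cons del: partials.simps)
    qed
  qed
qed

section \<open>Approximants on \<open>\<real>\<^sup>d\<close>\<close>

text \<open>Inserting the cutoff changes the value of \<open>u\<close> by \<open>O(1 / R)\<close>, whether or not the cutoff is
  translated together with the function, and the bound is polynomial in the translation \<open>h\<close>.\<close>

lemma tempered_cutoff_bound:
  fixes u :: "(real^'n::finite \<Rightarrow> complex) \<Rightarrow> complex"
  assumes u: "tempered_distribution u" and \<eta>: "test_function \<eta>" "\<eta> 0 = 1" and \<psi>: "schwartz \<psi>"
  obtains C n where "0 \<le> C"
    "\<And>R h. 1 \<le> R \<Longrightarrow> norm (u (\<lambda>x. \<eta> ((1 / R) *\<^sub>R x) * \<psi> (x + h)) - u (\<lambda>x. \<psi> (x + h))) \<le> C / R * (1 + norm h) ^ n"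
    "\<And>R h. 1 \<le> R \<Longrightarrow> norm (u (\<lambda>x. \<eta> ((1 / R) *\<^sub>R (x + h)) * \<psi> (x + h)) - u (\<lambda>x. \<psi> (x + h))) \<le> C / R * (1 + norm h) ^ n"
proof (rule tempered_bound[OF u])
  fix n C assume C: "0 \<le> C" "\<And>\<psi> M. schwartz \<psi> \<Longrightarrow> seminorm_le n \<psi> M \<Longrightarrow> norm (u \<psi>) \<le> C * M"
  obtain M where M: "seminorm_le (n + 1) \<psi> M" using schwartz_seminorm[OF \<psi>] by blast
  show ?thesis
  proof (rule cutoff_bound[OF \<eta>, of n])
  have M0: "0 \<le> M" by (rule seminorm_le_nonneg[OF M])
  fix A assume A: "0 < A"
     "\<And>R is x. 1 \<le> R \<Longrightarrow> length is \<le> n \<Longrightarrow> norm (partials is (\<lambda>x. \<eta> ((1 / R) *\<^sub>R x)) x) \<le> A"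
     "\<And>R is x. 1 \<le> R \<Longrightarrow> length is \<le> n \<Longrightarrow> norm (partials is (\<lambda>x. \<eta> ((1 / R) *\<^sub>R x) + (-1)) x) \<le> A / R * (1 + norm x) ^ 1"
  have s\<eta>: "smooth \<eta>" using \<eta> by (simp add: test_function_def)
  have s\<psi>: "smooth \<psi>" by (rule schwartz_smooth[OF \<psi>])
  have sc: "smooth (\<lambda>x. \<eta> ((1 / R) *\<^sub>R x) + (-1))" for R by (rule smooth_add[OF smooth_scale[OF s\<eta>] smooth_const])
  have tf: "test_function (\<lambda>x. \<eta> ((1 / R) *\<^sub>R x))" if "1 \<le> R" for R
    by (rule test_function_scale[OF \<eta>(1)]) (use that in simp)
  have sem: "seminorm_le n (\<lambda>x. (\<eta> ((1 / R) *\<^sub>R x) + (-1)) * \<psi> (x + h)) (2 ^ n * (A / R * ((1 + norm h) ^ (n + 1) * M)))" if R: "1 \<le> R" for R h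
    by (rule seminorm_le_mult[OF smooth_shift[OF s\<psi>] sc seminorm_le_shift[OF s\<psi> M] A(3)[OF R]])
  have sch: "schwartz (\<lambda>x. (\<eta> ((1 / R) *\<^sub>R x) + (-1)) * \<psi> (x + h))"
    and eq: "u (\<lambda>x. (\<eta> ((1 / R) *\<^sub>R x) + (-1)) * \<psi> (x + h)) = u (\<lambda>x. \<eta> ((1 / R) *\<^sub>R x) * \<psi> (x + h)) - u (\<lambda>x. \<psi> (x + h))"
    if R: "1 \<le> R" for R h
  proof -
    have s1: "schwartz (\<lambda>x. \<psi> (x + h))" by (rule schwartz_shift[OF \<psi>])
    have s2: "schwartz (\<lambda>x. \<eta> ((1 / R) *\<^sub>R x) * \<psi> (x + h))" by (rule schwartz_mult_test[OF s1 tf[OF R]])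
    have e: "(\<lambda>x. (\<eta> ((1 / R) *\<^sub>R x) + (-1)) * \<psi> (x + h)) = (\<lambda>x. \<eta> ((1 / R) *\<^sub>R x) * \<psi> (x + h) - \<psi> (x + h))"
      by (simp add: algebra_simps)
    show s3: "schwartz (\<lambda>x. (\<eta> ((1 / R) *\<^sub>R x) + (-1)) * \<psi> (x + h))"
    proof (rule schwartzI)
      show "smooth (\<lambda>x. (\<eta> ((1 / R) *\<^sub>R x) + (-1)) * \<psi> (x + h))" by (rule smooth_mult[OF sc smooth_shift[OF s\<psi>]])
      fix k
      obtain M1 where M1: "seminorm_le (k + 1) (\<lambda>x. \<psi> (x + h)) M1" using schwartz_seminorm[OF s1] by blast
      show "\<exists>M. seminorm_le k (\<lambda>x. (\<eta> ((1 / R) *\<^sub>R x) + (-1)) * \<psi> (x + h)) M"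
      proof (rule cutoff_bound[OF \<eta>, of k])
        fix A1 assume A1: "\<And>R is x. 1 \<le> R \<Longrightarrow> length is \<le> k \<Longrightarrow> norm (partials is (\<lambda>x. \<eta> ((1 / R) *\<^sub>R x) + (-1)) x) \<le> A1 / R * (1 + norm x) ^ 1"
        show ?thesis
          by (rule exI, rule seminorm_le_mult[OF smooth_shift[OF s\<psi>] sc M1 A1[OF R]])
      qed
    qed
    show "u (\<lambda>x. (\<eta> ((1 / R) *\<^sub>R x) + (-1)) * \<psi> (x + h)) = u (\<lambda>x. \<eta> ((1 / R) *\<^sub>R x) * \<psi> (x + h)) - u (\<lambda>x. \<psi> (x + h))"
      using tempered_diff[OF u s2 s1] s3 unfolding e by blast
  qed
  show ?thesis
  proof (rule that[of "C * (2 ^ n * (A * M))" "n + 1"])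
    show "0 \<le> C * (2 ^ n * (A * M))" using C(1) A(1) M0 by simp
    fix R :: real and h :: "real^'n" assume R: "1 \<le> R"
    have "norm (u (\<lambda>x. (\<eta> ((1 / R) *\<^sub>R x) + (-1)) * \<psi> (x + h))) \<le> C * (2 ^ n * (A / R * ((1 + norm h) ^ (n + 1) * M)))"
      by (rule C(2)[OF sch[OF R] sem[OF R]])
    then show "norm (u (\<lambda>x. \<eta> ((1 / R) *\<^sub>R x) * \<psi> (x + h)) - u (\<lambda>x. \<psi> (x + h))) \<le> C * (2 ^ n * (A * M)) / R * (1 + norm h) ^ (n + 1)"
      unfolding eq[OF R] by (simp add: mult_ac)
    let ?g = "\<lambda>x. (\<eta> ((1 / R) *\<^sub>R x) + (-1)) * \<psi> (x + 0)"
    have s0: "schwartz ?g" by (rule sch[OF R])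
    have sm0: "seminorm_le n ?g (2 ^ n * (A / R * M))" using sem[OF R, of 0] by simp
    have "norm (u (\<lambda>x. ?g (x + h))) \<le> C * ((1 + norm h) ^ n * (2 ^ n * (A / R * M)))"
      by (rule C(2)[OF schwartz_shift[OF s0] seminorm_le_shift[OF schwartz_smooth[OF s0] sm0]])
    also have "\<dots> \<le> C * ((1 + norm h) ^ (n + 1) * (2 ^ n * (A / R * M)))"
      using C(1) A(1) M0 R by (intro mult_left_mono mult_right_mono power_increasing) auto
    finally have le: "norm (u (\<lambda>x. ?g (x + h))) \<le> C * (2 ^ n * (A * M)) / R * (1 + norm h) ^ (n + 1)" by (simp add: mult_ac)
    have s1: "schwartz (\<lambda>x. \<psi> (x + h))" by (rule schwartz_shift[OF \<psi>])
    have s2: "schwartz (\<lambda>x. \<eta> ((1 / R) *\<^sub>R (x + h)) * \<psi> (x + h))"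
      by (rule schwartz_mult_test[OF s1 test_function_shift[OF tf[OF R]]])
    have e: "(\<lambda>x. ?g (x + h)) = (\<lambda>x. \<eta> ((1 / R) *\<^sub>R (x + h)) * \<psi> (x + h) - \<psi> (x + h))"
      by (simp add: algebra_simps)
    have "u (\<lambda>x. ?g (x + h)) = u (\<lambda>x. \<eta> ((1 / R) *\<^sub>R (x + h)) * \<psi> (x + h)) - u (\<lambda>x. \<psi> (x + h))"
      using tempered_diff[OF u s2 s1] schwartz_shift[OF s0, of h] unfolding e by blast
    then show "norm (u (\<lambda>x. \<eta> ((1 / R) *\<^sub>R (x + h)) * \<psi> (x + h)) - u (\<lambda>x. \<psi> (x + h))) \<le> C * (2 ^ n * (A * M)) / R * (1 + norm h) ^ (n + 1)"
      using le by simp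
  qed
  qed
qed

lemma locally_integrable_test:
  fixes f \<theta> :: "real^'n::finite \<Rightarrow> complex"
  assumes f: "locally_integrable f" and f': "f' \<in> borel_measurable borel" "AE x in lborel. f x = f' x" and \<theta>: "test_function \<theta>"
  shows "integrable lborel (\<lambda>x. f' x * \<theta> x)" "integrable lebesgue (\<lambda>x. f x * \<theta> x)"
    "(LINT x|lebesgue. f x * \<theta> x) = (LINT x|lborel. f' x * \<theta> x)"
proof -
  have m[measurable]: "\<theta> \<in> borel_measurable borel" "f' \<in> borel_measurable borel" using test_function_measurable[OF \<theta>] f' by auto
  have fm: "f \<in> borel_measurable lebesgue" by (rule locally_integrable_measurable[OF f])
  have \<theta>m: "\<theta> \<in> borel_measurable lebesgue" using m(1) by (simp add: measurable_completion)
  obtain r where r: "\<And>x. r < norm x \<Longrightarrow> \<theta> x = 0" using test_function_bounded_support[OF \<theta>] by blast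
  obtain C where C: "0 < C" "\<And>x. norm (\<theta> x) \<le> C" using test_function_bounded[OF \<theta>] by blast
  have "integrable lebesgue (\<lambda>x. C *\<^sub>R (indicator (cball 0 r) x *\<^sub>R f x))"
    using f by (intro integrable_scaleR_right) (simp add: locally_integrable_def set_integrable_def)
  then show i: "integrable lebesgue (\<lambda>x. f x * \<theta> x)"
  proof (rule Bochner_Integration.integrable_bound)
    show "(\<lambda>x. f x * \<theta> x) \<in> borel_measurable lebesgue" using fm \<theta>m by simp
    have "norm (f x * \<theta> x) \<le> norm (C *\<^sub>R (indicator (cball 0 r) x *\<^sub>R f x))" for x
    proof (cases "r < norm x")
      case False
      then show ?thesis using C by (simp add: norm_mult mult.commute[of C] mult_left_mono)
    qed (use r in simp)
    then show "AE x in lebesgue. norm (f x * \<theta> x) \<le> norm (C *\<^sub>R (indicator (cball 0 r) x *\<^sub>R f x))" by simp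
  qed
  have ae: "AE x in lebesgue. f x * \<theta> x = f' x * \<theta> x"
    using f'(2) unfolding AE_lebesgue_iff by eventually_elim simp
  have m2: "(\<lambda>x. f' x * \<theta> x) \<in> borel_measurable lborel" by measurable
  then have m3: "(\<lambda>x. f' x * \<theta> x) \<in> borel_measurable lebesgue" by (rule measurable_completion)
  have "integrable lebesgue (\<lambda>x. f' x * \<theta> x)"
    using i by (subst integrable_cong_AE[OF m3 _ ]) (use ae fm \<theta>m in \<open>auto elim: eventually_mono\<close>)
  then show "integrable lborel (\<lambda>x. f' x * \<theta> x)" using integrable_completion[OF m2] by blast
  have "(LINT x|lebesgue. f x * \<theta> x) = (LINT x|lebesgue. f' x * \<theta> x)"
    by (rule integral_cong_AE[OF _ m3 ae]) (use fm \<theta>m in simp)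
  also have "\<dots> = (LINT x|lborel. f' x * \<theta> x)" by (rule integral_completion[OF m2])
  finally show "(LINT x|lebesgue. f x * \<theta> x) = (LINT x|lborel. f' x * \<theta> x)" .
qed

text \<open>By Fubini the integral is that of \<open>\<psi>(y) e\<^bsup>-ixy\<^esup>\<close> against the Fourier transform of \<open>K\<close> at \<open>b y\<close>, which
  vanishes on the support of \<open>\<psi>\<close>.\<close>

lemma kernel_fourier_convolution_vanishes:
  fixes \<psi> :: "real^'n::finite \<Rightarrow> complex" and K :: "real^'n \<Rightarrow> real"
  assumes Kc: "continuous_on UNIV K" and Ki: "integrable lborel K"
    and van: "\<And>w. 1 < norm w \<Longrightarrow> (LINT u|lborel. of_real (K u) * cis (u \<bullet> w)) = 0"
    and \<psi>: "test_function \<psi>" and b: "0 < b" and supp: "\<And>y. \<psi> y \<noteq> 0 \<Longrightarrow> 1 / b < norm y"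
  shows "(LINT u|lborel. of_real (K u) * fourier \<psi> (x + (- b) *\<^sub>R u)) = 0"
proof -
  let ?F = "\<lambda>z. of_real (K (fst z)) * (cis (- (snd z \<bullet> (x + (- b) *\<^sub>R fst z))) * \<psi> (snd z))"
  have pc: "continuous_on UNIV \<psi>" using \<psi> by (intro smooth_continuous_on) (simp add: test_function_def)
  have "(LINT u|lborel. of_real (K u) * fourier \<psi> (x + (- b) *\<^sub>R u)) = (LINT u|lborel. LINT y|lborel. ?F (u, y))"
    unfolding fourier_lborel[OF \<psi>] fst_conv snd_conv integral_mult_right_zero ..
  also have "\<dots> = (LINT y|lborel. LINT u|lborel. ?F (u, y))"
  proof (rule lborel_Fubini_dominated)
    have "continuous_on UNIV (\<lambda>z::(real^'n)\<times>(real^'n). K (fst z))" "continuous_on UNIV (\<lambda>z::(real^'n)\<times>(real^'n). \<psi> (snd z))"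
      by (rule continuous_on_compose2[OF Kc], auto intro: continuous_intros)
         (rule continuous_on_compose2[OF pc], auto intro: continuous_intros)
    then show "?F \<in> borel_measurable (lborel \<Otimes>\<^sub>M lborel)"
      unfolding cis_conv_exp by (intro continuous_imp_measurable_pair continuous_intros)
    show "integrable lborel (\<lambda>u. \<bar>K u\<bar>)" using Ki by simp
    show "integrable lborel (\<lambda>y. norm (\<psi> y))" using test_function_integrable[OF \<psi>] by simp
    show "norm (?F (u, y)) \<le> \<bar>K u\<bar> * norm (\<psi> y)" for u y by (simp add: norm_mult)
  qed
  also have "\<dots> = (LINT y::real^'n|lborel. 0)"
  proof (rule Bochner_Integration.integral_cong[OF refl])
    fix y :: "real^'n"
    have "?F (u, y) = (cis (- (y \<bullet> x)) * \<psi> y) * (of_real (K u) * cis (u \<bullet> (b *\<^sub>R y)))" for u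
    proof -
      have "cis (- (y \<bullet> (x + (- b) *\<^sub>R u))) = cis (- (y \<bullet> x)) * cis (u \<bullet> (b *\<^sub>R y))"
        by (simp add: cis_mult inner_add_right inner_commute[of u y] inner_diff_right algebra_simps)
      then show ?thesis by (simp add: mult_ac)
    qed
    then have "(LINT u|lborel. ?F (u, y)) = (LINT u|lborel. (cis (- (y \<bullet> x)) * \<psi> y) * (of_real (K u) * cis (u \<bullet> (b *\<^sub>R y))))"
      by (simp only:)
    also have "\<dots> = (cis (- (y \<bullet> x)) * \<psi> y) * (LINT u|lborel. of_real (K u) * cis (u \<bullet> (b *\<^sub>R y)))"
      by (rule integral_mult_right_zero)
    also have "\<dots> = 0"
    proof (cases "\<psi> y = 0")
      case False
      then have "1 < norm (b *\<^sub>R y)" using supp[OF False] b by (simp add: field_simps)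
      from van[OF this] show ?thesis by (simp only: mult_zero_right)
    qed simp
    finally show "(LINT u|lborel. ?F (u, y)) = 0" .
  qed
  finally show ?thesis by simp
qed

context translation_space
begin

text \<open>Pairing with a test function is continuous on \<open>B\<close> and hence can be interchanged with the integral in \<open>B\<close>.\<close>

lemma pairing_grid_sum:
  fixes K :: "real^'n \<Rightarrow> real"
  assumes loc: "\<And>f. f \<in> B \<Longrightarrow> locally_integrable f"
    and cont: "\<And>f. f \<in> B \<Longrightarrow> norm (LINT x|lebesgue. f x * \<theta> x) \<le> C * N f"
    and \<theta>: "test_function \<theta>"
    and Kc: "continuous_on UNIV K" and KG: "\<And>n u. \<bar>K (gridcell n u)\<bar> \<le> G u" "integrable lborel G"
    and f: "f \<in> B" and \<Phi>: "\<Phi> \<in> B"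
    and lim: "(\<lambda>n. N (\<lambda>x. grid_sum n (\<lambda>u x. K u *\<^sub>R f (x + b *\<^sub>R u)) x - \<Phi> x)) \<longlonglongrightarrow> 0"
  shows "integrable lborel (\<lambda>u. K u *\<^sub>R (LINT x|lebesgue. f (x + b *\<^sub>R u) * \<theta> x))"
    "(LINT x|lebesgue. \<Phi> x * \<theta> x) = (LINT u|lborel. K u *\<^sub>R (LINT x|lebesgue. f (x + b *\<^sub>R u) * \<theta> x))"
proof -
  let ?L = "\<lambda>g. (LINT x|lebesgue. g x * \<theta> x)"
  have int: "integrable lebesgue (\<lambda>x. g x * \<theta> x)" if g: "g \<in> B" for g
  proof -
    obtain g' where g': "g' \<in> borel_measurable borel" "AE x in lborel. g x = g' x"
      using lebesgue_measurable_AE_eq_borel[OF locally_integrable_measurable[OF loc[OF g]]] by blast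
    show ?thesis by (rule locally_integrable_test(2)[OF loc[OF g] g' \<theta>])
  qed
  have Ldiff: "?L g - ?L h = ?L (\<lambda>x. g x - h x)" if "g \<in> B" "h \<in> B" for g h
    using int that by (simp add: left_diff_distrib)
  have Llim: "((\<lambda>n. ?L (X n)) \<longlongrightarrow> ?L g) F" if "\<And>n. X n \<in> B" "g \<in> B" "((\<lambda>n. N (\<lambda>x. X n x - g x)) \<longlongrightarrow> 0) F" for X :: "nat \<Rightarrow> _" and g F
  proof (rule LIM_zero_cancel, rule Lim_null_comparison)
    have "((\<lambda>n. C * N (\<lambda>x. X n x - g x)) \<longlongrightarrow> C * 0) F" by (intro tendsto_intros that)
    then show "((\<lambda>n. C * N (\<lambda>x. X n x - g x)) \<longlongrightarrow> 0) F" by simp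
    show "\<forall>\<^sub>F n in F. norm (?L (X n) - ?L g) \<le> C * N (\<lambda>x. X n x - g x)"
      by (intro always_eventually allI) (simp only: Ldiff that cont diff_mem)
  qed
  let ?H = "\<lambda>u. K u *\<^sub>R ?L (\<lambda>x. f (x + b *\<^sub>R u))"
  have H1: "(\<lambda>n. ?H (gridcell n u)) \<longlonglongrightarrow> ?H u" for u
  proof (rule tendsto_scaleR)
    have "isCont K u" using Kc by (simp add: continuous_on_eq_continuous_at)
    then show "(\<lambda>n. K (gridcell n u)) \<longlonglongrightarrow> K u" using tendsto_gridcell by (rule isCont_tendsto_compose)
    have "(\<lambda>n. b *\<^sub>R gridcell n u) \<longlonglongrightarrow> b *\<^sub>R u" by (intro tendsto_intros tendsto_gridcell)
    then show "(\<lambda>n. ?L (\<lambda>x. f (x + b *\<^sub>R gridcell n u))) \<longlonglongrightarrow> ?L (\<lambda>x. f (x + b *\<^sub>R u))"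
      by (intro Llim shift_mem f N_shift_tendsto)
  qed
  have H2: "norm (?H (gridcell n u)) \<le> G u * (C * N f)" for n u
  proof -
    have "norm (?L (\<lambda>x. f (x + b *\<^sub>R gridcell n u))) \<le> C * N f"
      using cont[OF shift_mem[OF f]] N_shift[OF f] by metis
    then show ?thesis using KG(1)[of n u] by (simp add: mult_mono)
  qed
  have H3: "integrable lborel (\<lambda>u. G u * (C * N f))" using KG(2) by simp
  show "integrable lborel ?H" by (rule integrable_grid_limit[of ?H, OF H1 H2 H3])
  have s1: "(\<lambda>n. \<Sum>z\<in>gridindex n. (1 / 2 ^ n) ^ CARD('n) *\<^sub>R ?H (gridpoint n z)) \<longlonglongrightarrow> (LINT u|lborel. ?H u)"
    by (rule grid_sum_tendsto_integral[of ?H, OF H1 H2 H3])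
  have gs: "?L (grid_sum n (\<lambda>u x. K u *\<^sub>R f (x + b *\<^sub>R u))) = (\<Sum>z\<in>gridindex n. (1 / 2 ^ n) ^ CARD('n) *\<^sub>R ?H (gridpoint n z))" for n
  proof -
    have i: "integrable lebesgue (\<lambda>x. ((1 / 2 ^ n) ^ CARD('n) * K (gridpoint n z)) *\<^sub>R (f (x + b *\<^sub>R gridpoint n z) * \<theta> x))" for z :: "int^'n"
      by (intro integrable_scaleR_right int shift_mem f)
    have "?L (grid_sum n (\<lambda>u x. K u *\<^sub>R f (x + b *\<^sub>R u))) = (LINT x|lebesgue. (\<Sum>z\<in>gridindex n. ((1 / 2 ^ n) ^ CARD('n) * K (gridpoint n z)) *\<^sub>R (f (x + b *\<^sub>R gridpoint n z) * \<theta> x)))"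
      by (simp add: grid_sum_def sum_distrib_right)
    also have "\<dots> = (\<Sum>z\<in>gridindex n. (LINT x|lebesgue. ((1 / 2 ^ n) ^ CARD('n) * K (gridpoint n z)) *\<^sub>R (f (x + b *\<^sub>R gridpoint n z) * \<theta> x)))"
      by (rule Bochner_Integration.integral_sum) (rule i)
    finally show ?thesis by simp
  qed
  have s2: "(\<lambda>n. ?L (grid_sum n (\<lambda>u x. K u *\<^sub>R f (x + b *\<^sub>R u)))) \<longlonglongrightarrow> ?L \<Phi>"
    by (rule Llim[OF _ \<Phi> lim]) (intro grid_sum_mem scale_mem shift_mem f)
  show "?L \<Phi> = (LINT u|lborel. ?H u)"
    using s1 s2 unfolding gs by (rule LIMSEQ_unique[rotated])
qed

text \<open>Write \<open>\<psi>^\<close> for the Fourier transform of \<open>\<psi>\<close> and \<open>\<tau> R\<close> for the cutoff. The pairing of \<open>\<Phi>\<close> with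
  \<open>\<tau> R \<psi>^\<close> is the integral of \<open>K(v) Bf R v\<close>, where in \<open>Bf\<close> the product \<open>\<tau> R \<psi>^\<close> is translated as a
  whole. In \<open>Af\<close> only \<open>\<psi>^\<close> is translated, and the integral of \<open>K(v) Af R v\<close> is the pairing of \<open>f\<close> with
  \<open>\<tau> R\<close> times a convolution of \<open>K\<close> and \<open>\<psi>^\<close>, which is \<open>0\<close> as the spectra are disjoint. The two
  differ by \<open>O(1 / R)\<close>, since both \<open>Bf\<close> and \<open>Af\<close> approximate the value of the distribution \<open>f\<close> at the
  translate of \<open>\<psi>^\<close>, and the rapid decay of \<open>K\<close> makes the polynomial bound integrable.\<close>

lemma kernel_mean_band_limited:
  fixes K :: "real^'n \<Rightarrow> real"
  assumes loc: "\<And>f. f \<in> B \<Longrightarrow> \<exists>u. distribution_of f u"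
    and cont: "\<And>\<theta>. test_function \<theta> \<Longrightarrow> \<exists>C. \<forall>f\<in>B. norm (LINT x|lebesgue. f x * \<theta> x) \<le> C * N f"
    and Kc: "continuous_on UNIV K" and Kd: "\<And>p. \<exists>C>0. \<forall>u. \<bar>K u\<bar> \<le> C / weight u ^ p"
    and KG: "\<And>n u. \<bar>K (gridcell n u)\<bar> \<le> G u" "integrable lborel G"
    and van: "\<And>w. 1 < norm w \<Longrightarrow> (LINT u|lborel. of_real (K u) * cis (u \<bullet> w)) = 0"
    and f: "f \<in> B" and \<Phi>: "\<Phi> \<in> B" and b: "0 < b"
    and lim: "(\<lambda>n. N (\<lambda>x. grid_sum n (\<lambda>u x. K u *\<^sub>R f (x + b *\<^sub>R u)) x - \<Phi> x)) \<longlonglongrightarrow> 0"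
    and \<psi>: "test_function \<psi>" and supp: "\<And>y. \<psi> y \<noteq> 0 \<Longrightarrow> 1 / b < norm y"
    and \<eta>: "test_function \<eta>" "\<eta> 0 = 1"
  shows "(\<lambda>R. LINT x|lebesgue. \<Phi> x * (\<eta> ((1 / real (Suc R)) *\<^sub>R x) * fourier \<psi> x)) \<longlonglongrightarrow> 0"
proof -
  let ?ph = "fourier \<psi>"
  have sph: "smooth ?ph" by (rule smooth_fourier[OF \<psi>])
  have schph: "schwartz ?ph" by (rule schwartz_fourier[OF \<psi>])
  have li: "locally_integrable g" if "g \<in> B" for g using loc[OF that] by (auto simp: distribution_of_def)
  obtain u where u: "tempered_distribution u" "\<And>\<theta>. test_function \<theta> \<Longrightarrow> u \<theta> = (LINT x|lebesgue. f x * \<theta> x)"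
    using loc[OF f] by (auto simp: distribution_of_def)
  obtain f' where f': "f' \<in> borel_measurable borel" "AE x in lborel. f x = f' x"
    using lebesgue_measurable_AE_eq_borel[OF locally_integrable_measurable[OF li[OF f]]] by blast
  note f'm[measurable] = f'(1)
  have uf: "u \<theta> = (LINT x|lborel. f' x * \<theta> x)" if "test_function \<theta>" for \<theta>
    using u(2)[OF that] locally_integrable_test(3)[OF li[OF f] f' that] by simp
  define \<tau> where "\<tau> R x = \<eta> ((1 / real (Suc R)) *\<^sub>R x)" for R x
  have t\<tau>: "test_function (\<tau> R)" for R unfolding \<tau>_def by (rule test_function_scale[OF \<eta>(1)]) simp
  have t\<Theta>: "test_function (\<lambda>x. \<tau> R x * ?ph x)" for R
    using test_function_mult[OF t\<tau>[of R] sph] by (simp add: mult.commute)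
  define Bf where "Bf R v = u (\<lambda>x. \<tau> R (x + (- b) *\<^sub>R v) * ?ph (x + (- b) *\<^sub>R v))" for R v
  define Af where "Af R v = u (\<lambda>x. \<tau> R x * ?ph (x + (- b) *\<^sub>R v))" for R v
  have tA: "test_function (\<lambda>x. \<tau> R x * ?ph (x + v))" for R v
    using test_function_mult[OF t\<tau>[of R] smooth_shift[OF sph, of v]] by (simp add: mult.commute)
  have LB: "(LINT x|lebesgue. f (x + b *\<^sub>R v) * (\<tau> R x * ?ph x)) = Bf R v" for R v
  proof -
    have "AE x in lborel. f (x + b *\<^sub>R v) = f' (x + b *\<^sub>R v)"
      using AE_lborel_affine[OF _ f'(2), of 1 "b *\<^sub>R v"] by (simp add: add.commute)
    moreover have "(\<lambda>x. f' (x + b *\<^sub>R v)) \<in> borel_measurable borel" by measurable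
    ultimately have "(LINT x|lebesgue. f (x + b *\<^sub>R v) * (\<tau> R x * ?ph x)) = (LINT x|lborel. f' (x + b *\<^sub>R v) * (\<tau> R x * ?ph x))"
      by (intro locally_integrable_test(3)[OF li[OF shift_mem[OF f]] _ _ t\<Theta>])
    also have "\<dots> = (LINT x|lborel. f' x * (\<tau> R (x + (- b) *\<^sub>R v) * ?ph (x + (- b) *\<^sub>R v)))"
      using lborel_integral_shift(2)[OF locally_integrable_test(1)[OF li[OF f] f' test_function_shift[OF t\<Theta>[of R], of "(- b) *\<^sub>R v"]], of "b *\<^sub>R v"]
      by simp
    also have "\<dots> = Bf R v" unfolding Bf_def by (rule uf[symmetric]) (rule test_function_shift[OF t\<Theta>])
    finally show ?thesis .
  qed
  have step1: "integrable lborel (\<lambda>v. K v *\<^sub>R Bf R v)" "(LINT x|lebesgue. \<Phi> x * (\<tau> R x * ?ph x)) = (LINT v|lborel. K v *\<^sub>R Bf R v)" for R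
  proof -
    obtain C where "\<forall>f\<in>B. norm (LINT x|lebesgue. f x * (\<tau> R x * ?ph x)) \<le> C * N f" using cont[OF t\<Theta>] by blast
    then have C: "\<And>f. f \<in> B \<Longrightarrow> norm (LINT x|lebesgue. f x * (\<tau> R x * ?ph x)) \<le> C * N f" by blast
    note p = pairing_grid_sum[OF li C t\<Theta> Kc KG f \<Phi> lim]
    show "integrable lborel (\<lambda>v. K v *\<^sub>R Bf R v)" using p(1) by (simp only: LB)
    show "(LINT x|lebesgue. \<Phi> x * (\<tau> R x * ?ph x)) = (LINT v|lborel. K v *\<^sub>R Bf R v)" using p(2) by (simp only: LB)
  qed
  have Km[measurable]: "K \<in> borel_measurable borel" by (rule borel_measurable_continuous_onI[OF Kc])
  have Kint: "integrable lborel (\<lambda>v. \<bar>K v\<bar> * (1 + norm (b *\<^sub>R v)) ^ n)" for n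
  proof -
    obtain C where C: "0 < C" "\<And>v. \<bar>K v\<bar> \<le> C / weight v ^ (n + 2)" using Kd[of "n + 2"] by blast
    have "\<bar>K v\<bar> * (1 + norm (b *\<^sub>R v)) ^ n \<le> C * (1 + b) ^ n * (1 / weight v ^ 2)" for v
    proof -
      have "(1 + norm (b *\<^sub>R v)) \<le> (1 + b) * weight v"
      proof -
        have "1 + b * norm v \<le> (1 + b) * (1 + norm v)" using b by (simp add: algebra_simps)
        also have "\<dots> \<le> (1 + b) * weight v" using b by (intro mult_left_mono one_plus_norm_le_weight) auto
        finally show ?thesis using b by simp
      qed
      then have "(1 + norm (b *\<^sub>R v)) ^ n \<le> ((1 + b) * weight v) ^ n" by (intro power_mono) auto
      then have "\<bar>K v\<bar> * (1 + norm (b *\<^sub>R v)) ^ n \<le> C / weight v ^ (n + 2) * ((1 + b) * weight v) ^ n"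
        using C by (intro mult_mono) (auto simp: weight_nonneg)
      also have "\<dots> = C * (1 + b) ^ n * (1 / weight v ^ 2)"
      proof -
        have "C / (x * y) * (z * x) = C * z * (1 / y)" if "0 < x" for x y z :: real using that by simp
        from this[OF zero_less_power[OF weight_pos]] show ?thesis by (simp only: power_mult_distrib power_add)
      qed
      finally show ?thesis .
    qed
    note le = this
    show ?thesis
    proof (rule Bochner_Integration.integrable_bound)
      show "integrable lborel (\<lambda>v::real^'n. C * (1 + b) ^ n * (1 / weight v ^ 2))"
        by (rule integrable_mult_right[OF integrable_inverse_weight]) simp
      show "(\<lambda>v. \<bar>K v\<bar> * (1 + norm (b *\<^sub>R v)) ^ n) \<in> borel_measurable lborel" by measurable
      show "AE v in lborel. norm (\<bar>K v\<bar> * (1 + norm (b *\<^sub>R v)) ^ n) \<le> norm (C * (1 + b) ^ n * (1 / weight v ^ 2))"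
      proof (rule AE_I2)
        fix v
        have "norm (\<bar>K v\<bar> * (1 + norm (b *\<^sub>R v)) ^ n) = \<bar>K v\<bar> * (1 + norm (b *\<^sub>R v)) ^ n" by (simp add: abs_mult)
        also have "\<dots> \<le> norm (C * (1 + b) ^ n * (1 / weight v ^ 2))"
          by (rule order_trans[OF le]) (simp only: real_norm_def abs_ge_self)
        finally show "norm (\<bar>K v\<bar> * (1 + norm (b *\<^sub>R v)) ^ n) \<le> norm (C * (1 + b) ^ n * (1 / weight v ^ 2))" .
      qed
    qed
  qed
  have Ki: "integrable lborel K"
    by (rule Bochner_Integration.integrable_bound[OF Kint[of 0]]) auto
  have step2: "integrable lborel (\<lambda>v. K v *\<^sub>R Af R v)" "(LINT v|lborel. K v *\<^sub>R Af R v) = 0" for R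
  proof -
    let ?F = "\<lambda>z. of_real (K (fst z)) * ((f' (snd z) * \<tau> R (snd z)) * ?ph (snd z + (- b) *\<^sub>R fst z))"
    have \<tau>c: "continuous_on UNIV (\<tau> R)" using t\<tau> by (intro smooth_continuous_on) (simp add: test_function_def)
    have pc: "continuous_on UNIV ?ph" by (rule smooth_continuous_on[OF sph])
    obtain S where S: "0 < S" "\<And>x. norm (?ph x) \<le> S" using fourier_decay[OF \<psi>, of 0] by auto
    have i1: "integrable lborel (\<lambda>x. f' x * \<tau> R x)" by (rule locally_integrable_test(1)[OF li[OF f] f' t\<tau>])
    have Fm: "?F \<in> borel_measurable (lborel \<Otimes>\<^sub>M lborel)"
    proof -
      have "(\<lambda>z. f' (snd z)) \<in> borel_measurable (lborel \<Otimes>\<^sub>M lborel)"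
        by (rule measurable_compose[OF _ f'm]) measurable
      moreover have "(\<lambda>z. of_real (K (fst z)) * (\<tau> R (snd z) * ?ph (snd z + (- b) *\<^sub>R fst z))) \<in> borel_measurable (lborel \<Otimes>\<^sub>M lborel)"
      proof (rule continuous_imp_measurable_pair)
        have "continuous_on UNIV (\<lambda>z::(real^'n)\<times>(real^'n). K (fst z))" 
          by (rule continuous_on_compose2[OF Kc]) (auto intro: continuous_intros)
        moreover have "continuous_on UNIV (\<lambda>z::(real^'n)\<times>(real^'n). \<tau> R (snd z))"
          by (rule continuous_on_compose2[OF \<tau>c]) (auto intro: continuous_intros)
        moreover have "continuous_on UNIV (\<lambda>z::(real^'n)\<times>(real^'n). ?ph (snd z + (- b) *\<^sub>R fst z))"
          by (rule continuous_on_compose2[OF pc]) (auto intro!: continuous_intros)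
        ultimately show "continuous_on UNIV (\<lambda>z. complex_of_real (K (fst z)) * (\<tau> R (snd z) * ?ph (snd z + (- b) *\<^sub>R fst z)))"
          by (intro continuous_on_mult continuous_on_of_real)
      qed
      ultimately have "(\<lambda>z. f' (snd z) * (of_real (K (fst z)) * (\<tau> R (snd z) * ?ph (snd z + (- b) *\<^sub>R fst z)))) \<in> borel_measurable (lborel \<Otimes>\<^sub>M lborel)"
        by (rule borel_measurable_times)
      then show ?thesis by (simp add: mult_ac)
    qed
    have AF: "K v *\<^sub>R Af R v = (LINT x|lborel. ?F (v, x))" for v
    proof -
      have "Af R v = (LINT x|lborel. f' x * \<tau> R x * ?ph (x + (- b) *\<^sub>R v))"
        unfolding Af_def uf[OF tA] by (simp only: mult.assoc)
      then show ?thesis unfolding fst_conv snd_conv integral_mult_right_zero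
        by (simp only: scaleR_conv_of_real[where 'a=complex])
    qed
    have bound: "norm (?F (v, x)) \<le> (S * \<bar>K v\<bar>) * norm (f' x * \<tau> R x)" for v x
    proof -
      have "norm (?F (v, x)) = (\<bar>K v\<bar> * norm (f' x * \<tau> R x)) * norm (?ph (x + (- b) *\<^sub>R v))"
        by (simp add: norm_mult)
      also have "\<dots> \<le> (\<bar>K v\<bar> * norm (f' x * \<tau> R x)) * S" by (intro mult_left_mono S) simp
      finally show ?thesis by (simp add: mult_ac)
    qed
    have fi: "integrable lborel (\<lambda>v. S * \<bar>K v\<bar>)" using Ki by simp
    have gi: "integrable lborel (\<lambda>x. norm (f' x * \<tau> R x))" by (rule integrable_norm[OF i1])
    show "integrable lborel (\<lambda>v. K v *\<^sub>R Af R v)"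
      unfolding AF
    proof (rule Bochner_Integration.integrable_bound[OF integrable_mult_left[OF fi, of "LINT x|lborel. norm (f' x * \<tau> R x)"]])
      show "(\<lambda>v. LINT x|lborel. ?F (v, x)) \<in> borel_measurable lborel"
        using Fm by (intro lborel.borel_measurable_lebesgue_integral) simp
      have le: "norm (LINT x|lborel. ?F (v, x)) \<le> S * \<bar>K v\<bar> * (LINT x|lborel. norm (f' x * \<tau> R x))" for v
      proof -
        have "norm (LINT x|lborel. ?F (v, x)) \<le> (LINT x|lborel. norm (?F (v, x)))" by (rule integral_norm_bound)
        also have "\<dots> \<le> (LINT x|lborel. (S * \<bar>K v\<bar>) * norm (f' x * \<tau> R x))"
          by (rule integral_mono'[OF integrable_mult_right[OF gi]]) (use bound S in auto)
        also have "\<dots> = S * \<bar>K v\<bar> * (LINT x|lborel. norm (f' x * \<tau> R x))" by (rule integral_mult_right_zero)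
        finally show ?thesis .
      qed
      show "AE v in lborel. norm (LINT x|lborel. ?F (v, x)) \<le> norm (S * \<bar>K v\<bar> * (LINT x|lborel. norm (f' x * \<tau> R x)))"
        by (rule AE_I2, rule order_trans[OF le]) (simp only: real_norm_def abs_ge_self)
    qed
    have "(LINT v|lborel. K v *\<^sub>R Af R v) = (LINT v|lborel. LINT x|lborel. ?F (v, x))" unfolding AF ..
    also have "\<dots> = (LINT x|lborel. LINT v|lborel. ?F (v, x))"
      by (rule lborel_Fubini_dominated[OF Fm fi gi bound])
    also have "\<dots> = (LINT x::real^'n|lborel. 0)"
    proof (rule Bochner_Integration.integral_cong[OF refl])
      fix x :: "real^'n"
      have "(LINT v|lborel. ?F (v, x)) = (LINT v|lborel. (f' x * \<tau> R x) * (of_real (K v) * ?ph (x + (- b) *\<^sub>R v)))"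
        by (intro Bochner_Integration.integral_cong refl) (simp add: mult_ac)
      also have "\<dots> = (f' x * \<tau> R x) * (LINT v|lborel. of_real (K v) * ?ph (x + (- b) *\<^sub>R v))"
        by (rule integral_mult_right_zero)
      also have "\<dots> = 0"
      proof -
        have "(LINT v|lborel. of_real (K v) * ?ph (x + (- b) *\<^sub>R v)) = 0"
          by (rule kernel_fourier_convolution_vanishes[OF Kc Ki van \<psi> b supp])
        then show ?thesis by (simp only: mult_zero_right)
      qed
      finally show "(LINT v|lborel. ?F (v, x)) = 0" .
    qed
    finally show "(LINT v|lborel. K v *\<^sub>R Af R v) = 0" by simp
  qed
  show ?thesis
  proof (rule tempered_cutoff_bound[OF u(1) \<eta> schph])
    fix C n assume C0: "0 \<le> C"
      and C1: "\<And>R h. 1 \<le> R \<Longrightarrow> norm (u (\<lambda>x. \<eta> ((1 / R) *\<^sub>R x) * ?ph (x + h)) - u (\<lambda>x. ?ph (x + h))) \<le> C / R * (1 + norm h) ^ n"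
      and C2: "\<And>R h. 1 \<le> R \<Longrightarrow> norm (u (\<lambda>x. \<eta> ((1 / R) *\<^sub>R (x + h)) * ?ph (x + h)) - u (\<lambda>x. ?ph (x + h))) \<le> C / R * (1 + norm h) ^ n"
    let ?I = "LINT v|lborel. \<bar>K v\<bar> * (1 + norm (b *\<^sub>R v)) ^ n"
    have diff: "norm (Bf R v - Af R v) \<le> 2 * C / real (Suc R) * (1 + norm (b *\<^sub>R v)) ^ n" for R v
    proof -
      have R: "1 \<le> real (Suc R)" by simp
      let ?m = "u (\<lambda>x. ?ph (x + (- b) *\<^sub>R v))"
      have "norm (Bf R v - Af R v) \<le> norm (Bf R v - ?m) + norm (Af R v - ?m)"
        using norm_triangle_ineq4[of "Bf R v - ?m" "Af R v - ?m"] by simp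
      also have "\<dots> \<le> C / real (Suc R) * (1 + norm ((- b) *\<^sub>R v)) ^ n + C / real (Suc R) * (1 + norm ((- b) *\<^sub>R v)) ^ n"
        unfolding Bf_def Af_def \<tau>_def by (rule add_mono[OF C2[OF R] C1[OF R]])
      finally show ?thesis by (simp add: add_divide_distrib)
    qed
    have est: "norm (LINT x|lebesgue. \<Phi> x * (\<tau> R x * ?ph x)) \<le> (2 * C * ?I) * (1 / real (Suc R))" for R
    proof -
      have "(LINT x|lebesgue. \<Phi> x * (\<tau> R x * ?ph x)) = (LINT v|lborel. K v *\<^sub>R Bf R v) - (LINT v|lborel. K v *\<^sub>R Af R v)"
        by (simp only: step1(2) step2(2) diff_zero)
      also have "\<dots> = (LINT v|lborel. K v *\<^sub>R (Bf R v - Af R v))"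
        by (subst Bochner_Integration.integral_diff[symmetric, OF step1(1) step2(1)]) (simp add: scaleR_diff_right)
      also have "norm \<dots> \<le> (LINT v|lborel. (2 * C / real (Suc R)) * (\<bar>K v\<bar> * (1 + norm (b *\<^sub>R v)) ^ n))"
      proof (rule Bochner_Integration.integral_norm_bound_integral)
        show "integrable lborel (\<lambda>v. K v *\<^sub>R (Bf R v - Af R v))"
          unfolding scaleR_diff_right by (rule Bochner_Integration.integrable_diff[OF step1(1) step2(1)])
        show "integrable lborel (\<lambda>v. (2 * C / real (Suc R)) * (\<bar>K v\<bar> * (1 + norm (b *\<^sub>R v)) ^ n))"
          by (rule integrable_mult_right[OF Kint])
        fix v
        have "\<bar>K v\<bar> * norm (Bf R v - Af R v) \<le> \<bar>K v\<bar> * (2 * C / real (Suc R) * (1 + norm (b *\<^sub>R v)) ^ n)"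
          by (rule mult_left_mono[OF diff]) simp
        then show "norm (K v *\<^sub>R (Bf R v - Af R v)) \<le> (2 * C / real (Suc R)) * (\<bar>K v\<bar> * (1 + norm (b *\<^sub>R v)) ^ n)"
          by (simp only: norm_scaleR mult.left_commute)
      qed
      also have "\<dots> = (2 * C / real (Suc R)) * ?I" by (rule integral_mult_right_zero)
      finally show ?thesis by (simp add: mult_ac)
    qed
    have "(\<lambda>R. (2 * C * ?I) * (1 / real (Suc R))) \<longlonglongrightarrow> (2 * C * ?I) * 0"
      using LIMSEQ_inverse_real_of_nat by (intro tendsto_mult_left) (simp only: inverse_eq_divide)
    then have "(\<lambda>R. (2 * C * ?I) * (1 / real (Suc R))) \<longlonglongrightarrow> 0" by (simp only: mult_zero_right)
    then have "(\<lambda>R. LINT x|lebesgue. \<Phi> x * (\<tau> R x * ?ph x)) \<longlonglongrightarrow> 0"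
      by (rule Lim_null_comparison[rotated]) (intro always_eventually allI est)
    then show "(\<lambda>R. LINT x|lebesgue. \<Phi> x * (\<eta> ((1 / real (Suc R)) *\<^sub>R x) * ?ph x)) \<longlonglongrightarrow> 0"
      by (simp only: \<tau>_def)
  qed
qed

end

context translation_space
begin

text \<open>The means with the kernel of \<open>band_limited_kernel_exists\<close>, dilated by \<open>l a\<close>, have spectrum in the
  ball of radius \<open>1 / (l a) \<le> 1 / a\<close>.\<close>

lemma euclidean_jackson:
  assumes loc: "\<And>f. f \<in> B \<Longrightarrow> \<exists>u. distribution_of f u"
    and cont: "\<And>\<theta>. test_function \<theta> \<Longrightarrow> \<exists>C. \<forall>f\<in>B. norm (LINT x|lebesgue. f x * \<theta> x) \<le> C * N f"
  shows "\<exists>A p. p0 \<le> real p \<and> (\<forall>a>0. \<forall>f\<in>B. \<exists>\<phi>\<in>B. approximant Euclidean (1 / a) \<phi> \<and>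
     N (\<lambda>x. f x - \<phi> x) \<le> A * (LINT u|lborel. 1 / weight u ^ p * N ((fdiff (a *\<^sub>R u) ^^ R) f)))"
proof -
  obtain p1 :: nat where p1: "p0 \<le> real p1" using real_arch_simple by blast
  (* The exponent must be at least 2 for the majorant to be integrable. *)
  define p where "p = p1 + 2"
  obtain K :: "real^'n \<Rightarrow> real" where Kc: "continuous_on UNIV K" and Kd: "\<And>p. \<exists>C>0. \<forall>u. \<bar>K u\<bar> \<le> C / weight u ^ p"
    and K1: "(LINT u|lborel. K u) = 1" and van: "\<And>w. 1 < norm w \<Longrightarrow> (LINT u|lborel. of_real (K u) * cis (u \<bullet> w)) = 0"
    using band_limited_kernel_exists by blast
  obtain C where C: "0 < C" "\<And>u. \<bar>K u\<bar> \<le> C / weight u ^ p" using Kd[of p] by blast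
  obtain \<eta> :: "real^'n \<Rightarrow> complex" where \<eta>: "test_function \<eta>" "\<eta> 0 = 1" using bump_exists by blast
  (* Moving from u to the corner of its grid cell changes the weight by a factor of at most 2 per coordinate. *)
  define G where "G u = (C * (2 ^ CARD('n)) ^ p) * (1 / weight u ^ p)" for u :: "real^'n"
  have G: "integrable lborel G"
    unfolding G_def[abs_def] by (rule integrable_mult_right[OF integrable_inverse_weight]) (simp add: p_def)
  have KG: "\<bar>K (gridcell n u)\<bar> \<le> G u" for n u
  proof -
    have "weight u ^ p \<le> (2 ^ CARD('n) * weight (gridcell n u)) ^ p"
      by (intro power_mono weight_gridcell weight_nonneg)
    then have w: "weight u ^ p \<le> (2 ^ CARD('n)) ^ p * weight (gridcell n u) ^ p" by (simp only: power_mult_distrib)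
    have "C / weight (gridcell n u) ^ p \<le> G u"
      using mult_left_mono[OF w, of C] C(1) weight_pos[of u] weight_pos[of "gridcell n u"]
      by (simp add: G_def field_simps)
    then show ?thesis using C(2)[of "gridcell n u"] by linarith
  qed
  have Klim: "(\<lambda>n. K (gridcell n u)) \<longlonglongrightarrow> K u" for u
  proof -
    have "isCont K u" using Kc by (simp add: continuous_on_eq_continuous_at)
    then show ?thesis using tendsto_gridcell by (rule isCont_tendsto_compose)
  qed
  have "\<exists>\<phi>\<in>B. approximant Euclidean (1 / a) \<phi> \<and>
     N (\<lambda>x. f x - \<phi> x) \<le> C * (LINT u|lborel. 1 / weight u ^ p * N ((fdiff (a *\<^sub>R u) ^^ R) f))"
    if a: "0 < a" and f: "f \<in> B" for a f
  proof -
    have "\<forall>l. \<exists>\<phi>. \<phi> \<in> B \<and> (\<lambda>n. N (\<lambda>x. grid_sum n (\<lambda>u x. K u *\<^sub>R f (x + (real l * a) *\<^sub>R u)) x - \<phi> x)) \<longlonglongrightarrow> 0"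
      using kernel_mean_exists[OF Klim KG G f] by (simp only: Bex_def) blast
    from choice[OF this] obtain \<Phi> where \<Phi>: "\<And>l. \<Phi> l \<in> B"
      "\<And>l. (\<lambda>n. N (\<lambda>x. grid_sum n (\<lambda>u x. K u *\<^sub>R f (x + (real l * a) *\<^sub>R u)) x - \<Phi> l x)) \<longlonglongrightarrow> 0" by blast
    let ?\<phi> = "\<lambda>x. \<Sum>l\<in>{1..R}. mean_coeff R l *\<^sub>R \<Phi> l x"
    have \<phi>B: "?\<phi> \<in> B" by (intro sum_mem scale_mem \<Phi>)
    have "N (\<lambda>x. f x - ?\<phi> x) \<le> (LINT u|lborel. \<bar>K u\<bar> * N ((fdiff (a *\<^sub>R u) ^^ R) f))"
      by (rule kernel_mean_error[OF Klim KG G f K1 \<Phi>])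
    also have "\<dots> \<le> (LINT u|lborel. C * (1 / weight u ^ p * N ((fdiff (a *\<^sub>R u) ^^ R) f)))"
    proof (rule integral_mono')
      show "integrable lborel (\<lambda>u. C * (1 / weight u ^ p * N ((fdiff (a *\<^sub>R u) ^^ R) f)))"
        by (intro integrable_mult_right integrable_weight_N_fdiff f) (simp add: p_def)
      fix u :: "real^'n"
      have N0: "0 \<le> N ((fdiff (a *\<^sub>R u) ^^ R) f)" by (intro N_nonneg fdiff_power_mem f)
      show "0 \<le> C * (1 / weight u ^ p * N ((fdiff (a *\<^sub>R u) ^^ R) f))"
        using N0 C(1) by (simp add: weight_nonneg)
      show "\<bar>K u\<bar> * N ((fdiff (a *\<^sub>R u) ^^ R) f) \<le> C * (1 / weight u ^ p * N ((fdiff (a *\<^sub>R u) ^^ R) f))"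
        using mult_right_mono[OF C(2)[of u] N0] by simp
    qed
    also have "\<dots> = C * (LINT u|lborel. 1 / weight u ^ p * N ((fdiff (a *\<^sub>R u) ^^ R) f))"
      by (rule integral_mult_right_zero)
    finally have err: "N (\<lambda>x. f x - ?\<phi> x) \<le> C * (LINT u|lborel. 1 / weight u ^ p * N ((fdiff (a *\<^sub>R u) ^^ R) f))" .
    have li: "locally_integrable g" if "g \<in> B" for g using loc[OF that] by (auto simp: distribution_of_def)
    have int: "integrable lebesgue (\<lambda>x. g x * \<theta> x)" if g: "g \<in> B" and \<theta>: "test_function \<theta>" for g \<theta>
    proof -
      obtain g' where g': "g' \<in> borel_measurable borel" "AE x in lborel. g x = g' x"
        using lebesgue_measurable_AE_eq_borel[OF locally_integrable_measurable[OF li[OF g]]] by blast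
      show ?thesis by (rule locally_integrable_test(2)[OF li[OF g] g' \<theta>])
    qed
    obtain u where u: "distribution_of ?\<phi> u" using loc[OF \<phi>B] by blast
    then have ut: "tempered_distribution u" and ueq: "\<And>\<theta>. test_function \<theta> \<Longrightarrow> u \<theta> = (LINT x|lebesgue. ?\<phi> x * \<theta> x)"
      by (auto simp: distribution_of_def)
    have zero: "u (fourier \<psi>) = 0" if \<psi>: "test_function \<psi>" and out: "supp \<psi> \<subseteq> - cball 0 (1 / a)" for \<psi>
    proof -
      let ?T = "\<lambda>R x. \<eta> ((1 / real (Suc R)) *\<^sub>R x) * fourier \<psi> x"
      have tT: "test_function (?T k)" for k
      proof -
        have "test_function (\<lambda>x. \<eta> ((1 / real (Suc k)) *\<^sub>R x))" by (rule test_function_scale[OF \<eta>(1)]) simp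
        from test_function_mult[OF this smooth_fourier[OF \<psi>]] show ?thesis by (simp only: mult.commute)
      qed
      have l0: "(\<lambda>k. LINT x|lebesgue. \<Phi> l x * ?T k x) \<longlonglongrightarrow> 0" if l: "l \<in> {1..R}" for l
      proof (rule kernel_mean_band_limited[OF loc cont Kc Kd KG G van f \<Phi>(1) _ \<Phi>(2)[of l] \<psi> _ \<eta>])
        have l1: "1 \<le> real l" using l by simp
        show "0 < real l * a" using l1 a by simp
        fix y assume "\<psi> y \<noteq> 0"
        then have "y \<in> supp \<psi>" using not_supp by blast
        then have "1 / a < norm y" using out by auto
        moreover have "1 / (real l * a) \<le> 1 / a" using l1 a by (intro divide_left_mono) auto
        ultimately show "1 / (real l * a) < norm y" by linarith
      qed
      have sum: "u (?T k) = (\<Sum>l\<in>{1..R}. mean_coeff R l *\<^sub>R (LINT x|lebesgue. \<Phi> l x * ?T k x))" for k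
      proof -
        have "u (?T k) = (LINT x|lebesgue. (\<Sum>l\<in>{1..R}. mean_coeff R l *\<^sub>R (\<Phi> l x * ?T k x)))"
          unfolding ueq[OF tT] by (simp add: sum_distrib_right)
        also have "\<dots> = (\<Sum>l\<in>{1..R}. (LINT x|lebesgue. mean_coeff R l *\<^sub>R (\<Phi> l x * ?T k x)))"
          by (rule Bochner_Integration.integral_sum) (intro integrable_scaleR_right int \<Phi> tT)
        finally show ?thesis by simp
      qed
      have "(\<lambda>k. \<Sum>l\<in>{1..R}. mean_coeff R l *\<^sub>R (LINT x|lebesgue. \<Phi> l x * ?T k x)) \<longlonglongrightarrow> (\<Sum>l\<in>{1..R}. mean_coeff R l *\<^sub>R 0)"
        by (rule tendsto_sum, rule tendsto_scaleR[OF tendsto_const], rule l0)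
      then have lim0: "(\<lambda>k. u (?T k)) \<longlonglongrightarrow> 0" by (simp only: sum scaleR_zero_right sum.neutral_const)
      have lim1: "(\<lambda>k. u (?T k)) \<longlonglongrightarrow> u (fourier \<psi>)"
      proof (rule tempered_cutoff_bound[OF ut \<eta> schwartz_fourier[OF \<psi>]])
        fix C n
        assume C1: "\<And>R h. 1 \<le> R \<Longrightarrow> norm (u (\<lambda>x. \<eta> ((1 / R) *\<^sub>R x) * fourier \<psi> (x + h)) - u (\<lambda>x. fourier \<psi> (x + h))) \<le> C / R * (1 + norm h) ^ n"
        have le: "norm (u (?T k) - u (fourier \<psi>)) \<le> C * (1 / real (Suc k))" for k
          using C1[of "real (Suc k)" 0] by simp
        have "(\<lambda>k. C * (1 / real (Suc k))) \<longlonglongrightarrow> C * 0"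
          using LIMSEQ_inverse_real_of_nat by (intro tendsto_mult_left) (simp only: inverse_eq_divide)
        then have "(\<lambda>k. C * (1 / real (Suc k))) \<longlonglongrightarrow> 0" by (simp only: mult_zero_right)
        then have "(\<lambda>k. u (?T k) - u (fourier \<psi>)) \<longlonglongrightarrow> 0"
          by (rule Lim_null_comparison[rotated]) (intro always_eventually allI le)
        then show ?thesis by (rule LIM_zero_cancel)
      qed
      show ?thesis by (rule LIMSEQ_unique[OF lim1 lim0])
    qed
    have "- cball 0 (1 / a) \<in> {U. open U \<and> (\<forall>\<psi>. test_function \<psi> \<longrightarrow> supp \<psi> \<subseteq> U \<longrightarrow> fourier_dist u \<psi> = 0)}"
      using zero by (auto simp: fourier_dist_def)
    then have "dist_supp (fourier_dist u) \<subseteq> cball 0 (1 / a)"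
      unfolding dist_supp_def by blast
    then have "approximant Euclidean (1 / a) ?\<phi>"
      using u by (auto simp: subset_iff)
    then show ?thesis using err \<phi>B by blast
  qed
  moreover have "p0 \<le> real p" using p1 by (simp add: p_def)
  ultimately show ?thesis by blast
qed

end

section \<open>The sharp lower bound for the modulus of smoothness\<close>

theorem theorem9p3:
  fixes D :: underlying
    and B :: "(real ^ 'n::finite \<Rightarrow> complex) set"
    and N :: "(real ^ 'n \<Rightarrow> complex) \<Rightarrow> real"
    and r :: nat
    and s m :: real
  assumes "CARD('n) > 1"
    and "r \<ge> 1"
    and "banach_function_space D B N"
    and "2 \<le> s" and "m > 0"
    and "\<And>F G. F \<in> B \<Longrightarrow> G \<in> B \<Longrightarrow>
           max (N (\<lambda>x. F x + G x)) (N (\<lambda>x. F x - G x))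
             \<ge> (N F powr s + m * N G powr s) powr (1 / s)"
    and "\<And>f \<xi>. f \<in> B \<Longrightarrow> (\<lambda>x. f (x + \<xi>)) \<in> B \<and> N (\<lambda>x. f (x + \<xi>)) = N f"
    and "\<And>f. f \<in> B \<Longrightarrow> ((\<lambda>h. N (\<lambda>x. f (x + h) - f x)) \<longlongrightarrow> 0) (at 0)"
    and "\<And>f. f \<in> B \<Longrightarrow> (\<lambda>x. f (- x)) \<in> B \<and> N (\<lambda>x. f (- x)) = N f"
  shows "\<exists>C>0. \<forall>f\<in>B. \<forall>t>0.
           summable (\<lambda>j. 2 powr (- real (Suc j) * real r * s)
             * best_approx D B N (1 / (t * 2 ^ Suc j)) f powr s) \<and>
           modulus N r f t \<ge>
             C * (\<Sum>j. 2 powr (- real (Suc j) * real r * s)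
               * best_approx D B N (1 / (t * 2 ^ Suc j)) f powr s) powr (1 / s)"
proof -
  note bfs = assms(3)[unfolded banach_function_space_def]
  have fo: "\<And>f. f \<in> B \<Longrightarrow> function_on D f" by (rule bfs[THEN conjunct1, rule_format])
  have zero: "(\<lambda>x. 0) \<in> B" by (rule bfs[THEN conjunct2, THEN conjunct1])
  note bfs1 = bfs[THEN conjunct2, THEN conjunct2]
  have add: "(\<lambda>x. f x + g x) \<in> B \<and> N (\<lambda>x. f x + g x) \<le> N f + N g" if "f \<in> B" "g \<in> B" for f g
    by (rule bfs1[THEN conjunct1, rule_format, OF that])
  have scale: "(\<lambda>x. c *\<^sub>R f x) \<in> B \<and> N (\<lambda>x. c *\<^sub>R f x) = \<bar>c\<bar> * N f" if "f \<in> B" for f c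
    by (rule bfs1[THEN conjunct2, THEN conjunct1, rule_format, OF that])
  note bfs2 = bfs1[THEN conjunct2, THEN conjunct2]
  have null: "0 \<le> N f \<and> (N f = 0 \<longleftrightarrow> (AE x in lebesgue. f x = 0))" if "f \<in> B" for f
    by (rule bfs2[THEN conjunct1, rule_format, OF that])
  have complete: "\<forall>X. (\<forall>n::nat. X n \<in> B) \<longrightarrow>
      (\<forall>e>0. \<exists>M. \<forall>i\<ge>M. \<forall>j\<ge>M. N (\<lambda>x. X i x - X j x) < e) \<longrightarrow>
      (\<exists>f\<in>B. (\<lambda>n. N (\<lambda>x. X n x - f x)) \<longlonglongrightarrow> 0)"
    by (rule bfs2[THEN conjunct2, THEN conjunct1])
  have cont: "D = Euclidean \<longrightarrow> (\<forall>\<psi>. test_function \<psi> \<longrightarrow>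
      (\<exists>C. \<forall>f\<in>B. norm (LINT x|lebesgue. f x * \<psi> x) \<le> C * N f))"
    by (rule bfs2[THEN conjunct2, THEN conjunct2])
  interpret convex_translation_space B N s m
  proof
    show "(\<lambda>x. 0) \<in> B" by (rule zero)
    show "(\<lambda>x. f x + g x) \<in> B" if "f \<in> B" "g \<in> B" for f g by (rule add[OF that, THEN conjunct1])
    show "N (\<lambda>x. f x + g x) \<le> N f + N g" if "f \<in> B" "g \<in> B" for f g by (rule add[OF that, THEN conjunct2])
    show "(\<lambda>x. c *\<^sub>R f x) \<in> B" if "f \<in> B" for f c by (rule scale[OF that, THEN conjunct1])
    show "N (\<lambda>x. c *\<^sub>R f x) = \<bar>c\<bar> * N f" if "f \<in> B" for f c by (rule scale[OF that, THEN conjunct2])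
    show "0 \<le> N f" if "f \<in> B" for f by (rule null[OF that, THEN conjunct1])
    show "N f = 0 \<longleftrightarrow> (AE x in lebesgue. f x = 0)" if "f \<in> B" for f by (rule null[OF that, THEN conjunct2])
    show "\<exists>f\<in>B. (\<lambda>n. N (\<lambda>x. X n x - f x)) \<longlonglongrightarrow> 0"
      if "\<And>n. X n \<in> B" "\<forall>e>0. \<exists>M. \<forall>i\<ge>M. \<forall>j\<ge>M. N (\<lambda>x. X i x - X j x) < e" for X :: "nat \<Rightarrow> real^'n \<Rightarrow> complex"
      by (rule complete[THEN spec, THEN mp, THEN mp, OF allI]) (rule that)+
    show "(\<lambda>x. f (x + \<xi>)) \<in> B" if "f \<in> B" for f \<xi> by (rule assms(7)[OF that, THEN conjunct1])
    show "N (\<lambda>x. f (x + \<xi>)) = N f" if "f \<in> B" for f \<xi> by (rule assms(7)[OF that, THEN conjunct2])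
    show "((\<lambda>h. N (\<lambda>x. f (x + h) - f x)) \<longlongrightarrow> 0) (at 0)" if "f \<in> B" for f by (rule assms(8)[OF that])
    show "1 \<le> s" using assms(4) by simp
    show "0 < m" by (rule assms(5))
    show "(N F powr s + m * N G powr s) powr (1 / s) \<le> max (N (\<lambda>x. F x + G x)) (N (\<lambda>x. F x - G x))"
      if "F \<in> B" "G \<in> B" for F G by (rule assms(6)[OF that])
  qed
  have "\<exists>A p. real r * s + 2 \<le> real p \<and> (\<forall>a>0. \<forall>f\<in>B. \<exists>\<phi>\<in>B. approximant D (1 / a) \<phi> \<and>
     N (\<lambda>x. f x - \<phi> x) \<le> A * (LINT u|lborel. 1 / weight u ^ p * N ((fdiff (a *\<^sub>R u) ^^ Suc r) f)))"
  proof (cases D)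
    case Euclidean
    have loc: "\<exists>u. distribution_of f u" if "f \<in> B" for f using fo[OF that] by (simp add: Euclidean)
    have ct: "\<exists>C. \<forall>f\<in>B. norm (LINT x|lebesgue. f x * \<theta> x) \<le> C * N f" if "test_function \<theta>" for \<theta>
      by (rule cont[rule_format, OF Euclidean that])
    show ?thesis unfolding Euclidean by (rule euclidean_jackson[OF loc ct])
  next
    case Torus
    have per: "locally_integrable f \<and> periodic f" if "f \<in> B" for f using fo[OF that] by (simp add: Torus)
    show ?thesis unfolding Torus by (rule torus_jackson[OF per])
  qed
  then obtain A p where p: "real r * s + 2 \<le> real p" and jackson: "\<forall>a>0. \<forall>f\<in>B. \<exists>\<phi>\<in>B. approximant D (1 / a) \<phi> \<and>
     N (\<lambda>x. f x - \<phi> x) \<le> A * (LINT u|lborel. 1 / weight u ^ p * N ((fdiff (a *\<^sub>R u) ^^ Suc r) f))"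
    by (elim exE conjE)
  show ?thesis
  proof (rule sharp_lower_bound[where E = "best_approx D B N", OF assms(2) _ p])
    fix a :: real and f assume af: "0 < a" "f \<in> B"
    from jackson[rule_format, OF this] obtain \<phi> where \<phi>: "\<phi> \<in> B" "approximant D (1 / a) \<phi>"
      and le: "N (\<lambda>x. f x - \<phi> x) \<le> A * (LINT u|lborel. 1 / weight u ^ p * N ((fdiff (a *\<^sub>R u) ^^ Suc r) f))" by (elim bexE conjE)
    show "0 \<le> best_approx D B N (1 / a) f" by (rule best_approx_nonneg[OF af(2) \<phi>])
    show "best_approx D B N (1 / a) f \<le> A * (LINT u|lborel. 1 / weight u ^ p * N ((fdiff (a *\<^sub>R u) ^^ Suc r) f))"
      by (rule order_trans[OF best_approx_le[OF af(2) \<phi>] le])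
  qed
qed

end
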